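(* Let $\kappa\in(0,+\infty)$. For each $n\in\mathbb N$ let $B_n\in\mathcal A_n^{m(n)}$ (an adjacency matrix of a multigraph on $n$ vertices with $m(n)$ edges), and let $(\mathbf X_n(T))_{T=0,1,2,\dots}$ be the edge reconnecting model with parameter $\kappa$ on the state space $\mathcal A_n^{m(n)}$ with initial state $\mathbf X_n(0)=B_n$. Assume that $B_n\to W$ for some multigraphon $W$ with $\rho(W)>0$, and that there exist $\lambda>0$ and $C<+\infty$ such that for all $n$ $$\frac{1}{\binom n2}\sum_{1\le i<j\le n}e^{\lambda B_n(i,j)}\le C,\qquad \frac1n\sum_{i=1}^n e^{\lambda B_n(i,i)}\le C .$$ Then for all $t\in[0,+\infty)$ we have $$\mathbf X_n\left(\left\lfloor t\cdot\frac{\rho(W)\cdot n^2}{2}\right\rfloor\right)\xrightarrow{\ \mathrm p\ }W_t\qquad\text{as } n\to\infty,$$ where $$W_t(x,y,k)=\begin{cases}\displaystyle\sum_{h=0}^\infty W(x,y,h)\,\mathbf q\left(t,h,k,\frac{D(W,x)D(W,y)}{\rho(W)}\right)& \text{if } x\ne y,\\[3mm] \displaystyle\mathbf 1[2\mid k]\cdot\sum_{h=0}^\infty W(x,y,h)\,\mathbf q\left(t,\frac h2,\frac k2,\frac{D(W,x)D(W,y)}{2\rho(W)}\right)&\text{if } x=y.\end{cases}$$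
   Context: **Adjacency matrices.** $\mathbb N_0=\{0,1,2,\dots\}$, $[n]=\{1,\dots,n\}$. $\mathcal A_n$ is the set of symmetric matrices $B\in\mathbb N_0^{n\times n}$ with all diagonal entries $B(i,i)$ even (adjacency matrices of undirected multigraphs; $B(i,i)$ is twice the number of loops at $i$). $d(B,i)=\sum_{j=1}^nB(i,j)$ is the degree of $i$. $\mathcal A_n^m$ is the set of $B\in\mathcal A_n$ with $\frac12\sum_{i,j=1}^nB(i,j)=m$ ($m$ edges). **Edge reconnecting model.** For $\kappa\in(0,\infty)$ it is the Markov chain $\mathbf X(T)=(X(T,i,j))_{i,j=1}^n$, $T=0,1,2,\dots$, on $\mathcal A_n^m$ with the following step. Given $\mathbf X(T)$, choose $V_{old}$ with $P(V_{old}=i)=\frac{d(\mathbf X(T),i)}{2m}$; given $V_{old}$ choose $V'$ with $P(V'=i)=\frac{X(T,V_{old},i)}{d(\mathbf X(T),V_{old})}$; and, conditionally independently of $(V_{old},V')$ given $\mathbf X(T)$, choose $V_{new}$ with $P(V_{new}=i)=\frac{d(\mathbf X(T),i)+\kappa}{2m+n\kappa}$. Then $$X(T+1,i,j)=X(T,i,j)-\mathbf 1[V_{old}=i,V'=j]-\mathbf 1[V_{old}=j,V'=i]+\mathbf 1[V_{new}=i,V'=j]+\mathbf 1[V_{new}=j,V'=i].$$ (If $m=0$ the chain is constant.) **Multigraphons.** A multigraphon is a measurable function $W:[0,1]\times[0,1]\times\mathbb N_0\to[0,1]$ with $W(x,y,l)=W(y,x,l)$, $\sum_{l=0}^\infty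 W(x,y,l)=1$, and $W(x,x,2l+1)=0$ for all $x,y\in[0,1]$, $l\in\mathbb N_0$. Put $$D(W,x)=\int_0^1\sum_{l=0}^\infty l\,W(x,y,l)\,dy,\qquad \rho(W)=\int_0^1 D(W,x)\,dx .$$ (If $\rho(W)<\infty$ then $D(W,x)<\infty$ for almost every $x$; values on null sets of $x$ are immaterial.) **Densities and convergence.** For $A\in\mathcal A_k$, $B\in\mathcal A_n$ and a multigraphon $W$ let $$t_=(A,B)=\frac1{n^k}\sum_{\varphi:[k]\to[n]}\mathbf 1\big[\forall i,j\in[k]:A(i,j)=B(\varphi(i),\varphi(j))\big],$$ $$t_=(A,W)=\int_{[0,1]^k}\prod_{1\le i\le j\le k}W(x_i,x_j,A(i,j))\,dx_1\cdots dx_k .$$ $B_n\to W$ (with $B_n\in\mathcal A_n$) means $t_=(A,B_n)\to t_=(A,W)$ for all $k\in\mathbb N$ and $A\in\mathcal A_k$. For random $\mathbf X_n\in\mathcal A_n$, $\mathbf X_n\xrightarrow{\mathrm p}W$ means that $t_=(A,\mathbf X_n)\to t_=(A,W)$ in probability for all $k\in\mathbb N$ and $A\in\mathcal A_k$. **The function $\mathbf q$.** With $\mathbf p(k,\lambda)=e^{-\lambda}\lambda^k/k!$ and $\mathbf b(l,h,p)=\binom hl p^l(1-p)^{h-l}$ (equal to $0$ for $l>h$), put $$\mathbf q(t,h,k,\mu)=\sum_{l=0}^k\mathbf b(l,h,e^{-t})\,\mathbf p\big(k-l,(1-e^{-t})\mu\big),\qquad t\ge0,\ h,k\in\mathbb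 N_0,\ \mu\ge0,$$ which is the probability that an M/M/$\infty$ queue with arrival rate $\mu$ and service rate $1$ started from length $h$ has length $k$ at time $t$. In the case $x=y$ in the claim, terms with odd $h$ vanish because $W(x,x,h)=0$. For $n=1$ the condition involving $\binom n2$ is regarded as vacuous. *)

theory Defs
  imports "HOL-Probability.Probability"
begin

text \<open>
  An \<open>n \<times> n\<close> matrix with entries in the natural numbers is a function on indices \<open>1, \<dots>, n\<close> that
  is \<open>0\<close> outside this range, so that equality of functions is equality of matrices.
\<close>

type_synonym nmat = "nat \<Rightarrow> nat \<Rightarrow> nat"

definition adj :: "nat \<Rightarrow> nmat set" where
  "adj n = {B. (\<forall>i\<in>{1..n}. \<forall>j\<in>{1..n}. B i j = B j i) \<and> (\<forall>i\<in>{1..n}. even (B i i)) \<and>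
     (\<forall>i j. i \<notin> {1..n} \<or> j \<notin> {1..n} \<longrightarrow> B i j = 0)}"

definition deg :: "nat \<Rightarrow> nmat \<Rightarrow> nat \<Rightarrow> nat" where
  "deg n B i = (\<Sum>j\<in>{1..n}. B i j)"

definition adj_edges :: "nat \<Rightarrow> nat \<Rightarrow> nmat set" where
  "adj_edges n m = {B \<in> adj n. (\<Sum>i\<in>{1..n}. \<Sum>j\<in>{1..n}. real (B i j)) / 2 = real m}"


subsection \<open>The edge reconnecting model\<close>

text \<open>
  The matrix after the step in which \<open>V\<^sub>o\<^sub>l\<^sub>d = v\<close>, \<open>V' = w\<close>, \<open>V\<^sub>n\<^sub>e\<^sub>w = u\<close>. For \<open>B \<in> adj n\<close> with
  \<open>B v w > 0\<close> the truncated subtraction is exact (if \<open>v = w\<close> then \<open>B v v \<ge> 2\<close>, by parity).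
\<close>

definition reconnect :: "nat \<Rightarrow> nat \<Rightarrow> nat \<Rightarrow> nmat \<Rightarrow> nmat" where
  "reconnect v w u B = (\<lambda>i j.
     B i j - of_bool (v = i \<and> w = j) - of_bool (v = j \<and> w = i)
           + of_bool (u = i \<and> w = j) + of_bool (u = j \<and> w = i))"

text \<open>
  The one-step transition probability from \<open>B\<close> to \<open>B'\<close>: the total probability of the choices
  \<open>(V\<^sub>o\<^sub>l\<^sub>d, V', V\<^sub>n\<^sub>e\<^sub>w) = (v, w, u)\<close> leading from \<open>B\<close> to \<open>B'\<close>. If \<open>deg n B v = 0\<close>, the summand is \<open>0\<close>.
\<close>

definition reconnect_prob :: "real \<Rightarrow> nat \<Rightarrow> nat \<Rightarrow> nmat \<Rightarrow> nmat \<Rightarrow> real" where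
  "reconnect_prob \<kappa> n m B B' =
     (if m = 0 then of_bool (B' = B)
      else \<Sum>v\<in>{1..n}. \<Sum>w\<in>{1..n}. \<Sum>u\<in>{1..n}.
        real (deg n B v) / (2 * real m) * (real (B v w) / real (deg n B v)) *
        ((real (deg n B u) + \<kappa>) / (2 * real m + real n * \<kappa>)) *
        of_bool (B' = reconnect v w u B))"

text \<open>
  \<open>X\<close> is a realisation, on the probability space \<open>M\<close>, of the Markov chain with state space
  \<open>adj_edges n m\<close>, initial state \<open>B\<close> and transition probabilities \<open>reconnect_prob \<kappa> n m\<close>.
\<close>

definition edge_reconnecting_model ::
  "real \<Rightarrow> nat \<Rightarrow> nat \<Rightarrow> nmat \<Rightarrow> 'a measure \<Rightarrow> (nat \<Rightarrow> 'a \<Rightarrow> nmat) \<Rightarrow> bool" where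
  "edge_reconnecting_model \<kappa> n m B M X \<longleftrightarrow>
     prob_space M \<and>
     (\<forall>T. X T \<in> M \<rightarrow>\<^sub>M count_space (adj_edges n m)) \<and>
     (AE \<omega> in M. X 0 \<omega> = B) \<and>
     (\<forall>T b. (\<forall>s\<le>Suc T. b s \<in> adj_edges n m) \<longrightarrow>
        measure M {\<omega> \<in> space M. \<forall>s\<le>Suc T. X s \<omega> = b s} =
        measure M {\<omega> \<in> space M. \<forall>s\<le>T. X s \<omega> = b s} * reconnect_prob \<kappa> n m (b T) (b (Suc T)))"


subsection \<open>Multigraphons\<close>

abbreviation lborel01 :: "real measure" where
  "lborel01 \<equiv> restrict_space lborel {0..1}"

text \<open>
  Measurability is Borel measurability, which makes the diagonal sections
  \<open>x \<mapsto> W x x l\<close> measurable. Values of \<open>W\<close> outside the unit square are irrelevant.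
\<close>

definition multigraphon :: "(real \<Rightarrow> real \<Rightarrow> nat \<Rightarrow> real) \<Rightarrow> bool" where
  "multigraphon W \<longleftrightarrow>
     (\<lambda>(x, y, l). W x y l) \<in> borel_measurable (lborel01 \<Otimes>\<^sub>M lborel01 \<Otimes>\<^sub>M count_space UNIV) \<and>
     (\<forall>x\<in>{0..1}. \<forall>y\<in>{0..1}.
        (\<forall>l. W x y l \<in> {0..1} \<and> W x y l = W y x l) \<and> (\<lambda>l. W x y l) sums 1) \<and>
     (\<forall>x\<in>{0..1}. \<forall>l. W x x (2 * l + 1) = 0)"

definition degW :: "(real \<Rightarrow> real \<Rightarrow> nat \<Rightarrow> real) \<Rightarrow> real \<Rightarrow> ennreal" where
  "degW W x = (\<integral>\<^sup>+y. (\<Sum>l. of_nat l * ennreal (W x y l)) \<partial>lborel01)"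

definition rho :: "(real \<Rightarrow> real \<Rightarrow> nat \<Rightarrow> real) \<Rightarrow> ennreal" where
  "rho W = (\<integral>\<^sup>+x. degW W x \<partial>lborel01)"


subsection \<open>Densities and convergence\<close>

definition t_eq :: "nat \<Rightarrow> nmat \<Rightarrow> nat \<Rightarrow> nmat \<Rightarrow> real" where
  "t_eq k A n B = 1 / real n ^ k *
     (\<Sum>\<phi>\<in>{1..k} \<rightarrow>\<^sub>E {1..n}. of_bool (\<forall>i\<in>{1..k}. \<forall>j\<in>{1..k}. A i j = B (\<phi> i) (\<phi> j)))"

definition t_eqW :: "nat \<Rightarrow> nmat \<Rightarrow> (real \<Rightarrow> real \<Rightarrow> nat \<Rightarrow> real) \<Rightarrow> real" where
  "t_eqW k A W =
     (\<integral>x. (\<Prod>j\<in>{1..k}. \<Prod>i\<in>{1..j}. W (x i) (x j) (A i j)) \<partial>(Pi\<^sub>M {1..k} (\<lambda>_. lborel01)))"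

definition graph_converges :: "(nat \<Rightarrow> nmat) \<Rightarrow> (real \<Rightarrow> real \<Rightarrow> nat \<Rightarrow> real) \<Rightarrow> bool" where
  "graph_converges B W \<longleftrightarrow>
     (\<forall>k\<ge>1. \<forall>A\<in>adj k. (\<lambda>n. t_eq k A n (B n)) \<longlonglongrightarrow> t_eqW k A W)"

definition converges_in_probability ::
  "(nat \<Rightarrow> 'a measure) \<Rightarrow> (nat \<Rightarrow> 'a \<Rightarrow> real) \<Rightarrow> real \<Rightarrow> bool" where
  "converges_in_probability M Y c \<longleftrightarrow>
     (\<forall>\<epsilon>>0. (\<lambda>n. measure (M n) {\<omega> \<in> space (M n). \<bar>Y n \<omega> - c\<bar> > \<epsilon>}) \<longlonglongrightarrow> 0)"

definition graph_converges_in_probability ::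
  "(nat \<Rightarrow> 'a measure) \<Rightarrow> (nat \<Rightarrow> 'a \<Rightarrow> nmat) \<Rightarrow> (real \<Rightarrow> real \<Rightarrow> nat \<Rightarrow> real) \<Rightarrow> bool" where
  "graph_converges_in_probability M Y W \<longleftrightarrow>
     (\<forall>k\<ge>1. \<forall>A\<in>adj k. converges_in_probability M (\<lambda>n \<omega>. t_eq k A n (Y n \<omega>)) (t_eqW k A W))"


subsection \<open>The limit object\<close>

definition poisson_weight :: "nat \<Rightarrow> real \<Rightarrow> real" where
  "poisson_weight k \<mu> = exp (- \<mu>) * \<mu> ^ k / fact k"

text \<open>The binomial coefficient, hence the weight, is \<open>0\<close> for \<open>l > h\<close>.\<close>

definition binomial_weight :: "nat \<Rightarrow> nat \<Rightarrow> real \<Rightarrow> real" where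
  "binomial_weight l h p = real (h choose l) * p ^ l * (1 - p) ^ (h - l)"

definition queue :: "real \<Rightarrow> nat \<Rightarrow> nat \<Rightarrow> real \<Rightarrow> real" where
  "queue t h k \<mu> =
     (\<Sum>l\<le>k. binomial_weight l h (exp (- t)) * poisson_weight (k - l) ((1 - exp (- t)) * \<mu>))"

text \<open>
  Where \<open>degW W x\<close> is infinite, which happens only on a null set if \<open>rho W\<close> is finite,
  \<open>enn2real\<close> replaces it by \<open>0\<close>. In the diagonal case only even \<open>h\<close> and \<open>k\<close> contribute, so the
  integer divisions are exact.
\<close>

definition W_evol :: "(real \<Rightarrow> real \<Rightarrow> nat \<Rightarrow> real) \<Rightarrow> real \<Rightarrow> real \<Rightarrow> real \<Rightarrow> nat \<Rightarrow> real" where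
  "W_evol W t x y k =
     (let dx = enn2real (degW W x); dy = enn2real (degW W y); r = enn2real (rho W)
      in if x \<noteq> y then \<Sum>h. W x y h * queue t h k (dx * dy / r)
         else of_bool (even k) *
           (\<Sum>h. W x y h * queue t (h div 2) (k div 2) (dx * dy / (2 * r))))"

end

theory Submission
  imports Defs
begin

text \<open>
  Follow the numbers \<open>H p\<close> of edges between finitely many pairs \<open>p\<close> of tracked vertices. With time
  scaled by \<open>m\<close>, remaining time \<open>\<tau>\<close> and arrival rates \<open>\<mu> p\<close> frozen at the initial degrees, the product
  of the queue transition probabilities \<open>queue \<tau> (H p) (k p) (\<mu> p)\<close> solves a backward equation, and at
  \<open>\<tau> = 0\<close> it is the indicator of \<open>H = k\<close>. Its one-step drift along the chain is a Taylor remainder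
  plus two corrections: a step may affect two tracked quantities at once, and degrees fluctuate. After
  averaging over the tracked vertices these sum to \<open>o(1)\<close> over order \<open>n\<^sup>2\<close> steps, because a degree of
  order \<open>n\<close> moves only by order \<open>sqrt n\<close>.

  It remains to find the limit of an average over vertices of a function of the initial matrix entries
  and degrees. A degree is replaced by an empirical mean over \<open>r\<close> additional random vertices, at
  the cost of a variance of order \<open>1 / r\<close>, uniformly in \<open>n\<close> and also for the limit. What is left is a
  bounded function of a finite random submatrix, whose law converges in total variation by Scheffe's
  lemma. Two disjoint sets of tracked vertices give the second moments, hence convergence in
  probability.
\<close>

section \<open>The M/M/infinity queue\<close>


text \<open>The convergence hypothesis sees only finite submatrices, whereas the queue rates contain
  degrees, which are sums of n unbounded entries. Along the chain the rates are frozen, so that the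
  backward equation keeps an explicit product solution; the price is measured by degree moments up
  to order four, which the exponential condition supplies. In the limit, a matrix with uniformly
  chosen vertices and a multigraphon on [0, 1] are two instances of one notion,
  \<open>kernel\<close>, so that the variance bound for empirical degrees is proved once and used on
  both sides of the limit.

  Loops are the other difficulty. A diagonal entry is twice a loop count, and its frozen rate is
  half the off-diagonal one. Only n diagonal positions are averaged over instead of n^2, so squared
  loop counts need a finer bound than squared multiplicities. Label maps that are not injective mix
  the two cases, but form a fraction of order 1 / n.

  The chain is handled through its transition operator on functions of matrices; paths enter only to
  identify iterates of that operator with expectations.\<close>

lemma binomial_weight_Suc_Suc:
  "binomial_weight (Suc l) (Suc h) p = p * binomial_weight l h p + (1 - p) * binomial_weight (Suc l) h p"
proof (cases "l < h")
  case True
  then have "(1 - p) ^ (h - l) = (1 - p) * (1 - p) ^ (h - Suc l)"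
    by (metis Suc_diff_Suc power_Suc)
  then show ?thesis
    by (simp add: binomial_weight_def) (simp add: algebra_simps)
next
  case False
  then consider "l = h" | "l > h" by linarith
  then show ?thesis
    by cases (simp_all add: binomial_weight_def binomial_eq_0)
qed

lemma binomial_weight_0_Suc:
  "binomial_weight 0 (Suc h) p = (1 - p) * binomial_weight 0 h p"
  by (simp add: binomial_weight_def)

lemma binomial_weight_nonneg: "0 \<le> p \<Longrightarrow> p \<le> 1 \<Longrightarrow> 0 \<le> binomial_weight l h p"
  by (simp add: binomial_weight_def)

text \<open>The cut-off k may lie on either side of h, so the sum is first enlarged to
  \<open>max k h\<close>, then cut to h, where the binomial theorem evaluates it.\<close>

lemma sum_binomial_weight_le_1:
  assumes "0 \<le> p" "p \<le> 1"
  shows "(\<Sum>l\<le>k. binomial_weight l h p) \<le> 1"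
proof -
  have "(\<Sum>l\<le>k. binomial_weight l h p) \<le> (\<Sum>l\<le>max k h. binomial_weight l h p)"
    using assms by (intro sum_mono2) (auto intro: binomial_weight_nonneg)
  also have "\<dots> = (\<Sum>l\<le>h. binomial_weight l h p)"
    by (rule sum.mono_neutral_right) (auto simp: binomial_weight_def binomial_eq_0)
  also have "\<dots> = (p + (1 - p)) ^ h"
    unfolding binomial_weight_def by (subst binomial_ring) simp
  finally show ?thesis by simp
qed

lemma poisson_weight_nonneg: "0 \<le> \<mu> \<Longrightarrow> 0 \<le> poisson_weight k \<mu>"
  by (simp add: poisson_weight_def)

text \<open>A single term of the exponential series is at most the whole series. With k = 4 the same
  fact later turns exponential moments into fourth moments.\<close>

lemma poisson_weight_le_1:
  assumes "0 \<le> \<mu>"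
  shows "poisson_weight k \<mu> \<le> 1"
proof -
  have "(\<Sum>i<Suc k. \<mu> ^ i / fact i) \<le> exp \<mu>"
  proof -
    have "(\<lambda>i. \<mu> ^ i / fact i) sums exp \<mu>"
      using exp_converges[of \<mu>] by (simp add: divide_inverse mult.commute)
    then show ?thesis
      using assms sum_le_suminf[of "\<lambda>i. \<mu> ^ i / fact i" "{..<Suc k}"] by (simp add: sums_iff)
  qed
  moreover have "\<mu> ^ k / fact k \<le> (\<Sum>i<Suc k. \<mu> ^ i / fact i)"
    using assms by (auto intro!: sum_nonneg)
  ultimately have "\<mu> ^ k / fact k \<le> exp \<mu>" by linarith
  then have "exp (- \<mu>) * (\<mu> ^ k / fact k) \<le> exp (- \<mu>) * exp \<mu>"
    by (intro mult_left_mono) auto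
  then show ?thesis
    by (simp add: poisson_weight_def flip: exp_add)
qed

text \<open>The weight at index k - 1, with value 0 at k = 0, where natural subtraction would return
  the weight at 0 instead. The derivative of a Poisson weight in its mean is then a difference of
  neighbouring weights for every k.\<close>

definition pred_poisson_weight :: "nat \<Rightarrow> real \<Rightarrow> real" where
  "pred_poisson_weight k \<mu> = (if k = 0 then 0 else poisson_weight (k - 1) \<mu>)"

lemma has_field_derivative_poisson_weight:
  "(poisson_weight k has_field_derivative pred_poisson_weight k \<mu> - poisson_weight k \<mu>) (at \<mu>)"
proof (cases k)
  case 0
  have "((\<lambda>x. exp (- x)) has_field_derivative - exp (- \<mu>)) (at \<mu>)"
    by (auto intro!: derivative_eq_intros)
  then show ?thesis using 0
    unfolding poisson_weight_def pred_poisson_weight_def by (simp add: fun_eq_iff)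
next
  case (Suc j)
  have "((\<lambda>x. exp (- x) * x ^ Suc j / fact (Suc j)) has_field_derivative
      (- exp (- \<mu>) * \<mu> ^ Suc j + exp (- \<mu>) * (real (Suc j) * \<mu> ^ j)) / fact (Suc j)) (at \<mu>)"
    by (rule derivative_eq_intros refl | simp)+
  moreover have "exp (- \<mu>) * (real (Suc j) * \<mu> ^ j) / fact (Suc j) = exp (- \<mu>) * \<mu> ^ j / fact j"
    by (simp add: fact_Suc divide_simps)
  ultimately show ?thesis using Suc
    unfolding poisson_weight_def[abs_def] pred_poisson_weight_def
    by (simp add: add_divide_distrib diff_divide_distrib poisson_weight_def)
qed

lemma pred_poisson_weight_bounds:
  "0 \<le> \<mu> \<Longrightarrow> 0 \<le> pred_poisson_weight k \<mu>" "0 \<le> \<mu> \<Longrightarrow> pred_poisson_weight k \<mu> \<le> 1"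
  by (auto simp: pred_poisson_weight_def poisson_weight_nonneg poisson_weight_le_1)

definition pred_binomial_weight :: "nat \<Rightarrow> nat \<Rightarrow> real \<Rightarrow> real" where
  "pred_binomial_weight l h p = (if l = 0 then 0 else binomial_weight (l - 1) h p)"

lemma binomial_weight_Suc:
  "binomial_weight l (Suc h) p = p * pred_binomial_weight l h p + (1 - p) * binomial_weight l h p"
  by (cases l) (auto simp: pred_binomial_weight_def binomial_weight_Suc_Suc binomial_weight_0_Suc)

text \<open>Differentiating a binomial law in p replaces one of the h trials, each in turn, by a
  sure success minus a sure failure. The proof is by induction on h through Pascal's rule; the
  factor \<open>real h\<close> covers the truncated \<open>h - 1\<close> at h = 0.\<close>

lemma has_field_derivative_binomial_weight:
  "(binomial_weight l h has_field_derivative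
     real h * (pred_binomial_weight l (h - 1) p - binomial_weight l (h - 1) p)) (at p)"
proof (induction h arbitrary: l)
  case 0
  then show ?case
    by (cases l) (auto simp: binomial_weight_def[abs_def])
next
  case (Suc h)
  have pred: "(pred_binomial_weight l h has_field_derivative
     real h * (pred_binomial_weight (l - 1) (h - 1) p - binomial_weight (l - 1) (h - 1) p) * of_bool (l \<noteq> 0)) (at p)"
    using Suc.IH[of "l - 1"] by (cases l) (auto simp: pred_binomial_weight_def[abs_def])
  have "(binomial_weight l (Suc h) has_field_derivative
      1 * pred_binomial_weight l h p +
      real h * (pred_binomial_weight (l - 1) (h - 1) p - binomial_weight (l - 1) (h - 1) p) * of_bool (l \<noteq> 0) * p
      + ((0 - 1) * binomial_weight l h p
      + real h * (pred_binomial_weight l (h - 1) p - binomial_weight l (h - 1) p) * (1 - p))) (at p)"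
    unfolding binomial_weight_Suc[abs_def]
    by (intro DERIV_add DERIV_mult DERIV_ident DERIV_diff DERIV_const Suc.IH pred)
  moreover have "pred_binomial_weight l h p - binomial_weight l h p + 
      (real h * (pred_binomial_weight (l - 1) (h - 1) p - binomial_weight (l - 1) (h - 1) p) * of_bool (l \<noteq> 0) * p
      + real h * (pred_binomial_weight l (h - 1) p - binomial_weight l (h - 1) p) * (1 - p)) =
      real (Suc h) * (pred_binomial_weight l (Suc h - 1) p - binomial_weight l (Suc h - 1) p)"
  proof (cases h)
    case (Suc g)
    \<comment> \<open>\<open>?X\<close> is the weight with index lowered by two, and 0 when l <
      2.\<close>
    let ?X = "of_bool (l \<noteq> 0) * pred_binomial_weight (l - 1) g p"
    have P: "pred_binomial_weight l (Suc g) p = p * ?X + (1 - p) * pred_binomial_weight l g p"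
      by (cases l) (auto simp: pred_binomial_weight_def binomial_weight_Suc)
    have Q: "(pred_binomial_weight (l - 1) g p - binomial_weight (l - 1) g p) * of_bool (l \<noteq> 0) =
        ?X - pred_binomial_weight l g p"
      by (auto simp: pred_binomial_weight_def)
    have R: "real h * (pred_binomial_weight (l - 1) (h - 1) p - binomial_weight (l - 1) (h - 1) p) * of_bool (l \<noteq> 0) * p =
        real (Suc g) * (?X - pred_binomial_weight l g p) * p"
      using Q by (simp add: Suc mult.assoc)
    show ?thesis
      by (simp only: R) (simp only: Suc diff_Suc_1 binomial_weight_Suc P, simp add: algebra_simps)
  qed simp
  ultimately show ?case by (elim DERIV_cong) (simp only: algebra_simps)
qed

section \<open>Transition probabilities of a single queue\<close>

lemma queue_bounds:
  assumes "0 \<le> t" "0 \<le> \<mu>"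
  shows "0 \<le> queue t h k \<mu>" "queue t h k \<mu> \<le> 1"
proof -
  let ?p = "exp (- t)"
  have p: "0 \<le> ?p" "?p \<le> 1" "0 \<le> (1 - ?p) * \<mu>" using assms by auto
  show "0 \<le> queue t h k \<mu>"
    unfolding queue_def using p
    by (intro sum_nonneg mult_nonneg_nonneg[OF binomial_weight_nonneg poisson_weight_nonneg])
  have "queue t h k \<mu> \<le> (\<Sum>l\<le>k. binomial_weight l h ?p)"
    unfolding queue_def
    by (intro sum_mono mult_left_le binomial_weight_nonneg poisson_weight_le_1 p)
  also have "\<dots> \<le> 1" by (intro sum_binomial_weight_le_1 p)
  finally show "queue t h k \<mu> \<le> 1" .
qed

lemma queue_0: "queue 0 h k \<mu> = of_bool (h = k)"
proof -
  have b: "binomial_weight l h 1 = of_bool (l = h)" for l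
    by (cases "l < h") (auto simp: binomial_weight_def binomial_eq_0)
  have "queue 0 h k \<mu> = (\<Sum>l\<le>k. of_bool (l = h) * poisson_weight (k - l) 0)"
    by (simp add: queue_def b)
  also have "\<dots> = (\<Sum>l\<le>k. if l = h then poisson_weight (k - h) 0 else 0)"
    by (intro sum.cong) auto
  also have "\<dots> = of_bool (h = k)"
    by (auto simp: poisson_weight_def)
  finally show ?thesis .
qed

text \<open>Kolmogorov's backward equation, in which the generator acts on the initial length h.
  Differentiating the convolution, the Poisson factor produces the arrival term and the binomial
  factor the service term.\<close>

lemma has_field_derivative_queue_time:
  "((\<lambda>t. queue t h k \<mu>) has_field_derivative
     \<mu> * (queue t (Suc h) k \<mu> - queue t h k \<mu>) + real h * (queue t (h - 1) k \<mu> - queue t h k \<mu>)) (at t)"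
proof -
  define p where "p = exp (- t)"
  define c where "c = (1 - p) * \<mu>"
  have dp: "((\<lambda>t. exp (- t)) has_field_derivative - p) (at t)"
    unfolding p_def by (auto intro!: derivative_eq_intros)
  have dc: "((\<lambda>t. (1 - exp (- t)) * \<mu>) has_field_derivative p * \<mu>) (at t)"
    unfolding p_def by (auto intro!: derivative_eq_intros)
  have db: "((\<lambda>t. binomial_weight l h (exp (- t))) has_field_derivative
     real h * (pred_binomial_weight l (h - 1) p - binomial_weight l (h - 1) p) * - p) (at t)" for l
    using DERIV_chain2[OF has_field_derivative_binomial_weight dp, of l h] unfolding p_def .
  have dw: "((\<lambda>t. poisson_weight (k - l) ((1 - exp (- t)) * \<mu>)) has_field_derivative
     (pred_poisson_weight (k - l) c - poisson_weight (k - l) c) * (p * \<mu>)) (at t)" for l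
    using DERIV_chain2[OF has_field_derivative_poisson_weight dc, of "k - l"]
    unfolding c_def p_def .
  have der: "((\<lambda>t. queue t h k \<mu>) has_field_derivative
     (\<Sum>l\<le>k. real h * (pred_binomial_weight l (h - 1) p - binomial_weight l (h - 1) p) * - p *
         poisson_weight (k - l) c +
       (pred_poisson_weight (k - l) c - poisson_weight (k - l) c) * (p * \<mu>) * binomial_weight l h p)) (at t)"
    unfolding queue_def
    by (intro DERIV_sum) (rule DERIV_cong[OF DERIV_mult[OF db dw]], simp add: p_def c_def)
  have q: "queue t h' k \<mu> = (\<Sum>l\<le>k. binomial_weight l h' p * poisson_weight (k - l) c)" for h'
    by (simp add: queue_def p_def c_def)
  \<comment> \<open>An index shift may be moved from one factor of a convolution to the other. This
    converts an additional initial customer into a shifted Poisson weight.\<close>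
  have shift: "(\<Sum>l\<le>k. pred_binomial_weight l h p * poisson_weight (k - l) c) =
      (\<Sum>l\<le>k. binomial_weight l h p * pred_poisson_weight (k - l) c)"
  proof (cases k)
    case (Suc j)
    have "(\<Sum>l\<le>Suc j. pred_binomial_weight l h p * poisson_weight (Suc j - l) c) =
        (\<Sum>l\<le>j. binomial_weight l h p * poisson_weight (j - l) c)"
      by (subst sum.atMost_Suc_shift) (simp add: pred_binomial_weight_def)
    also have "\<dots> = (\<Sum>l\<le>Suc j. binomial_weight l h p * pred_poisson_weight (Suc j - l) c)"
      by (simp add: pred_poisson_weight_def Suc_diff_le)
    finally show ?thesis using Suc by simp
  qed (simp add: pred_binomial_weight_def pred_poisson_weight_def)
  have up: "queue t (Suc h) k \<mu> - queue t h k \<mu> =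
     p * (\<Sum>l\<le>k. (pred_poisson_weight (k - l) c - poisson_weight (k - l) c) * binomial_weight l h p)"
    unfolding q binomial_weight_Suc
    using arg_cong[OF shift, of "\<lambda>x. p * x"]
    by (simp add: algebra_simps sum.distrib sum_subtractf sum_distrib_left)
  have down: "real h * (queue t (h - 1) k \<mu> - queue t h k \<mu>) =
     (\<Sum>l\<le>k. real h * (pred_binomial_weight l (h - 1) p - binomial_weight l (h - 1) p) * - p *
         poisson_weight (k - l) c)"
  proof (cases h)
    case (Suc g)
    show ?thesis
      unfolding q Suc diff_Suc_1 binomial_weight_Suc
      by (simp add: algebra_simps sum.distrib sum_subtractf sum_distrib_left)
  qed simp
  show ?thesis
    by (rule DERIV_cong[OF der], subst up, subst down)
      (simp only: sum.distrib sum_distrib_left, simp add: mult_ac)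
qed

lemma abs_diff_le_of_derivative_bound:
  fixes f f' :: "real \<Rightarrow> real"
  assumes "\<And>x. x \<ge> 0 \<Longrightarrow> (f has_field_derivative f' x) (at x)" "\<And>x. x \<ge> 0 \<Longrightarrow> \<bar>f' x\<bar> \<le> L"
    and "a \<ge> 0" "b \<ge> 0"
  shows "\<bar>f a - f b\<bar> \<le> L * \<bar>a - b\<bar>"
  using field_differentiable_bound[of "{0..}" f f' L a b] assms
  by (auto intro: has_field_derivative_at_within)

text \<open>The derivative in the rate is a binomial average of differences of Poisson weights,
  damped by 1 - p. The constant 1 is uniform in t, h and k, which is what allows degrees to be
  replaced by approximations with small mean square error.\<close>

lemma queue_lipschitz_rate:
  assumes "0 \<le> t" "0 \<le> \<mu>" "0 \<le> \<nu>"
  shows "\<bar>queue t h k \<mu> - queue t h k \<nu>\<bar> \<le> \<bar>\<mu> - \<nu>\<bar>"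
proof -
  let ?p = "exp (- t)"
  define f' where "f' x = (\<Sum>l\<le>k. binomial_weight l h ?p *
      ((pred_poisson_weight (k - l) ((1 - ?p) * x) - poisson_weight (k - l) ((1 - ?p) * x)) * (1 - ?p)))" for x
  have p: "0 \<le> ?p" "?p \<le> 1" using assms by auto
  have der: "(queue t h k has_field_derivative f' x) (at x)" for x
    unfolding queue_def[abs_def] f'_def
    by (intro DERIV_sum DERIV_cmult DERIV_chain2[OF has_field_derivative_poisson_weight])
      (auto intro!: derivative_eq_intros)
  have "\<bar>f' x\<bar> \<le> 1" if "x \<ge> 0" for x
  proof -
    have x: "0 \<le> (1 - ?p) * x" using p that by simp
    have "\<bar>f' x\<bar> \<le> (\<Sum>l\<le>k. binomial_weight l h ?p * 1)"
      unfolding f'_def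
    proof (intro order_trans[OF sum_abs] sum_mono)
      fix l
      have "\<bar>pred_poisson_weight (k - l) ((1 - ?p) * x) - poisson_weight (k - l) ((1 - ?p) * x)\<bar> \<le> 1"
        using pred_poisson_weight_bounds[OF x, of "k - l"] poisson_weight_le_1[OF x, of "k - l"]
          poisson_weight_nonneg[OF x, of "k - l"] by linarith
      then have "\<bar>(pred_poisson_weight (k - l) ((1 - ?p) * x) - poisson_weight (k - l) ((1 - ?p) * x)) * (1 - ?p)\<bar> \<le> 1"
        using p unfolding abs_mult by (intro mult_le_one) auto
      then show "\<bar>binomial_weight l h ?p * ((pred_poisson_weight (k - l) ((1 - ?p) * x) - poisson_weight (k - l) ((1 - ?p) * x)) * (1 - ?p))\<bar>
           \<le> binomial_weight l h ?p * 1"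
        using binomial_weight_nonneg[OF p, of l h] unfolding abs_mult[of "binomial_weight l h ?p"]
        by (intro mult_mono) auto
    qed
    also have "\<dots> \<le> 1" using sum_binomial_weight_le_1[OF p] by simp
    finally show ?thesis .
  qed
  from abs_diff_le_of_derivative_bound[OF der this assms(2,3)] show ?thesis by simp
qed

text \<open>By the backward equation the time derivative is at most the total jump rate, because all
  transition probabilities lie in [0, 1].\<close>

lemma queue_lipschitz_time:
  assumes "0 \<le> t" "0 \<le> s" "0 \<le> \<mu>"
  shows "\<bar>queue t h k \<mu> - queue s h k \<mu>\<bar> \<le> (\<mu> + real h) * \<bar>t - s\<bar>"
proof (rule abs_diff_le_of_derivative_bound[OF has_field_derivative_queue_time _ assms(1,2)])
  fix x :: real assume x: "x \<ge> 0"
  have d: "\<bar>queue x h' k \<mu> - queue x h k \<mu>\<bar> \<le> 1" for h'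
    using queue_bounds[OF x assms(3), of h' k] queue_bounds[OF x assms(3), of h k] by linarith
  have "\<bar>\<mu> * (queue x (Suc h) k \<mu> - queue x h k \<mu>) + real h * (queue x (h - 1) k \<mu> - queue x h k \<mu>)\<bar>
     \<le> \<mu> * \<bar>queue x (Suc h) k \<mu> - queue x h k \<mu>\<bar> + real h * \<bar>queue x (h - 1) k \<mu> - queue x h k \<mu>\<bar>"
    using assms(3) by (intro order_trans[OF abs_triangle_ineq]) (simp add: abs_mult)
  also have "\<dots> \<le> \<mu> * 1 + real h * 1"
    using d assms(3) by (intro add_mono mult_left_mono) auto
  finally show "\<bar>\<mu> * (queue x (Suc h) k \<mu> - queue x h k \<mu>) + real h * (queue x (h - 1) k \<mu> - queue x h k \<mu>)\<bar>
     \<le> \<mu> + real h" by simp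
qed


text \<open>The generator of independent M/M/infinity queues indexed by P, with service rate 1 per
  customer. Truncation of \<open>h p - 1\<close> at 0 is harmless because of the factor
  \<open>h p\<close>.\<close>

definition queues_gen :: "'p set \<Rightarrow> ('p \<Rightarrow> real) \<Rightarrow> (('p \<Rightarrow> nat) \<Rightarrow> real) \<Rightarrow> ('p \<Rightarrow> nat) \<Rightarrow> real" where
  "queues_gen P \<mu> G h =
     (\<Sum>p\<in>P. \<mu> p * (G (h(p := Suc (h p))) - G h) + real (h p) * (G (h(p := h p - 1)) - G h))"

definition queues :: "'p set \<Rightarrow> ('p \<Rightarrow> nat) \<Rightarrow> ('p \<Rightarrow> real) \<Rightarrow> real \<Rightarrow> ('p \<Rightarrow> nat) \<Rightarrow> real" where
  "queues P k \<mu> t h = (\<Prod>p\<in>P. queue t (h p) (k p) (\<mu> p))"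

lemma queues_bounds:
  assumes "0 \<le> t" "\<And>p. p \<in> P \<Longrightarrow> 0 \<le> \<mu> p"
  shows "0 \<le> queues P k \<mu> t h" "queues P k \<mu> t h \<le> 1"
  unfolding queues_def using assms by (auto intro!: prod_nonneg prod_le_1 queue_bounds)

lemma queues_cong: "(\<And>p. p \<in> P \<Longrightarrow> h p = h' p) \<Longrightarrow> queues P k \<mu> t h = queues P k \<mu> t h'"
  unfolding queues_def by (auto intro: prod.cong)

text \<open>The product rule: each summand of the generator alters one coordinate, hence one factor
  of the product.\<close>

lemma has_field_derivative_queues:
  assumes "finite P"
  shows "((\<lambda>t. queues P k \<mu> t h) has_field_derivative queues_gen P \<mu> (queues P k \<mu> t) h) (at t)"
proof -
  have upd: "queues P k \<mu> t (h(p := z)) = queue t z (k p) (\<mu> p) * (\<Prod>q\<in>P - {p}. queue t (h q) (k q) (\<mu> q))"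
    if "p \<in> P" for p z
    unfolding queues_def using assms that by (subst prod.remove[of P p]) auto
  have same: "queues P k \<mu> t h = queue t (h p) (k p) (\<mu> p) * (\<Prod>q\<in>P - {p}. queue t (h q) (k q) (\<mu> q))"
    if "p \<in> P" for p
    using upd[OF that, of "h p"] by simp
  have "((\<lambda>t. queues P k \<mu> t h) has_field_derivative
    (\<Sum>p\<in>P. (\<mu> p * (queue t (Suc (h p)) (k p) (\<mu> p) - queue t (h p) (k p) (\<mu> p)) +
        real (h p) * (queue t (h p - 1) (k p) (\<mu> p) - queue t (h p) (k p) (\<mu> p))) *
      (\<Prod>q\<in>P - {p}. queue t (h q) (k q) (\<mu> q)))) (at t)"
    unfolding queues_def by (rule has_field_derivative_prod) (rule has_field_derivative_queue_time)
  moreover have "(\<Sum>p\<in>P. (\<mu> p * (queue t (Suc (h p)) (k p) (\<mu> p) - queue t (h p) (k p) (\<mu> p)) +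
        real (h p) * (queue t (h p - 1) (k p) (\<mu> p) - queue t (h p) (k p) (\<mu> p))) *
      (\<Prod>q\<in>P - {p}. queue t (h q) (k q) (\<mu> q))) = queues_gen P \<mu> (queues P k \<mu> t) h"
    unfolding queues_gen_def
  proof (intro sum.cong refl)
    fix p assume p: "p \<in> P"
    show "(\<mu> p * (queue t (Suc (h p)) (k p) (\<mu> p) - queue t (h p) (k p) (\<mu> p)) +
        real (h p) * (queue t (h p - 1) (k p) (\<mu> p) - queue t (h p) (k p) (\<mu> p))) *
      (\<Prod>q\<in>P - {p}. queue t (h q) (k q) (\<mu> q)) =
      \<mu> p * (queues P k \<mu> t (h(p := Suc (h p))) - queues P k \<mu> t h) +
      real (h p) * (queues P k \<mu> t (h(p := h p - 1)) - queues P k \<mu> t h)"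
      unfolding upd[OF p] same[OF p] by (simp add: algebra_simps)
  qed
  ultimately show ?thesis by simp
qed

lemma has_field_derivative_queues_gen:
  assumes "\<And>h. ((\<lambda>s. G s h) has_field_derivative G' h) (at t)"
  shows "((\<lambda>s. queues_gen P \<mu> (G s) h) has_field_derivative queues_gen P \<mu> G' h) (at t)"
  unfolding queues_gen_def by (intro DERIV_sum DERIV_add DERIV_cmult DERIV_diff assms)

lemma abs_queues_gen_le:
  assumes "\<And>p. p \<in> P \<Longrightarrow> 0 \<le> \<mu> p"
    and "\<And>p. p \<in> P \<Longrightarrow> \<bar>G (h(p := Suc (h p))) - G h\<bar> \<le> c"
    and "\<And>p. p \<in> P \<Longrightarrow> h p > 0 \<Longrightarrow> \<bar>G (h(p := h p - 1)) - G h\<bar> \<le> c"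
  shows "\<bar>queues_gen P \<mu> G h\<bar> \<le> c * (\<Sum>p\<in>P. \<mu> p + real (h p))"
  unfolding queues_gen_def sum_distrib_left
proof (intro order_trans[OF sum_abs] sum_mono)
  fix p assume p: "p \<in> P"
  have "\<bar>real (h p) * (G (h(p := h p - 1)) - G h)\<bar> \<le> real (h p) * c"
    using assms(3)[OF p] by (cases "h p") (auto simp: abs_mult intro!: mult_left_mono)
  moreover have "\<bar>\<mu> p * (G (h(p := Suc (h p))) - G h)\<bar> \<le> \<mu> p * c"
    using assms(1,2)[OF p] by (auto simp: abs_mult intro!: mult_left_mono)
  ultimately show "\<bar>\<mu> p * (G (h(p := Suc (h p))) - G h) + real (h p) * (G (h(p := h p - 1)) - G h)\<bar>
     \<le> c * (\<mu> p + real (h p))"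
    using abs_triangle_ineq[of "\<mu> p * (G (h(p := Suc (h p))) - G h)" "real (h p) * (G (h(p := h p - 1)) - G h)"]
    by (simp add: algebra_simps)
qed

text \<open>The second time derivative is the generator applied twice. One application is at most
  the total jump rate \<open>\<Lambda> h\<close>; a jump raises that rate by at most 1, so
  increments of the first application are at most \<open>2 * \<Lambda> h + 1\<close>, which bounds
  the second one.\<close>

lemma queues_taylor:
  fixes \<mu> :: "'p \<Rightarrow> real"
  assumes fin: "finite P" and mu: "\<And>p. p \<in> P \<Longrightarrow> 0 \<le> \<mu> p" and t: "0 \<le> t" "0 \<le> \<delta>"
  defines "\<Lambda> \<equiv> \<lambda>h. (\<Sum>p\<in>P. \<mu> p + real (h p))"
  shows "\<bar>queues P k \<mu> (t + \<delta>) h - queues P k \<mu> t h - \<delta> * queues_gen P \<mu> (queues P k \<mu> t) h\<bar>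
     \<le> \<delta>\<^sup>2 * (\<Lambda> h * (2 * \<Lambda> h + 1))"
proof -
  let ?G = "queues P k \<mu>"
  let ?L = "queues_gen P \<mu>"
  have L1: "\<bar>?L (?G s) h\<bar> \<le> \<Lambda> h" if "0 \<le> s" for s h
  proof -
    have "\<bar>?G s h' - ?G s h\<bar> \<le> 1" for h'
      using queues_bounds[of s P \<mu> k h] queues_bounds[of s P \<mu> k h'] that mu by fastforce
    then have "\<bar>?L (?G s) h\<bar> \<le> 1 * \<Lambda> h"
      unfolding \<Lambda>_def using mu by (intro abs_queues_gen_le) auto
    then show ?thesis by simp
  qed
  have \<Lambda>_up: "\<Lambda> (h(p := Suc (h p))) = \<Lambda> h + 1" if "p \<in> P" for p h
    unfolding \<Lambda>_def sum.remove[OF fin that] by simp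
  have \<Lambda>_down: "\<Lambda> (h(p := h p - 1)) \<le> \<Lambda> h" for p h
    unfolding \<Lambda>_def by (intro sum_mono) auto
  have L2: "\<bar>?L (?L (?G s)) h\<bar> \<le> (2 * \<Lambda> h + 1) * \<Lambda> h" if s: "0 \<le> s" for s
    unfolding \<Lambda>_def
  proof (rule abs_queues_gen_le)
    fix p assume p: "p \<in> P"
    show "0 \<le> \<mu> p" using mu p .
    show "\<bar>?L (?G s) (h(p := Suc (h p))) - ?L (?G s) h\<bar> \<le> 2 * (\<Sum>p\<in>P. \<mu> p + real (h p)) + 1"
      using L1[OF s, of h] L1[OF s, of "h(p := Suc (h p))"] \<Lambda>_up[OF p, of h] unfolding \<Lambda>_def by linarith
    show "\<bar>?L (?G s) (h(p := h p - 1)) - ?L (?G s) h\<bar> \<le> 2 * (\<Sum>p\<in>P. \<mu> p + real (h p)) + 1"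
      using L1[OF s, of h] L1[OF s, of "h(p := h p - 1)"] \<Lambda>_down[of h p] unfolding \<Lambda>_def by linarith
  qed
  have dL: "((\<lambda>s. ?L (?G s) h) has_field_derivative ?L (?L (?G s)) h) (at s)" for s
    by (intro has_field_derivative_queues_gen has_field_derivative_queues fin)
  have lip: "\<bar>?L (?G (t + s)) h - ?L (?G t) h\<bar> \<le> (2 * \<Lambda> h + 1) * \<Lambda> h * s" if "0 \<le> s" for s
    using abs_diff_le_of_derivative_bound[of "\<lambda>s. ?L (?G s) h" "\<lambda>s. ?L (?L (?G s)) h" _ "t + s" t]
      dL L2 that t by simp
  define F where "F s = ?G (t + s) h - ?G t h - s * ?L (?G t) h" for s
  have "(F has_field_derivative ?L (?G (t + s)) h - ?L (?G t) h) (at s)" for s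
  proof -
    have "((\<lambda>s. t + s) has_field_derivative 1) (at s)" by (auto intro!: derivative_eq_intros)
    from DERIV_chain2[OF has_field_derivative_queues[OF fin] this]
    have "((\<lambda>s. ?G (t + s) h) has_field_derivative ?L (?G (t + s)) h) (at s)" by simp
    then show ?thesis unfolding F_def[abs_def]
      by (auto intro!: derivative_eq_intros)
  qed
  \<comment> \<open>The derivative of the remainder grows at most linearly and is bounded on
    [0, \<delta>] by its value at \<delta>; this gives up the factor 1/2 of Taylor's
    formula.\<close>
  then have "norm (F \<delta> - F 0) \<le> ((2 * \<Lambda> h + 1) * \<Lambda> h * \<delta>) * norm (\<delta> - 0)"
  proof (intro field_differentiable_bound[of "{0..\<delta>}" F "\<lambda>s. ?L (?G (t + s)) h - ?L (?G t) h"])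
    fix s assume s: "s \<in> {0..\<delta>}"
    have "0 \<le> \<Lambda> h" unfolding \<Lambda>_def using mu by (auto intro!: sum_nonneg)
    then have "(2 * \<Lambda> h + 1) * \<Lambda> h * s \<le> (2 * \<Lambda> h + 1) * \<Lambda> h * \<delta>"
      using s by (intro mult_left_mono) auto
    then show "norm (?L (?G (t + s)) h - ?L (?G t) h) \<le> (2 * \<Lambda> h + 1) * \<Lambda> h * \<delta>"
      using lip[of s] s by auto
  qed (use t in \<open>auto intro: has_field_derivative_at_within\<close>)
  moreover have "F 0 = 0" by (simp add: F_def)
  ultimately show ?thesis using t
    by (simp add: F_def power2_eq_square mult_ac)
qed


section \<open>Entries, degrees and edge counts under one step\<close>

lemma of_bool_doubleton:
  "of_bool ({x, y} = {v, w}) =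
    (if x = y then of_bool (v = x) * of_bool (w = x)
     else of_bool (v = x) * of_bool (w = y) + of_bool (v = y) * of_bool (w = x) :: 'b :: semiring_1)"
  by (auto simp: doubleton_eq_iff)

text \<open>Halving on the diagonal counts each loop once, so that a step changes every count by at
  most one, as in a queue.\<close>

definition edges :: "nmat \<Rightarrow> nat \<Rightarrow> nat \<Rightarrow> nat" where
  "edges X x y = X x y div (if x = y then 2 else 1)"

lemma adj_sym: "X \<in> adj n \<Longrightarrow> X i j = X j i"
  unfolding adj_def by (cases "i \<in> {1..n} \<and> j \<in> {1..n}") auto

lemma adj_even: "X \<in> adj n \<Longrightarrow> even (X i i)"
  unfolding adj_def by (cases "i \<in> {1..n}") auto

lemma adj_range: "X \<in> adj n \<Longrightarrow> X i j > 0 \<Longrightarrow> i \<in> {1..n} \<and> j \<in> {1..n}"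
proof -
  assume X: "X \<in> adj n" "X i j > 0"
  then have "i \<notin> {1..n} \<or> j \<notin> {1..n} \<longrightarrow> X i j = 0" unfolding adj_def by blast
  then show ?thesis using X(2) by auto
qed

lemma int_reconnect:
  assumes X: "X \<in> adj n" and pos: "X v w > 0"
  shows "int (reconnect v w u X i j) = int (X i j) - of_bool (v = i \<and> w = j) - of_bool (v = j \<and> w = i)
     + of_bool (u = i \<and> w = j) + of_bool (u = j \<and> w = i)"
proof -
  have "of_bool (v = i \<and> w = j) + of_bool (v = j \<and> w = i) \<le> X i j"
  proof (cases "v = w")
    case True
    then have "X v w \<ge> 2" using pos adj_even[OF X, of v] by (auto elim!: evenE)
    then show ?thesis using True by auto
  next
    case False
    then show ?thesis using pos adj_sym[OF X, of v w] by auto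
  qed
  moreover have "a + b \<le> x \<Longrightarrow> int (x - a - b + c + d) = int x - int a - int b + int c + int d" for a b c d x :: nat
    by linarith
  ultimately show ?thesis unfolding reconnect_def by (simp only: of_nat_of_bool)
qed

lemma real_reconnect:
  assumes X: "X \<in> adj n" and pos: "X v w > 0"
  shows "real (reconnect v w u X i j) = real (X i j) - of_bool (v = i) * of_bool (w = j) - of_bool (w = i) * of_bool (v = j)
     + of_bool (u = i) * of_bool (w = j) + of_bool (w = i) * of_bool (u = j)"
proof -
  have "real (reconnect v w u X i j) = of_int (int (reconnect v w u X i j))" by simp
  also have "\<dots> = real (X i j) - of_bool (v = i) * of_bool (w = j) - of_bool (w = i) * of_bool (v = j)
     + of_bool (u = i) * of_bool (w = j) + of_bool (w = i) * of_bool (u = j)"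
    unfolding int_reconnect[OF assms] by (auto simp: of_bool_def)
  finally show ?thesis .
qed

lemma sum_of_bool_mult:
  fixes f :: "nat \<Rightarrow> real"
  shows "v \<in> {1..n} \<Longrightarrow> (\<Sum>j\<in>{1..n}. of_bool (v = j) * f j) = f v"
    "v \<in> {1..n} \<Longrightarrow> (\<Sum>j\<in>{1..n}. f j * of_bool (v = j)) = f v"
    "v \<in> {1..n} \<Longrightarrow> (\<Sum>j\<in>{1..n}. of_bool (v = j) :: real) = 1"
    "v \<in> {1..n} \<Longrightarrow> (\<Sum>j\<in>{1..n}. of_bool (j = v) * f j) = f v"
    "v \<in> {1..n} \<Longrightarrow> (\<Sum>j\<in>{1..n}. f j * of_bool (j = v)) = f v"
    "v \<in> {1..n} \<Longrightarrow> (\<Sum>j\<in>{1..n}. of_bool (j = v) :: real) = 1"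
proof -
  assume v: "v \<in> {1..n}"
  have d: "(\<Sum>j\<in>{1..n}. if j = v then f j else 0) = f v" for f :: "nat \<Rightarrow> real"
    using v by simp
  show "(\<Sum>j\<in>{1..n}. of_bool (v = j) * f j) = f v" "(\<Sum>j\<in>{1..n}. f j * of_bool (v = j)) = f v"
    "(\<Sum>j\<in>{1..n}. of_bool (j = v) * f j) = f v" "(\<Sum>j\<in>{1..n}. f j * of_bool (j = v)) = f v"
    by (rule trans[OF _ d[of f]], intro sum.cong refl, force)+
  show "(\<Sum>j\<in>{1..n}. of_bool (v = j) :: real) = 1" "(\<Sum>j\<in>{1..n}. of_bool (j = v) :: real) = 1"
    by (rule trans[OF _ d[of "\<lambda>_. 1"]], intro sum.cong refl, force)+
qed

text \<open>The end w keeps the edge and hence its degree; only the moved end matters. Loops need no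
  separate treatment because row sums count them twice.\<close>

lemma real_deg_reconnect:
  assumes X: "X \<in> adj n" and pos: "X v w > 0" and u: "u \<in> {1..n}"
  shows "real (deg n (reconnect v w u X) i) = real (deg n X i) - of_bool (v = i) + of_bool (u = i)"
proof -
  have vw: "v \<in> {1..n}" "w \<in> {1..n}" using adj_range[OF X pos] by auto
  show ?thesis
    unfolding deg_def of_nat_sum real_reconnect[OF X pos]
    unfolding sum.distrib sum_subtractf sum_of_bool_mult(1-2)[OF vw(1)] sum_distrib_left[symmetric]
      sum_of_bool_mult(3)[OF vw(1)] sum_of_bool_mult(3)[OF vw(2)] sum_of_bool_mult(3)[OF u] by simp
qed

lemma adj_edges_sum:
  assumes "X \<in> adj_edges n m"
  shows "(\<Sum>i\<in>{1..n}. real (deg n X i)) = 2 * real m" "(\<Sum>i\<in>{1..n}. \<Sum>j\<in>{1..n}. real (X i j)) = 2 * real m"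
  using assms by (auto simp: adj_edges_def deg_def)

lemma adj_edges_adj: "X \<in> adj_edges n m \<Longrightarrow> X \<in> adj n"
  by (simp add: adj_edges_def)

text \<open>On the diagonal the two orientations coincide, so changes there are even; the total
  degree is preserved because one edge end moves from v to u.\<close>

lemma reconnect_in_adj_edges:
  assumes X: "X \<in> adj_edges n m" and pos: "X v w > 0" and u: "u \<in> {1..n}"
  shows "reconnect v w u X \<in> adj_edges n m"
proof -
  note A = adj_edges_adj[OF X]
  have vw: "v \<in> {1..n}" "w \<in> {1..n}" using adj_range[OF A pos] by auto
  note I = int_reconnect[OF A pos]
  have "reconnect v w u X \<in> adj n"
    unfolding adj_def
  proof (safe)
    fix i j
    have "int (reconnect v w u X i j) = int (reconnect v w u X j i)"
      unfolding I using adj_sym[OF A, of i j] by simp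
    then show "reconnect v w u X i j = reconnect v w u X j i" by simp
  next
    fix i
    have "int (reconnect v w u X i i) = int (X i i) + 2 * (of_bool (u = i \<and> w = i) - of_bool (v = i \<and> w = i))"
      unfolding I by simp
    moreover have "even (int (X i i))" using adj_even[OF A, of i] by simp
    ultimately have "even (int (reconnect v w u X i i))" by simp
    then show "even (reconnect v w u X i i)" by simp
  next
    fix i j assume "i \<notin> {1..n}"
    then have "v \<noteq> i" "w \<noteq> i" "u \<noteq> i" using vw u by auto
    then have "int (reconnect v w u X i j) = int (X i j)" unfolding I by simp
    then show "reconnect v w u X i j = 0" using \<open>i \<notin> {1..n}\<close> A by (auto simp: adj_def)
  next
    fix i j assume "j \<notin> {1..n}"
    then have "v \<noteq> j" "w \<noteq> j" "u \<noteq> j" using vw u by auto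
    then have "int (reconnect v w u X i j) = int (X i j)" unfolding I by simp
    then show "reconnect v w u X i j = 0" using \<open>j \<notin> {1..n}\<close> A by (auto simp: adj_def)
  qed
  moreover have "(\<Sum>i\<in>{1..n}. real (deg n (reconnect v w u X) i)) = 2 * real m"
    unfolding real_deg_reconnect[OF A pos u] sum.distrib sum_subtractf
      sum_of_bool_mult(3)[OF vw(1)] sum_of_bool_mult(3)[OF u] adj_edges_sum(1)[OF X] by simp
  ultimately show ?thesis by (simp add: adj_edges_def deg_def)
qed

lemma real_edges: "X \<in> adj n \<Longrightarrow> real (edges X x y) = real (X x y) / (if x = y then 2 else 1)"
  using adj_even[of X n x] by (auto simp: edges_def real_of_nat_div)

text \<open>Comparing unordered pairs as sets makes a loop and an ordinary edge obey the same
  formula. It is stated over the integers so that the decrement is a genuine subtraction.\<close>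

lemma int_edges_reconnect:
  assumes X: "X \<in> adj_edges n m" and pos: "X v w > 0" and u: "u \<in> {1..n}"
  shows "int (edges (reconnect v w u X) x y) = int (edges X x y) - of_bool ({x, y} = {v, w}) + of_bool ({x, y} = {u, w})"
proof -
  note A = adj_edges_adj[OF X]
  have "real (edges (reconnect v w u X) x y) =
     real (edges X x y) - of_bool ({x, y} = {v, w}) + of_bool ({x, y} = {u, w})"
    unfolding of_bool_doubleton real_edges[OF adj_edges_adj[OF reconnect_in_adj_edges[OF assms]]]
      real_edges[OF A] real_reconnect[OF A pos]
    by (cases "x = y") (simp_all add: add_divide_distrib diff_divide_distrib)
  then have "(of_int (int (edges (reconnect v w u X) x y)) :: real) =
     of_int (int (edges X x y) - of_bool ({x, y} = {v, w}) + of_bool ({x, y} = {u, w}))"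
    by (simp only: of_int_add of_int_diff of_int_of_nat_eq of_int_of_bool)
  then show ?thesis by (simp only: of_int_eq_iff)
qed


section \<open>The edge reconnecting chain\<close>


locale reconnecting =
  fixes \<kappa> :: real and n m :: nat
  assumes kappa_pos: "\<kappa> > 0" and m_pos: "m > 0"
begin

definition new_prob :: "nmat \<Rightarrow> nat \<Rightarrow> real" where
  "new_prob X u = (real (deg n X u) + \<kappa>) / (2 * real m + real n * \<kappa>)"

text \<open>
  In \<open>g v w u\<close>, the arguments are \<open>V\<^sub>o\<^sub>l\<^sub>d\<close>, \<open>V'\<close> and \<open>V\<^sub>n\<^sub>e\<^sub>w\<close>; the factor \<open>deg n X v\<close> of the
  transition probabilities cancels.
\<close>

definition choice_mean :: "nmat \<Rightarrow> (nat \<Rightarrow> nat \<Rightarrow> nat \<Rightarrow> real) \<Rightarrow> real" where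
  "choice_mean X g = (\<Sum>v\<in>{1..n}. \<Sum>w\<in>{1..n}. \<Sum>u\<in>{1..n}. real (X v w) / (2 * real m) * new_prob X u * g v w u)"

definition mean :: "(nmat \<Rightarrow> real) \<Rightarrow> nmat \<Rightarrow> real" where
  "mean f X = choice_mean X (\<lambda>v w u. f (reconnect v w u X))"

lemma denominator_pos: "2 * real m + real n * \<kappa> > 0"
  using m_pos kappa_pos by (simp add: add_pos_nonneg)

lemma new_prob_nonneg: "0 \<le> new_prob X u"
  using denominator_pos kappa_pos by (simp add: new_prob_def)

lemma new_prob_le: "new_prob X u \<le> (real (deg n X u) + \<kappa>) / (2 * real m)"
  unfolding new_prob_def using m_pos kappa_pos by (intro frac_le) auto

text \<open>Comparison is demanded only where X v w > 0: elsewhere the choice has probability 0, and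
  \<open>reconnect\<close> may leave the state space.\<close>

lemma choice_mean_mono:
  assumes "\<And>v w u. v \<in> {1..n} \<Longrightarrow> w \<in> {1..n} \<Longrightarrow> u \<in> {1..n} \<Longrightarrow> X v w > 0 \<Longrightarrow> g v w u \<le> g' v w u"
  shows "choice_mean X g \<le> choice_mean X g'"
  unfolding choice_mean_def
proof (intro sum_mono)
  fix v w u assume vwu: "v \<in> {1..n}" "w \<in> {1..n}" "u \<in> {1..n}"
  show "real (X v w) / (2 * real m) * new_prob X u * g v w u \<le> real (X v w) / (2 * real m) * new_prob X u * g' v w u"
  proof (cases "X v w = 0")
    case False
    then show ?thesis using assms[OF vwu] new_prob_nonneg by (intro mult_left_mono) auto
  qed simp
qed

lemma choice_mean_cong:
  assumes "\<And>v w u. v \<in> {1..n} \<Longrightarrow> w \<in> {1..n} \<Longrightarrow> u \<in> {1..n} \<Longrightarrow> X v w > 0 \<Longrightarrow> g v w u = g' v w u"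
  shows "choice_mean X g = choice_mean X g'"
  using assms by (intro antisym choice_mean_mono) auto

lemma choice_mean_add: "choice_mean X (\<lambda>v w u. g v w u + g' v w u) = choice_mean X g + choice_mean X g'"
  by (simp add: choice_mean_def distrib_left sum.distrib)

lemma choice_mean_diff: "choice_mean X (\<lambda>v w u. g v w u - g' v w u) = choice_mean X g - choice_mean X g'"
  by (simp add: choice_mean_def right_diff_distrib sum_subtractf)

lemma choice_mean_cmult: "choice_mean X (\<lambda>v w u. c * g v w u) = c * choice_mean X g"
  by (simp add: choice_mean_def sum_distrib_left mult_ac)

lemma choice_mean_cmult_right: "choice_mean X (\<lambda>v w u. g v w u * c) = choice_mean X g * c"
  using choice_mean_cmult[of X c g] by (simp add: mult.commute)

lemma choice_mean_sum: "choice_mean X (\<lambda>v w u. \<Sum>p\<in>P. g p v w u) = (\<Sum>p\<in>P. choice_mean X (g p))"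
  by (induction P rule: infinite_finite_induct)
    (simp_all add: choice_mean_add, simp_all add: choice_mean_def)

lemma choice_mean_abs: "\<bar>choice_mean X g\<bar> \<le> choice_mean X (\<lambda>v w u. \<bar>g v w u\<bar>)"
proof -
  have "choice_mean X (\<lambda>v w u. - 1 * g v w u) \<le> choice_mean X (\<lambda>v w u. \<bar>g v w u\<bar>)"
    by (intro choice_mean_mono) auto
  moreover have "choice_mean X g \<le> choice_mean X (\<lambda>v w u. \<bar>g v w u\<bar>)"
    by (intro choice_mean_mono) auto
  ultimately show ?thesis unfolding choice_mean_cmult by simp
qed

lemma choice_mean_product:
  "choice_mean X (\<lambda>v w u. a v w * b u) =
    (\<Sum>v\<in>{1..n}. \<Sum>w\<in>{1..n}. real (X v w) / (2 * real m) * a v w) * (\<Sum>u\<in>{1..n}. new_prob X u * b u)"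
  unfolding choice_mean_def sum_distrib_right
  unfolding sum_distrib_left by (intro sum.cong refl) (simp add: mult_ac)

context
  fixes X assumes X: "X \<in> adj_edges n m"
begin

lemma sum_old: "(\<Sum>v\<in>{1..n}. \<Sum>w\<in>{1..n}. real (X v w) / (2 * real m)) = 1"
  using adj_edges_sum(2)[OF X] m_pos by (simp flip: sum_divide_distrib)

lemma sum_new_prob: "(\<Sum>u\<in>{1..n}. new_prob X u) = 1"
  using adj_edges_sum(1)[OF X] denominator_pos
  by (simp add: new_prob_def sum.distrib flip: sum_divide_distrib)

lemma choice_mean_old_new: "choice_mean X (\<lambda>v w u. a v w) = (\<Sum>v\<in>{1..n}. \<Sum>w\<in>{1..n}. real (X v w) / (2 * real m) * a v w)"
  "choice_mean X (\<lambda>v w u. b u) = (\<Sum>u\<in>{1..n}. new_prob X u * b u)"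
  using choice_mean_product[of X a "\<lambda>_. 1"] choice_mean_product[of X "\<lambda>_ _. 1" b] sum_old sum_new_prob by simp_all

lemma choice_mean_const: "choice_mean X (\<lambda>v w u. c) = c"
  using sum_new_prob by (simp add: choice_mean_old_new(2) flip: sum_distrib_right)

lemma choice_mean_is_new: "x \<in> {1..n} \<Longrightarrow> choice_mean X (\<lambda>v w u. of_bool (u = x)) = new_prob X x"
  by (simp add: choice_mean_old_new(2) sum_of_bool_mult)

lemma choice_mean_is_old: "x \<in> {1..n} \<Longrightarrow> choice_mean X (\<lambda>v w u. of_bool (v = x)) = real (deg n X x) / (2 * real m)"
  by (simp add: choice_mean_old_new(1) sum_of_bool_mult deg_def flip: sum_distrib_right sum_divide_distrib)

lemma sum_target: "w \<in> {1..n} \<Longrightarrow> (\<Sum>v\<in>{1..n}. real (X v w) / (2 * real m)) = real (deg n X w) / (2 * real m)"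
  using adj_sym[OF adj_edges_adj[OF X]] by (simp add: deg_def flip: sum_divide_distrib)

text \<open>An edge with distinct ends is hit in two orientations, each with probability X x y / (2
  m), whereas a loop position is hit in one, with X x x twice the number of loops. Both give edges /
  m, so in time units of m steps every edge is removed at rate 1. The new end is chosen
  independently.\<close>

lemma choice_mean_edge_new:
  assumes "x \<in> {1..n}" "y \<in> {1..n}"
  shows "choice_mean X (\<lambda>v w u. of_bool ({x, y} = {v, w}) * b u) =
    real (edges X x y) / real m * (\<Sum>u\<in>{1..n}. new_prob X u * b u)"
proof -
  note A = adj_edges_adj[OF X]
  have one: "(\<Sum>v\<in>{1..n}. \<Sum>w\<in>{1..n}. real (X v w) / (2 * real m) * (of_bool (v = x) * of_bool (w = y))) =
     real (X x y) / (2 * real m)" if "x \<in> {1..n}" "y \<in> {1..n}" for x y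
  proof -
    have "(\<Sum>v\<in>{1..n}. \<Sum>w\<in>{1..n}. real (X v w) / (2 * real m) * (of_bool (v = x) * of_bool (w = y))) =
      (\<Sum>v\<in>{1..n}. of_bool (v = x) * (\<Sum>w\<in>{1..n}. real (X v w) / (2 * real m) * of_bool (w = y)))"
      by (simp add: sum_distrib_left mult_ac)
    then show ?thesis unfolding sum_of_bool_mult(4)[OF that(1)] sum_of_bool_mult(5)[OF that(2)] .
  qed
  have "(\<Sum>v\<in>{1..n}. \<Sum>w\<in>{1..n}. real (X v w) / (2 * real m) * of_bool ({x, y} = {v, w})) = real (edges X x y) / real m"
    unfolding real_edges[OF A]
    using one[OF assms] one[OF assms(2,1)] adj_sym[OF A, of x y]
    by (cases "x = y") (simp_all add: of_bool_doubleton of_bool_conj distrib_left sum.distrib add_divide_distrib)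
  then show ?thesis unfolding choice_mean_product by simp
qed

lemma choice_mean_edge:
  assumes "x \<in> {1..n}" "y \<in> {1..n}"
  shows "choice_mean X (\<lambda>v w u. of_bool ({x, y} = {v, w})) = real (edges X x y) / real m"
  using choice_mean_edge_new[OF assms, of "\<lambda>_. 1"] sum_new_prob by simp

lemma choice_mean_target_new:
  assumes "x \<in> {1..n}" "y \<in> {1..n}"
  shows "choice_mean X (\<lambda>v w u. of_bool (u = x) * of_bool (w = y)) = new_prob X x * (real (deg n X y) / (2 * real m))"
proof -
  have "choice_mean X (\<lambda>v w u. of_bool (w = y) * of_bool (u = x)) = 
    (\<Sum>v\<in>{1..n}. \<Sum>w\<in>{1..n}. real (X v w) / (2 * real m) * of_bool (w = y)) * new_prob X x"
    using assms unfolding choice_mean_product by (simp add: sum_of_bool_mult)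
  then show ?thesis
    unfolding sum_of_bool_mult(5)[OF assms(2)] sum_target[OF assms(2)] by (simp add: mult.commute)
qed

text \<open>Either vertex may be the new end, with the other being the end that stays; for x = y the
  two events coincide, hence the halving.\<close>

lemma choice_mean_new_edge:
  assumes "x \<in> {1..n}" "y \<in> {1..n}"
  shows "choice_mean X (\<lambda>v w u. of_bool ({x, y} = {u, w})) =
    (new_prob X x * real (deg n X y) + new_prob X y * real (deg n X x)) / (2 * real m * (if x = y then 2 else 1))"
  using choice_mean_target_new[OF assms] choice_mean_target_new[OF assms(2,1)]
  by (cases "x = y") (simp_all add: of_bool_doubleton of_bool_conj choice_mean_add add_divide_distrib mult.commute)

lemma mean_mono:
  assumes "\<And>Y. Y \<in> adj_edges n m \<Longrightarrow> f Y \<le> g Y"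
  shows "mean f X \<le> mean g X"
  unfolding mean_def using reconnect_in_adj_edges[OF X] assms by (intro choice_mean_mono) auto

lemma mean_const: "mean (\<lambda>_. c) X = c"
  by (simp add: mean_def choice_mean_const)

end

section \<open>Expectations after several steps\<close>

lemma mean_add: "mean (\<lambda>Y. f Y + g Y) = (\<lambda>X. mean f X + mean g X)"
  by (auto simp: mean_def choice_mean_add)

lemma mean_cmult: "mean (\<lambda>Y. c * f Y) = (\<lambda>X. c * mean f X)"
  by (auto simp: mean_def choice_mean_cmult)

text \<open>The mean of f after T steps as a function of the initial matrix, namely the T-th power
  of the transition operator. The estimates on the chain use this form without a probability
  space.\<close>

definition expect :: "nat \<Rightarrow> (nmat \<Rightarrow> real) \<Rightarrow> nmat \<Rightarrow> real" where
  "expect T f = (mean ^^ T) f"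

lemma expect_0: "expect 0 f X = f X"
  by (simp add: expect_def)

text \<open>This splits off the last step, whereas unfolding the power splits off the first.
  Inductions for moment bounds need the last step.\<close>

lemma expect_Suc: "expect (Suc T) f X = expect T (mean f) X"
  unfolding expect_def funpow.simps comp_def by (simp add: funpow_swap1)

lemma expect_mono:
  assumes "X \<in> adj_edges n m" "\<And>Y. Y \<in> adj_edges n m \<Longrightarrow> f Y \<le> g Y"
  shows "expect T f X \<le> expect T g X"
  using assms(1)
proof (induction T arbitrary: X)
  case 0
  then show ?case using assms(2) by (simp add: expect_def)
next
  case (Suc T)
  show ?case using mean_mono[OF Suc.prems, of "expect T f" "expect T g"] Suc.IH
    by (simp add: expect_def)
qed

lemma expect_const: "X \<in> adj_edges n m \<Longrightarrow> expect T (\<lambda>_. c) X = c"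
proof (induction T arbitrary: X)
  case (Suc T)
  have "mean (expect T (\<lambda>_. c)) X = mean (\<lambda>_. c) X"
    using Suc.IH by (intro antisym mean_mono[OF Suc.prems]) auto
  then show ?case by (simp add: expect_def mean_const[OF Suc.prems])
qed (simp add: expect_def)

lemma expect_add: "expect T (\<lambda>Y. f Y + g Y) X = expect T f X + expect T g X"
proof -
  have "expect T (\<lambda>Y. f Y + g Y) = (\<lambda>X. expect T f X + expect T g X)"
    by (induction T) (simp_all add: expect_def mean_add)
  then show ?thesis by simp
qed

lemma expect_cmult: "expect T (\<lambda>Y. c * f Y) X = c * expect T f X"
proof -
  have "expect T (\<lambda>Y. c * f Y) = (\<lambda>X. c * expect T f X)"
    by (induction T) (simp_all add: expect_def mean_cmult)
  then show ?thesis by simp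
qed

lemma expect_diff: "expect T (\<lambda>Y. f Y - g Y) X = expect T f X - expect T g X"
  using expect_add[of T f "\<lambda>Y. - 1 * g Y" X] by (simp only: expect_cmult) simp

lemma expect_sum: "X \<in> adj_edges n m \<Longrightarrow> expect T (\<lambda>Y. \<Sum>p\<in>P. f p Y) X = (\<Sum>p\<in>P. expect T (f p) X)"
  by (induction P rule: infinite_finite_induct) (simp_all add: expect_add expect_const)

lemma expect_abs: "X \<in> adj_edges n m \<Longrightarrow> \<bar>expect T f X\<bar> \<le> expect T (\<lambda>Y. \<bar>f Y\<bar>) X"
  using expect_mono[of X f "\<lambda>Y. \<bar>f Y\<bar>" T] expect_mono[of X "\<lambda>Y. - 1 * f Y" "\<lambda>Y. \<bar>f Y\<bar>" T]
  unfolding expect_cmult by fastforce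

lemma expect_nonneg: "X \<in> adj_edges n m \<Longrightarrow> (\<And>Y. Y \<in> adj_edges n m \<Longrightarrow> 0 \<le> f Y) \<Longrightarrow> 0 \<le> expect T f X"
  using expect_mono[of X "\<lambda>_. 0" f T] by (simp add: expect_const)

text \<open>Preferential attachment returns on average what the uniform choice of an edge end
  removes; only the contribution of \<kappa> is left.\<close>

lemma mean_deg_le:
  assumes X: "X \<in> adj_edges n m" and x: "x \<in> {1..n}"
  shows "mean (\<lambda>Y. real (deg n Y x)) X \<le> real (deg n X x) + \<kappa> / (2 * real m)"
proof -
  let ?d = "real (deg n X x)"
  have "mean (\<lambda>Y. real (deg n Y x)) X = choice_mean X (\<lambda>v w u. ?d - of_bool (v = x) + of_bool (u = x))"
    unfolding mean_def using real_deg_reconnect[OF adj_edges_adj[OF X]] by (intro choice_mean_cong) simp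
  also have "\<dots> = ?d - ?d / (2 * real m) + new_prob X x"
    using x by (simp add: choice_mean_add choice_mean_diff choice_mean_const[OF X] choice_mean_is_new[OF X] choice_mean_is_old[OF X])
  also have "\<dots> \<le> ?d + \<kappa> / (2 * real m)"
    using new_prob_le[of X x] by (simp add: add_divide_distrib)
  finally show ?thesis .
qed

text \<open>Expanding the square for increments of size one leaves the probability of a jump and a
  cross term with the drift. The reference value c is kept free so that the bound can be iterated
  from the initial degree.\<close>

lemma mean_deg_deviation_le:
  assumes X: "X \<in> adj_edges n m" and x: "x \<in> {1..n}" and c: "c \<ge> 0"
  shows "mean (\<lambda>Y. (real (deg n Y x) - c)\<^sup>2) X \<le> (real (deg n X x) - c)\<^sup>2
    + 1 / (2 * real m) * ((2 * \<kappa> + 2) * real (deg n X x) + 2 * \<kappa> * (real n / (2 * real m)) * c\<^sup>2 + \<kappa>)"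
proof -
  let ?d = "real (deg n X x)"
  define a where "a = real n / (2 * real m)"
  have a: "a \<ge> 0" by (simp add: a_def)
  have "mean (\<lambda>Y. (real (deg n Y x) - c)\<^sup>2) X \<le>
    choice_mean X (\<lambda>v w u. (?d - c)\<^sup>2 + ((2 * (?d - c) + 1) * of_bool (u = x) + (1 - 2 * (?d - c)) * of_bool (v = x)))"
    unfolding mean_def
  proof (rule choice_mean_mono)
    \<comment> \<open>This is an equality unless x is both old and new vertex; then the degree is
      unchanged, while the right-hand side exceeds the square by 2.\<close>
    fix v w u assume "u \<in> {1..n}" "X v w > 0"
    then have e: "real (deg n (reconnect v w u X) x) = ?d - of_bool (v = x) + of_bool (u = x)"
      using real_deg_reconnect[OF adj_edges_adj[OF X]] by simp
    show "(real (deg n (reconnect v w u X) x) - c)\<^sup>2 \<le>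
      (?d - c)\<^sup>2 + ((2 * (?d - c) + 1) * of_bool (u = x) + (1 - 2 * (?d - c)) * of_bool (v = x))"
      unfolding e by (cases "v = x"; cases "u = x") (simp_all add: power2_eq_square algebra_simps)
  qed
  also have "\<dots> = (?d - c)\<^sup>2 + ((2 * (?d - c) + 1) * new_prob X x + (1 - 2 * (?d - c)) * (?d / (2 * real m)))"
    using x by (simp only: choice_mean_add choice_mean_cmult choice_mean_const[OF X] choice_mean_is_new[OF X] choice_mean_is_old[OF X])
  also have "\<dots> = (?d - c)\<^sup>2 + 2 * ((?d - c) * (new_prob X x - ?d / (2 * real m))) + (new_prob X x + ?d / (2 * real m))"
  proof -
    have "(2 * D + 1) * p + (1 - 2 * D) * z = 2 * (D * (p - z)) + (p + z)" for D p z :: real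
      by (simp add: algebra_simps)
    then show ?thesis by (simp only: add.assoc)
  qed
  \<comment> \<open>The drift points towards the average degree 1 / a = 2 m / n.\<close>
  also have "new_prob X x - ?d / (2 * real m) = \<kappa> / (2 * real m + real n * \<kappa>) * (1 - a * ?d)"
    using denominator_pos m_pos by (simp add: new_prob_def a_def field_simps)
  also have "(?d - c) * (\<kappa> / (2 * real m + real n * \<kappa>) * (1 - a * ?d)) \<le> \<kappa> / (2 * real m) * (?d + a * c\<^sup>2)"
  proof -
    have "(?d - c) * (1 - a * c) \<le> ?d + a * c\<^sup>2"
    proof (cases "?d \<ge> c")
      case True
      have "(?d - c) * (1 - a * c) \<le> (?d - c) * 1" using True a c by (intro mult_left_mono) auto
      also have "\<dots> \<le> ?d + a * c\<^sup>2" using c a by (simp add: add_increasing2)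
      finally show ?thesis .
    next
      case False
      have "0 \<le> ?d * (a * c)" using a c by simp
      moreover have "(?d - c) * (1 - a * c) = ?d - c - ?d * (a * c) + a * c\<^sup>2"
        by (simp add: algebra_simps power2_eq_square)
      ultimately show ?thesis using c by linarith
    qed
    \<comment> \<open>Replacing the current degree by c inside the drift leaves a term of favourable
      sign.\<close>
    moreover have "(?d - c) * (1 - a * ?d) = (?d - c) * (1 - a * c) - a * (?d - c)\<^sup>2"
      by (simp add: algebra_simps power2_eq_square)
    moreover have "0 \<le> a * (?d - c)\<^sup>2" using a by simp
    ultimately have "(?d - c) * (1 - a * ?d) \<le> ?d + a * c\<^sup>2" by linarith
    then have "\<kappa> / (2 * real m + real n * \<kappa>) * ((?d - c) * (1 - a * ?d)) \<le> \<kappa> / (2 * real m + real n * \<kappa>) * (?d + a * c\<^sup>2)"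
      using denominator_pos kappa_pos by (intro mult_left_mono) auto
    also have "\<dots> \<le> \<kappa> / (2 * real m) * (?d + a * c\<^sup>2)"
      using kappa_pos m_pos a by (intro mult_right_mono frac_le) auto
    finally show ?thesis by (simp add: mult_ac)
  qed
  also have "new_prob X x + ?d / (2 * real m) \<le> (2 * ?d + \<kappa>) / (2 * real m)"
    using new_prob_le[of X x] by (simp add: add_divide_distrib)
  also have "(?d - c)\<^sup>2 + 2 * (\<kappa> / (2 * real m) * (?d + a * c\<^sup>2)) + (2 * ?d + \<kappa>) / (2 * real m) =
    (?d - c)\<^sup>2 + 1 / (2 * real m) * ((2 * \<kappa> + 2) * ?d + 2 * \<kappa> * a * c\<^sup>2 + \<kappa>)"
    using m_pos by (simp add: field_simps)
  finally show ?thesis unfolding a_def by simp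
qed

lemma expect_deg_le:
  assumes X: "X \<in> adj_edges n m" and x: "x \<in> {1..n}"
  shows "expect T (\<lambda>Y. real (deg n Y x)) X \<le> real (deg n X x) + real T * (\<kappa> / (2 * real m))"
proof (induction T)
  case (Suc T)
  have "expect (Suc T) (\<lambda>Y. real (deg n Y x)) X \<le> expect T (\<lambda>Y. real (deg n Y x) + \<kappa> / (2 * real m)) X"
    unfolding expect_Suc by (intro expect_mono[OF X] mean_deg_le x)
  also have "\<dots> = expect T (\<lambda>Y. real (deg n Y x)) X + \<kappa> / (2 * real m)"
    by (simp only: expect_add expect_const[OF X])
  also have "real (Suc T) * (\<kappa> / (2 * real m)) = real T * (\<kappa> / (2 * real m)) + \<kappa> / (2 * real m)"
    by (simp add: distrib_right add_divide_distrib)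
  ultimately show ?case using Suc by linarith
qed (simp add: expect_0)

text \<open>The deviation starts at 0 and gains a bounded amount per step. When m and T' are of
  order n^2 and the degree of order n, the bound is of order n. The horizon T' appears in place of T
  so that the bound serves all intermediate times.\<close>

lemma expect_deg_deviation_le:
  assumes X: "X \<in> adj_edges n m" and x: "x \<in> {1..n}" and T: "T \<le> T'"
  shows "expect T (\<lambda>Y. (real (deg n Y x) - real (deg n X x))\<^sup>2) X \<le>
    real T' / (2 * real m) * ((2 * \<kappa> + 2) * (real (deg n X x) + real T' * (\<kappa> / (2 * real m)))
       + 2 * \<kappa> * (real n / (2 * real m)) * (real (deg n X x))\<^sup>2 + \<kappa>)"
proof -
  define c where "c = real (deg n X x)"
  define U where "U = 1 / (2 * real m) * ((2 * \<kappa> + 2) * (c + real T' * (\<kappa> / (2 * real m)))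
       + 2 * \<kappa> * (real n / (2 * real m)) * c\<^sup>2 + \<kappa>)"
  have U0: "0 \<le> U" unfolding U_def c_def using kappa_pos by auto
  have "expect T (\<lambda>Y. (real (deg n Y x) - c)\<^sup>2) X \<le> real T * U"
    using T
  proof (induction T)
    case 0
    then show ?case by (simp add: expect_0 c_def)
  next
    case (Suc T)
    have "expect (Suc T) (\<lambda>Y. (real (deg n Y x) - c)\<^sup>2) X \<le>
      expect T (\<lambda>Y. (real (deg n Y x) - c)\<^sup>2 + 1 / (2 * real m) * ((2 * \<kappa> + 2) * real (deg n Y x) + (2 * \<kappa> * (real n / (2 * real m)) * c\<^sup>2 + \<kappa>))) X"
      unfolding expect_Suc
      using mean_deg_deviation_le[OF _ x, of _ c] by (intro expect_mono[OF X]) (simp add: c_def add.assoc)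
    also have "\<dots> = expect T (\<lambda>Y. (real (deg n Y x) - c)\<^sup>2) X +
      1 / (2 * real m) * ((2 * \<kappa> + 2) * expect T (\<lambda>Y. real (deg n Y x)) X + (2 * \<kappa> * (real n / (2 * real m)) * c\<^sup>2 + \<kappa>))"
      by (simp only: expect_add expect_cmult expect_const[OF X])
    finally have step: "expect (Suc T) (\<lambda>Y. (real (deg n Y x) - c)\<^sup>2) X \<le> expect T (\<lambda>Y. (real (deg n Y x) - c)\<^sup>2) X +
      1 / (2 * real m) * ((2 * \<kappa> + 2) * expect T (\<lambda>Y. real (deg n Y x)) X + (2 * \<kappa> * (real n / (2 * real m)) * c\<^sup>2 + \<kappa>))" .
    have "real T * (\<kappa> / (2 * real m)) \<le> real T' * (\<kappa> / (2 * real m))"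
      using Suc.prems kappa_pos by (intro mult_right_mono) auto
    then have "expect T (\<lambda>Y. real (deg n Y x)) X \<le> c + real T' * (\<kappa> / (2 * real m))"
      using expect_deg_le[OF X x, of T] by (simp add: c_def)
    then have "1 / (2 * real m) * ((2 * \<kappa> + 2) * expect T (\<lambda>Y. real (deg n Y x)) X + (2 * \<kappa> * (real n / (2 * real m)) * c\<^sup>2 + \<kappa>)) \<le> U"
      unfolding U_def add.assoc using kappa_pos by (intro mult_left_mono add_right_mono) auto
    moreover have "real (Suc T) * U = real T * U + U" by (simp add: distrib_right)
    ultimately show ?case using step Suc by simp
  qed
  also have "\<dots> \<le> real T' * U" using T U0 by (intro mult_right_mono) auto
  finally show ?thesis unfolding U_def c_def by simp
qed

text \<open>Losses are dropped. A loop at x is created only if the new end and the end that stays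
  are both x, which raises the entry by 2.\<close>

lemma mean_loop_le:
  assumes X: "X \<in> adj_edges n m" and x: "x \<in> {1..n}"
  shows "mean (\<lambda>Y. real (Y x x)) X \<le> real (X x x) + 1 / (real m)\<^sup>2 * ((real (deg n X x))\<^sup>2 + \<kappa>\<^sup>2)"
proof -
  let ?d = "real (deg n X x)"
  have "mean (\<lambda>Y. real (Y x x)) X \<le> choice_mean X (\<lambda>v w u. real (X x x) + 2 * (of_bool (u = x) * of_bool (w = x)))"
    unfolding mean_def using real_reconnect[OF adj_edges_adj[OF X]] by (intro choice_mean_mono) simp
  also have "\<dots> = real (X x x) + 2 * (new_prob X x * (?d / (2 * real m)))"
    using x by (simp only: choice_mean_add choice_mean_cmult choice_mean_const[OF X] choice_mean_target_new[OF X])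
  also have "\<dots> \<le> real (X x x) + 2 * (((?d + \<kappa>) / (2 * real m)) * (?d / (2 * real m)))"
    using new_prob_le[of X x] by (intro add_left_mono mult_left_mono mult_right_mono) auto
  also have "\<dots> = real (X x x) + 1 / (real m)\<^sup>2 * ((?d\<^sup>2 + ?d * \<kappa>) / 2)"
    using m_pos by (simp add: field_simps power2_eq_square)
  also have "\<dots> \<le> real (X x x) + 1 / (real m)\<^sup>2 * (?d\<^sup>2 + \<kappa>\<^sup>2)"
  proof -
    have sq: "2 * (?d * \<kappa>) \<le> ?d\<^sup>2 + \<kappa>\<^sup>2" using sum_squares_bound[of ?d \<kappa>] by (simp only: mult.assoc)
    have "2 * a \<le> x + y \<Longrightarrow> 0 \<le> x \<Longrightarrow> 0 \<le> y \<Longrightarrow> (x + a) / 2 \<le> x + y" for a x y :: real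
      by (simp add: field_simps)
    from this[OF sq] have "(?d\<^sup>2 + ?d * \<kappa>) / 2 \<le> ?d\<^sup>2 + \<kappa>\<^sup>2" by simp
    then show ?thesis by (intro add_left_mono mult_left_mono) auto
  qed
  finally show ?thesis .
qed

end


section \<open>Drift of functions of the tracked edge counts\<close>

context reconnecting
begin

text \<open>The probability that the edge created in a step joins x and y, as computed in
  \<open>choice_mean_new_edge\<close>.\<close>

definition arrival :: "nmat \<Rightarrow> nat \<Rightarrow> nat \<Rightarrow> real" where
  "arrival X x y = (new_prob X x * real (deg n X y) + new_prob X y * real (deg n X x)) / (2 * real m * (if x = y then 2 else 1))"

text \<open>
  A step changes the numbers of edges between tracked pairs of vertices like a step of independent
  queues, unless it both removes a tracked edge and attaches the new end to a tracked vertex.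
\<close>

lemma mean_tracked:
  fixes x y :: "'p \<Rightarrow> nat" and G :: "('p \<Rightarrow> nat) \<Rightarrow> real" and P :: "'p set"
  assumes X: "X \<in> adj_edges n m" and P: "finite P"
    and vertex: "\<And>p. p \<in> P \<Longrightarrow> x p \<in> {1..n}" "\<And>p. p \<in> P \<Longrightarrow> y p \<in> {1..n}"
    and inj: "inj_on (\<lambda>p. {x p, y p}) P"
    and G01: "\<And>h. 0 \<le> G h" "\<And>h. G h \<le> 1"
    and G_cong: "\<And>h h'. (\<And>p. p \<in> P \<Longrightarrow> h p = h' p) \<Longrightarrow> G h = G h'"
  defines "H \<equiv> \<lambda>Y p. edges Y (x p) (y p)"
  shows "\<bar>mean (\<lambda>Y. G (H Y)) X - G (H X)
      - (\<Sum>p\<in>P. real (H X p) / real m * (G ((H X)(p := H X p - 1)) - G (H X)))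
      - (\<Sum>p\<in>P. arrival X (x p) (y p) * (G ((H X)(p := Suc (H X p))) - G (H X)))\<bar>
    \<le> 2 * (\<Sum>p\<in>P. real (H X p) / real m * (\<Sum>q\<in>P. new_prob X (x q) + new_prob X (y q)))"
proof -
  let ?h = "H X"
  define dn where "dn p = G (?h(p := ?h p - 1)) - G ?h" for p
  define up where "up p = G (?h(p := Suc (?h p))) - G ?h" for p
  define old where "old v w = (\<Sum>p\<in>P. of_bool ({x p, y p} = {v, w}) * dn p)" for v w
  define new where "new u w = (\<Sum>p\<in>P. of_bool ({x p, y p} = {u, w}) * up p)" for u w
  \<comment> \<open>\<open>hit\<close> is at least 1 when a tracked edge is removed and the new end
    is a tracked vertex. Otherwise the difference estimated below vanishes; in that case it is at
    most 2, being a signed sum of at most four values of G in [0, 1].\<close>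
  define hit :: "nat \<Rightarrow> nat \<Rightarrow> nat \<Rightarrow> real" where "hit v w u = (\<Sum>p\<in>P. \<Sum>q\<in>P. of_bool ({x p, y p} = {v, w}) * (of_bool (u = x q) + of_bool (u = y q)))"
    for v w u
  \<comment> \<open>Injectivity of the tracked pairs leaves at most one nonzero summand for each
    vertex pair.\<close>
  have single: "(\<Sum>p\<in>P. of_bool ({x p, y p} = e) * f p) = f q"
    if "q \<in> P" "{x q, y q} = e" for e q and f :: "'p \<Rightarrow> real"
  proof -
    have eq: "of_bool ({x p, y p} = e) * f p = (if p = q then f p else 0)" if "p \<in> P" for p
    proof (cases "p = q")
      case False
      then have "{x p, y p} \<noteq> {x q, y q}" using inj_onD[OF inj, of p q] that \<open>q \<in> P\<close> by blast
      then show ?thesis using False \<open>{x q, y q} = e\<close> by simp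
    qed (simp add: \<open>{x q, y q} = e\<close>)
    show ?thesis using P \<open>q \<in> P\<close> by (simp add: eq cong: sum.cong)
  qed
  have none: "(\<Sum>p\<in>P. of_bool ({x p, y p} = e) * f p) = 0"
    if "\<not> (\<exists>q\<in>P. {x q, y q} = e)" for e and f :: "'p \<Rightarrow> real"
    using that by (intro sum.neutral) auto
  have bound: "\<bar>G h - G ?h\<bar> \<le> 1" for h
    using G01[of h] G01[of ?h] by linarith
  have hit_nonneg: "0 \<le> hit v w u" for v w u
    unfolding hit_def by (intro sum_nonneg) auto
  have pointwise: "\<bar>G (H (reconnect v w u X)) - G ?h - old v w - new u w\<bar> \<le> 2 * hit v w u"
    if "X v w > 0" "u \<in> {1..n}" for v w u
  proof -
    have HY: "int (H (reconnect v w u X) p) = int (?h p) - of_bool ({x p, y p} = {v, w}) + of_bool ({x p, y p} = {u, w})" for p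
      unfolding H_def using int_edges_reconnect[OF X that] .
    have neq: "{x p, y p} \<noteq> {x q, y q}" if "p \<in> P" "q \<in> P" "p \<noteq> q" for p q
      using inj_onD[OF inj, of p q] that by blast
    show ?thesis
    proof (cases "\<exists>p\<in>P. {x p, y p} = {v, w}")
      case False
      then have old0: "old v w = 0" unfolding old_def by (rule none)
      have HY': "int (H (reconnect v w u X) p) = int (?h p) + of_bool ({x p, y p} = {u, w})" if "p \<in> P" for p
        using HY[of p] False that by auto
      have "G (H (reconnect v w u X)) - G ?h = new u w"
      proof (cases "\<exists>p\<in>P. {x p, y p} = {u, w}")
        case False
        then have "new u w = 0" unfolding new_def by (rule none)
        moreover have "G (H (reconnect v w u X)) = G ?h"
        proof (rule G_cong)
          fix p assume "p \<in> P"
          with HY'[OF this] False show "H (reconnect v w u X) p = ?h p" by auto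
        qed
        ultimately show ?thesis by simp
      next
        case True
        then obtain q where q: "q \<in> P" "{x q, y q} = {u, w}" by blast
        have "G (H (reconnect v w u X)) = G (?h(q := Suc (?h q)))"
        proof (rule G_cong)
          fix p assume p: "p \<in> P"
          show "H (reconnect v w u X) p = (?h(q := Suc (?h q))) p"
            using HY'[OF p] neq[OF p q(1)] q by (cases "p = q") auto
        qed
        then show ?thesis using single[OF q, of up] by (simp add: new_def up_def)
      qed
      then show ?thesis using old0 hit_nonneg[of v w u] by simp
    next
      case True
      then obtain q where q: "q \<in> P" "{x q, y q} = {v, w}" by blast
      have old_eq: "old v w = dn q" using single[OF q, of dn] by (simp add: old_def)
      show ?thesis
      proof (cases "\<exists>p\<in>P. u = x p \<or> u = y p")
        case True
        then obtain p where p: "p \<in> P" "u = x p \<or> u = y p" by blast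
        have "(1 :: real) \<le> of_bool (u = x p) + of_bool (u = y p)" using p by auto
        also have "\<dots> \<le> (\<Sum>p\<in>P. of_bool (u = x p) + of_bool (u = y p))"
          by (rule member_le_sum[OF p(1)]) (use P in auto)
        also have "\<dots> = hit v w u"
          using single[OF q, of "\<lambda>p. \<Sum>q\<in>P. of_bool (u = x q) + of_bool (u = y q)"]
          by (simp add: hit_def flip: sum_distrib_left)
        finally have hit1: "1 \<le> hit v w u" .
        have a: "0 \<le> G ?h" "G ?h \<le> 1" "0 \<le> G (H (reconnect v w u X))" "G (H (reconnect v w u X)) \<le> 1"
          "0 \<le> G (?h(q := ?h q - 1))" "G (?h(q := ?h q - 1)) \<le> 1"
          by (simp_all add: G01)
        consider "new u w = 0" | p where "new u w = up p"
        proof (cases "\<exists>p\<in>P. {x p, y p} = {u, w}")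
          case True
          then obtain p where "p \<in> P" "{x p, y p} = {u, w}" by blast
          from single[OF this, of up] show ?thesis by (intro that(2)) (simp add: new_def)
        next
          case False
          from none[OF this, of up] show ?thesis by (intro that(1)) (simp add: new_def)
        qed
        then show ?thesis
        proof cases
          case 1
          then show ?thesis using a hit1 unfolding old_eq dn_def by linarith
        next
          case (2 p)
          have "0 \<le> G (?h(p := Suc (?h p)))" "G (?h(p := Suc (?h p))) \<le> 1" by (simp_all add: G01)
          then show ?thesis using a hit1 unfolding old_eq 2 dn_def up_def by linarith
        qed
      next
        case False
        then have no_new: "\<not> (\<exists>p\<in>P. {x p, y p} = {u, w})" by (auto simp: doubleton_eq_iff)
        then have "new u w = 0" unfolding new_def by (rule none)
        moreover have "G (H (reconnect v w u X)) = G (?h(q := ?h q - 1))"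
        proof (rule G_cong)
          fix p assume p: "p \<in> P"
          have "{v, w} \<noteq> {u, w}" using no_new q by auto
          then show "H (reconnect v w u X) p = (?h(q := ?h q - 1)) p"
            using HY[of p] neq[OF p q(1)] q no_new p by (cases "p = q") auto
        qed
        ultimately show ?thesis using old_eq hit_nonneg[of v w u] by (simp add: dn_def)
      qed
    qed
  qed
  have old_mean: "choice_mean X (\<lambda>v w u. old v w) = (\<Sum>p\<in>P. real (?h p) / real m * dn p)"
    unfolding old_def choice_mean_sum choice_mean_cmult_right H_def
    by (intro sum.cong refl) (simp add: choice_mean_edge[OF X vertex(1) vertex(2)])
  have new_mean: "choice_mean X (\<lambda>v w u. new u w) = (\<Sum>p\<in>P. arrival X (x p) (y p) * up p)"
    unfolding new_def choice_mean_sum choice_mean_cmult_right arrival_def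
    by (intro sum.cong refl) (simp add: choice_mean_new_edge[OF X vertex(1) vertex(2)])
  have hit_mean: "choice_mean X (\<lambda>v w u. hit v w u) =
      (\<Sum>p\<in>P. real (?h p) / real m * (\<Sum>q\<in>P. new_prob X (x q) + new_prob X (y q)))"
    unfolding hit_def choice_mean_sum sum_distrib_left
  proof (intro sum.cong refl)
    fix p q assume pq: "p \<in> P" "q \<in> P"
    have s: "(\<Sum>u\<in>{1..n}. new_prob X u * (of_bool (u = x q) + of_bool (u = y q))) = new_prob X (x q) + new_prob X (y q)"
      unfolding distrib_left sum.distrib
        sum_of_bool_mult(5)[OF vertex(1)[OF pq(2)]] sum_of_bool_mult(5)[OF vertex(2)[OF pq(2)]] ..
    show "choice_mean X (\<lambda>v w u. of_bool ({x p, y p} = {v, w}) * (of_bool (u = x q) + of_bool (u = y q))) =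
       real (?h p) / real m * (new_prob X (x q) + new_prob X (y q))"
      unfolding choice_mean_edge_new[OF X vertex(1)[OF pq(1)] vertex(2)[OF pq(1)]] H_def s ..
  qed
  have "mean (\<lambda>Y. G (H Y)) X - G ?h - (\<Sum>p\<in>P. real (?h p) / real m * dn p) - (\<Sum>p\<in>P. arrival X (x p) (y p) * up p) =
    choice_mean X (\<lambda>v w u. G (H (reconnect v w u X)) - G ?h - old v w - new u w)"
    unfolding choice_mean_diff old_mean new_mean choice_mean_const[OF X] mean_def ..
  also have "\<bar>\<dots>\<bar> \<le> choice_mean X (\<lambda>v w u. 2 * hit v w u)"
    by (intro order_trans[OF choice_mean_abs] choice_mean_mono pointwise)
  finally show ?thesis unfolding choice_mean_cmult hit_mean dn_def up_def .
qed

text \<open>One step of the chain against time 1 / m of the queues. Removal probabilities are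
  exactly the service rates divided by m, so the errors are coincidences within a step, the mismatch
  of arrival rates, and the Taylor remainder.\<close>

lemma mean_queues:
  fixes x y :: "'p \<Rightarrow> nat" and P :: "'p set" and \<mu> :: "'p \<Rightarrow> real"
  assumes X: "X \<in> adj_edges n m" and P: "finite P"
    and vertex: "\<And>p. p \<in> P \<Longrightarrow> x p \<in> {1..n}" "\<And>p. p \<in> P \<Longrightarrow> y p \<in> {1..n}"
    and inj: "inj_on (\<lambda>p. {x p, y p}) P"
    and mu: "\<And>p. p \<in> P \<Longrightarrow> 0 \<le> \<mu> p" and t: "0 \<le> t"
  defines "H \<equiv> \<lambda>Y p. edges Y (x p) (y p)"
  defines "\<Lambda> \<equiv> \<Sum>p\<in>P. \<mu> p + real (H X p)"
  shows "\<bar>mean (\<lambda>Y. queues P k \<mu> t (H Y)) X - queues P k \<mu> (t + 1 / real m) (H X)\<bar>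
    \<le> 2 * (\<Sum>p\<in>P. real (H X p) / real m * (\<Sum>q\<in>P. new_prob X (x q) + new_prob X (y q)))
      + (\<Sum>p\<in>P. \<bar>arrival X (x p) (y p) - \<mu> p / real m\<bar>)
      + (1 / real m)\<^sup>2 * (\<Lambda> * (2 * \<Lambda> + 1))"
proof -
  let ?G = "queues P k \<mu> t"
  let ?h = "H X"
  have b: "\<And>h. 0 \<le> ?G h" "\<And>h. ?G h \<le> 1" using queues_bounds[of t P \<mu> k] t mu by auto
  have one: "\<bar>mean (\<lambda>Y. ?G (H Y)) X - ?G ?h
      - (\<Sum>p\<in>P. real (?h p) / real m * (?G (?h(p := ?h p - 1)) - ?G ?h))
      - (\<Sum>p\<in>P. arrival X (x p) (y p) * (?G (?h(p := Suc (?h p))) - ?G ?h))\<bar>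
    \<le> 2 * (\<Sum>p\<in>P. real (?h p) / real m * (\<Sum>q\<in>P. new_prob X (x q) + new_prob X (y q)))"
    unfolding H_def using b by (intro mean_tracked[OF X P vertex inj] queues_cong) auto
  have "\<bar>(\<Sum>p\<in>P. (arrival X (x p) (y p) - \<mu> p / real m) * (?G (?h(p := Suc (?h p))) - ?G ?h))\<bar>
     \<le> (\<Sum>p\<in>P. \<bar>arrival X (x p) (y p) - \<mu> p / real m\<bar>)"
  proof (intro order_trans[OF sum_abs] sum_mono)
    fix p
    have "\<bar>?G (?h(p := Suc (?h p))) - ?G ?h\<bar> \<le> 1"
      using b[of ?h] b[of "?h(p := Suc (?h p))"] by linarith
    then show "\<bar>(arrival X (x p) (y p) - \<mu> p / real m) * (?G (?h(p := Suc (?h p))) - ?G ?h)\<bar>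
       \<le> \<bar>arrival X (x p) (y p) - \<mu> p / real m\<bar>"
      unfolding abs_mult by (intro mult_left_le) auto
  qed
  moreover have "\<bar>queues P k \<mu> (t + 1 / real m) ?h - ?G ?h - 1 / real m * queues_gen P \<mu> ?G ?h\<bar>
     \<le> (1 / real m)\<^sup>2 * (\<Lambda> * (2 * \<Lambda> + 1))"
    unfolding \<Lambda>_def by (rule queues_taylor[OF P mu t]) auto
  \<comment> \<open>With arrival probabilities replaced by \<mu> / m, the two sums combine to 1 / m
    times the generator.\<close>
  moreover have "(\<Sum>p\<in>P. real (?h p) / real m * (?G (?h(p := ?h p - 1)) - ?G ?h))
      + (\<Sum>p\<in>P. arrival X (x p) (y p) * (?G (?h(p := Suc (?h p))) - ?G ?h)) =
     1 / real m * queues_gen P \<mu> ?G ?h +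
     (\<Sum>p\<in>P. (arrival X (x p) (y p) - \<mu> p / real m) * (?G (?h(p := Suc (?h p))) - ?G ?h))"
    unfolding queues_gen_def sum_distrib_left sum.distrib[symmetric]
    by (intro sum.cong refl) (simp add: algebra_simps add_divide_distrib diff_divide_distrib)
  ultimately show ?thesis using one by linarith
qed

text \<open>Telescoping along the solution of the backward equation.\<close>

lemma expect_queues:
  fixes x y :: "'p \<Rightarrow> nat" and P :: "'p set" and \<mu> :: "'p \<Rightarrow> real" and err :: "nmat \<Rightarrow> real"
  assumes X: "X \<in> adj_edges n m" and P: "finite P"
    and vertex: "\<And>p. p \<in> P \<Longrightarrow> x p \<in> {1..n}" "\<And>p. p \<in> P \<Longrightarrow> y p \<in> {1..n}"
    and inj: "inj_on (\<lambda>p. {x p, y p}) P"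
    and mu: "\<And>p. p \<in> P \<Longrightarrow> 0 \<le> \<mu> p"
  defines "H \<equiv> \<lambda>Y p. edges Y (x p) (y p)"
  assumes err: "\<And>t Y. 0 \<le> t \<Longrightarrow> Y \<in> adj_edges n m \<Longrightarrow>
      \<bar>mean (\<lambda>Y. queues P k \<mu> t (H Y)) Y - queues P k \<mu> (t + 1 / real m) (H Y)\<bar> \<le> err Y"
  shows "\<bar>expect N (\<lambda>Y. queues P k \<mu> 0 (H Y)) X - queues P k \<mu> (real N / real m) (H X)\<bar>
     \<le> (\<Sum>T<N. expect T err X)"
proof -
  \<comment> \<open>Generalised over the remaining time t, since each step of the induction moves it
    by 1 / m.\<close>
  have "\<bar>expect N (\<lambda>Y. queues P k \<mu> t (H Y)) X - queues P k \<mu> (t + real N / real m) (H X)\<bar>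
     \<le> (\<Sum>T<N. expect T err X)" if "0 \<le> t" for t
    using that
  proof (induction N arbitrary: t)
    case 0
    then show ?case by (simp add: expect_0)
  next
    case (Suc N)
    let ?f = "\<lambda>Y. queues P k \<mu> (t + 1 / real m) (H Y)"
    have "\<bar>expect N (\<lambda>Y. mean (\<lambda>Y. queues P k \<mu> t (H Y)) Y - ?f Y) X\<bar> \<le> expect N err X"
      using err[OF Suc.prems] by (intro order_trans[OF expect_abs[OF X]] expect_mono[OF X])
    then have "\<bar>expect (Suc N) (\<lambda>Y. queues P k \<mu> t (H Y)) X - expect N ?f X\<bar> \<le> expect N err X"
      unfolding expect_Suc expect_diff .
    moreover have "t + 1 / real m + real N / real m = t + real (Suc N) / real m"
      by (simp add: add_divide_distrib)
    then have "\<bar>expect N ?f X - queues P k \<mu> (t + real (Suc N) / real m) (H X)\<bar> \<le> (\<Sum>T<N. expect T err X)"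
      using Suc.IH[of "t + 1 / real m"] Suc.prems by (simp only:) simp
    ultimately show ?case by simp
  qed
  from this[of 0] show ?thesis by simp
qed

end


section \<open>Bounds for the one-step errors\<close>

lemma young:
  fixes a b \<eta> :: real
  assumes "\<eta> > 0"
  shows "2 * (a * b) \<le> a\<^sup>2 / \<eta> + \<eta> * b\<^sup>2"
proof -
  have "0 \<le> (a - \<eta> * b)\<^sup>2 / \<eta>" using assms by simp
  also have "\<dots> = a\<^sup>2 / \<eta> + \<eta> * b\<^sup>2 - 2 * (a * b)"
    using assms by (simp add: field_simps power2_eq_square)
  finally show ?thesis by simp
qed

lemma square_sum_le: "((a::real) + b)\<^sup>2 \<le> 2 * a\<^sup>2 + 2 * b\<^sup>2"
  using sum_squares_bound[of a b] by (simp add: power2_sum)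

context reconnecting
begin

definition step_error :: "(nat \<Rightarrow> real) \<Rightarrow> real \<Rightarrow> nmat \<Rightarrow> nat \<Rightarrow> nat \<Rightarrow> real" where
  "step_error c \<eta> Y v w = (real (edges Y v w))\<^sup>2 / \<eta> + (\<eta> + real n / real m) * ((c v)\<^sup>2 + (c w)\<^sup>2)
     + (1 / \<eta> + real n / real m) * ((real (deg n Y v) - c v)\<^sup>2 + (real (deg n Y w) - c w)\<^sup>2)
     + ((c v) ^ 4 + (c w) ^ 4) / (real m)\<^sup>2 + 1 / \<eta>"

lemma tracked_bound:
  assumes \<eta>: "0 < \<eta>" "\<eta> \<le> 1" and P: "finite P"
  shows "2 * (\<Sum>p\<in>P. real (edges Y (x p) (y p)) / real m * (\<Sum>q\<in>P. new_prob Y (x q) + new_prob Y (y q)))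
    \<le> real (card P) * (2 + \<kappa>\<^sup>2) / (real m)\<^sup>2 * (\<Sum>p\<in>P. step_error c \<eta> Y (x p) (y p))"
proof -
  define d where "d v = real (deg n Y v)" for v
  define h where "h p = real (edges Y (x p) (y p))" for p
  have dsq: "(d v)\<^sup>2 \<le> 2 * (c v)\<^sup>2 + 2 * (d v - c v)\<^sup>2" for v
    using square_sum_le[of "c v" "d v - c v"] by simp
  have \<eta>': "\<eta> \<le> 1 / \<eta>" using \<eta> by (simp add: field_simps mult_le_one)
  have one: "h p * (d (x q) + d (y q) + 2 * \<kappa>) \<le>
      2 * (h p)\<^sup>2 / \<eta> + (\<eta> * (d (x q))\<^sup>2 + \<eta> * (d (y q))\<^sup>2) + \<kappa>\<^sup>2 / \<eta>" for p q
  proof -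
    have "2 * (h p * d v) \<le> (h p)\<^sup>2 / \<eta> + \<eta> * (d v)\<^sup>2" for v by (rule young[OF \<eta>(1)])
    from this[of "x q"] this[of "y q"] young[OF \<eta>(1), of "h p" \<kappa>]
    have "2 * (h p * d (x q)) + 2 * (h p * d (y q)) + 4 * (h p * \<kappa>) \<le>
      4 * ((h p)\<^sup>2 / \<eta>) + (\<eta> * (d (x q))\<^sup>2 + \<eta> * (d (y q))\<^sup>2) + 2 * (\<eta> * \<kappa>\<^sup>2)" by linarith
    moreover have "\<eta> * \<kappa>\<^sup>2 \<le> 1 / \<eta> * \<kappa>\<^sup>2" using \<eta>' by (intro mult_right_mono) auto
    moreover have "0 \<le> \<eta> * (d (x q))\<^sup>2" "0 \<le> \<eta> * (d (y q))\<^sup>2" using \<eta> by auto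
    ultimately show ?thesis by (simp add: algebra_simps)
  qed
  have F: "2 * (h p)\<^sup>2 / \<eta> + (\<eta> * (d (x p))\<^sup>2 + \<eta> * (d (y p))\<^sup>2) + \<kappa>\<^sup>2 / \<eta> \<le> (2 + \<kappa>\<^sup>2) * step_error c \<eta> Y (x p) (y p)" for p
  proof -
    define S where "S = (c (x p))\<^sup>2 + (c (y p))\<^sup>2"
    define E where "E = (d (x p) - c (x p))\<^sup>2 + (d (y p) - c (y p))\<^sup>2"
    define R where "R = real n / real m"
    define I where "I = 1 / \<eta>"
    define Z where "Z = ((c (x p)) ^ 4 + (c (y p)) ^ 4) / (real m)\<^sup>2"
    have pos: "0 \<le> S" "0 \<le> E" "0 \<le> R" "0 \<le> I" "0 \<le> Z" unfolding S_def E_def R_def I_def Z_def using \<eta> by auto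
    have e: "step_error c \<eta> Y (x p) (y p) = (h p)\<^sup>2 * I + (\<eta> + R) * S + (I + R) * E + Z + I"
      by (simp add: step_error_def S_def E_def R_def I_def Z_def h_def d_def)
    have "\<eta> * (d (x p))\<^sup>2 + \<eta> * (d (y p))\<^sup>2 \<le> \<eta> * (2 * S + 2 * E)"
      unfolding distrib_left[symmetric] using dsq[of "x p"] dsq[of "y p"] \<eta> unfolding S_def E_def
      by (intro mult_left_mono) auto
    also have "\<dots> \<le> 2 * (\<eta> * S) + 2 * (I * E)"
    proof -
      have "\<eta> * E \<le> I * E" using mult_right_mono[OF \<eta>' pos(2)] by (simp add: I_def)
      moreover have "\<eta> * (2 * S + 2 * E) = 2 * (\<eta> * S) + 2 * (\<eta> * E)" by (simp add: algebra_simps)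
      ultimately show ?thesis by linarith
    qed
    finally have "2 * (h p)\<^sup>2 / \<eta> + (\<eta> * (d (x p))\<^sup>2 + \<eta> * (d (y p))\<^sup>2) + \<kappa>\<^sup>2 / \<eta>
       \<le> 2 * ((h p)\<^sup>2 * I) + 2 * (\<eta> * S) + 2 * (I * E) + \<kappa>\<^sup>2 * I"
      by (simp add: I_def)
    also have "\<dots> \<le> 2 * step_error c \<eta> Y (x p) (y p) + \<kappa>\<^sup>2 * step_error c \<eta> Y (x p) (y p)"
    proof -
      have "0 \<le> (h p)\<^sup>2 * I" "0 \<le> \<eta> * S" "0 \<le> R * S" "0 \<le> I * E" "0 \<le> R * E" using pos \<eta> by auto
      then have "(h p)\<^sup>2 * I + \<eta> * S + I * E \<le> step_error c \<eta> Y (x p) (y p)" "I \<le> step_error c \<eta> Y (x p) (y p)"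
        unfolding e using pos by (simp_all add: distrib_right)
      moreover from this(2) have "\<kappa>\<^sup>2 * I \<le> \<kappa>\<^sup>2 * step_error c \<eta> Y (x p) (y p)" by (intro mult_left_mono) auto
      ultimately show ?thesis by linarith
    qed
    finally show ?thesis by (simp add: distrib_right)
  qed
  have sw: "(\<Sum>p\<in>P. \<Sum>q\<in>P. f p + g q) = real (card P) * (\<Sum>p\<in>P. f p + g p)" for f g :: "'a \<Rightarrow> real"
    by (simp add: sum.distrib distrib_left sum_distrib_left)
  have "2 * (\<Sum>p\<in>P. h p / real m * (\<Sum>q\<in>P. new_prob Y (x q) + new_prob Y (y q))) =
     (\<Sum>p\<in>P. \<Sum>q\<in>P. 2 * (h p / real m * (new_prob Y (x q) + new_prob Y (y q))))"
    by (simp add: sum_distrib_left)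
  also have "\<dots> \<le> (\<Sum>p\<in>P. \<Sum>q\<in>P. 1 / (real m)\<^sup>2 * (h p * (d (x q) + d (y q) + 2 * \<kappa>)))"
  proof (intro sum_mono)
    fix p q
    have "2 * (h p / real m * (new_prob Y (x q) + new_prob Y (y q))) \<le>
        2 * (h p / real m * ((d (x q) + \<kappa>) / (2 * real m) + (d (y q) + \<kappa>) / (2 * real m)))"
      unfolding d_def using new_prob_le by (intro mult_left_mono add_mono) (auto simp: h_def)
    also have "\<dots> = 1 / (real m)\<^sup>2 * (h p * (d (x q) + d (y q) + 2 * \<kappa>))"
      using m_pos by (simp add: field_simps power2_eq_square)
    finally show "2 * (h p / real m * (new_prob Y (x q) + new_prob Y (y q))) \<le> 1 / (real m)\<^sup>2 * (h p * (d (x q) + d (y q) + 2 * \<kappa>))" .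
  qed
  also have "\<dots> \<le> (\<Sum>p\<in>P. \<Sum>q\<in>P. 1 / (real m)\<^sup>2 * (2 * (h p)\<^sup>2 / \<eta> + (\<eta> * (d (x q))\<^sup>2 + \<eta> * (d (y q))\<^sup>2 + \<kappa>\<^sup>2 / \<eta>)))"
    using one by (intro sum_mono mult_left_mono) (auto simp: add.assoc)
  also have "\<dots> = 1 / (real m)\<^sup>2 * (real (card P) * (\<Sum>p\<in>P. 2 * (h p)\<^sup>2 / \<eta> + (\<eta> * (d (x p))\<^sup>2 + \<eta> * (d (y p))\<^sup>2 + \<kappa>\<^sup>2 / \<eta>)))"
    unfolding sum_distrib_left[symmetric] sw ..
  also have "\<dots> \<le> 1 / (real m)\<^sup>2 * (real (card P) * (\<Sum>p\<in>P. (2 + \<kappa>\<^sup>2) * step_error c \<eta> Y (x p) (y p)))"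
    using F by (intro mult_left_mono sum_mono) (auto simp: add.assoc)
  finally show ?thesis unfolding h_def by (simp add: mult_ac flip: sum_distrib_left)
qed

lemma arrival_bound:
  assumes \<eta>: "0 < \<eta>" "\<eta> \<le> 1" and c: "\<And>v. 0 \<le> c v"
  shows "\<bar>arrival Y v w - c v * c w / (2 * real m * (if v = w then 2 else 1)) / real m\<bar>
     \<le> (5 + 2 * \<kappa> + \<kappa>\<^sup>2) / (real m)\<^sup>2 * step_error c \<eta> Y v w"
proof -
  define d where "d v = real (deg n Y v)" for v
  define N where "N = 2 * real m + real n * \<kappa>"
  have d: "0 \<le> d v" for v by (simp add: d_def)
  have N: "0 < N" "2 * real m \<le> N" using denominator_pos kappa_pos by (simp_all add: N_def)
  have M: "0 < real m" using m_pos by simp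
  define S where "S = (c v)\<^sup>2 + (c w)\<^sup>2"
  define E where "E = (d v - c v)\<^sup>2 + (d w - c w)\<^sup>2"
  define R where "R = real n / real m"
  define I where "I = 1 / \<eta>"
  define Z where "Z = ((c v) ^ 4 + (c w) ^ 4) / (real m)\<^sup>2"
  have pos: "0 \<le> S" "0 \<le> E" "0 \<le> R" "0 \<le> I" "0 \<le> Z" unfolding S_def E_def R_def I_def Z_def using \<eta> by auto
  have e: "step_error c \<eta> Y v w = (real (edges Y v w))\<^sup>2 * I + (\<eta> + R) * S + (I + R) * E + Z + I"
    by (simp add: step_error_def S_def E_def R_def I_def Z_def d_def)
  have \<eta>': "\<eta> \<le> I" using \<eta> by (simp add: I_def field_simps mult_le_one)
  have dsq: "(d v)\<^sup>2 + (d w)\<^sup>2 \<le> 2 * S + 2 * E"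
    using square_sum_le[of "c v" "d v - c v"] square_sum_le[of "c w" "d w - c w"] by (simp add: S_def E_def)
  let ?s = "if v = w then 2 else 1 :: real"
  \<comment> \<open>All contributions are brought to the denominator (2 m)^2, so that the three
    departures appear as separate summands.\<close>
  have eq: "arrival Y v w - c v * c w / (2 * real m * ?s) / real m =
      1 / ?s * ((2 * (d v * d w - c v * c w) + (\<kappa> * (d v + d w) * (2 * real m / N) - 2 * (d v * d w) * (real n * \<kappa> / N))) / (2 * real m)\<^sup>2)"
  proof -
    have "arrival Y v w = 1 / ?s * ((2 * (d v * d w) + \<kappa> * (d v + d w)) / (2 * real m * N))"
      unfolding arrival_def new_prob_def d_def[symmetric] N_def[symmetric] using M N by (simp add: field_simps)
    also have "(2 * (d v * d w) + \<kappa> * (d v + d w)) / (2 * real m * N) =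
      (2 * (d v * d w) * ((N - real n * \<kappa>) / N) + \<kappa> * (d v + d w) * (2 * real m / N)) / (2 * real m)\<^sup>2"
    proof -
      have e: "N - real n * \<kappa> = 2 * real m" by (simp add: N_def)
      show ?thesis unfolding e using M N(1) by (simp add: field_simps power2_eq_square)
    qed
    also have "(N - real n * \<kappa>) / N = 1 - real n * \<kappa> / N" using N by (simp add: diff_divide_distrib)
    finally have arr: "arrival Y v w = 1 / ?s * ((2 * (d v * d w) * (1 - real n * \<kappa> / N) + \<kappa> * (d v + d w) * (2 * real m / N)) / (2 * real m)\<^sup>2)" .
    have cc: "c v * c w / (2 * real m * ?s) / real m = 1 / ?s * (2 * (c v * c w) / (2 * real m)\<^sup>2)"
      using M by (simp add: power2_eq_square)
    have num: "2 * (d v * d w - c v * c w) + (\<kappa> * (d v + d w) * (2 * real m / N) - 2 * (d v * d w) * (real n * \<kappa> / N)) =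
      2 * (d v * d w) * (1 - real n * \<kappa> / N) + \<kappa> * (d v + d w) * (2 * real m / N) - 2 * (c v * c w)"
      unfolding right_diff_distrib[of _ 1] by (simp only: right_diff_distrib mult_1_right)
    show ?thesis unfolding arr cc num diff_divide_distrib[of _ _ "(2 * real m)\<^sup>2"] right_diff_distrib[of "1 / ?s"] ..
  qed
  have t1: "2 * \<bar>d v * d w - c v * c w\<bar> \<le> \<eta> * ((d v)\<^sup>2 + (d w)\<^sup>2) + \<eta> * S + I * E"
  proof -
    have "d v * d w - c v * c w = d v * (d w - c w) + c w * (d v - c v)" by (simp add: algebra_simps)
    then have "\<bar>d v * d w - c v * c w\<bar> \<le> \<bar>d w - c w\<bar> * d v + \<bar>d v - c v\<bar> * c w"
      using d[of v] c[of w] abs_triangle_ineq[of "d v * (d w - c w)" "c w * (d v - c v)"] by (simp add: abs_mult mult.commute)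
    moreover have "x \<le> a + b \<Longrightarrow> 2 * a \<le> p \<Longrightarrow> 2 * b \<le> q \<Longrightarrow> 2 * x \<le> p + q" for a b p q x :: real
      by linarith
    ultimately have "2 * \<bar>d v * d w - c v * c w\<bar> \<le> ((d w - c w)\<^sup>2 / \<eta> + \<eta> * (d v)\<^sup>2) + ((d v - c v)\<^sup>2 / \<eta> + \<eta> * (c w)\<^sup>2)"
      using young[OF \<eta>(1), of "\<bar>d w - c w\<bar>" "d v"] young[OF \<eta>(1), of "\<bar>d v - c v\<bar>" "c w"]
      unfolding power2_abs by blast
    also have "\<dots> = I * E + \<eta> * (d v)\<^sup>2 + \<eta> * (c w)\<^sup>2"
      by (simp add: I_def E_def add_divide_distrib)
    finally have "2 * \<bar>d v * d w - c v * c w\<bar> \<le> I * E + \<eta> * (d v)\<^sup>2 + \<eta> * (c w)\<^sup>2" .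
    moreover have "0 \<le> \<eta> * (d w)\<^sup>2" "0 \<le> \<eta> * (c v)\<^sup>2" using \<eta> by auto
    ultimately show ?thesis unfolding S_def distrib_left by linarith
  qed
  have t2: "2 * (d v * d w) * (real n * \<kappa> / N) \<le> \<kappa> * R * ((d v)\<^sup>2 + (d w)\<^sup>2)"
  proof -
    have "2 * (d v * d w) \<le> (d v)\<^sup>2 + (d w)\<^sup>2" using sum_squares_bound[of "d v" "d w"] by (simp only: mult.assoc)
    moreover have "real n * \<kappa> / N \<le> real n * \<kappa> / real m" using N M kappa_pos by (intro frac_le) auto
    ultimately have "2 * (d v * d w) * (real n * \<kappa> / N) \<le> ((d v)\<^sup>2 + (d w)\<^sup>2) * (real n * \<kappa> / real m)"
      using d N kappa_pos by (intro mult_mono) auto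
    then show ?thesis by (simp add: R_def mult_ac)
  qed
  have t3: "\<kappa> * (d v + d w) * (2 * real m / N) \<le> \<kappa>\<^sup>2 * I + \<eta> * ((d v)\<^sup>2 + (d w)\<^sup>2)"
  proof -
    have "\<kappa> * (d v + d w) * (2 * real m / N) \<le> \<kappa> * (d v + d w) * 1"
      using N M kappa_pos d by (intro mult_left_mono) (auto simp: field_simps)
    also have "\<dots> \<le> \<kappa>\<^sup>2 * I + \<eta> * ((d v)\<^sup>2 + (d w)\<^sup>2)"
    proof -
      have "0 \<le> \<eta> * (d v)\<^sup>2" "0 \<le> \<eta> * (d w)\<^sup>2" using \<eta> by auto
      then show ?thesis
        using young[OF \<eta>(1), of \<kappa> "d v"] young[OF \<eta>(1), of \<kappa> "d w"]
        by (simp add: I_def distrib_left)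
    qed
    finally show ?thesis .
  qed
  have nn: "0 \<le> 2 * (d v * d w) * (real n * \<kappa> / N)" "0 \<le> \<kappa> * (d v + d w) * (2 * real m / N)"
    using d N kappa_pos by auto
  have abs3: "\<bar>2 * a + (b - z)\<bar> \<le> 2 * \<bar>a\<bar> + b + z" if "0 \<le> b" "0 \<le> z" for a b z :: real
    using that by linarith
  have "\<bar>arrival Y v w - c v * c w / (2 * real m * ?s) / real m\<bar> =
    1 / ?s / (2 * real m)\<^sup>2 * \<bar>2 * (d v * d w - c v * c w) + (\<kappa> * (d v + d w) * (2 * real m / N) - 2 * (d v * d w) * (real n * \<kappa> / N))\<bar>"
    unfolding eq by (simp add: abs_mult)
  also have "\<dots> \<le> 1 / (real m)\<^sup>2 * (2 * \<bar>d v * d w - c v * c w\<bar> + \<kappa> * (d v + d w) * (2 * real m / N) + 2 * (d v * d w) * (real n * \<kappa> / N))"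
    using M by (intro mult_mono abs3 nn) (auto simp: field_simps power2_eq_square)
  also have "\<dots> \<le> 1 / (real m)\<^sup>2 * ((5 + 2 * \<kappa> + \<kappa>\<^sup>2) * step_error c \<eta> Y v w)"
  proof (intro mult_left_mono)
    let ?F = "step_error c \<eta> Y v w"
    have *: "0 \<le> (real (edges Y v w))\<^sup>2 * I" "0 \<le> \<eta> * S" "0 \<le> R * S" "0 \<le> I * E" "0 \<le> R * E" using pos \<eta> by auto
    have f1: "\<eta> * S + I * E \<le> ?F" and f2: "R * S + R * E \<le> ?F" and f3: "I \<le> ?F"
      unfolding e using pos * by (simp_all add: distrib_right)
    have "2 * (\<eta> * ((d v)\<^sup>2 + (d w)\<^sup>2)) \<le> 2 * (\<eta> * (2 * S + 2 * E))"
      using dsq \<eta> by (intro mult_left_mono) auto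
    also have "\<dots> \<le> 4 * (\<eta> * S) + 4 * (I * E)" using mult_right_mono[OF \<eta>' pos(2)] by (simp add: algebra_simps)
    finally have a: "2 * (\<eta> * ((d v)\<^sup>2 + (d w)\<^sup>2)) + \<eta> * S + I * E \<le> 5 * ?F" using f1 * by linarith
    have "\<kappa> * R * ((d v)\<^sup>2 + (d w)\<^sup>2) \<le> \<kappa> * R * (2 * S + 2 * E)"
      using dsq kappa_pos pos by (intro mult_left_mono) auto
    also have "\<dots> = 2 * \<kappa> * (R * S + R * E)" by (simp add: algebra_simps)
    also have "\<dots> \<le> 2 * \<kappa> * ?F" using f2 kappa_pos by (intro mult_left_mono) auto
    finally have b: "\<kappa> * R * ((d v)\<^sup>2 + (d w)\<^sup>2) \<le> 2 * \<kappa> * ?F" .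
    have "\<kappa>\<^sup>2 * I \<le> \<kappa>\<^sup>2 * ?F" using f3 by (intro mult_left_mono) auto
    then show "2 * \<bar>d v * d w - c v * c w\<bar> + \<kappa> * (d v + d w) * (2 * real m / N) + 2 * (d v * d w) * (real n * \<kappa> / N)
      \<le> (5 + 2 * \<kappa> + \<kappa>\<^sup>2) * ?F"
      using t1 t2 t3 a b unfolding distrib_right by linarith
  qed simp
  finally show ?thesis by simp
qed

text \<open>The remainder is quadratic in the total rate. By Cauchy-Schwarz it suffices to square
  each rate and count; squaring a rate c c / (2 m) is the source of the fourth powers in
  \<open>step_error\<close>.\<close>

lemma taylor_bound:
  fixes x y :: "'p \<Rightarrow> nat" and c :: "nat \<Rightarrow> real" and Y :: nmat
  assumes \<eta>: "0 < \<eta>" "\<eta> \<le> 1" and c: "\<And>v. 0 \<le> c v" and P: "finite P"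
  defines "\<Lambda> \<equiv> (\<Sum>p\<in>P. c (x p) * c (y p) / (2 * real m * (if x p = y p then 2 else 1)) + real (edges Y (x p) (y p)))"
  shows "(1 / real m)\<^sup>2 * (\<Lambda> * (2 * \<Lambda> + 1)) \<le>
     (2 * real (card P) + 1) * 2 / (real m)\<^sup>2 * (\<Sum>p\<in>P. step_error c \<eta> Y (x p) (y p))"
proof -
  define r where "r p = c (x p) * c (y p) / (2 * real m * (if x p = y p then 2 else 1))" for p
  define h where "h p = real (edges Y (x p) (y p))" for p
  have M: "0 < real m" using m_pos by simp
  have F: "(r p + h p)\<^sup>2 + 1 \<le> 2 * step_error c \<eta> Y (x p) (y p)" for p
  proof -
    have "r p \<le> c (x p) * c (y p) / (2 * real m)"
      unfolding r_def using M c by (intro frac_le) auto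
    then have "(r p)\<^sup>2 \<le> (c (x p) * c (y p) / (2 * real m))\<^sup>2"
      using M c by (intro power_mono) (auto simp: r_def)
    also have "\<dots> = (c (x p))\<^sup>2 * (c (y p))\<^sup>2 / (4 * (real m)\<^sup>2)"
      by (simp add: power2_eq_square)
    also have "\<dots> \<le> ((c (x p)) ^ 4 + (c (y p)) ^ 4) / (4 * (real m)\<^sup>2)"
    proof (intro divide_right_mono)
      have "2 * ((c (x p))\<^sup>2 * (c (y p))\<^sup>2) \<le> ((c (x p))\<^sup>2)\<^sup>2 + ((c (y p))\<^sup>2)\<^sup>2"
        using sum_squares_bound[of "(c (x p))\<^sup>2" "(c (y p))\<^sup>2"] by (simp only: mult.assoc)
      moreover have "2 * z \<le> t \<Longrightarrow> 0 \<le> z \<Longrightarrow> z \<le> t" for z t :: real by simp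
      ultimately have "(c (x p))\<^sup>2 * (c (y p))\<^sup>2 \<le> ((c (x p))\<^sup>2)\<^sup>2 + ((c (y p))\<^sup>2)\<^sup>2" by fastforce
      then show "(c (x p))\<^sup>2 * (c (y p))\<^sup>2 \<le> (c (x p)) ^ 4 + (c (y p)) ^ 4"
        by (simp add: power_mult[symmetric])
    qed simp
    also have "\<dots> \<le> ((c (x p)) ^ 4 + (c (y p)) ^ 4) / (real m)\<^sup>2" using M by (intro frac_le) auto
    finally have r2: "(r p)\<^sup>2 \<le> ((c (x p)) ^ 4 + (c (y p)) ^ 4) / (real m)\<^sup>2" .
    have i: "1 \<le> 1 / \<eta>" using \<eta> by simp
    have "(h p)\<^sup>2 * 1 \<le> (h p)\<^sup>2 * (1 / \<eta>)" using i by (intro mult_left_mono) auto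
    moreover have "0 \<le> (\<eta> + real n / real m) * ((c (x p))\<^sup>2 + (c (y p))\<^sup>2)"
      "0 \<le> (1 / \<eta> + real n / real m) * ((real (deg n Y (x p)) - c (x p))\<^sup>2 + (real (deg n Y (y p)) - c (y p))\<^sup>2)"
      using \<eta> by auto
    ultimately have "(r p)\<^sup>2 + (h p)\<^sup>2 + 1 \<le> step_error c \<eta> Y (x p) (y p)"
      using r2 i unfolding step_error_def h_def by simp
    then show ?thesis using square_sum_le[of "r p" "h p"] by linarith
  qed
  have \<Lambda>: "\<Lambda> = (\<Sum>p\<in>P. r p + h p)" unfolding \<Lambda>_def r_def h_def ..
  have "\<Lambda>\<^sup>2 \<le> real (card P) * (\<Sum>p\<in>P. (r p + h p)\<^sup>2)"
    unfolding \<Lambda> using sum_squared_le_sum_of_squares[of "\<lambda>p. r p + h p" P] P by (simp add: mult.commute)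
  also have "\<dots> \<le> real (card P) * (\<Sum>p\<in>P. (r p + h p)\<^sup>2 + 1)"
    by (intro mult_left_mono sum_mono) auto
  finally have sq: "\<Lambda>\<^sup>2 \<le> real (card P) * (\<Sum>p\<in>P. (r p + h p)\<^sup>2 + 1)" .
  have lin: "\<Lambda> \<le> (\<Sum>p\<in>P. (r p + h p)\<^sup>2 + 1)"
    unfolding \<Lambda>
  proof (intro sum_mono)
    fix p show "r p + h p \<le> (r p + h p)\<^sup>2 + 1"
    proof -
      have "2 * z \<le> t \<Longrightarrow> 0 \<le> t \<Longrightarrow> z \<le> t" for z t :: real by simp
      moreover have "2 * (r p + h p) \<le> (r p + h p)\<^sup>2 + 1" using sum_squares_bound[of "r p + h p" 1] by simp
      ultimately show ?thesis by (simp only: add_nonneg_nonneg zero_le_power2 zero_le_one)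
    qed
  qed
  have "\<Lambda> * (2 * \<Lambda> + 1) = 2 * \<Lambda>\<^sup>2 + \<Lambda>" by (simp add: algebra_simps power2_eq_square)
  also have "\<dots> \<le> 2 * (real (card P) * (\<Sum>p\<in>P. (r p + h p)\<^sup>2 + 1)) + (\<Sum>p\<in>P. (r p + h p)\<^sup>2 + 1)"
    using sq lin by linarith
  also have "\<dots> = (2 * real (card P) + 1) * (\<Sum>p\<in>P. (r p + h p)\<^sup>2 + 1)" by (simp add: distrib_right)
  also have "\<dots> \<le> (2 * real (card P) + 1) * (\<Sum>p\<in>P. 2 * step_error c \<eta> Y (x p) (y p))"
    using F by (intro mult_left_mono sum_mono) auto
  finally have "\<Lambda> * (2 * \<Lambda> + 1) \<le> (2 * real (card P) + 1) * 2 * (\<Sum>p\<in>P. step_error c \<eta> Y (x p) (y p))"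
    unfolding sum_distrib_left[symmetric] by (simp only: mult.assoc)
  from mult_left_mono[OF this, of "(1 / real m)\<^sup>2"] show ?thesis
    by (simp add: power_divide)
qed

end


section \<open>Averaging over the tracked vertices\<close>


definition pairs :: "nat \<Rightarrow> (nat \<times> nat) set" where
  "pairs k = {(a, b). 1 \<le> a \<and> a \<le> b \<and> b \<le> k}"

lemma finite_pairs [simp]: "finite (pairs k)"
  by (rule finite_subset[of _ "{1..k} \<times> {1..k}"]) (auto simp: pairs_def)

lemma sum_PiE_component:
  fixes f :: "'b \<Rightarrow> real"
  assumes "finite A" "a \<in> A" "finite V"
  shows "(\<Sum>\<phi>\<in>A \<rightarrow>\<^sub>E V. f (\<phi> a)) = real (card V) ^ (card A - 1) * (\<Sum>v\<in>V. f v)"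
proof -
  have "(\<Sum>\<phi>\<in>A \<rightarrow>\<^sub>E V. f (\<phi> a)) = (\<Sum>\<phi>\<in>A \<rightarrow>\<^sub>E V. \<Prod>x\<in>A. if x = a then f (\<phi> x) else 1)"
    using assms by (intro sum.cong refl) simp
  also have "\<dots> = (\<Prod>x\<in>A. \<Sum>v\<in>V. if x = a then f v else 1)"
    using assms by (intro prod_sum_PiE[symmetric]) auto
  also have "\<dots> = (\<Sum>v\<in>V. f v) * (\<Prod>x\<in>A - {a}. \<Sum>v\<in>V. if x = a then f v else 1)"
    using assms by (subst prod.remove[of A a]) auto
  also have "(\<Prod>x\<in>A - {a}. \<Sum>v\<in>V. if x = a then f v else 1) = (\<Prod>x\<in>A - {a}. real (card V))"
    by (intro prod.cong) auto
  finally show ?thesis using assms by (simp add: mult.commute)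
qed

lemma sum_PiE_component2:
  fixes f :: "'b \<Rightarrow> 'b \<Rightarrow> real"
  assumes "finite A" "a \<in> A" "b \<in> A" "a \<noteq> b" "finite V"
  shows "(\<Sum>\<phi>\<in>A \<rightarrow>\<^sub>E V. f (\<phi> a) (\<phi> b)) = real (card V) ^ (card A - 2) * (\<Sum>v\<in>V. \<Sum>w\<in>V. f v w)"
proof -
  have "(\<Sum>\<phi>\<in>A \<rightarrow>\<^sub>E V. f (\<phi> a) (\<phi> b)) =
      (\<Sum>\<phi>\<in>A \<rightarrow>\<^sub>E V. \<Sum>v\<in>V. \<Sum>w\<in>V. f v w * (of_bool (\<phi> a = v) * of_bool (\<phi> b = w)))"
  proof (intro sum.cong refl)
    fix \<phi> assume "\<phi> \<in> A \<rightarrow>\<^sub>E V"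
    then have V: "\<phi> a \<in> V" "\<phi> b \<in> V" using assms by (auto simp: PiE_iff)
    have "(\<Sum>v\<in>V. \<Sum>w\<in>V. f v w * (of_bool (\<phi> a = v) * of_bool (\<phi> b = w))) =
      (\<Sum>v\<in>V. if v = \<phi> a then (\<Sum>w\<in>V. if w = \<phi> b then f v w else 0) else 0)"
      by (intro sum.cong refl) (auto intro!: sum.neutral sum.cong)
    also have "\<dots> = f (\<phi> a) (\<phi> b)" using assms V by simp
    finally show "f (\<phi> a) (\<phi> b) = (\<Sum>v\<in>V. \<Sum>w\<in>V. f v w * (of_bool (\<phi> a = v) * of_bool (\<phi> b = w)))" ..
  qed
  also have "\<dots> = (\<Sum>v\<in>V. \<Sum>w\<in>V. f v w * (\<Sum>\<phi>\<in>A \<rightarrow>\<^sub>E V. of_bool (\<phi> a = v) * of_bool (\<phi> b = w)))"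
    by (subst sum.swap, rule sum.cong[OF refl], subst sum.swap) (simp add: sum_distrib_left)
  also have "\<dots> = (\<Sum>v\<in>V. \<Sum>w\<in>V. f v w * real (card V) ^ (card A - 2))"
  proof (intro sum.cong refl arg_cong2[of _ _ _ _ "(*)"])
    fix v w assume vw: "v \<in> V" "w \<in> V"
    let ?g = "\<lambda>x u. if x = a then of_bool (u = v) else if x = b then of_bool (u = w) else (1::real)"
    have rem: "(\<Prod>x\<in>A. F x) = F a * (F b * (\<Prod>x\<in>A - {a} - {b}. F x))" for F :: "'a \<Rightarrow> real"
      using assms by (subst prod.remove[of A a], simp, simp, subst prod.remove[of "A - {a}" b]) auto
    have one: "(\<Prod>x\<in>A - {a} - {b}. ?g x (\<phi> x)) = 1" for \<phi>
      by (intro prod.neutral) auto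
    have cards: "(\<Prod>x\<in>A - {a} - {b}. \<Sum>u\<in>V. ?g x u) = (\<Prod>x\<in>A - {a} - {b}. real (card V))"
      by (intro prod.cong) auto
    have delta: "(\<Sum>u\<in>V. of_bool (u = z)) = (1::real)" if "z \<in> V" for z
    proof -
      have "(\<Sum>u\<in>V. of_bool (u = z)) = (\<Sum>u\<in>V. if u = z then 1 else (0::real))" by (intro sum.cong) auto
      then show ?thesis using assms that by simp
    qed
    have "(\<Sum>\<phi>\<in>A \<rightarrow>\<^sub>E V. of_bool (\<phi> a = v) * of_bool (\<phi> b = w)) = (\<Sum>\<phi>\<in>A \<rightarrow>\<^sub>E V. \<Prod>x\<in>A. ?g x (\<phi> x))"
      unfolding rem one using assms by (intro sum.cong refl) simp
    also have "\<dots> = (\<Prod>x\<in>A. \<Sum>u\<in>V. ?g x u)"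
      using assms by (intro prod_sum_PiE[symmetric]) auto
    also have "\<dots> = real (card V) ^ (card A - 2)"
      unfolding rem cards using assms delta[OF vw(1)] delta[OF vw(2)] by (simp add: card_Diff_singleton numeral_2_eq_2)
    finally show "(\<Sum>\<phi>\<in>A \<rightarrow>\<^sub>E V. of_bool (\<phi> a = v) * of_bool (\<phi> b = w)) = real (card V) ^ (card A - 2)" .
  qed
  finally show ?thesis by (simp add: mult.commute flip: sum_distrib_right)
qed

text \<open>The remaining labels are free and cancel against the normalisation. Distinct labels may
  still share a vertex, so the double sum includes its diagonal.\<close>

lemma average_pair:
  fixes f :: "nat \<Rightarrow> nat \<Rightarrow> real"
  assumes "n \<ge> 1" "(a, b) \<in> pairs k"
  shows "1 / real n ^ k * (\<Sum>\<phi>\<in>{1..k} \<rightarrow>\<^sub>E {1..n}. f (\<phi> a) (\<phi> b)) =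
    (if a = b then (\<Sum>v\<in>{1..n}. f v v) / real n else (\<Sum>v\<in>{1..n}. \<Sum>w\<in>{1..n}. f v w) / (real n)\<^sup>2)"
proof (cases "a = b")
  case True
  have "real n ^ k = real n ^ (k - 1) * real n"
    using assms True by (cases k) (auto simp: pairs_def)
  then show ?thesis
    using sum_PiE_component[of "{1..k}" a "{1..n}" "\<lambda>v. f v v"] assms True by (simp add: pairs_def)
next
  case False
  then have "2 \<le> k" using assms by (auto simp: pairs_def)
  then have "real n ^ k = real n ^ (k - 2) * (real n)\<^sup>2"
    by (metis le_add_diff_inverse2 power_add)
  then show ?thesis
    using sum_PiE_component2[of "{1..k}" a b "{1..n}" f] assms False by (simp add: pairs_def)
qed

lemma edges_le_deg:
  assumes "x \<in> {1..n}" "y \<in> {1..n}"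
  shows "edges Y x y \<le> deg n Y x"
proof -
  have "edges Y x y \<le> Y x y" by (simp add: edges_def)
  also have "\<dots> \<le> deg n Y x" unfolding deg_def using assms by (intro member_le_sum) auto
  finally show ?thesis .
qed

text \<open>
  The parameter \<open>s\<close> is the fourth root of \<open>n\<close>, chosen because with the weight \<open>\<eta> = 1 / s\<close> in Young's
  inequality all error terms are of order at most \<open>1 / s\<close>.
\<close>

locale scaled_reconnecting = reconnecting +
  fixes \<alpha> \<tau> Q s :: real and N :: nat and B :: nmat
  assumes B: "B \<in> adj_edges n m"
    and n_pos: "n \<ge> 1"
    and alpha: "0 < \<alpha>" "\<alpha> * (real n)\<^sup>2 \<le> real m"
    and tau: "0 \<le> \<tau>" "real N \<le> \<tau> * real m"
    and s: "1 \<le> s" "real n = s ^ 4"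
    and Q: "1 \<le> Q"
      "(\<Sum>v\<in>{1..n}. real (deg n B v)) \<le> Q * (real n)^2"
      "(\<Sum>v\<in>{1..n}. (real (deg n B v))^2) \<le> Q * (real n)^3"
      "(\<Sum>v\<in>{1..n}. (real (deg n B v))^4) \<le> Q * (real n)^5"
      "(\<Sum>v\<in>{1..n}. (real (B v v))\<^sup>2) \<le> Q * real n"
begin

section \<open>Moments of degrees and edge counts along the chain\<close>

abbreviation c :: "nat \<Rightarrow> real" where "c v \<equiv> real (deg n B v)"

text \<open>What \<open>expect_deg_deviation_le\<close> leaves once N / m is bounded by \<tau> and n
  / m by 1 / (\<alpha> n), with the three kinds of terms 1, c and c^2 / n merged under one
  constant.\<close>

definition "deviation_const = \<tau> / 2 * ((2 * \<kappa> + 2) * (1 + \<tau> * \<kappa> / 2) + \<kappa> / \<alpha> + \<kappa>)"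

lemma deviation_const_nonneg: "0 \<le> deviation_const"
  unfolding deviation_const_def using tau kappa_pos alpha by auto

lemma n_real: "1 \<le> real n" "0 < real n" using n_pos by auto

lemma ratio: "real n / real m \<le> 1 / (\<alpha> * real n)" "1 / real m \<le> 1 / (\<alpha> * (real n)\<^sup>2)"
  using alpha m_pos n_real by (auto simp: field_simps power2_eq_square)

lemma deviation_le:
  assumes v: "v \<in> {1..n}" and T: "T \<le> N"
  shows "expect T (\<lambda>Y. (real (deg n Y v) - c v)\<^sup>2) B \<le> deviation_const * (1 + c v + (c v)\<^sup>2 / real n)"
proof -
  have M: "0 < real m" using m_pos by simp
  have a: "real N / (2 * real m) \<le> \<tau> / 2" using tau M by (simp add: field_simps)
  have b: "real N * (\<kappa> / (2 * real m)) \<le> \<tau> * \<kappa> / 2"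
    using mult_right_mono[OF a, of \<kappa>] kappa_pos by simp
  have "real n / (2 * real m) \<le> 1 / (2 * \<alpha> * real n)" using ratio(1) by simp
  then have "2 * \<kappa> * (real n / (2 * real m)) \<le> 2 * \<kappa> * (1 / (2 * \<alpha> * real n))"
    using kappa_pos by (intro mult_left_mono) auto
  then have d: "2 * \<kappa> * (real n / (2 * real m)) * (c v)\<^sup>2 \<le> \<kappa> / \<alpha> * ((c v)\<^sup>2 / real n)"
    using mult_right_mono[of "2 * \<kappa> * (real n / (2 * real m))" "2 * \<kappa> * (1 / (2 * \<alpha> * real n))" "(c v)\<^sup>2"] by simp
  have "expect T (\<lambda>Y. (real (deg n Y v) - c v)\<^sup>2) B \<le>
    real N / (2 * real m) * ((2 * \<kappa> + 2) * (c v + real N * (\<kappa> / (2 * real m)))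
       + 2 * \<kappa> * (real n / (2 * real m)) * (c v)\<^sup>2 + \<kappa>)"
    by (rule expect_deg_deviation_le[OF B v T])
  also have "\<dots> \<le> \<tau> / 2 * ((2 * \<kappa> + 2) * (c v + \<tau> * \<kappa> / 2) + \<kappa> / \<alpha> * ((c v)\<^sup>2 / real n) + \<kappa>)"
  proof -
    have "(2 * \<kappa> + 2) * (c v + real N * (\<kappa> / (2 * real m))) \<le> (2 * \<kappa> + 2) * (c v + \<tau> * \<kappa> / 2)"
      using b kappa_pos by (intro mult_left_mono) auto
    then have inner: "(2 * \<kappa> + 2) * (c v + real N * (\<kappa> / (2 * real m))) + 2 * \<kappa> * (real n / (2 * real m)) * (c v)\<^sup>2 + \<kappa> \<le>
      (2 * \<kappa> + 2) * (c v + \<tau> * \<kappa> / 2) + \<kappa> / \<alpha> * ((c v)\<^sup>2 / real n) + \<kappa>"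
      using d by linarith
    show ?thesis by (intro mult_mono a inner) (use tau kappa_pos in auto)
  qed
  also have "\<dots> \<le> \<tau> / 2 * (((2 * \<kappa> + 2) * (1 + \<tau> * \<kappa> / 2) + \<kappa> / \<alpha> + \<kappa>) * (1 + c v + (c v)\<^sup>2 / real n))"
  proof (intro mult_left_mono)
    define z where "z = (c v)\<^sup>2 / real n"
    have z: "0 \<le> z" "0 \<le> c v" by (simp_all add: z_def)
    have "(2 * \<kappa> + 2) * (c v + \<tau> * \<kappa> / 2) \<le> (2 * \<kappa> + 2) * (1 + \<tau> * \<kappa> / 2) * (1 + c v + z)"
    proof -
      have "c v + \<tau> * \<kappa> / 2 \<le> (1 + \<tau> * \<kappa> / 2) * (1 + c v + z)"
        using z tau kappa_pos by (simp add: algebra_simps)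
      then show ?thesis using kappa_pos mult_left_mono[of "c v + \<tau> * \<kappa> / 2" _ "2 * \<kappa> + 2"] by (simp only: mult.assoc)
    qed
    moreover have "\<kappa> / \<alpha> * z \<le> \<kappa> / \<alpha> * (1 + c v + z)" using z kappa_pos alpha by (intro mult_left_mono) auto
    moreover have "\<kappa> * 1 \<le> \<kappa> * (1 + c v + z)" using z kappa_pos by (intro mult_left_mono) auto
    ultimately show "(2 * \<kappa> + 2) * (c v + \<tau> * \<kappa> / 2) + \<kappa> / \<alpha> * ((c v)\<^sup>2 / real n) + \<kappa> \<le>
       ((2 * \<kappa> + 2) * (1 + \<tau> * \<kappa> / 2) + \<kappa> / \<alpha> + \<kappa>) * (1 + c v + (c v)\<^sup>2 / real n)"
      unfolding z_def[symmetric] distrib_right[of _ _ "1 + c v + z"] by linarith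
  qed (use tau in auto)
  finally show ?thesis by (simp add: deviation_const_def)
qed

text \<open>The factor 3 counts the terms 1, c and c^2 / n, each of which sums to at most Q n^2 over
  the vertices.\<close>

definition "sum_deviation_const = 3 * deviation_const * Q"

lemma sum_deviation_const_nonneg: "0 \<le> sum_deviation_const" unfolding sum_deviation_const_def using deviation_const_nonneg Q by auto

lemma sum_deviation_le:
  assumes T: "T \<le> N"
  shows "(\<Sum>v\<in>{1..n}. expect T (\<lambda>Y. (real (deg n Y v) - c v)\<^sup>2) B) \<le> sum_deviation_const * (real n)\<^sup>2"
proof -
  have "(\<Sum>v\<in>{1..n}. expect T (\<lambda>Y. (real (deg n Y v) - c v)\<^sup>2) B) \<le> (\<Sum>v\<in>{1..n}. deviation_const * (1 + c v + (c v)\<^sup>2 / real n))"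
    using T by (intro sum_mono deviation_le) auto
  also have "\<dots> = deviation_const * (real n + (\<Sum>v\<in>{1..n}. c v) + (\<Sum>v\<in>{1..n}. (c v)\<^sup>2) / real n)"
    by (simp add: sum.distrib sum_divide_distrib flip: sum_distrib_left)
  also have "\<dots> \<le> deviation_const * (Q * (real n)\<^sup>2 + Q * (real n)\<^sup>2 + Q * (real n)\<^sup>2)"
  proof (intro mult_left_mono add_mono Q deviation_const_nonneg)
    have "real n * 1 \<le> (real n)\<^sup>2 * Q" using n_real Q unfolding power2_eq_square mult.assoc
      by (intro mult_left_mono) (auto intro: order_trans[OF _ mult_mono[of 1 _ 1 Q]])
    then show "real n \<le> Q * (real n)\<^sup>2" by (simp add: mult.commute)
    have "(\<Sum>v\<in>{1..n}. (c v)\<^sup>2) / real n \<le> Q * (real n)^3 / real n" using Q n_real by (intro divide_right_mono) auto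
    then show "(\<Sum>v\<in>{1..n}. (c v)\<^sup>2) / real n \<le> Q * (real n)\<^sup>2" using n_real by (simp add: power3_eq_cube power2_eq_square)
  qed
  finally show ?thesis by (simp add: sum_deviation_const_def)
qed

lemma sq_deg_le: "(real (deg n Y v))\<^sup>2 \<le> 2 * (c v)\<^sup>2 + 2 * (real (deg n Y v) - c v)\<^sup>2"
  using square_sum_le[of "c v" "real (deg n Y v) - c v"] by simp

lemma expect_sq_deg_le:
  "expect T (\<lambda>Y. (real (deg n Y v))\<^sup>2) B \<le> 2 * (c v)\<^sup>2 + 2 * expect T (\<lambda>Y. (real (deg n Y v) - c v)\<^sup>2) B"
proof -
  have "expect T (\<lambda>Y. (real (deg n Y v))\<^sup>2) B \<le> expect T (\<lambda>Y. 2 * (c v)\<^sup>2 + 2 * (real (deg n Y v) - c v)\<^sup>2) B"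
    by (intro expect_mono[OF B] sq_deg_le)
  then show ?thesis by (simp only: expect_add expect_cmult expect_const[OF B])
qed

lemma sum_sq_deg_le:
  assumes T: "T \<le> N"
  shows "(\<Sum>v\<in>{1..n}. expect T (\<lambda>Y. (real (deg n Y v))\<^sup>2) B) \<le> (2 * Q + 2 * sum_deviation_const) * (real n)^3"
proof -
  have "(\<Sum>v\<in>{1..n}. expect T (\<lambda>Y. (real (deg n Y v))\<^sup>2) B) \<le>
     2 * (\<Sum>v\<in>{1..n}. (c v)\<^sup>2) + 2 * (\<Sum>v\<in>{1..n}. expect T (\<lambda>Y. (real (deg n Y v) - c v)\<^sup>2) B)"
    unfolding sum_distrib_left sum.distrib[symmetric] by (intro sum_mono expect_sq_deg_le)
  also have "\<dots> \<le> 2 * (Q * (real n)^3) + 2 * (sum_deviation_const * (real n)^2)"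
    using sum_deviation_le[OF T] Q(3) by linarith
  also have "\<dots> \<le> 2 * (Q * (real n)^3) + 2 * (sum_deviation_const * (real n)^3)"
    using sum_deviation_const_nonneg n_real by (intro add_left_mono mult_left_mono power_increasing) auto
  finally show ?thesis by (simp add: algebra_simps)
qed

text \<open>One factor of the square is bounded by the entry and the other by the degree, so a row
  sums to at most the squared degree. The resulting mean square per ordered pair is of order n,
  which suffices off the diagonal.\<close>

lemma sum_edges_sq_le:
  assumes T: "T \<le> N"
  shows "(\<Sum>v\<in>{1..n}. \<Sum>w\<in>{1..n}. expect T (\<lambda>Y. (real (edges Y v w))\<^sup>2) B) \<le> (2 * Q + 2 * sum_deviation_const) * (real n)^3"
proof -
  have "(\<Sum>w\<in>{1..n}. expect T (\<lambda>Y. (real (edges Y v w))\<^sup>2) B) \<le> expect T (\<lambda>Y. (real (deg n Y v))\<^sup>2) B"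
    if v: "v \<in> {1..n}" for v
    unfolding expect_sum[OF B, symmetric]
  proof (rule expect_mono[OF B])
    fix Y
    have "(\<Sum>w\<in>{1..n}. (real (edges Y v w))\<^sup>2) \<le> (\<Sum>w\<in>{1..n}. real (Y v w) * real (deg n Y v))"
    proof (intro sum_mono)
      fix w assume "w \<in> {1..n}"
      then have "edges Y v w \<le> deg n Y v" using edges_le_deg v by blast
      moreover have "edges Y v w \<le> Y v w" by (simp add: edges_def)
      ultimately show "(real (edges Y v w))\<^sup>2 \<le> real (Y v w) * real (deg n Y v)"
        unfolding power2_eq_square by (intro mult_mono) auto
    qed
    also have "\<dots> = (real (deg n Y v))\<^sup>2" by (simp add: deg_def power2_eq_square flip: sum_distrib_right)
    finally show "(\<Sum>w\<in>{1..n}. (real (edges Y v w))\<^sup>2) \<le> (real (deg n Y v))\<^sup>2" .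
  qed
  then have "(\<Sum>v\<in>{1..n}. \<Sum>w\<in>{1..n}. expect T (\<lambda>Y. (real (edges Y v w))\<^sup>2) B) \<le>
      (\<Sum>v\<in>{1..n}. expect T (\<lambda>Y. (real (deg n Y v))\<^sup>2) B)"
    by (intro sum_mono)
  then show ?thesis using sum_sq_deg_le[OF T] by linarith
qed

text \<open>The one-step gains of \<open>mean_loop_le\<close> are summed over N steps, with the
  squared degree replaced by its frozen value plus deviation. As N is of order m, the total gain is
  of order c^2 / m.\<close>

lemma expect_loops_le:
  assumes v: "v \<in> {1..n}" and T: "T \<le> N"
  shows "expect T (\<lambda>Y. real (Y v v)) B \<le>
    real (B v v) + \<tau> / real m * (2 * (c v)\<^sup>2 + 2 * (deviation_const * (1 + c v + (c v)\<^sup>2 / real n)) + \<kappa>\<^sup>2)"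
proof -
  define U where "U = 2 * (c v)\<^sup>2 + 2 * (deviation_const * (1 + c v + (c v)\<^sup>2 / real n)) + \<kappa>\<^sup>2"
  have U: "0 \<le> U" unfolding U_def using deviation_const_nonneg by auto
  have "expect T (\<lambda>Y. real (Y v v)) B \<le> real (B v v) + real T * (1 / (real m)\<^sup>2 * U)"
    using T
  proof (induction T)
    case (Suc T)
    have "expect (Suc T) (\<lambda>Y. real (Y v v)) B \<le>
       expect T (\<lambda>Y. real (Y v v) + 1 / (real m)\<^sup>2 * ((real (deg n Y v))\<^sup>2 + \<kappa>\<^sup>2)) B"
      unfolding expect_Suc by (intro expect_mono[OF B] mean_loop_le v)
    also have "\<dots> = expect T (\<lambda>Y. real (Y v v)) B + 1 / (real m)\<^sup>2 * (expect T (\<lambda>Y. (real (deg n Y v))\<^sup>2) B + \<kappa>\<^sup>2)"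
      by (simp only: expect_add expect_cmult expect_const[OF B])
    also have "\<dots> \<le> (real (B v v) + real T * (1 / (real m)\<^sup>2 * U)) + 1 / (real m)\<^sup>2 * U"
      using Suc expect_sq_deg_le[of T v] deviation_le[OF v, of T] unfolding U_def
      by (intro add_mono mult_left_mono) auto
    finally show ?case by (simp add: distrib_right add_divide_distrib)
  qed (simp add: expect_0)
  also have "real T * (1 / (real m)\<^sup>2 * U) \<le> \<tau> * real m * (1 / (real m)\<^sup>2 * U)"
    using T tau U by (intro mult_right_mono) auto
  also have "\<tau> * real m * (1 / (real m)\<^sup>2 * U) = \<tau> / real m * U"
    using m_pos by (simp add: power2_eq_square)
  finally show ?thesis by (simp add: U_def)
qed

definition "loops_const = 4 * Q + 3 * sum_deviation_const + \<tau> / \<alpha> * (4 * Q + 8 * deviation_const * Q + \<kappa>\<^sup>2 * Q)"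

lemma loops_const_nonneg: "0 \<le> loops_const"
  unfolding loops_const_def using sum_deviation_const_nonneg deviation_const_nonneg Q tau alpha by (intro add_nonneg_nonneg mult_nonneg_nonneg divide_nonneg_nonneg) auto

text \<open>Bounding a squared loop count by the squared degree would give a mean of order n^2 =
  s^8, too large after multiplication by 1 / \<eta> = s. Instead the degree factor is frozen at c,
  so that only a first moment of loops is needed, and the deviation of the degree is paid for
  separately.\<close>

lemma sum_loops_sq_le:
  assumes T: "T \<le> N"
  shows "(\<Sum>v\<in>{1..n}. expect T (\<lambda>Y. (real (edges Y v v))\<^sup>2) B) \<le> loops_const * (real n * s ^ 6)"
proof -
  let ?D = "\<lambda>v. expect T (\<lambda>Y. (real (deg n Y v) - c v)\<^sup>2) B"
  \<comment> \<open>The weight r is the square root of n: with degrees of order n and squared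
    deviations of order n, both c^2 / r and r times the squared deviation are then of order n^(3/2)
    = s^6.\<close>
  define r where "r = s\<^sup>2"
  have r: "0 < r" "1 \<le> r" "real n = r\<^sup>2" "s ^ 6 = r ^ 3"
    using s one_le_power[of s 2] by (simp_all add: r_def power_mult[symmetric])
  have one: "expect T (\<lambda>Y. (real (edges Y v v))\<^sup>2) B \<le>
     c v * expect T (\<lambda>Y. real (Y v v)) B + (2 * (c v)\<^sup>2 / r + 2 * ?D v / r + r * ?D v)" if v: "v \<in> {1..n}" for v
  proof -
    have "expect T (\<lambda>Y. (real (edges Y v v))\<^sup>2) B \<le>
      expect T (\<lambda>Y. c v * real (Y v v) + (2 * (c v)\<^sup>2 / r + (2 / r * (real (deg n Y v) - c v)\<^sup>2 + r * (real (deg n Y v) - c v)\<^sup>2))) B"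
    proof (rule expect_mono[OF B])
      fix Y
      let ?d = "real (deg n Y v)" and ?y = "real (Y v v)"
      have y: "?y \<le> ?d" using v unfolding deg_def by (auto intro!: member_le_sum)
      have "(real (edges Y v v))\<^sup>2 \<le> ?y * ?d"
        unfolding power2_eq_square using edges_le_deg[OF v v, of Y] by (intro mult_mono) (auto simp: edges_def)
      \<comment> \<open>The degree is written as c plus a deviation, and the diagonal entry in front
        of the deviation is enlarged to the degree.\<close>
      also have "\<dots> \<le> c v * ?y + ?d * \<bar>?d - c v\<bar>"
      proof -
        have "?y * (?d - c v) \<le> ?y * \<bar>?d - c v\<bar>" by (intro mult_left_mono) auto
        also have "\<dots> \<le> ?d * \<bar>?d - c v\<bar>" using y by (intro mult_right_mono) auto
        finally show ?thesis by (simp add: algebra_simps)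
      qed
      also have "?d * \<bar>?d - c v\<bar> \<le> 2 * (c v)\<^sup>2 / r + (2 / r * (?d - c v)\<^sup>2 + r * (?d - c v)\<^sup>2)"
      proof -
        have "?d\<^sup>2 / r \<le> (2 * (c v)\<^sup>2 + 2 * (?d - c v)\<^sup>2) / r"
          using sq_deg_le[of Y v] r by (intro divide_right_mono) auto
        moreover have "0 \<le> ?d * \<bar>?d - c v\<bar>" by simp
        moreover have "2 * z \<le> x + y \<Longrightarrow> x \<le> w \<Longrightarrow> 0 \<le> z \<Longrightarrow> z \<le> w + y" for w x y z :: real by linarith
        ultimately have "?d * \<bar>?d - c v\<bar> \<le> (2 * (c v)\<^sup>2 + 2 * (?d - c v)\<^sup>2) / r + r * (?d - c v)\<^sup>2"
          using young[OF r(1), of ?d "\<bar>?d - c v\<bar>"] unfolding power2_abs by blast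
        then show ?thesis by (simp add: add_divide_distrib)
      qed
      finally show "(real (edges Y v v))\<^sup>2 \<le> c v * ?y + (2 * (c v)\<^sup>2 / r + (2 / r * (?d - c v)\<^sup>2 + r * (?d - c v)\<^sup>2))"
        by simp
    qed
    also have "\<dots> = c v * expect T (\<lambda>Y. real (Y v v)) B + (2 * (c v)\<^sup>2 / r + (2 / r * ?D v + r * ?D v))"
      by (simp only: expect_add expect_cmult expect_const[OF B])
    finally show ?thesis by simp
  qed
  have two: "c v * expect T (\<lambda>Y. real (Y v v)) B \<le>
     (c v)\<^sup>2 / r + r * (real (B v v))\<^sup>2 + \<tau> / \<alpha> / (real n)\<^sup>2 *
       (2 * (real n * (c v)\<^sup>2 + (c v) ^ 4 / real n) + 2 * deviation_const * (c v + (c v)\<^sup>2 + ((c v)\<^sup>2 + (c v) ^ 4 / (real n)\<^sup>2)) + \<kappa>\<^sup>2 * c v)"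
    if v: "v \<in> {1..n}" for v
  proof -
    \<comment> \<open>The third moment is interpolated between the second and the fourth, with
      weight n because degrees are of order n.\<close>
    have c3: "(c v) ^ 3 \<le> real n * (c v)\<^sup>2 + (c v) ^ 4 / real n"
    proof -
      have "2 * (((c v)\<^sup>2) * c v) \<le> ((c v)\<^sup>2)\<^sup>2 / real n + real n * (c v)\<^sup>2"
        by (rule young) (use n_real in auto)
      moreover have e: "((c v)\<^sup>2)\<^sup>2 = (c v) ^ 4" "(c v)\<^sup>2 * c v = (c v) ^ 3" by (simp_all add: power2_eq_square power3_eq_cube eval_nat_numeral)
      moreover have "2 * z \<le> x + y \<Longrightarrow> 0 \<le> z \<Longrightarrow> z \<le> y + x" for x y z :: real by linarith
      moreover have "0 \<le> (c v) ^ 3" by simp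
      ultimately show ?thesis unfolding e by blast
    qed
    have c3n: "(c v) ^ 3 / real n \<le> (c v)\<^sup>2 + (c v) ^ 4 / (real n)\<^sup>2"
      using divide_right_mono[OF c3, of "real n"] n_real by (simp add: add_divide_distrib power2_eq_square)
    have "c v * expect T (\<lambda>Y. real (Y v v)) B \<le>
      c v * (real (B v v) + \<tau> / real m * (2 * (c v)\<^sup>2 + 2 * (deviation_const * (1 + c v + (c v)\<^sup>2 / real n)) + \<kappa>\<^sup>2))"
      by (intro mult_left_mono expect_loops_le v T) auto
    also have "\<dots> = c v * real (B v v) + \<tau> / real m * (2 * (c v) ^ 3 + 2 * deviation_const * (c v + (c v)\<^sup>2 + (c v) ^ 3 / real n) + \<kappa>\<^sup>2 * c v)"
      by (simp add: algebra_simps power2_eq_square power3_eq_cube)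
    also have "c v * real (B v v) \<le> (c v)\<^sup>2 / r + r * (real (B v v))\<^sup>2"
    proof -
      have "0 \<le> c v * real (B v v)" by simp
      then show ?thesis using young[OF r(1), of "c v" "real (B v v)"] by linarith
    qed
    also have "\<tau> / real m * (2 * (c v) ^ 3 + 2 * deviation_const * (c v + (c v)\<^sup>2 + (c v) ^ 3 / real n) + \<kappa>\<^sup>2 * c v)
       \<le> \<tau> / \<alpha> / (real n)\<^sup>2 *
       (2 * (real n * (c v)\<^sup>2 + (c v) ^ 4 / real n) + 2 * deviation_const * (c v + (c v)\<^sup>2 + ((c v)\<^sup>2 + (c v) ^ 4 / (real n)\<^sup>2)) + \<kappa>\<^sup>2 * c v)"
    proof (intro mult_mono)
      show "\<tau> / real m \<le> \<tau> / \<alpha> / (real n)\<^sup>2"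
        using mult_left_mono[OF ratio(2) tau(1)] by simp
      have "2 * deviation_const * (c v + (c v)\<^sup>2 + (c v) ^ 3 / real n) \<le> 2 * deviation_const * (c v + (c v)\<^sup>2 + ((c v)\<^sup>2 + (c v) ^ 4 / (real n)\<^sup>2))"
        using c3n deviation_const_nonneg by (intro mult_left_mono) auto
      then show "2 * (c v) ^ 3 + 2 * deviation_const * (c v + (c v)\<^sup>2 + (c v) ^ 3 / real n) + \<kappa>\<^sup>2 * c v \<le>
        2 * (real n * (c v)\<^sup>2 + (c v) ^ 4 / real n) + 2 * deviation_const * (c v + (c v)\<^sup>2 + ((c v)\<^sup>2 + (c v) ^ 4 / (real n)\<^sup>2)) + \<kappa>\<^sup>2 * c v"
        by (intro add_mono order_refl mult_left_mono[OF c3]) simp_all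
      show "0 \<le> 2 * (c v) ^ 3 + 2 * deviation_const * (c v + (c v)\<^sup>2 + (c v) ^ 3 / real n) + \<kappa>\<^sup>2 * c v"
        using deviation_const_nonneg kappa_pos by (intro add_nonneg_nonneg mult_nonneg_nonneg divide_nonneg_nonneg zero_le_power) auto
    qed (use tau alpha in auto)
    finally show ?thesis by (simp add: add.assoc)
  qed
  let ?S = "\<lambda>f. \<Sum>v\<in>{1..n}. f v"
  have "(\<Sum>v\<in>{1..n}. expect T (\<lambda>Y. (real (edges Y v v))\<^sup>2) B) \<le>
    (\<Sum>v\<in>{1..n}. (c v)\<^sup>2 / r + r * (real (B v v))\<^sup>2 + \<tau> / \<alpha> / (real n)\<^sup>2 *
       (2 * (real n * (c v)\<^sup>2 + (c v) ^ 4 / real n) + 2 * deviation_const * (c v + (c v)\<^sup>2 + ((c v)\<^sup>2 + (c v) ^ 4 / (real n)\<^sup>2)) + \<kappa>\<^sup>2 * c v)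
      + (2 * (c v)\<^sup>2 / r + 2 * ?D v / r + r * ?D v))"
  proof (intro sum_mono)
    fix v assume v: "v \<in> {1..n}"
    show "expect T (\<lambda>Y. (real (edges Y v v))\<^sup>2) B \<le> (c v)\<^sup>2 / r + r * (real (B v v))\<^sup>2 + \<tau> / \<alpha> / (real n)\<^sup>2 *
       (2 * (real n * (c v)\<^sup>2 + (c v) ^ 4 / real n) + 2 * deviation_const * (c v + (c v)\<^sup>2 + ((c v)\<^sup>2 + (c v) ^ 4 / (real n)\<^sup>2)) + \<kappa>\<^sup>2 * c v)
      + (2 * (c v)\<^sup>2 / r + 2 * ?D v / r + r * ?D v)"
      using one[OF v] two[OF v] by linarith
  qed
  also have "\<dots> = ?S (\<lambda>v. (c v)\<^sup>2) / r + r * ?S (\<lambda>v. (real (B v v))\<^sup>2) + \<tau> / \<alpha> / (real n)\<^sup>2 *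
       (2 * (real n * ?S (\<lambda>v. (c v)\<^sup>2) + ?S (\<lambda>v. (c v) ^ 4) / real n) +
        2 * deviation_const * (?S c + ?S (\<lambda>v. (c v)\<^sup>2) + (?S (\<lambda>v. (c v)\<^sup>2) + ?S (\<lambda>v. (c v) ^ 4) / (real n)\<^sup>2)) + \<kappa>\<^sup>2 * ?S c)
      + (2 * ?S (\<lambda>v. (c v)\<^sup>2) / r + 2 * ?S ?D / r + r * ?S ?D)"
    by (simp only: sum.distrib sum_distrib_left[symmetric] sum_divide_distrib[symmetric])
  also have "\<dots> \<le> Q * (real n)^3 / r + r * (Q * real n) + \<tau> / \<alpha> / (real n)\<^sup>2 *
       (2 * (real n * (Q * (real n)^3) + Q * (real n)^5 / real n) +
        2 * deviation_const * (Q * (real n)\<^sup>2 + Q * (real n)^3 + (Q * (real n)^3 + Q * (real n)^5 / (real n)\<^sup>2)) + \<kappa>\<^sup>2 * (Q * (real n)\<^sup>2))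
      + (2 * (Q * (real n)^3) / r + 2 * (sum_deviation_const * (real n)\<^sup>2) / r + r * (sum_deviation_const * (real n)\<^sup>2))"
    by (intro add_mono mult_left_mono divide_right_mono Q sum_deviation_le[OF T])
      (use r n_real deviation_const_nonneg tau alpha in auto)
  also have "\<dots> = 3 * Q * (real n * r ^ 3) + Q * (real n * r) + \<tau> / \<alpha> *
       (4 * Q * (real n)\<^sup>2 + 2 * deviation_const * Q * (1 + 3 * real n) + \<kappa>\<^sup>2 * Q) + 2 * sum_deviation_const * (real n * r) + sum_deviation_const * (real n * r ^ 3)"
  proof -
    have "r \<noteq> 0" "\<alpha> \<noteq> 0" using r alpha by auto
    then show ?thesis unfolding r(3) by (simp add: field_simps eval_nat_numeral)
  qed
  also have "\<dots> \<le> 3 * Q * (real n * r ^ 3) + Q * (real n * r ^ 3) + \<tau> / \<alpha> *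
       (4 * Q * (real n * r ^ 3) + 2 * deviation_const * Q * (4 * (real n * r ^ 3)) + \<kappa>\<^sup>2 * Q * (real n * r ^ 3)) + 2 * sum_deviation_const * (real n * r ^ 3) + sum_deviation_const * (real n * r ^ 3)"
  proof -
    have r13: "r \<le> r ^ 3" using power_increasing[of 1 3 r] r by simp
    then have a: "real n * r \<le> real n * r ^ 3" by (intro mult_left_mono) auto
    have "(real n)\<^sup>2 = real n * r\<^sup>2" using r by (simp add: power2_eq_square)
    also have "\<dots> \<le> real n * r ^ 3" using r by (intro mult_left_mono power_increasing) auto
    finally have b: "(real n)\<^sup>2 \<le> real n * r ^ 3" .
    have d: "real n \<le> real n * r ^ 3" using one_le_power[OF r(2), of 3] n_real by simp
    have e: "1 \<le> real n * r ^ 3" using d n_real by linarith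
    have g: "\<kappa>\<^sup>2 * Q * 1 \<le> \<kappa>\<^sup>2 * Q * (real n * r ^ 3)" using e Q by (intro mult_left_mono) auto
    show ?thesis
      using r13 b d e g Q(1) deviation_const_nonneg sum_deviation_const_nonneg tau(1) alpha(1)
      by (intro add_mono mult_left_mono order_refl) (auto intro!: mult_nonneg_nonneg)
  qed
  also have "\<dots> = loops_const * (real n * r ^ 3)" by (simp add: loops_const_def algebra_simps)
  finally show ?thesis unfolding r(4) .
qed

definition "step_const = (2 * Q + 2 * sum_deviation_const) + loops_const + 2 * (1 + 1 / \<alpha>) * Q + 2 * (1 + 1 / \<alpha>) * sum_deviation_const + 2 * Q / \<alpha>\<^sup>2 + 1"

lemma expect_step_error:
  "expect T (\<lambda>Y. step_error c (1 / s) Y v w) B =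
     s * expect T (\<lambda>Y. (real (edges Y v w))\<^sup>2) B + (1 / s + real n / real m) * ((c v)\<^sup>2 + (c w)\<^sup>2)
     + (s + real n / real m) * (expect T (\<lambda>Y. (real (deg n Y v) - c v)\<^sup>2) B + expect T (\<lambda>Y. (real (deg n Y w) - c w)\<^sup>2) B)
     + ((c v) ^ 4 + (c w) ^ 4) / (real m)\<^sup>2 + s"
proof -
  have "step_error c (1 / s) Y v w = s * (real (edges Y v w))\<^sup>2 + (1 / s + real n / real m) * ((c v)\<^sup>2 + (c w)\<^sup>2)
     + (s + real n / real m) * ((real (deg n Y v) - c v)\<^sup>2 + (real (deg n Y w) - c w)\<^sup>2)
     + ((c v) ^ 4 + (c w) ^ 4) / (real m)\<^sup>2 + s" for Y
    by (simp add: step_error_def mult.commute)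
  then show ?thesis by (simp only: expect_add expect_cmult expect_const[OF B])
qed

text \<open>The right-hand side is \<open>n\<^sup>2 / s\<close>.\<close>

lemma average_step_error:
  assumes T: "T \<le> N" and ab: "(a, b) \<in> pairs k"
  shows "1 / real n ^ k * (\<Sum>\<phi>\<in>{1..k} \<rightarrow>\<^sub>E {1..n}. expect T (\<lambda>Y. step_error c (1 / s) Y (\<phi> a) (\<phi> b)) B) \<le> step_const * s ^ 7"
proof -
  let ?D = "\<lambda>v. expect T (\<lambda>Y. (real (deg n Y v) - c v)\<^sup>2) B"
  let ?E = "\<lambda>v w. expect T (\<lambda>Y. (real (edges Y v w))\<^sup>2) B"
  let ?f = "\<lambda>v w. expect T (\<lambda>Y. step_error c (1 / s) Y v w) B"
  define R where "R = real n / real m"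
  have sp: "0 < s" using s by simp
  have R: "0 \<le> R" "R \<le> 1 / \<alpha> / s"
  proof -
    have "s ^ 1 \<le> s ^ 4" using s by (intro power_increasing) auto
    then have "1 / (\<alpha> * s ^ 4) \<le> 1 / (\<alpha> * s)" using sp alpha by (intro divide_left_mono mult_left_mono) auto
    then show "R \<le> 1 / \<alpha> / s" using ratio(1) unfolding R_def s(2) by simp
  qed (simp add: R_def)
  have s2n: "(1 / s + R) \<le> (1 + 1 / \<alpha>) / s" using R by (simp add: add_divide_distrib)
  \<comment> \<open>Deliberately coarse: squared deviations average to order s^4, so a coefficient
    of order s^3 still stays within the target s^7.\<close>
  have sRn: "(s + R) \<le> (1 + 1 / \<alpha>) * s ^ 3"
  proof -
    have "R \<le> 1 / \<alpha> / s" by (rule R)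
    also have "\<dots> \<le> 1 / \<alpha> * s ^ 3"
    proof -
      have "1 / s \<le> 1" "1 \<le> s ^ 3" using s by auto
      then have "1 / s \<le> s ^ 3" by linarith
      from mult_left_mono[OF this, of "1 / \<alpha>"] alpha show ?thesis by simp
    qed
    moreover have "s \<le> s ^ 3" using power_increasing[of 1 3 s] s by simp
    ultimately show ?thesis by (simp add: distrib_right)
  qed
  define S2 where "S2 = (\<Sum>v\<in>{1..n}. (c v)\<^sup>2) / real n"
  define SD where "SD = (\<Sum>v\<in>{1..n}. ?D v) / real n"
  define S4 where "S4 = (\<Sum>v\<in>{1..n}. (c v) ^ 4) / real n"
  define SE where "SE = (if a = b then (\<Sum>v\<in>{1..n}. ?E v v) / real n else (\<Sum>v\<in>{1..n}. \<Sum>w\<in>{1..n}. ?E v w) / (real n)\<^sup>2)"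
  have "1 / real n ^ k * (\<Sum>\<phi>\<in>{1..k} \<rightarrow>\<^sub>E {1..n}. ?f (\<phi> a) (\<phi> b)) =
    (if a = b then (\<Sum>v\<in>{1..n}. ?f v v) / real n else (\<Sum>v\<in>{1..n}. \<Sum>w\<in>{1..n}. ?f v w) / (real n)\<^sup>2)"
    by (rule average_pair[OF n_pos ab])
  also have "\<dots> = s * SE + (1 / s + R) * (2 * S2) + (s + R) * (2 * SD) + 2 * S4 / (real m)\<^sup>2 + s"
  proof -
    have n0: "real n \<noteq> 0" using n_real by simp
    have diag: "(\<Sum>v\<in>{1..n}. ?f v v) / real n = s * ((\<Sum>v\<in>{1..n}. ?E v v) / real n) + (1 / s + R) * (2 * S2) + (s + R) * (2 * SD) + 2 * S4 / (real m)\<^sup>2 + s"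
    proof -
      have eq: "(\<Sum>v\<in>{1..n}. ?f v v) = s * (\<Sum>v\<in>{1..n}. ?E v v) + (1 / s + R) * (2 * (\<Sum>v\<in>{1..n}. (c v)\<^sup>2)) + (s + R) * (2 * (\<Sum>v\<in>{1..n}. ?D v))
        + 2 * (\<Sum>v\<in>{1..n}. (c v) ^ 4) / (real m)\<^sup>2 + real n * s"
        unfolding expect_step_error R_def[symmetric]
        by (simp add: sum.distrib flip: sum_distrib_left sum_divide_distrib)
      show ?thesis unfolding eq S2_def SD_def S4_def using n0 by (simp add: add_divide_distrib)
    qed
    have off: "(\<Sum>v\<in>{1..n}. \<Sum>w\<in>{1..n}. ?f v w) / (real n)\<^sup>2 = s * ((\<Sum>v\<in>{1..n}. \<Sum>w\<in>{1..n}. ?E v w) / (real n)\<^sup>2) + (1 / s + R) * (2 * S2) + (s + R) * (2 * SD) + 2 * S4 / (real m)\<^sup>2 + s"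
    proof -
      have sw: "(\<Sum>v\<in>{1..n}. \<Sum>w\<in>{1..n}. g v + g w) = 2 * real n * (\<Sum>v\<in>{1..n}. g v)" for g :: "nat \<Rightarrow> real"
        by (simp add: sum.distrib flip: sum_distrib_left)
      have gen: "(\<Sum>v\<in>{1..n}. \<Sum>w\<in>{1..n}. s * e v w + p * g v w + q * d v w + h v w / M + s) =
        s * (\<Sum>v\<in>{1..n}. \<Sum>w\<in>{1..n}. e v w) + p * (\<Sum>v\<in>{1..n}. \<Sum>w\<in>{1..n}. g v w) + q * (\<Sum>v\<in>{1..n}. \<Sum>w\<in>{1..n}. d v w)
        + (\<Sum>v\<in>{1..n}. \<Sum>w\<in>{1..n}. h v w) / M + (\<Sum>v\<in>{1..n}. \<Sum>w\<in>{1..n}. s)"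
        for e g d h :: "nat \<Rightarrow> nat \<Rightarrow> real" and p q M :: real
        by (simp only: sum.distrib sum_distrib_left sum_divide_distrib)
      have "(\<Sum>v\<in>{1..n}. \<Sum>w\<in>{1..n}. ?f v w) = s * (\<Sum>v\<in>{1..n}. \<Sum>w\<in>{1..n}. ?E v w)
        + (1 / s + R) * (\<Sum>v\<in>{1..n}. \<Sum>w\<in>{1..n}. (c v)\<^sup>2 + (c w)\<^sup>2)
        + (s + R) * (\<Sum>v\<in>{1..n}. \<Sum>w\<in>{1..n}. ?D v + ?D w)
        + (\<Sum>v\<in>{1..n}. \<Sum>w\<in>{1..n}. (c v) ^ 4 + (c w) ^ 4) / (real m)\<^sup>2 + (\<Sum>v\<in>{1..n}. \<Sum>w\<in>{1..n}. s)"
        unfolding expect_step_error R_def[symmetric] by (rule gen)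
      also have "\<dots> = s * (\<Sum>v\<in>{1..n}. \<Sum>w\<in>{1..n}. ?E v w)
        + (1 / s + R) * (2 * real n * (\<Sum>v\<in>{1..n}. (c v)\<^sup>2))
        + (s + R) * (2 * real n * (\<Sum>v\<in>{1..n}. ?D v))
        + (2 * real n * (\<Sum>v\<in>{1..n}. (c v) ^ 4)) / (real m)\<^sup>2 + (real n)\<^sup>2 * s"
        unfolding sw by (simp add: power2_eq_square)
      finally have eq: "(\<Sum>v\<in>{1..n}. \<Sum>w\<in>{1..n}. ?f v w) = s * (\<Sum>v\<in>{1..n}. \<Sum>w\<in>{1..n}. ?E v w)
        + (1 / s + R) * (2 * real n * (\<Sum>v\<in>{1..n}. (c v)\<^sup>2))
        + (s + R) * (2 * real n * (\<Sum>v\<in>{1..n}. ?D v))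
        + (2 * real n * (\<Sum>v\<in>{1..n}. (c v) ^ 4)) / (real m)\<^sup>2 + (real n)\<^sup>2 * s" .
      show ?thesis unfolding eq S2_def SD_def S4_def using n0 by (simp add: add_divide_distrib power2_eq_square)
    qed
    show ?thesis unfolding SE_def by (simp only: diag off split: if_split) simp
  qed
  also have "\<dots> \<le> s * ((2 * Q + 2 * sum_deviation_const + loops_const) * s ^ 6) + (1 + 1 / \<alpha>) / s * (2 * (Q * s ^ 8)) + (1 + 1 / \<alpha>) * s ^ 3 * (2 * (sum_deviation_const * s ^ 4)) + 2 * (Q / \<alpha>\<^sup>2) + s"
  proof -
    have n4: "real n = s ^ 4" by (rule s)
    have "SE \<le> (2 * Q + 2 * sum_deviation_const + loops_const) * s ^ 6"
    proof (cases "a = b")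
      case True
      then have "SE = (\<Sum>v\<in>{1..n}. ?E v v) / real n" by (simp add: SE_def)
      also have "\<dots> \<le> loops_const * (real n * s ^ 6) / real n"
        by (intro divide_right_mono sum_loops_sq_le T) simp
      also have "\<dots> = loops_const * s ^ 6" using n_real by simp
      also have "\<dots> \<le> (2 * Q + 2 * sum_deviation_const + loops_const) * s ^ 6" using Q sum_deviation_const_nonneg sp by (intro mult_right_mono) auto
      finally show ?thesis .
    next
      case False
      then have "SE = (\<Sum>v\<in>{1..n}. \<Sum>w\<in>{1..n}. ?E v w) / (real n)\<^sup>2" by (simp add: SE_def)
      also have "\<dots> \<le> (2 * Q + 2 * sum_deviation_const) * (real n)^3 / (real n)\<^sup>2"
        by (intro divide_right_mono sum_edges_sq_le T) simp
      also have "\<dots> = (2 * Q + 2 * sum_deviation_const) * s ^ 4" using n_real unfolding n4[symmetric] by (simp add: power2_eq_square power3_eq_cube)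
      also have "\<dots> \<le> (2 * Q + 2 * sum_deviation_const + loops_const) * s ^ 6"
        using Q sum_deviation_const_nonneg loops_const_nonneg s by (intro mult_mono power_increasing) auto
      finally show ?thesis .
    qed
    moreover have "S2 \<le> Q * s ^ 8"
    proof -
      have "S2 \<le> Q * (real n)^3 / real n" unfolding S2_def using Q n_real by (intro divide_right_mono) auto
      also have "\<dots> = Q * (real n)\<^sup>2" using n_real by (simp add: power2_eq_square power3_eq_cube)
      finally show ?thesis unfolding n4 by (simp add: power_mult[symmetric])
    qed
    moreover have "SD \<le> sum_deviation_const * s ^ 4"
    proof -
      have "SD \<le> sum_deviation_const * (real n)\<^sup>2 / real n" unfolding SD_def using sum_deviation_le[OF T] n_real by (intro divide_right_mono) auto
      then show ?thesis unfolding n4[symmetric] using n_real by (simp add: power2_eq_square)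
    qed
    moreover have "S4 / (real m)\<^sup>2 \<le> Q / \<alpha>\<^sup>2"
    proof -
      have "S4 \<le> Q * (real n)^5 / real n" unfolding S4_def using Q n_real by (intro divide_right_mono) auto
      also have "\<dots> = Q * (real n)^4" using n_real by (simp add: eval_nat_numeral)
      finally have "S4 / (real m)\<^sup>2 \<le> Q * (real n)^4 / (\<alpha> * (real n)\<^sup>2)\<^sup>2"
        using alpha n_real Q m_pos by (intro frac_le power_mono zero_less_power mult_pos_pos) auto
      also have "\<dots> = Q / \<alpha>\<^sup>2" using n_real alpha by (simp add: power_mult_distrib power_mult[symmetric])
      finally show ?thesis .
    qed
    moreover have "0 \<le> S2" "0 \<le> SD" "0 \<le> SE" "0 \<le> S4 / (real m)\<^sup>2" unfolding S2_def SD_def SE_def S4_def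
      by (auto intro!: divide_nonneg_nonneg sum_nonneg expect_nonneg[OF B])
    ultimately show ?thesis
      using s2n sRn sp R alpha unfolding times_divide_eq_right[of 2 S4, symmetric]
      by (intro add_mono mult_mono order_refl) auto
  qed
  also have "\<dots> = (2 * Q + 2 * sum_deviation_const + loops_const) * s ^ 7 + 2 * (1 + 1 / \<alpha>) * Q * s ^ 7 + 2 * (1 + 1 / \<alpha>) * sum_deviation_const * s ^ 7 + 2 * Q / \<alpha>\<^sup>2 * 1 + s"
    using sp by (simp add: eval_nat_numeral field_simps)
  also have "\<dots> \<le> (2 * Q + 2 * sum_deviation_const + loops_const) * s ^ 7 + 2 * (1 + 1 / \<alpha>) * Q * s ^ 7 + 2 * (1 + 1 / \<alpha>) * sum_deviation_const * s ^ 7 + 2 * Q / \<alpha>\<^sup>2 * s ^ 7 + s ^ 7"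
    using s Q power_increasing[of 1 7 s] by (intro add_mono mult_left_mono order_refl) auto
  also have "\<dots> = step_const * s ^ 7" by (simp add: step_const_def algebra_simps)
  finally show ?thesis .
qed

end


text \<open>A union bound over pairs of distinct labels, each of which collides with probability 1 /
  n. Only injective maps carry distinct label pairs to distinct vertex pairs.\<close>

lemma sum_noninjective_le:
  assumes n: "n \<ge> 1"
  shows "1 / real n ^ k * real (card {\<phi> \<in> {1..k} \<rightarrow>\<^sub>E {1..n}. \<not> inj_on \<phi> {1..k}}) \<le> real (card (pairs k)) / real n"
proof -
  let ?F = "{1..k} \<rightarrow>\<^sub>E {1..n}"
  have fin: "finite ?F" by (intro finite_PiE) auto
  have "real (card {\<phi> \<in> ?F. \<not> inj_on \<phi> {1..k}}) = (\<Sum>\<phi>\<in>?F. of_bool (\<not> inj_on \<phi> {1..k}))"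
    using fin by (simp add: of_bool_def sum.If_cases Int_def)
  also have "\<dots> \<le> (\<Sum>\<phi>\<in>?F. \<Sum>p\<in>{p \<in> pairs k. fst p \<noteq> snd p}. of_bool (\<phi> (fst p) = \<phi> (snd p)))"
  proof (intro sum_mono)
    fix \<phi> :: "nat \<Rightarrow> nat"
    show "of_bool (\<not> inj_on \<phi> {1..k}) \<le> (\<Sum>p\<in>{p \<in> pairs k. fst p \<noteq> snd p}. of_bool (\<phi> (fst p) = \<phi> (snd p)) :: real)"
    proof (cases "inj_on \<phi> {1..k}")
      case False
      then obtain a b where ab: "a \<in> {1..k}" "b \<in> {1..k}" "\<phi> a = \<phi> b" "a \<noteq> b"
        by (auto simp: inj_on_def)
      have "\<exists>p\<in>{p \<in> pairs k. fst p \<noteq> snd p}. \<phi> (fst p) = \<phi> (snd p)"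
      proof (cases "a \<le> b")
        case True
        then show ?thesis using ab by (intro bexI[of _ "(a, b)"]) (auto simp: pairs_def)
      next
        case False
        then show ?thesis using ab by (intro bexI[of _ "(b, a)"]) (auto simp: pairs_def)
      qed
      then obtain p where p: "p \<in> {p \<in> pairs k. fst p \<noteq> snd p}" "\<phi> (fst p) = \<phi> (snd p)" by blast
      have "(1 :: real) = of_bool (\<phi> (fst p) = \<phi> (snd p))" using p by simp
      also have "\<dots> \<le> (\<Sum>p\<in>{p \<in> pairs k. fst p \<noteq> snd p}. of_bool (\<phi> (fst p) = \<phi> (snd p)))"
        by (rule member_le_sum[OF p(1)]) auto
      finally show ?thesis using False by simp
    qed (auto intro!: sum_nonneg)
  qed
  finally have "1 / real n ^ k * real (card {\<phi> \<in> ?F. \<not> inj_on \<phi> {1..k}}) \<le>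
     1 / real n ^ k * (\<Sum>\<phi>\<in>?F. \<Sum>p\<in>{p \<in> pairs k. fst p \<noteq> snd p}. of_bool (\<phi> (fst p) = \<phi> (snd p)))"
    by (intro mult_left_mono) auto
  also have "\<dots> = (\<Sum>p\<in>{p \<in> pairs k. fst p \<noteq> snd p}. 1 / real n ^ k * (\<Sum>\<phi>\<in>?F. of_bool (\<phi> (fst p) = \<phi> (snd p))))"
    unfolding sum_distrib_left by (rule sum.swap)
  also have "\<dots> = (\<Sum>p\<in>{p \<in> pairs k. fst p \<noteq> snd p}. 1 / real n)"
  proof (intro sum.cong refl)
    fix p assume p: "p \<in> {p \<in> pairs k. fst p \<noteq> snd p}"
    have "(\<Sum>w\<in>{1..n}. of_bool (v = w) :: real) = 1" if "v \<in> {1..n}" for v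
      using that by (rule sum_of_bool_mult(3))
    then have one: "(\<Sum>v\<in>{1..n}. \<Sum>w\<in>{1..n}. of_bool (v = w) :: real) = real n" by simp
    have "1 / real n ^ k * (\<Sum>\<phi>\<in>?F. of_bool (\<phi> (fst p) = \<phi> (snd p))) = real n / (real n)\<^sup>2"
      using average_pair[OF n, of "fst p" "snd p" k "\<lambda>v w. of_bool (v = w)"] p unfolding one by auto
    then show "1 / real n ^ k * (\<Sum>\<phi>\<in>?F. of_bool (\<phi> (fst p) = \<phi> (snd p))) = 1 / real n"
      using n by (simp add: power2_eq_square)
  qed
  also have "\<dots> = real (card {p \<in> pairs k. fst p \<noteq> snd p}) / real n" by simp
  also have "\<dots> \<le> real (card (pairs k)) / real n"
    by (intro divide_right_mono) (auto intro!: card_mono)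
  finally show ?thesis .
qed

section \<open>The averaged comparison with independent queues\<close>

context scaled_reconnecting
begin

text \<open>The three summands are the constants of \<open>tracked_bound\<close>,
  \<open>arrival_bound\<close> and \<open>taylor_bound\<close>, with p the number of tracked
  pairs.\<close>

definition error_const :: "nat \<Rightarrow> real" where "error_const p = (real p * (2 + \<kappa>\<^sup>2) + (5 + 2 * \<kappa> + \<kappa>\<^sup>2) + (2 * real p + 1) * 2)"

definition average_const :: "nat \<Rightarrow> real" where "average_const p = \<tau> * error_const p * real p * step_const / \<alpha>"

lemma error_const_nonneg: "0 \<le> error_const p"
  unfolding error_const_def using kappa_pos by (intro add_nonneg_nonneg mult_nonneg_nonneg) auto

lemma step_const_nonneg: "0 \<le> step_const"
  unfolding step_const_def using loops_const_nonneg sum_deviation_const_nonneg Q alpha by (intro add_nonneg_nonneg mult_nonneg_nonneg divide_nonneg_nonneg) auto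

text \<open>m times the leading part of the arrival probability at the initial degrees. The case
  distinction is on vertices rather than labels, because it is the vertices that decide whether an
  edge is a loop.\<close>

definition rate :: "(nat \<Rightarrow> nat) \<Rightarrow> nat \<times> nat \<Rightarrow> real" where
  "rate \<phi> p = c (\<phi> (fst p)) * c (\<phi> (snd p)) / (2 * real m * (if \<phi> (fst p) = \<phi> (snd p) then 2 else 1))"

lemma rate_nonneg: "0 \<le> rate \<phi> p"
  by (simp add: rate_def)

lemma step_error_nonneg: "0 < \<eta> \<Longrightarrow> 0 \<le> step_error c \<eta> Y v w"
  unfolding step_error_def by (intro add_nonneg_nonneg mult_nonneg_nonneg divide_nonneg_nonneg) auto

text \<open>Injectivity of the label map together with the ordering inside \<open>pairs\<close>
  makes the tracked vertex sets distinct, which the comparison with queues requires.\<close>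

lemma expect_queues_le:
  assumes P: "P \<subseteq> pairs k" and \<phi>: "\<phi> \<in> {1..k} \<rightarrow>\<^sub>E {1..n}" "inj_on \<phi> {1..k}"
  defines "H \<equiv> \<lambda>Y p. edges Y (\<phi> (fst p)) (\<phi> (snd p))"
  shows "\<bar>expect N (\<lambda>Y. queues P K (rate \<phi>) 0 (H Y)) B - queues P K (rate \<phi>) (real N / real m) (H B)\<bar> \<le>
     (\<Sum>T<N. error_const (card P) / (real m)\<^sup>2 * (\<Sum>p\<in>P. expect T (\<lambda>Y. step_error c (1 / s) Y (\<phi> (fst p)) (\<phi> (snd p))) B))"
proof -
  have fin: "finite P" using finite_subset[OF P] by simp
  have P': "fst p \<in> {1..k}" "snd p \<in> {1..k}" "fst p \<le> snd p" if "p \<in> P" for p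
    using P that by (auto simp: pairs_def)
  have vertex: "\<phi> (fst p) \<in> {1..n}" "\<phi> (snd p) \<in> {1..n}" if "p \<in> P" for p
    using \<phi> P'[OF that] by blast+
  have inj: "inj_on (\<lambda>p. {\<phi> (fst p), \<phi> (snd p)}) P"
  proof (rule inj_onI)
    fix p q assume pq: "p \<in> P" "q \<in> P" "{\<phi> (fst p), \<phi> (snd p)} = {\<phi> (fst q), \<phi> (snd q)}"
    have "\<phi> ` {fst p, snd p} = \<phi> ` {fst q, snd q}" using pq(3) by simp
    then have "{fst p, snd p} = {fst q, snd q}"
      using inj_on_image_eq_iff[OF \<phi>(2), of "{fst p, snd p}" "{fst q, snd q}"] P'[OF pq(1)] P'[OF pq(2)] by blast
    then show "p = q" using P'(3)[OF pq(1)] P'(3)[OF pq(2)] by (cases p, cases q) (auto simp: doubleton_eq_iff)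
  qed
  have s': "0 < 1 / s" "1 / s \<le> 1" using s by auto
  have err: "\<bar>mean (\<lambda>Y. queues P K (rate \<phi>) t (H Y)) Y - queues P K (rate \<phi>) (t + 1 / real m) (H Y)\<bar>
      \<le> error_const (card P) / (real m)\<^sup>2 * (\<Sum>p\<in>P. step_error c (1 / s) Y (\<phi> (fst p)) (\<phi> (snd p)))"
    if t: "0 \<le> t" and Y: "Y \<in> adj_edges n m" for t Y
  proof -
    let ?F = "\<Sum>p\<in>P. step_error c (1 / s) Y (\<phi> (fst p)) (\<phi> (snd p))"
    let ?L = "\<Sum>p\<in>P. rate \<phi> p + real (H Y p)"
    have "\<bar>mean (\<lambda>Y. queues P K (rate \<phi>) t (H Y)) Y - queues P K (rate \<phi>) (t + 1 / real m) (H Y)\<bar>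
    \<le> 2 * (\<Sum>p\<in>P. real (H Y p) / real m * (\<Sum>q\<in>P. new_prob Y (\<phi> (fst q)) + new_prob Y (\<phi> (snd q))))
      + (\<Sum>p\<in>P. \<bar>arrival Y (\<phi> (fst p)) (\<phi> (snd p)) - rate \<phi> p / real m\<bar>)
      + (1 / real m)\<^sup>2 * (?L * (2 * ?L + 1))"
      unfolding H_def by (intro mean_queues[OF Y fin vertex inj _ t] rate_nonneg)
    also have "2 * (\<Sum>p\<in>P. real (H Y p) / real m * (\<Sum>q\<in>P. new_prob Y (\<phi> (fst q)) + new_prob Y (\<phi> (snd q))))
       \<le> real (card P) * (2 + \<kappa>\<^sup>2) / (real m)\<^sup>2 * ?F"
      unfolding H_def by (rule tracked_bound[OF s' fin])
    also have "(\<Sum>p\<in>P. \<bar>arrival Y (\<phi> (fst p)) (\<phi> (snd p)) - rate \<phi> p / real m\<bar>) \<le> (5 + 2 * \<kappa> + \<kappa>\<^sup>2) / (real m)\<^sup>2 * ?F"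
      unfolding sum_distrib_left rate_def by (intro sum_mono arrival_bound[OF s']) auto
    also have "(1 / real m)\<^sup>2 * (?L * (2 * ?L + 1)) \<le> (2 * real (card P) + 1) * 2 / (real m)\<^sup>2 * ?F"
      unfolding rate_def H_def by (rule taylor_bound[OF s' _ fin]) auto
    finally show ?thesis by (simp add: error_const_def add_divide_distrib distrib_right)
  qed
  have "\<bar>expect N (\<lambda>Y. queues P K (rate \<phi>) 0 (H Y)) B - queues P K (rate \<phi>) (real N / real m) (H B)\<bar> \<le>
     (\<Sum>T<N. expect T (\<lambda>Y. error_const (card P) / (real m)\<^sup>2 * (\<Sum>p\<in>P. step_error c (1 / s) Y (\<phi> (fst p)) (\<phi> (snd p)))) B)"
    unfolding H_def by (rule expect_queues[OF B fin vertex inj rate_nonneg err[unfolded H_def]])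
  then show ?thesis unfolding expect_cmult expect_sum[OF B] .
qed

text \<open>A step costs a constant times s^7 / m^2 on average, and there are at most \<tau> m
  steps; as m is at least \<alpha> s^8, the total is of order 1 / s. On the non-injective maps both
  quantities lie in [0, 1], which bounds the difference by 1.\<close>

lemma average_expect_queues:
  assumes P: "P \<subseteq> pairs k"
  shows "1 / real n ^ k * (\<Sum>\<phi>\<in>{1..k} \<rightarrow>\<^sub>E {1..n}.
      \<bar>expect N (\<lambda>Y. queues P K (rate \<phi>) 0 (\<lambda>p. edges Y (\<phi> (fst p)) (\<phi> (snd p)))) B -
        queues P K (rate \<phi>) (real N / real m) (\<lambda>p. edges B (\<phi> (fst p)) (\<phi> (snd p)))\<bar>)
    \<le> average_const (card P) / s + real (card (pairs k)) / real n"
proof -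
  let ?F = "{1..k} \<rightarrow>\<^sub>E {1..n}"
  let ?d = "\<lambda>\<phi>. \<bar>expect N (\<lambda>Y. queues P K (rate \<phi>) 0 (\<lambda>p. edges Y (\<phi> (fst p)) (\<phi> (snd p)))) B -
        queues P K (rate \<phi>) (real N / real m) (\<lambda>p. edges B (\<phi> (fst p)) (\<phi> (snd p)))\<bar>"
  let ?e = "\<lambda>\<phi> T p. expect T (\<lambda>Y. step_error c (1 / s) Y (\<phi> (fst p)) (\<phi> (snd p))) B"
  have finF: "finite ?F" by (intro finite_PiE) auto
  have sp: "0 < s" using s by simp
  have e_nonneg: "0 \<le> ?e \<phi> T p" for \<phi> T p
    using sp by (intro expect_nonneg[OF B] step_error_nonneg) auto
  have d1: "?d \<phi> \<le> 1" for \<phi>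
  proof -
    have q: "0 \<le> queues P K (rate \<phi>) t h" "queues P K (rate \<phi>) t h \<le> 1" if "0 \<le> t" for t h
      using queues_bounds[of t P "rate \<phi>" K h] that rate_nonneg by auto
    have "0 \<le> expect N (\<lambda>Y. queues P K (rate \<phi>) 0 (\<lambda>p. edges Y (\<phi> (fst p)) (\<phi> (snd p)))) B"
      using q by (intro expect_nonneg[OF B]) auto
    moreover have "expect N (\<lambda>Y. queues P K (rate \<phi>) 0 (\<lambda>p. edges Y (\<phi> (fst p)) (\<phi> (snd p)))) B \<le> expect N (\<lambda>_. 1) B"
      using q by (intro expect_mono[OF B]) auto
    ultimately show ?thesis
      using q[of "real N / real m" "\<lambda>p. edges B (\<phi> (fst p)) (\<phi> (snd p))"] by (simp add: expect_const[OF B])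
  qed
  have "(\<Sum>\<phi>\<in>?F. ?d \<phi>) \<le> (\<Sum>\<phi>\<in>?F. (\<Sum>T<N. error_const (card P) / (real m)\<^sup>2 * (\<Sum>p\<in>P. ?e \<phi> T p)) + of_bool (\<not> inj_on \<phi> {1..k}))"
  proof (intro sum_mono)
    fix \<phi> assume \<phi>: "\<phi> \<in> ?F"
    have nn: "0 \<le> (\<Sum>T<N. error_const (card P) / (real m)\<^sup>2 * (\<Sum>p\<in>P. ?e \<phi> T p))"
      using error_const_nonneg e_nonneg by (intro sum_nonneg mult_nonneg_nonneg) auto
    show "?d \<phi> \<le> (\<Sum>T<N. error_const (card P) / (real m)\<^sup>2 * (\<Sum>p\<in>P. ?e \<phi> T p)) + of_bool (\<not> inj_on \<phi> {1..k})"
    proof (cases "inj_on \<phi> {1..k}")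
      case True
      then show ?thesis using expect_queues_le[OF P \<phi> True, of K] by simp
    next
      case False
      then show ?thesis using nn d1[of \<phi>] by simp
    qed
  qed
  also have "\<dots> = (\<Sum>\<phi>\<in>?F. \<Sum>T<N. error_const (card P) / (real m)\<^sup>2 * (\<Sum>p\<in>P. ?e \<phi> T p)) + real (card {\<phi> \<in> ?F. \<not> inj_on \<phi> {1..k}})"
    using finF by (simp add: sum.distrib of_bool_def sum.If_cases Int_def)
  finally have "1 / real n ^ k * (\<Sum>\<phi>\<in>?F. ?d \<phi>) \<le>
     1 / real n ^ k * (\<Sum>\<phi>\<in>?F. \<Sum>T<N. error_const (card P) / (real m)\<^sup>2 * (\<Sum>p\<in>P. ?e \<phi> T p)) +
     1 / real n ^ k * real (card {\<phi> \<in> ?F. \<not> inj_on \<phi> {1..k}})"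
    unfolding distrib_left[symmetric] by (intro mult_left_mono) auto
  also have "1 / real n ^ k * (\<Sum>\<phi>\<in>?F. \<Sum>T<N. error_const (card P) / (real m)\<^sup>2 * (\<Sum>p\<in>P. ?e \<phi> T p)) =
     (\<Sum>T<N. \<Sum>p\<in>P. error_const (card P) / (real m)\<^sup>2 * (1 / real n ^ k * (\<Sum>\<phi>\<in>?F. ?e \<phi> T p)))"
    unfolding sum_distrib_left
    by (subst sum.swap, rule sum.cong[OF refl], subst sum.swap) (simp add: mult_ac)
  also have "\<dots> \<le> (\<Sum>T<N. \<Sum>p\<in>P. error_const (card P) / (real m)\<^sup>2 * (step_const * s ^ 7))"
  proof (intro sum_mono mult_left_mono)
    fix T p assume "T \<in> {..<N}" "p \<in> P"
    then show "1 / real n ^ k * (\<Sum>\<phi>\<in>?F. ?e \<phi> T p) \<le> step_const * s ^ 7"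
      using P by (intro average_step_error) auto
  qed (use error_const_nonneg in auto)
  also have "\<dots> = real N * (real (card P) * (error_const (card P) / (real m)\<^sup>2 * (step_const * s ^ 7)))" by simp
  also have "\<dots> \<le> (\<tau> * real m) * (real (card P) * (error_const (card P) / (real m)\<^sup>2 * (step_const * s ^ 7)))"
    using tau error_const_nonneg step_const_nonneg sp by (intro mult_right_mono mult_nonneg_nonneg divide_nonneg_nonneg) auto
  also have "\<dots> = \<tau> * error_const (card P) * real (card P) * step_const * s ^ 7 * (1 / real m)"
    using m_pos by (simp add: power2_eq_square)
  also have "\<dots> \<le> \<tau> * error_const (card P) * real (card P) * step_const * s ^ 7 * (1 / (\<alpha> * (real n)\<^sup>2))"
    using tau error_const_nonneg step_const_nonneg sp by (intro mult_left_mono ratio mult_nonneg_nonneg) auto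
  also have "\<dots> = average_const (card P) / s"
  proof -
    have "(real n)\<^sup>2 = s ^ 7 * s" unfolding s(2) by (simp add: power_mult[symmetric] flip: power_Suc2)
    then show ?thesis unfolding average_const_def using sp by simp
  qed
  finally show ?thesis using sum_noninjective_le[OF n_pos, of k] by linarith
qed

end

section \<open>Iterates of the operator as expectations of the chain\<close>

lemma finite_adj_edges: "finite (adj_edges n m)"
proof -
  let ?I = "{1..n} \<times> {1..n}"
  let ?ext = "\<lambda>g i j. if i \<in> {1..n} \<and> j \<in> {1..n} then g (i, j) else (0::nat)"
  have "adj_edges n m \<subseteq> ?ext ` (?I \<rightarrow>\<^sub>E {..2 * m})"
  proof
    fix X assume X: "X \<in> adj_edges n m"
    have le: "X i j \<le> 2 * m" if "i \<in> {1..n}" "j \<in> {1..n}" for i j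
    proof -
      have "real (X i j) \<le> (\<Sum>j\<in>{1..n}. real (X i j))" using that by (intro member_le_sum) auto
      also have "\<dots> \<le> (\<Sum>i\<in>{1..n}. \<Sum>j\<in>{1..n}. real (X i j))"
        by (rule member_le_sum[of i "{1..n}" "\<lambda>i. \<Sum>j\<in>{1..n}. real (X i j)"]) (use that in \<open>auto intro: sum_nonneg\<close>)
      finally show ?thesis using adj_edges_sum(2)[OF X] by linarith
    qed
    have "X = ?ext (restrict (\<lambda>(i, j). X i j) ?I)"
      using adj_range[OF adj_edges_adj[OF X]] by (intro ext) fastforce
    moreover have "restrict (\<lambda>(i, j). X i j) ?I \<in> ?I \<rightarrow>\<^sub>E {..2 * m}" using le by auto
    ultimately show "X \<in> ?ext ` (?I \<rightarrow>\<^sub>E {..2 * m})" by (rule image_eqI)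
  qed
  then show ?thesis by (rule finite_subset) (intro finite_imageI finite_PiE, auto)
qed

context reconnecting
begin

text \<open>Where X v w > 0 the degree of v is nonzero and cancels, and the new matrix lies in the
  state space; where X v w = 0 both sides vanish.\<close>

lemma sum_reconnect_prob:
  assumes X: "X \<in> adj_edges n m"
  shows "(\<Sum>Y\<in>adj_edges n m. reconnect_prob \<kappa> n m X Y * f Y) = mean f X"
proof -
  have "(\<Sum>Y\<in>adj_edges n m. reconnect_prob \<kappa> n m X Y * f Y) =
    (\<Sum>v\<in>{1..n}. \<Sum>w\<in>{1..n}. \<Sum>u\<in>{1..n}. \<Sum>Y\<in>adj_edges n m.
        real (deg n X v) / (2 * real m) * (real (X v w) / real (deg n X v)) *
        ((real (deg n X u) + \<kappa>) / (2 * real m + real n * \<kappa>)) *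
        of_bool (Y = reconnect v w u X) * f Y)"
    using m_pos unfolding reconnect_prob_def
    by (simp add: sum_distrib_right) (simp only: sum.swap[of _ "adj_edges n m"])
  also have "\<dots> = mean f X"
    unfolding mean_def choice_mean_def
  proof (intro sum.cong refl)
    fix v w u assume vwu: "v \<in> {1..n}" "w \<in> {1..n}" "u \<in> {1..n}"
    show "(\<Sum>Y\<in>adj_edges n m. real (deg n X v) / (2 * real m) * (real (X v w) / real (deg n X v)) *
        ((real (deg n X u) + \<kappa>) / (2 * real m + real n * \<kappa>)) * of_bool (Y = reconnect v w u X) * f Y) =
       real (X v w) / (2 * real m) * new_prob X u * f (reconnect v w u X)"
    proof (cases "X v w = 0")
      case False
      then have S: "reconnect v w u X \<in> adj_edges n m" using reconnect_in_adj_edges[OF X _ vwu(3)] by simp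
      have "X v w \<le> deg n X v" unfolding deg_def using vwu by (intro member_le_sum) auto
      then have d: "real (deg n X v) \<noteq> 0" using False by simp
      have "(\<Sum>Y\<in>adj_edges n m. real (deg n X v) / (2 * real m) * (real (X v w) / real (deg n X v)) *
        ((real (deg n X u) + \<kappa>) / (2 * real m + real n * \<kappa>)) * of_bool (Y = reconnect v w u X) * f Y) =
        (\<Sum>Y\<in>adj_edges n m. if Y = reconnect v w u X then real (X v w) / (2 * real m) * new_prob X u * f Y else 0)"
        using d by (intro sum.cong refl) (auto simp: new_prob_def)
      also have "\<dots> = real (X v w) / (2 * real m) * new_prob X u * f (reconnect v w u X)"
        using S finite_adj_edges by simp
      finally show ?thesis .
    qed simp
  qed
  finally show ?thesis .
qed

text \<open>The model prescribes probabilities of finite paths only, so expectations are expanded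
  over the finitely many paths up to time T. Summing out the last state of a path applies the
  operator once.\<close>

lemma expectation_edge_reconnecting_model:
  fixes M :: "'a measure"
  assumes model: "edge_reconnecting_model \<kappa> n m B M X" and B: "B \<in> adj_edges n m"
  shows "integrable M (\<lambda>\<omega>. f (X T \<omega>))" "(\<integral>\<omega>. f (X T \<omega>) \<partial>M) = expect T f B"
proof -
  let ?S = "adj_edges n m"
  interpret prob_space M using model by (simp add: edge_reconnecting_model_def)
  have X_meas[measurable]: "X T \<in> M \<rightarrow>\<^sub>M count_space ?S" for T
    using model by (simp add: edge_reconnecting_model_def)
  have X_in: "X T \<omega> \<in> ?S" if "\<omega> \<in> space M" for T \<omega>
    using measurable_space[OF X_meas that] by simp
  have path_sets: "{\<omega> \<in> space M. \<forall>s\<le>T. X s \<omega> = h s} \<in> sets M" for T h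
  proof -
    have "{\<omega> \<in> space M. \<forall>s\<le>T. X s \<omega> = h s} = space M \<inter> (\<Inter>s\<in>{..T}. X s -` ({h s} \<inter> ?S) \<inter> space M)"
      using X_in by auto
    also have "\<dots> \<in> sets M"
    proof -
      have "X s -` ({h s} \<inter> ?S) \<inter> space M \<in> sets M" for s
        by (rule measurable_sets[OF X_meas]) simp
      then show ?thesis by (intro sets.Int[OF sets.top] sets.finite_INT) auto
    qed
    finally show ?thesis .
  qed
  \<comment> \<open>Extensional paths, so that distinct paths give disjoint events and each sample
    point lies in exactly one of them.\<close>
  define paths where "paths T = {..T} \<rightarrow>\<^sub>E ?S" for T :: nat
  define path_prob where "path_prob T h = measure M {\<omega> \<in> space M. \<forall>s\<le>T. X s \<omega> = h s}" for T and h :: "nat \<Rightarrow> nmat"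
  have fin: "finite (paths T)" for T unfolding paths_def by (intro finite_PiE finite_adj_edges) auto
  have indicator: "g \<omega> = (\<Sum>h\<in>paths T. g \<omega> * indicator {\<omega> \<in> space M. \<forall>s\<le>T. X s \<omega> = h s} \<omega>)"
    if \<omega>: "\<omega> \<in> space M" for T \<omega> and g :: "'a \<Rightarrow> real"
  proof -
    let ?h = "restrict (\<lambda>s. X s \<omega>) {..T}"
    have h: "?h \<in> paths T" unfolding paths_def using X_in[OF \<omega>] by auto
    have "(\<Sum>h\<in>paths T. g \<omega> * indicator {\<omega> \<in> space M. \<forall>s\<le>T. X s \<omega> = h s} \<omega>) = (\<Sum>h\<in>paths T. if h = ?h then g \<omega> else 0)"
    proof (intro sum.cong refl)
      fix h assume "h \<in> paths T"
      then have "(\<forall>s\<le>T. X s \<omega> = h s) \<longleftrightarrow> h = ?h"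
        unfolding paths_def by (auto simp: PiE_iff extensional_def fun_eq_iff)
      then show "g \<omega> * indicator {\<omega> \<in> space M. \<forall>s\<le>T. X s \<omega> = h s} \<omega> = (if h = ?h then g \<omega> else 0)"
        using \<omega> by (simp add: indicator_def)
    qed
    then show ?thesis using h fin by simp
  qed
  have at_T: "integrable M (\<lambda>\<omega>. f (X T \<omega>)) \<and> (\<integral>\<omega>. f (X T \<omega>) \<partial>M) = (\<Sum>h\<in>paths T. f (h T) * path_prob T h)" for f :: "nmat \<Rightarrow> real" and T
  proof -
    have eq: "f (X T \<omega>) = (\<Sum>h\<in>paths T. f (h T) * indicator {\<omega> \<in> space M. \<forall>s\<le>T. X s \<omega> = h s} \<omega>)" if "\<omega> \<in> space M" for \<omega>
      by (subst indicator[OF that, of "\<lambda>\<omega>. f (X T \<omega>)" T]) (intro sum.cong refl, auto simp: indicator_def)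
    have "has_bochner_integral M (\<lambda>\<omega>. \<Sum>h\<in>paths T. f (h T) * indicator {\<omega> \<in> space M. \<forall>s\<le>T. X s \<omega> = h s} \<omega>)
       (\<Sum>h\<in>paths T. f (h T) * path_prob T h)"
      unfolding path_prob_def
      by (intro has_bochner_integral_sum has_bochner_integral_mult_right has_bochner_integral_real_indicator path_sets)
        (simp add: emeasure_eq_measure)
    then have "has_bochner_integral M (\<lambda>\<omega>. f (X T \<omega>)) (\<Sum>h\<in>paths T. f (h T) * path_prob T h)"
      using eq by (subst has_bochner_integral_cong) auto
    then show ?thesis by (auto simp: has_bochner_integral_iff)
  qed
  show "integrable M (\<lambda>\<omega>. f (X T \<omega>))" using at_T by blast
  have step: "(\<integral>\<omega>. f (X (Suc T) \<omega>) \<partial>M) = (\<integral>\<omega>. mean f (X T \<omega>) \<partial>M)" for f T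
  proof -
    have eq: "f (X (Suc T) \<omega>) = (\<Sum>h\<in>paths T. \<Sum>b\<in>?S. f b * indicator {\<omega> \<in> space M. \<forall>s\<le>Suc T. X s \<omega> = (h(Suc T := b)) s} \<omega>)"
      if \<omega>: "\<omega> \<in> space M" for \<omega>
    proof -
      have "(\<Sum>b\<in>?S. f b * indicator {\<omega> \<in> space M. \<forall>s\<le>Suc T. X s \<omega> = (h(Suc T := b)) s} \<omega>) =
        (\<Sum>b\<in>?S. if b = X (Suc T) \<omega> then f b * indicator {\<omega> \<in> space M. \<forall>s\<le>T. X s \<omega> = h s} \<omega> else 0)" for h
        using \<omega> by (intro sum.cong refl) (auto simp: indicator_def le_Suc_eq)
      also have "\<dots> h = f (X (Suc T) \<omega>) * indicator {\<omega> \<in> space M. \<forall>s\<le>T. X s \<omega> = h s} \<omega>" for h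
        using X_in[OF \<omega>, of "Suc T"] finite_adj_edges by simp
      finally show ?thesis using indicator[OF \<omega>, of "\<lambda>\<omega>. f (X (Suc T) \<omega>)" T] by simp
    qed
    have "has_bochner_integral M (\<lambda>\<omega>. \<Sum>h\<in>paths T. \<Sum>b\<in>?S. f b * indicator {\<omega> \<in> space M. \<forall>s\<le>Suc T. X s \<omega> = (h(Suc T := b)) s} \<omega>)
       (\<Sum>h\<in>paths T. \<Sum>b\<in>?S. f b * path_prob (Suc T) (h(Suc T := b)))"
      unfolding path_prob_def
      by (intro has_bochner_integral_sum has_bochner_integral_mult_right has_bochner_integral_real_indicator path_sets)
        (simp add: emeasure_eq_measure)
    then have "has_bochner_integral M (\<lambda>\<omega>. f (X (Suc T) \<omega>)) (\<Sum>h\<in>paths T. \<Sum>b\<in>?S. f b * path_prob (Suc T) (h(Suc T := b)))"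
      using eq by (subst has_bochner_integral_cong) auto
    then have "(\<integral>\<omega>. f (X (Suc T) \<omega>) \<partial>M) = (\<Sum>h\<in>paths T. \<Sum>b\<in>?S. f b * path_prob (Suc T) (h(Suc T := b)))"
      by (simp add: has_bochner_integral_iff)
    also have "\<dots> = (\<Sum>h\<in>paths T. mean f (h T) * path_prob T h)"
    proof (intro sum.cong refl)
      fix h assume h: "h \<in> paths T"
      then have hT: "h s \<in> ?S" if "s \<le> T" for s using that by (auto simp: paths_def PiE_iff)
      have "path_prob (Suc T) (h(Suc T := b)) = path_prob T h * reconnect_prob \<kappa> n m (h T) b" if b: "b \<in> ?S" for b
      proof -
        have "\<forall>s\<le>Suc T. (h(Suc T := b)) s \<in> ?S" using hT b by (auto simp: le_Suc_eq)
        with model have "path_prob (Suc T) (h(Suc T := b)) =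
          measure M {\<omega> \<in> space M. \<forall>s\<le>T. X s \<omega> = (h(Suc T := b)) s} * reconnect_prob \<kappa> n m ((h(Suc T := b)) T) ((h(Suc T := b)) (Suc T))"
          unfolding edge_reconnecting_model_def path_prob_def by blast
        also have "{\<omega> \<in> space M. \<forall>s\<le>T. X s \<omega> = (h(Suc T := b)) s} = {\<omega> \<in> space M. \<forall>s\<le>T. X s \<omega> = h s}"
          by auto
        finally show ?thesis by (simp add: path_prob_def)
      qed
      then have "(\<Sum>b\<in>?S. f b * path_prob (Suc T) (h(Suc T := b))) = (\<Sum>b\<in>?S. reconnect_prob \<kappa> n m (h T) b * f b) * path_prob T h"
        unfolding sum_distrib_right by (intro sum.cong refl) (simp add: mult_ac)
      then show "(\<Sum>b\<in>?S. f b * path_prob (Suc T) (h(Suc T := b))) = mean f (h T) * path_prob T h"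
        using sum_reconnect_prob[OF hT] by simp
    qed
    also have "\<dots> = (\<integral>\<omega>. mean f (X T \<omega>) \<partial>M)" using at_T[of "mean f" T] by simp
    finally show ?thesis .
  qed
  show "(\<integral>\<omega>. f (X T \<omega>) \<partial>M) = expect T f B"
  proof (induction T arbitrary: f)
    case 0
    have "(\<integral>\<omega>. f (X 0 \<omega>) \<partial>M) = (\<integral>\<omega>. f B \<partial>M)"
    proof (rule integral_cong_AE)
      show "(\<lambda>\<omega>. f (X 0 \<omega>)) \<in> borel_measurable M"
        using at_T[of f 0] by (auto dest: borel_measurable_integrable)
      show "AE \<omega> in M. f (X 0 \<omega>) = f B"
        using model unfolding edge_reconnecting_model_def by (auto elim!: eventually_mono)
    qed simp
    then show ?case by (simp add: expect_0 prob_space)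
  next
    case (Suc T)
    then show ?case using step[of f T] by (simp add: expect_Suc)
  qed
qed

end


section \<open>Random arrays sampled from kernels\<close>


text \<open>Covers both a multigraphon on [0, 1] and a matrix on uniformly chosen vertices, whose
  entry laws are point masses.\<close>

locale kernel = prob_space S for S :: "'s measure" +
  fixes V :: "'s \<Rightarrow> 's \<Rightarrow> nat \<Rightarrow> real"
  assumes V_measurable: "\<And>l. (\<lambda>(x, y). V x y l) \<in> borel_measurable (S \<Otimes>\<^sub>M S)"
    and V_nonneg: "\<And>x y l. x \<in> space S \<Longrightarrow> y \<in> space S \<Longrightarrow> 0 \<le> V x y l"
    and V_sums: "\<And>x y. x \<in> space S \<Longrightarrow> y \<in> space S \<Longrightarrow> (\<lambda>l. V x y l) sums 1"
begin

abbreviation points :: "nat \<Rightarrow> (nat \<Rightarrow> 's) measure" where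
  "points K \<equiv> Pi\<^sub>M {1..K} (\<lambda>_. S)"

abbreviation entries :: "nat \<Rightarrow> (nat \<times> nat \<Rightarrow> nat) measure" where
  "entries K \<equiv> Pi\<^sub>M (pairs K) (\<lambda>_. count_space UNIV)"

definition density_of :: "nat \<Rightarrow> (nat \<Rightarrow> 's) \<Rightarrow> (nat \<times> nat \<Rightarrow> nat) \<Rightarrow> ennreal" where
  "density_of K x a = (\<Prod>p\<in>pairs K. ennreal (V (x (fst p)) (x (snd p)) (a p)))"

text \<open>
  The law of \<open>K\<close> independent points together with a random array which, given the points, has
  independent entries, the entry at \<open>(a, b)\<close> having the law \<open>V (x a) (x b)\<close>.
\<close>

definition array :: "nat \<Rightarrow> ((nat \<Rightarrow> 's) \<times> (nat \<times> nat \<Rightarrow> nat)) measure" where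
  "array K = density (points K \<Otimes>\<^sub>M entries K) (\<lambda>(x, a). density_of K x a)"

sublocale points: product_prob_space "\<lambda>_ :: nat. S" "{1..K}" for K
  by standard

lemma prob_space_points: "prob_space (points K)"
  by (rule prob_space_PiM) (rule prob_space_axioms)

lemma pairs_le: "p \<in> pairs K \<Longrightarrow> fst p \<in> {1..K} \<and> snd p \<in> {1..K}"
  by (auto simp: pairs_def)

lemma V_measurable_pair:
  assumes "p \<in> pairs K"
  shows "(\<lambda>x. V (x (fst p)) (x (snd p)) l) \<in> borel_measurable (points K)"
proof -
  have "(\<lambda>x. (x (fst p), x (snd p))) \<in> points K \<rightarrow>\<^sub>M S \<Otimes>\<^sub>M S"
    using pairs_le[OF assms] by (intro measurable_Pair measurable_component_singleton) auto
  from measurable_compose[OF this V_measurable[of l]] show ?thesis by simp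
qed

lemma entry_measurable: "p \<in> pairs K \<Longrightarrow> (\<lambda>a. a p) \<in> entries K \<rightarrow>\<^sub>M count_space UNIV"
  by (rule measurable_component_singleton)

lemma entry_measurable': "p \<in> pairs K \<Longrightarrow> (\<lambda>z. snd z p) \<in> points K \<Otimes>\<^sub>M entries K \<rightarrow>\<^sub>M count_space UNIV"
  using measurable_compose[OF measurable_snd entry_measurable] by simp

lemma entry_function_measurable:
  assumes "p \<in> pairs K" "\<And>l. (\<lambda>x. h x l) \<in> borel_measurable (points K)"
  shows "(\<lambda>z. h (fst z) (snd z p)) \<in> borel_measurable (points K \<Otimes>\<^sub>M entries K)"
  by (rule measurable_compose_countable[OF _ entry_measurable'[OF assms(1)]])
    (rule measurable_compose[OF measurable_fst assms(2)])

lemma density_of_measurable: "(\<lambda>(x, a). density_of K x a) \<in> borel_measurable (points K \<Otimes>\<^sub>M entries K)"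
  unfolding density_of_def case_prod_beta
  by (intro borel_measurable_prod_ennreal entry_function_measurable measurable_compose[OF V_measurable_pair measurable_ennreal])

lemma sets_array [measurable_cong]: "sets (array K) = sets (points K \<Otimes>\<^sub>M entries K)"
  by (simp add: array_def)

lemma sigma_finite_entries: "sigma_finite_measure (entries K)"
proof -
  interpret c: sigma_finite_measure "count_space (UNIV :: nat set)"
    by (rule sigma_finite_measure_count_space)
  interpret product_sigma_finite "\<lambda>_ :: nat \<times> nat. count_space (UNIV :: nat set)"
    by standard
  show ?thesis by (rule sigma_finite) simp
qed

lemma nn_integral_array:
  assumes f: "f \<in> borel_measurable (points K \<Otimes>\<^sub>M entries K)"
  shows "(\<integral>\<^sup>+z. f z \<partial>array K) = (\<integral>\<^sup>+x. (\<integral>\<^sup>+a. density_of K x a * f (x, a) \<partial>entries K) \<partial>points K)"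
proof -
  interpret sigma_finite_measure "entries K" by (rule sigma_finite_entries)
  have "(\<integral>\<^sup>+z. f z \<partial>array K) = (\<integral>\<^sup>+z. (\<lambda>(x, a). density_of K x a) z * f z \<partial>(points K \<Otimes>\<^sub>M entries K))"
    unfolding array_def by (intro nn_integral_density density_of_measurable f)
  also have "\<dots> = (\<integral>\<^sup>+x. (\<integral>\<^sup>+a. (\<lambda>(x, a). density_of K x a) (x, a) * f (x, a) \<partial>entries K) \<partial>points K)"
    by (intro nn_integral_fst[symmetric] borel_measurable_times_ennreal density_of_measurable f)
  finally show ?thesis by simp
qed

text \<open>Tonelli's theorem: integrating the points out first exhibits the law of the entries
  alone as a density with respect to counting measure.\<close>

lemma nn_integral_array_entries:
  assumes f: "f \<in> borel_measurable (entries K)"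
  shows "(\<integral>\<^sup>+z. f (snd z) \<partial>array K) = (\<integral>\<^sup>+a. (\<integral>\<^sup>+x. density_of K x a \<partial>points K) * f a \<partial>entries K)"
proof -
  interpret e: sigma_finite_measure "entries K" by (rule sigma_finite_entries)
  interpret p: prob_space "points K" by (rule prob_space_points)
  interpret pair_sigma_finite "points K" "entries K" by standard
  have m: "(\<lambda>(x, a). density_of K x a * f a) \<in> borel_measurable (points K \<Otimes>\<^sub>M entries K)"
    using borel_measurable_times_ennreal[OF density_of_measurable measurable_compose[OF measurable_snd f]]
    by (simp add: case_prod_beta)
  have "(\<integral>\<^sup>+z. f (snd z) \<partial>array K) = (\<integral>\<^sup>+x. (\<integral>\<^sup>+a. density_of K x a * f a \<partial>entries K) \<partial>points K)"
    using nn_integral_array[OF measurable_compose[OF measurable_snd f]] by simp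
  also have "\<dots> = (\<integral>\<^sup>+a. (\<integral>\<^sup>+x. density_of K x a * f a \<partial>points K) \<partial>entries K)"
    using Fubini'[OF m] by simp
  also have "\<dots> = (\<integral>\<^sup>+a. (\<integral>\<^sup>+x. density_of K x a \<partial>points K) * f a \<partial>entries K)"
  proof (intro nn_integral_cong nn_integral_multc)
    fix a assume "a \<in> space (entries K)"
    then show "(\<lambda>x. density_of K x a) \<in> borel_measurable (points K)"
      using measurable_compose[OF measurable_Pair2' density_of_measurable] by fastforce
  qed
  finally show ?thesis .
qed

lemma V_suminf:
  assumes "x \<in> space S" "y \<in> space S"
  shows "(\<Sum>l. ennreal (V x y l)) = 1"
  using V_sums[OF assms] V_nonneg[OF assms] by (simp add: sums_unique[symmetric] suminf_ennreal_eq)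

text \<open>Given the points, the entries are independent, so the inner integral factorises over
  pairs. Pairs outside P contribute the total mass 1 of their law.\<close>

lemma nn_integral_array_product:
  assumes P: "P \<subseteq> pairs K" and f: "f \<in> borel_measurable (points K)"
    and h: "\<And>p l. p \<in> P \<Longrightarrow> (\<lambda>x. h p x l) \<in> borel_measurable (points K)"
  shows "(\<integral>\<^sup>+z. f (fst z) * (\<Prod>p\<in>P. h p (fst z) (snd z p)) \<partial>array K) =
    (\<integral>\<^sup>+x. f x * (\<Prod>p\<in>P. \<Sum>l. ennreal (V (x (fst p)) (x (snd p)) l) * h p x l) \<partial>points K)"
proof -
  interpret product_sigma_finite "\<lambda>_ :: nat \<times> nat. count_space (UNIV :: nat set)"
    by (intro product_sigma_finite.intro sigma_finite_measure_count_space)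
  define h' where "h' p x l = (if p \<in> P then h p x l else 1)" for p x l
  have P': "(\<Prod>p\<in>P. F p) = (\<Prod>p\<in>pairs K. if p \<in> P then F p else 1)" for F :: "nat \<times> nat \<Rightarrow> ennreal"
    using P by (simp add: prod.If_cases Int_absorb1)
  have meas: "(\<lambda>z. f (fst z) * (\<Prod>p\<in>P. h p (fst z) (snd z p))) \<in> borel_measurable (points K \<Otimes>\<^sub>M entries K)"
    by (intro borel_measurable_times_ennreal measurable_compose[OF measurable_fst f] borel_measurable_prod_ennreal
        entry_function_measurable h subsetD[OF P])
  have inner: "(\<integral>\<^sup>+a. density_of K x a * (f x * (\<Prod>p\<in>P. h p x (a p))) \<partial>entries K) =
     f x * (\<Prod>p\<in>P. \<Sum>l. ennreal (V (x (fst p)) (x (snd p)) l) * h p x l)" if x: "x \<in> space (points K)" for x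
  proof -
    have xs: "x (fst p) \<in> space S" "x (snd p) \<in> space S" if "p \<in> pairs K" for p
      using x pairs_le[OF that] by (auto simp: space_PiM PiE_iff)
    have "(\<integral>\<^sup>+a. density_of K x a * (f x * (\<Prod>p\<in>P. h p x (a p))) \<partial>entries K) =
      (\<integral>\<^sup>+a. f x * (\<Prod>p\<in>pairs K. ennreal (V (x (fst p)) (x (snd p)) (a p)) * h' p x (a p)) \<partial>entries K)"
      unfolding density_of_def P' h'_def prod.distrib by (intro nn_integral_cong) (simp add: mult_ac)
    also have "\<dots> = f x * (\<integral>\<^sup>+a. (\<Prod>p\<in>pairs K. ennreal (V (x (fst p)) (x (snd p)) (a p)) * h' p x (a p)) \<partial>entries K)"
      by (intro nn_integral_cmult borel_measurable_prod_ennreal measurable_compose[OF entry_measurable]) auto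
    also have "(\<integral>\<^sup>+a. (\<Prod>p\<in>pairs K. ennreal (V (x (fst p)) (x (snd p)) (a p)) * h' p x (a p)) \<partial>entries K) =
      (\<Prod>p\<in>pairs K. \<integral>\<^sup>+l. ennreal (V (x (fst p)) (x (snd p)) l) * h' p x l \<partial>count_space UNIV)"
      by (intro product_nn_integral_prod) auto
    also have "\<dots> = (\<Prod>p\<in>pairs K. if p \<in> P then \<Sum>l. ennreal (V (x (fst p)) (x (snd p)) l) * h p x l else 1)"
      using V_suminf xs by (intro prod.cong refl) (auto simp: nn_integral_count_space_nat h'_def)
    finally show ?thesis unfolding P' .
  qed
  show ?thesis
    unfolding nn_integral_array[OF meas] by (intro nn_integral_cong) (simp add: inner)
qed

lemma prob_space_array: "prob_space (array K)"
proof
  have "emeasure (array K) (space (array K)) = (\<integral>\<^sup>+z. 1 \<partial>array K)" by simp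
  also have "\<dots> = (\<integral>\<^sup>+x. 1 \<partial>points K)"
    using nn_integral_array_product[of "{}" K "\<lambda>_. 1"] by simp
  also have "\<dots> = 1"
    using prob_space.emeasure_space_1[OF prob_space_points[of K]] by simp
  finally show "emeasure (array K) (space (array K)) = 1" .
qed

text \<open>Integrates out the point with label s. That the first factor does not involve this point
  is encoded as invariance under updating x at s.\<close>

lemma nn_integral_points_extract:
  fixes f :: "(nat \<Rightarrow> 's) \<Rightarrow> ennreal"
  assumes s: "s \<in> {1..K}" "i \<in> {1..K}" "i \<noteq> s"
    and f: "f \<in> borel_measurable (points K)" "\<And>x y. f (x(s := y)) = f x"
    and g: "(\<lambda>(x, y). g x y) \<in> borel_measurable (S \<Otimes>\<^sub>M S)"
  shows "(\<integral>\<^sup>+x. f x * g (x i) (x s) \<partial>points K) = (\<integral>\<^sup>+x. f x * (\<integral>\<^sup>+y. g (x i) y \<partial>S) \<partial>points K)"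
proof -
  let ?J = "{1..K} - {s}"
  have I: "insert s ?J = {1..K}" using s by auto
  have gm: "(\<lambda>y. g x y) \<in> borel_measurable S" if "x \<in> space S" for x
    using measurable_compose[OF measurable_Pair1'[OF that] g] by simp
  have Gm: "(\<lambda>x. \<integral>\<^sup>+y. g x y \<partial>S) \<in> borel_measurable S"
    using borel_measurable_nn_integral_fst[OF g] by simp
  have comp: "(\<lambda>x. x j) \<in> points K \<rightarrow>\<^sub>M S" if "j \<in> {1..K}" for j
    using that by (rule measurable_component_singleton)
  have m1: "(\<lambda>x. f x * g (x i) (x s)) \<in> borel_measurable (Pi\<^sub>M (insert s ?J) (\<lambda>_. S))"
    unfolding I using measurable_compose[OF measurable_Pair[OF comp[OF s(2)] comp[OF s(1)]] g]
    by (intro borel_measurable_times_ennreal f(1)) (simp only: case_prod_conv)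
  have m2: "(\<lambda>x. f x * (\<integral>\<^sup>+y. g (x i) y \<partial>S)) \<in> borel_measurable (Pi\<^sub>M (insert s ?J) (\<lambda>_. S))"
    unfolding I by (intro borel_measurable_times_ennreal f(1) measurable_compose[OF comp[OF s(2)] Gm])
  have "(\<integral>\<^sup>+y. f (x(s := y)) * g ((x(s := y)) i) ((x(s := y)) s) \<partial>S) =
    (\<integral>\<^sup>+y. f (x(s := y)) * (\<integral>\<^sup>+z. g ((x(s := y)) i) z \<partial>S) \<partial>S)" if "x \<in> space (Pi\<^sub>M ?J (\<lambda>_. S))" for x
  proof -
    have xi: "x i \<in> space S" using that s by (auto simp: space_PiM PiE_iff)
    have "(\<integral>\<^sup>+y. f (x(s := y)) * g ((x(s := y)) i) ((x(s := y)) s) \<partial>S) = f x * (\<integral>\<^sup>+y. g (x i) y \<partial>S)"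
      using s gm[OF xi] by (simp add: f(2) nn_integral_cmult)
    also have "\<dots> = (\<integral>\<^sup>+y. f (x(s := y)) * (\<integral>\<^sup>+z. g ((x(s := y)) i) z \<partial>S) \<partial>S)"
      using s by (simp add: f(2) emeasure_space_1)
    finally show ?thesis .
  qed
  note inner = this
  have "(\<integral>\<^sup>+x. f x * g (x i) (x s) \<partial>points K) = (\<integral>\<^sup>+x. (\<integral>\<^sup>+y. f (x(s := y)) * g ((x(s := y)) i) ((x(s := y)) s) \<partial>S) \<partial>Pi\<^sub>M ?J (\<lambda>_. S))"
    by (rule points.product_nn_integral_insert[OF _ _ m1, unfolded I]) auto
  also have "\<dots> = (\<integral>\<^sup>+x. (\<integral>\<^sup>+y. f (x(s := y)) * (\<integral>\<^sup>+z. g ((x(s := y)) i) z \<partial>S) \<partial>S) \<partial>Pi\<^sub>M ?J (\<lambda>_. S))"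
    by (intro nn_integral_cong inner)
  also have "\<dots> = (\<integral>\<^sup>+x. f x * (\<integral>\<^sup>+y. g (x i) y \<partial>S) \<partial>points K)"
    by (rule points.product_nn_integral_insert[OF _ _ m2, unfolded I, symmetric]) auto
  finally show ?thesis .
qed

lemma nn_integral_points_component:
  assumes "i \<in> {1..K}" "g \<in> borel_measurable S"
  shows "(\<integral>\<^sup>+x. g (x i) \<partial>points K) = (\<integral>\<^sup>+x. g x \<partial>S)"
proof -
  have "(\<integral>\<^sup>+x. g x \<partial>S) = (\<integral>\<^sup>+x. g x \<partial>distr (points K) S (\<lambda>x. x i))"
    using distr_PiM_component[of "{1..K}" "\<lambda>_. S" i] assms prob_space_axioms by simp
  also have "\<dots> = (\<integral>\<^sup>+x. g (x i) \<partial>points K)"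
    using assms by (intro nn_integral_distr) auto
  finally show ?thesis ..
qed

section \<open>Degrees and second moments of a kernel\<close>

definition D :: "'s \<Rightarrow> ennreal" where
  "D x = (\<integral>\<^sup>+y. (\<Sum>l. of_nat l * ennreal (V x y l)) \<partial>S)"

definition moment2 :: ennreal where
  "moment2 = (\<integral>\<^sup>+x. (\<integral>\<^sup>+y. (\<Sum>l. of_nat l ^ 2 * ennreal (V x y l)) \<partial>S) \<partial>S)"

lemma series_measurable:
  "(\<lambda>(x, y). \<Sum>l. (c l :: ennreal) * ennreal (V x y l)) \<in> borel_measurable (S \<Otimes>\<^sub>M S)"
proof -
  have "(\<lambda>z. \<Sum>l. c l * ennreal (case z of (x, y) \<Rightarrow> V x y l)) \<in> borel_measurable (S \<Otimes>\<^sub>M S)"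
    by (intro borel_measurable_suminf_order borel_measurable_times_ennreal borel_measurable_const
        measurable_compose[OF V_measurable measurable_ennreal])
  then show ?thesis by (simp add: case_prod_beta)
qed

lemma D_measurable: "D \<in> borel_measurable S"
  unfolding D_def using borel_measurable_nn_integral_fst[OF series_measurable[of of_nat]] by simp

context
  fixes K i :: nat
  assumes i: "i \<in> {1..K}"
begin

lemma nn_integral_entry:
  assumes s: "s \<in> {1..K}" "i < s"
  shows "(\<integral>\<^sup>+z. of_nat (snd z (i, s)) \<partial>array K) = (\<integral>\<^sup>+x. D x \<partial>S)"
proof -
  have p: "(i, s) \<in> pairs K" using i s by (auto simp: pairs_def)
  have "(\<integral>\<^sup>+z. of_nat (snd z (i, s)) \<partial>array K) = (\<integral>\<^sup>+x. 1 * (\<Sum>l. of_nat l * ennreal (V (x i) (x s) l)) \<partial>points K)"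
    using nn_integral_array_product[of "{(i, s)}" K "\<lambda>_. 1" "\<lambda>p x l. of_nat l"] p by (simp add: mult.commute)
  also have "\<dots> = (\<integral>\<^sup>+x. 1 * D (x i) \<partial>points K)"
    unfolding D_def using s i by (intro nn_integral_points_extract series_measurable) auto
  finally show ?thesis using nn_integral_points_component[OF i D_measurable] by simp
qed

lemma nn_integral_entry_sq:
  assumes s: "s \<in> {1..K}" "i < s"
  shows "(\<integral>\<^sup>+z. of_nat (snd z (i, s)) ^ 2 \<partial>array K) = moment2"
proof -
  have p: "(i, s) \<in> pairs K" using i s by (auto simp: pairs_def)
  have "(\<integral>\<^sup>+z. of_nat (snd z (i, s)) ^ 2 \<partial>array K) = (\<integral>\<^sup>+x. 1 * (\<Sum>l. of_nat l ^ 2 * ennreal (V (x i) (x s) l)) \<partial>points K)"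
    using nn_integral_array_product[of "{(i, s)}" K "\<lambda>_. 1" "\<lambda>p x l. of_nat l ^ 2"] p by (simp add: mult.commute)
  also have "\<dots> = (\<integral>\<^sup>+x. 1 * (\<integral>\<^sup>+y. (\<Sum>l. of_nat l ^ 2 * ennreal (V (x i) y l)) \<partial>S) \<partial>points K)"
    using s i by (intro nn_integral_points_extract series_measurable) auto
  finally show ?thesis
    unfolding moment2_def
    using nn_integral_points_component[OF i borel_measurable_nn_integral_fst[OF series_measurable[of "\<lambda>l. of_nat l ^ 2"]]]
    by simp
qed

lemma nn_integral_deg_sq: "(\<integral>\<^sup>+z. D (fst z i) ^ 2 \<partial>array K) = (\<integral>\<^sup>+x. D x ^ 2 \<partial>S)"
proof -
  have m: "(\<lambda>x. D (x i) ^ 2) \<in> borel_measurable (points K)"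
    by (intro borel_measurable_power_ennreal measurable_compose[OF measurable_component_singleton[OF i] D_measurable])
  show ?thesis
    using nn_integral_array_product[of "{}" K "\<lambda>x. D (x i) ^ 2"] m
      nn_integral_points_component[OF i borel_measurable_power_ennreal[OF D_measurable]] by simp
qed

text \<open>Given point i, an entry of row i at a fresh label has mean D at that point.\<close>

lemma nn_integral_entry_deg:
  assumes s: "s \<in> {1..K}" "i < s"
  shows "(\<integral>\<^sup>+z. D (fst z i) * of_nat (snd z (i, s)) \<partial>array K) = (\<integral>\<^sup>+x. D x ^ 2 \<partial>S)"
proof -
  have p: "(i, s) \<in> pairs K" using i s by (auto simp: pairs_def)
  have m: "(\<lambda>x. D (x i)) \<in> borel_measurable (points K)"
    by (rule measurable_compose[OF measurable_component_singleton[OF i] D_measurable])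
  have "(\<integral>\<^sup>+z. D (fst z i) * of_nat (snd z (i, s)) \<partial>array K) = (\<integral>\<^sup>+x. D (x i) * (\<Sum>l. of_nat l * ennreal (V (x i) (x s) l)) \<partial>points K)"
    using nn_integral_array_product[of "{(i, s)}" K "\<lambda>x. D (x i)" "\<lambda>p x l. of_nat l"] p m by (simp add: mult.commute)
  also have "\<dots> = (\<integral>\<^sup>+x. D (x i) * D (x i) \<partial>points K)"
    unfolding D_def[of "x i" for x] using s i m[unfolded D_def] by (intro nn_integral_points_extract series_measurable) auto
  finally show ?thesis
    using nn_integral_points_component[OF i borel_measurable_power_ennreal[OF D_measurable, of 2]] by (simp add: power2_eq_square)
qed

text \<open>Given point i, the two entries are independent with common mean D; the two fresh points
  are integrated out one after the other.\<close>

lemma nn_integral_entry_entry: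
  assumes s: "s \<in> {1..K}" "i < s" "s' \<in> {1..K}" "i < s'" "s \<noteq> s'"
  shows "(\<integral>\<^sup>+z. of_nat (snd z (i, s)) * of_nat (snd z (i, s')) \<partial>array K) = (\<integral>\<^sup>+x. D x ^ 2 \<partial>S)"
proof -
  let ?w = "\<lambda>x y. \<Sum>l. of_nat l * ennreal (V x y l)"
  have p: "(i, s) \<in> pairs K" "(i, s') \<in> pairs K" using i s by (auto simp: pairs_def)
  have m: "(\<lambda>x. D (x i)) \<in> borel_measurable (points K)"
    by (rule measurable_compose[OF measurable_component_singleton[OF i] D_measurable])
  have m': "(\<lambda>x. ?w (x i) (x s')) \<in> borel_measurable (points K)"
    using measurable_compose[OF measurable_Pair[OF measurable_component_singleton[OF i] measurable_component_singleton[OF s(3)]] series_measurable[of of_nat]] by simp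
  have "(\<integral>\<^sup>+z. of_nat (snd z (i, s)) * of_nat (snd z (i, s')) \<partial>array K) = (\<integral>\<^sup>+x. ?w (x i) (x s') * ?w (x i) (x s) \<partial>points K)"
    using nn_integral_array_product[of "{(i, s), (i, s')}" K "\<lambda>_. 1" "\<lambda>p x l. of_nat l"] p s by (simp add: mult.commute)
  also have "\<dots> = (\<integral>\<^sup>+x. ?w (x i) (x s') * D (x i) \<partial>points K)"
    unfolding D_def using s i m' by (intro nn_integral_points_extract series_measurable) auto
  also have "\<dots> = (\<integral>\<^sup>+x. D (x i) * ?w (x i) (x s') \<partial>points K)" by (simp add: mult.commute)
  also have "\<dots> = (\<integral>\<^sup>+x. D (x i) * D (x i) \<partial>points K)"
    unfolding D_def[of "x i" for x] using s i m[unfolded D_def] by (intro nn_integral_points_extract series_measurable) auto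
  finally show ?thesis
    using nn_integral_points_component[OF i borel_measurable_power_ennreal[OF D_measurable, of 2]] by (simp add: power2_eq_square)
qed

end

text \<open>Jensen's inequality. The squared degree is represented by a product of two entries of
  one row, to which the arithmetic-geometric inequality applies; this also covers infinite
  values.\<close>

lemma deg_sq_le_moment2: "(\<integral>\<^sup>+x. D x ^ 2 \<partial>S) \<le> moment2"
proof -
  have p: "(1, 2) \<in> pairs 3" "(1, 3) \<in> pairs 3" by (auto simp: pairs_def)
  have le: "of_nat a * of_nat b \<le> ennreal (1/2) * (of_nat a ^ 2 + of_nat b ^ 2)" for a b :: nat
  proof -
    have "real a * real b \<le> 1/2 * (real a ^ 2 + real b ^ 2)"
      using sum_squares_bound[of "real a" "real b"] by simp
    then have "ennreal (real a * real b) \<le> ennreal (1/2 * (real a ^ 2 + real b ^ 2))" by (rule ennreal_leI)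
    also have "\<dots> = ennreal (1/2) * (ennreal (real a ^ 2) + ennreal (real b ^ 2))"
      by (subst ennreal_mult) auto
    finally show ?thesis by (simp only: ennreal_mult ennreal_of_nat_eq_real_of_nat ennreal_power of_nat_0_le_iff)
  qed
  have m: "(\<lambda>z. of_nat (snd z p) ^ 2 :: ennreal) \<in> borel_measurable (array 3)" if "p \<in> pairs 3" for p
    unfolding measurable_cong_sets[OF sets_array refl]
    using that by (intro entry_function_measurable[where h = "\<lambda>_ l. of_nat l ^ 2"]) auto
  have "(\<integral>\<^sup>+x. D x ^ 2 \<partial>S) = (\<integral>\<^sup>+z. of_nat (snd z (1, 2)) * of_nat (snd z (1, 3)) \<partial>array 3)"
    by (rule nn_integral_entry_entry[symmetric]) auto
  also have "\<dots> \<le> (\<integral>\<^sup>+z. ennreal (1/2) * (of_nat (snd z (1, 2)) ^ 2 + of_nat (snd z (1, 3)) ^ 2) \<partial>array 3)"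
    by (intro nn_integral_mono le)
  also have "\<dots> = ennreal (1/2) * (moment2 + moment2)"
    using m p nn_integral_entry_sq[of 1 3 2] nn_integral_entry_sq[of 1 3 3]
    by (simp add: nn_integral_cmult nn_integral_add)
  also have "\<dots> = moment2"
  proof (cases moment2)
    case (real r)
    have "ennreal (1/2) * (ennreal r + ennreal r) = ennreal (1/2) * ennreal (r + r)"
      using real by (simp only: ennreal_plus)
    also have "\<dots> = ennreal (1/2 * (r + r))"
      using real by (intro ennreal_mult[symmetric]) auto
    finally show ?thesis using real by simp
  qed (simp add: ennreal_mult_top)
  finally show ?thesis .
qed

end


section \<open>Empirical degrees from additional vertices\<close>

context kernel
begin

lemma entries_count_space: "entries K = count_space (pairs K \<rightarrow>\<^sub>E UNIV)"
  by (rule count_space_PiM_finite) auto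

lemma entries_function_measurable: "f \<in> borel_measurable (entries K)"
  unfolding entries_count_space by simp

lemma array_measurableI: "f \<in> borel_measurable (points K \<Otimes>\<^sub>M entries K) \<Longrightarrow> f \<in> borel_measurable (array K)"
  unfolding measurable_cong_sets[OF sets_array refl] .

lemma snd_measurable: "(\<lambda>z. f (snd z)) \<in> borel_measurable (array K)"
  by (intro array_measurableI measurable_compose[OF measurable_snd entries_function_measurable])

text \<open>Infinite degrees become 0. Under a finite second moment they occur only on a null
  set.\<close>

definition deg :: "'s \<Rightarrow> real" where
  "deg x = enn2real (D x)"

lemma deg_nonneg: "0 \<le> deg x" by (simp add: deg_def)

lemma deg_measurable: "deg \<in> borel_measurable S"
  unfolding deg_def using D_measurable by measurable

lemma deg_measurable_points: "i \<in> {1..K} \<Longrightarrow> (\<lambda>x. deg (x i)) \<in> borel_measurable (points K)"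
  by (rule measurable_compose[OF measurable_component_singleton[of i "{1..K}" "\<lambda>_. S"] deg_measurable])

lemma deg_measurable_array: "i \<in> {1..K} \<Longrightarrow> (\<lambda>z. deg (fst z i)) \<in> borel_measurable (array K)"
  by (intro array_measurableI measurable_compose[OF measurable_fst deg_measurable_points])

definition m2 :: real where "m2 = enn2real moment2"
definition deg2 :: real where "deg2 = enn2real (\<integral>\<^sup>+x. D x ^ 2 \<partial>S)"

context
  fixes mb :: real
  assumes mb: "0 \<le> mb" "moment2 \<le> ennreal mb"
begin

lemma moment2_real: "moment2 = ennreal m2" "0 \<le> m2" "m2 \<le> mb"
proof -
  have "moment2 < top" using mb(2) by (auto simp: le_less_trans[OF _ ennreal_less_top])
  then show "moment2 = ennreal m2" by (simp add: m2_def)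
  with mb show "m2 \<le> mb" by simp
qed (simp add: m2_def)

lemma deg2_real: "(\<integral>\<^sup>+x. D x ^ 2 \<partial>S) = ennreal deg2" "0 \<le> deg2" "deg2 \<le> mb"
proof -
  have le: "(\<integral>\<^sup>+x. D x ^ 2 \<partial>S) \<le> ennreal mb" using deg_sq_le_moment2 mb(2) by (rule order_trans)
  then have "(\<integral>\<^sup>+x. D x ^ 2 \<partial>S) < top" by (auto simp: le_less_trans[OF _ ennreal_less_top])
  then show "(\<integral>\<^sup>+x. D x ^ 2 \<partial>S) = ennreal deg2" by (simp add: deg2_def)
  with le mb show "deg2 \<le> mb" by simp
qed (simp add: deg2_def)

lemma AE_D_finite:
  assumes i: "i \<in> {1..K}"
  shows "AE z in array K. D (fst z i) = ennreal (deg (fst z i))"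
proof -
  have m: "(\<lambda>z. D (fst z i) ^ 2) \<in> borel_measurable (array K)"
    by (intro array_measurableI borel_measurable_power_ennreal measurable_compose[OF measurable_fst]
        measurable_compose[OF measurable_component_singleton[OF i] D_measurable])
  have "AE z in array K. D (fst z i) ^ 2 \<noteq> \<infinity>"
    by (rule nn_integral_PInf_AE[OF m]) (simp add: nn_integral_deg_sq[OF i] deg2_real)
  then show ?thesis
    by (rule eventually_mono) (auto simp: deg_def power2_eq_square less_top[symmetric] ennreal_mult_eq_top_iff)
qed

lemma entry_sq_integral:
  assumes "i \<in> {1..K}" "s \<in> {1..K}" "i < s"
  shows "has_bochner_integral (array K) (\<lambda>z. real (snd z (i, s)) * real (snd z (i, s))) m2"
  using nn_integral_entry_sq[OF assms] moment2_real
  by (intro has_bochner_integral_nn_integral snd_measurable[of "\<lambda>a. real (a (i, s)) * real (a (i, s))"])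
    (auto simp: ennreal_mult power2_eq_square simp flip: ennreal_of_nat_eq_real_of_nat)

lemma entry_entry_integral:
  assumes "i \<in> {1..K}" "s \<in> {1..K}" "i < s" "s' \<in> {1..K}" "i < s'" "s \<noteq> s'"
  shows "has_bochner_integral (array K) (\<lambda>z. real (snd z (i, s)) * real (snd z (i, s'))) deg2"
  using nn_integral_entry_entry[OF assms] deg2_real
  by (intro has_bochner_integral_nn_integral snd_measurable[of "\<lambda>a. real (a (i, s)) * real (a (i, s'))"])
    (auto simp: ennreal_mult simp flip: ennreal_of_nat_eq_real_of_nat)

lemma deg_sq_integral:
  assumes i: "i \<in> {1..K}"
  shows "has_bochner_integral (array K) (\<lambda>z. deg (fst z i) * deg (fst z i)) deg2"
proof (intro has_bochner_integral_nn_integral borel_measurable_times deg_measurable_array[OF i])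
  have "(\<integral>\<^sup>+z. ennreal (deg (fst z i) * deg (fst z i)) \<partial>array K) = (\<integral>\<^sup>+z. D (fst z i) ^ 2 \<partial>array K)"
    using AE_D_finite[OF i]
    by (intro nn_integral_cong_AE) (auto simp: ennreal_mult deg_nonneg power2_eq_square)
  then show "(\<integral>\<^sup>+z. ennreal (deg (fst z i) * deg (fst z i)) \<partial>array K) = ennreal deg2"
    using nn_integral_deg_sq[OF i] deg2_real by simp
qed (use deg2_real deg_nonneg in auto)

lemma entry_deg_integral:
  assumes i: "i \<in> {1..K}" and s: "s \<in> {1..K}" "i < s"
  shows "has_bochner_integral (array K) (\<lambda>z. deg (fst z i) * real (snd z (i, s))) deg2"
proof (intro has_bochner_integral_nn_integral borel_measurable_times deg_measurable_array[OF i]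
    snd_measurable[of "\<lambda>a. real (a (i, s))"])
  have "(\<integral>\<^sup>+z. ennreal (deg (fst z i) * real (snd z (i, s))) \<partial>array K) = (\<integral>\<^sup>+z. D (fst z i) * of_nat (snd z (i, s)) \<partial>array K)"
    using AE_D_finite[OF i]
    by (intro nn_integral_cong_AE) (auto simp: ennreal_mult deg_nonneg ennreal_of_nat_eq_real_of_nat)
  then show "(\<integral>\<^sup>+z. ennreal (deg (fst z i) * real (snd z (i, s))) \<partial>array K) = ennreal deg2"
    using nn_integral_entry_deg[OF i s] deg2_real by simp
qed (use deg2_real deg_nonneg in auto)

definition sample_deg :: "nat \<Rightarrow> nat \<Rightarrow> (nat \<times> nat \<Rightarrow> nat) \<Rightarrow> nat \<Rightarrow> real" where
  "sample_deg k r a i = 1 / real r * (\<Sum>s\<in>{k+1..k+r}. real (a (i, s)))"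

text \<open>Given point i, the r entries are independent with mean \<open>deg\<close>. In the
  expanded square all mixed products have expectation \<open>deg2\<close> and only the r diagonal
  ones have \<open>m2\<close>, which leaves (m2 - deg2) / r.\<close>

lemma sample_deg_variance:
  assumes i: "i \<in> {1..k}" and r: "r \<ge> 1"
  shows "integrable (array (k + r)) (\<lambda>z. (sample_deg k r (snd z) i - deg (fst z i))\<^sup>2)"
    "(\<integral>z. (sample_deg k r (snd z) i - deg (fst z i))\<^sup>2 \<partial>array (k + r)) \<le> mb / real r"
proof -
  let ?J = "{k+1..k+r}" and ?K = "k + r"
  let ?A = "\<lambda>z s. real (snd z (i, s))"
  have iK: "i \<in> {1..?K}" using i by auto
  have J: "s \<in> {1..?K} \<and> i < s" if "s \<in> ?J" for s using that i by auto
  have rr: "real r > 0" using r by simp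
  have expand: "(sample_deg k r (snd z) i - deg (fst z i))\<^sup>2 =
    (1 / real r)\<^sup>2 * (\<Sum>s\<in>?J. \<Sum>s'\<in>?J. ?A z s * ?A z s') - 2 / real r * (\<Sum>s\<in>?J. deg (fst z i) * ?A z s) + deg (fst z i) * deg (fst z i)"
    for z :: "(nat \<Rightarrow> 's) \<times> (nat \<times> nat \<Rightarrow> nat)"
    unfolding sample_deg_def power2_diff power_mult_distrib
    by (simp add: power2_eq_square sum_product sum_distrib_left mult_ac)
  have "has_bochner_integral (array ?K) (\<lambda>z. (sample_deg k r (snd z) i - deg (fst z i))\<^sup>2)
    ((1 / real r)\<^sup>2 * (\<Sum>s\<in>?J. \<Sum>s'\<in>?J. if s = s' then m2 else deg2) - 2 / real r * (\<Sum>s\<in>?J. deg2) + deg2)"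
    unfolding expand
  proof (intro has_bochner_integral_add has_bochner_integral_diff has_bochner_integral_mult_right has_bochner_integral_sum)
    fix s s' assume s: "s \<in> ?J" "s' \<in> ?J"
    show "has_bochner_integral (array ?K) (\<lambda>z. ?A z s * ?A z s') (if s = s' then m2 else deg2)"
      using entry_entry_integral[OF iK, of s s'] entry_sq_integral[OF iK, of s] J[OF s(1)] J[OF s(2)] by auto
  next
    fix s assume "s \<in> ?J"
    then show "has_bochner_integral (array ?K) (\<lambda>z. deg (fst z i) * ?A z s) deg2"
      using entry_deg_integral[OF iK] J by blast
  qed (rule deg_sq_integral[OF iK])
  moreover have "(1 / real r)\<^sup>2 * (\<Sum>s\<in>?J. \<Sum>s'\<in>?J. if s = s' then m2 else deg2) - 2 / real r * (\<Sum>s\<in>?J. deg2) + deg2 = (m2 - deg2) / real r"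
  proof -
    have "(\<Sum>s'\<in>?J. if s = s' then m2 else deg2) = (m2 - deg2) + real r * deg2" if "s \<in> ?J" for s
    proof -
      have "(\<Sum>s'\<in>?J. if s = s' then m2 else deg2) = (\<Sum>s'\<in>?J. (if s = s' then m2 - deg2 else 0) + deg2)"
        by (intro sum.cong) auto
      then show ?thesis using that by (simp add: sum.distrib)
    qed
    then have dbl: "(\<Sum>s\<in>?J. \<Sum>s'\<in>?J. if s = s' then m2 else deg2) = real r * ((m2 - deg2) + real r * deg2)"
      by simp
    show ?thesis unfolding dbl using rr by (simp add: field_simps power2_eq_square)
  qed
  ultimately have h: "has_bochner_integral (array ?K) (\<lambda>z. (sample_deg k r (snd z) i - deg (fst z i))\<^sup>2) ((m2 - deg2) / real r)"
    by simp
  show "integrable (array (k + r)) (\<lambda>z. (sample_deg k r (snd z) i - deg (fst z i))\<^sup>2)"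
    using h by (simp add: has_bochner_integral_iff)
  have "(m2 - deg2) / real r \<le> mb / real r"
    using moment2_real deg2_real rr by (intro divide_right_mono) auto
  then show "(\<integral>z. (sample_deg k r (snd z) i - deg (fst z i))\<^sup>2 \<partial>array (k + r)) \<le> mb / real r"
    using h by (simp add: has_bochner_integral_iff)
qed

context
  fixes P :: "(nat \<times> nat) set" and k :: nat and g :: "nat \<times> nat \<Rightarrow> nat \<Rightarrow> real \<Rightarrow> real" and \<beta> :: real
  assumes P: "P \<subseteq> pairs k"
    and g01: "\<And>p h \<mu>. p \<in> P \<Longrightarrow> 0 \<le> \<mu> \<Longrightarrow> 0 \<le> g p h \<mu> \<and> g p h \<mu> \<le> 1"
    and g_lipschitz: "\<And>p h \<mu> \<nu>. p \<in> P \<Longrightarrow> 0 \<le> \<mu> \<Longrightarrow> 0 \<le> \<nu> \<Longrightarrow> \<bar>g p h \<mu> - g p h \<nu>\<bar> \<le> \<bar>\<mu> - \<nu>\<bar>"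
    and g_measurable: "\<And>p h. p \<in> P \<Longrightarrow> g p h \<in> borel_measurable borel"
    and \<beta>: "0 \<le> \<beta>"
begin

lemma P_le: "p \<in> P \<Longrightarrow> fst p \<in> {1..k} \<and> snd p \<in> {1..k} \<and> p \<in> pairs (k + r)"
  using P by (fastforce simp: pairs_def)

lemma prod_g01:
  assumes "\<And>p. p \<in> P \<Longrightarrow> 0 \<le> \<mu> p"
  shows "0 \<le> (\<Prod>p\<in>P. g p (a p) (\<mu> p))" "(\<Prod>p\<in>P. g p (a p) (\<mu> p)) \<le> 1"
  using g01 assms by (auto intro!: prod_nonneg prod_le_1)

lemma sample_deg_nonneg: "0 \<le> sample_deg k r a i"
  unfolding sample_deg_def by (intro mult_nonneg_nonneg sum_nonneg) auto

lemma prod_deg_measurable: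
  "(\<lambda>z. \<Prod>p\<in>P. g p (snd z p) (\<beta> * deg (fst z (fst p)) * deg (fst z (snd p)))) \<in> borel_measurable (array (k + r))"
proof (intro array_measurableI borel_measurable_prod)
  fix p assume p: "p \<in> P"
  have "fst p \<in> {1..k + r}" "snd p \<in> {1..k + r}" using P_le[OF p, of 0] by auto
  then have "(\<lambda>x. \<beta> * deg (x (fst p)) * deg (x (snd p))) \<in> borel_measurable (points (k + r))"
    by (intro borel_measurable_times borel_measurable_const deg_measurable_points)
  from entry_function_measurable[OF _ measurable_compose[OF this g_measurable[OF p]], of p] P_le[OF p]
  show "(\<lambda>z. g p (snd z p) (\<beta> * deg (fst z (fst p)) * deg (fst z (snd p)))) \<in> borel_measurable (points (k + r) \<Otimes>\<^sub>M entries (k + r))"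
    by simp
qed

text \<open>A difference of products of numbers in [-1, 1] is at most the sum of the differences of
  the factors. Each of these is controlled by the Lipschitz bound and the mean square error of the
  empirical degrees.\<close>

lemma sample_comparison:
  assumes r: "r \<ge> 1"
  shows "\<bar>(\<integral>z. (\<Prod>p\<in>P. g p (snd z p) (\<beta> * sample_deg k r (snd z) (fst p) * sample_deg k r (snd z) (snd p))) \<partial>array (k + r)) -
    (\<integral>z. (\<Prod>p\<in>P. g p (snd z p) (\<beta> * deg (fst z (fst p)) * deg (fst z (snd p)))) \<partial>array (k + r))\<bar>
    \<le> real (card P) * (4 * \<beta> * mb / sqrt (real r))"
proof -
  interpret A: prob_space "array (k + r)" by (rule prob_space_array)
  let ?M = "array (k + r)"
  \<comment> \<open>The Young weight sqrt r balances the error, of order 1 / r, against the squared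
    degrees, which are merely bounded in mean.\<close>
  define q where "q = sqrt (real r)"
  have q: "1 \<le> q" "0 < q" "real r = q * q" using r by (auto simp: q_def)
  define d where "d i z = sample_deg k r (snd z) i" for i and z :: "(nat \<Rightarrow> 's) \<times> (nat \<times> nat \<Rightarrow> nat)"
  define \<delta> where "\<delta> i z = deg (fst z i)" for i and z :: "(nat \<Rightarrow> 's) \<times> (nat \<times> nat \<Rightarrow> nat)"
  define e where "e i z = (d i z - \<delta> i z)\<^sup>2" for i z
  have nn: "0 \<le> d i z" "0 \<le> \<delta> i z" for i z by (simp_all add: d_def \<delta>_def sample_deg_nonneg deg_nonneg)
  let ?F = "\<lambda>z. \<Prod>p\<in>P. g p (snd z p) (\<beta> * d (fst p) z * d (snd p) z)"
  let ?G = "\<lambda>z. \<Prod>p\<in>P. g p (snd z p) (\<beta> * \<delta> (fst p) z * \<delta> (snd p) z)"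
  define bound where "bound p z = \<beta> / 2 * (q * (e (fst p) z + e (snd p) z) + ((2 * e (snd p) z + 2 * (\<delta> (snd p) z * \<delta> (snd p) z)) + \<delta> (fst p) z * \<delta> (fst p) z) / q)" for p z
  have pw: "\<bar>?F z - ?G z\<bar> \<le> (\<Sum>p\<in>P. bound p z)" for z
  proof -
    have "\<bar>?F z - ?G z\<bar> \<le> (\<Sum>p\<in>P. \<bar>g p (snd z p) (\<beta> * d (fst p) z * d (snd p) z) - g p (snd z p) (\<beta> * \<delta> (fst p) z * \<delta> (snd p) z)\<bar>)"
      using norm_prod_diff[of P "\<lambda>p. g p (snd z p) (\<beta> * d (fst p) z * d (snd p) z)" "\<lambda>p. g p (snd z p) (\<beta> * \<delta> (fst p) z * \<delta> (snd p) z)"]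
        g01 nn \<beta> by simp
    also have "\<dots> \<le> (\<Sum>p\<in>P. bound p z)"
    proof (intro sum_mono)
      fix p assume p: "p \<in> P"
      obtain a b where ab: "a = fst p" "b = snd p" by simp
      have "\<bar>g p (snd z p) (\<beta> * d a z * d b z) - g p (snd z p) (\<beta> * \<delta> a z * \<delta> b z)\<bar> \<le> \<bar>\<beta> * d a z * d b z - \<beta> * \<delta> a z * \<delta> b z\<bar>"
        using p nn \<beta> by (intro g_lipschitz) auto
      also have "\<dots> = \<beta> * \<bar>(d a z - \<delta> a z) * d b z + \<delta> a z * (d b z - \<delta> b z)\<bar>"
      proof -
        have eq: "\<beta> * d a z * d b z - \<beta> * \<delta> a z * \<delta> b z = \<beta> * ((d a z - \<delta> a z) * d b z + \<delta> a z * (d b z - \<delta> b z))"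
          by (simp add: algebra_simps)
        show ?thesis unfolding eq abs_mult[of \<beta>] using \<beta> by simp
      qed
      also have "\<dots> \<le> \<beta> * (1 / 2 * (q * (e a z + e b z) + ((2 * e b z + 2 * (\<delta> b z * \<delta> b z)) + \<delta> a z * \<delta> a z) / q))"
      proof (intro mult_left_mono \<beta>)
        have y: "2 * (\<bar>u\<bar> * v) \<le> q * u\<^sup>2 + v\<^sup>2 / q" for u v
          using young[of "1 / q" "\<bar>u\<bar>" v] q by (simp add: mult.commute)
        have "\<bar>(d a z - \<delta> a z) * d b z + \<delta> a z * (d b z - \<delta> b z)\<bar> \<le> \<bar>d a z - \<delta> a z\<bar> * d b z + \<bar>d b z - \<delta> b z\<bar> * \<delta> a z"
          using nn by (intro order_trans[OF abs_triangle_ineq]) (simp add: abs_mult mult.commute)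
        moreover have "2 * (\<bar>d a z - \<delta> a z\<bar> * d b z) \<le> q * e a z + (d b z)\<^sup>2 / q"
          "2 * (\<bar>d b z - \<delta> b z\<bar> * \<delta> a z) \<le> q * e b z + (\<delta> a z)\<^sup>2 / q"
          unfolding e_def by (rule y)+
        moreover have "(d b z)\<^sup>2 / q \<le> (2 * e b z + 2 * (\<delta> b z * \<delta> b z)) / q"
          using square_sum_le[of "d b z - \<delta> b z" "\<delta> b z"] q unfolding e_def
          by (intro divide_right_mono) (auto simp: power2_eq_square)
        moreover have "X \<le> Y + Z \<Longrightarrow> 2 * Y \<le> A1 + A2 \<Longrightarrow> 2 * Z \<le> B1 + B2 \<Longrightarrow> A2 \<le> A3 \<Longrightarrow> X \<le> 1 / 2 * ((A1 + B1) + (A3 + B2))"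
          for X Y Z A1 A2 A3 B1 B2 :: real
        proof -
          assume "X \<le> Y + Z" "2 * Y \<le> A1 + A2" "2 * Z \<le> B1 + B2" "A2 \<le> A3"
          then have "2 * X \<le> (A1 + B1) + (A3 + B2)" by linarith
          then show "X \<le> 1 / 2 * ((A1 + B1) + (A3 + B2))" by simp
        qed
        ultimately show "\<bar>(d a z - \<delta> a z) * d b z + \<delta> a z * (d b z - \<delta> b z)\<bar> \<le>
           1 / 2 * (q * (e a z + e b z) + ((2 * e b z + 2 * (\<delta> b z * \<delta> b z)) + \<delta> a z * \<delta> a z) / q)"
          unfolding distrib_left[of q] add_divide_distrib[of _ "\<delta> a z * \<delta> a z"] power2_eq_square[of "\<delta> a z"] by blast
      qed
      finally show "\<bar>g p (snd z p) (\<beta> * d (fst p) z * d (snd p) z) - g p (snd z p) (\<beta> * \<delta> (fst p) z * \<delta> (snd p) z)\<bar> \<le> bound p z"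
        unfolding bound_def ab by simp
    qed
    finally show ?thesis .
  qed
  have F: "integrable ?M ?F"
  proof (rule A.integrable_const_bound[of _ 1])
    show "AE z in ?M. norm (?F z) \<le> 1" using prod_g01 nn \<beta> by (auto intro!: AE_I2)
    show "?F \<in> borel_measurable ?M"
      using snd_measurable[of "\<lambda>a. \<Prod>p\<in>P. g p (a p) (\<beta> * sample_deg k r a (fst p) * sample_deg k r a (snd p))"]
      by (simp add: d_def)
  qed
  have G: "integrable ?M ?G"
  proof (rule A.integrable_const_bound[of _ 1])
    show "AE z in ?M. norm (?G z) \<le> 1" using prod_g01 nn \<beta> by (auto intro!: AE_I2)
    show "?G \<in> borel_measurable ?M" using prod_deg_measurable by (simp add: \<delta>_def)
  qed
  have e_int: "integrable ?M (e i)" "(\<integral>z. e i z \<partial>?M) \<le> mb / (q * q)" if "i \<in> {1..k}" for i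
    unfolding e_def d_def \<delta>_def q(3)[symmetric] using sample_deg_variance[OF that r] by auto
  have \<delta>_int: "integrable ?M (\<lambda>z. \<delta> i z * \<delta> i z)" "(\<integral>z. \<delta> i z * \<delta> i z \<partial>?M) \<le> mb" if "i \<in> {1..k}" for i
    unfolding \<delta>_def using deg_sq_integral[of i "k + r"] deg2_real that by (auto simp: has_bochner_integral_iff)
  have b_int: "integrable ?M (bound p)" "(\<integral>z. bound p z \<partial>?M) \<le> 4 * \<beta> * mb / q" if "p \<in> P" for p
  proof -
    have ab: "fst p \<in> {1..k}" "snd p \<in> {1..k}" using P_le[OF that] by auto
    show "integrable ?M (bound p)"
      unfolding bound_def
      by (intro integrable_mult_right Bochner_Integration.integrable_add integrable_divide e_int \<delta>_int ab)
    have "(\<integral>z. bound p z \<partial>?M) = \<beta> / 2 * (q * ((\<integral>z. e (fst p) z \<partial>?M) + (\<integral>z. e (snd p) z \<partial>?M)) +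
        ((2 * (\<integral>z. e (snd p) z \<partial>?M) + 2 * (\<integral>z. \<delta> (snd p) z * \<delta> (snd p) z \<partial>?M)) + (\<integral>z. \<delta> (fst p) z * \<delta> (fst p) z \<partial>?M)) / q)"
      unfolding bound_def using e_int(1)[OF ab(1)] e_int(1)[OF ab(2)] \<delta>_int(1)[OF ab(1)] \<delta>_int(1)[OF ab(2)]
      by simp
    also have "\<dots> \<le> \<beta> / 2 * (q * (mb / (q * q) + mb / (q * q)) + ((2 * (mb / (q * q)) + 2 * mb) + mb) / q)"
      using q \<beta> by (intro mult_left_mono add_mono divide_right_mono e_int \<delta>_int ab) auto
    also have "\<dots> \<le> \<beta> / 2 * (q * (mb / (q * q) + mb / (q * q)) + ((2 * mb + 2 * mb) + mb) / q)"
    proof -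
      have "mb / (q * q) \<le> mb / 1" using q mb mult_mono[of 1 q 1 q] by (intro divide_left_mono) auto
      then show ?thesis using q \<beta> by (intro mult_left_mono add_mono divide_right_mono order_refl) auto
    qed
    \<comment> \<open>The coefficient collects 2 from the squared errors and 5 from the squared
      degrees, times 1/2; it is then rounded up to 4.\<close>
    also have "\<dots> = 7 / 2 * (\<beta> * mb / q)" using q by (simp add: field_simps)
    also have "\<dots> \<le> 4 * (\<beta> * mb / q)" using \<beta> mb q by (intro mult_right_mono) auto
    finally show "(\<integral>z. bound p z \<partial>?M) \<le> 4 * \<beta> * mb / q" by simp
  qed
  have "\<bar>(\<integral>z. ?F z \<partial>?M) - (\<integral>z. ?G z \<partial>?M)\<bar> \<le> (\<integral>z. \<bar>?F z - ?G z\<bar> \<partial>?M)"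
  proof -
    have "(\<integral>z. ?F z \<partial>?M) - (\<integral>z. ?G z \<partial>?M) = (\<integral>z. ?F z - ?G z \<partial>?M)" using F G by simp
    then show ?thesis using integral_abs_bound[of ?M "\<lambda>z. ?F z - ?G z"] by (simp only:)
  qed
  also have "\<dots> \<le> (\<integral>z. (\<Sum>p\<in>P. bound p z) \<partial>?M)"
    using F G b_int(1) pw by (intro integral_mono integrable_abs Bochner_Integration.integrable_diff Bochner_Integration.integrable_sum) auto
  also have "\<dots> = (\<Sum>p\<in>P. \<integral>z. bound p z \<partial>?M)" using b_int(1) by (intro Bochner_Integration.integral_sum)
  also have "\<dots> \<le> (\<Sum>p\<in>P. 4 * \<beta> * mb / q)" using b_int(2) by (intro sum_mono)
  finally show ?thesis by (simp add: d_def \<delta>_def q_def)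
qed

text \<open>The integrand involves only labels up to k, so the additional points and entries
  integrate to 1 and the value does not depend on r.\<close>

lemma integral_prod_deg:
  "(\<integral>z. (\<Prod>p\<in>P. g p (snd z p) (\<beta> * deg (fst z (fst p)) * deg (fst z (snd p)))) \<partial>array (k + r)) =
   enn2real (\<integral>\<^sup>+x. (\<Prod>p\<in>P. \<Sum>l. ennreal (V (x (fst p)) (x (snd p)) l) * ennreal (g p l (\<beta> * deg (x (fst p)) * deg (x (snd p))))) \<partial>points k)"
proof -
  let ?h = "\<lambda>p x l. ennreal (g p l (\<beta> * deg (x (fst p)) * deg (x (snd p))))"
  let ?G = "\<lambda>z. \<Prod>p\<in>P. g p (snd z p) (\<beta> * deg (fst z (fst p)) * deg (fst z (snd p)))"
  let ?v = "\<lambda>x. \<Prod>p\<in>P. \<Sum>l. ennreal (V (x (fst p)) (x (snd p)) l) * ?h p x l"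
  have nn: "0 \<le> \<beta> * deg x * deg y" for x y using \<beta> deg_nonneg by simp
  have h_meas: "(\<lambda>x. ?h p x l) \<in> borel_measurable (points K)" if "p \<in> P" "k \<le> K" for p l K
  proof -
    have "fst p \<in> {1..K}" "snd p \<in> {1..K}" using P_le[OF that(1), of 0] that(2) by auto
    then have "(\<lambda>x. \<beta> * deg (x (fst p)) * deg (x (snd p))) \<in> borel_measurable (points K)"
      by (intro borel_measurable_times borel_measurable_const deg_measurable_points)
    from measurable_compose[OF measurable_compose[OF this g_measurable[OF that(1)]] measurable_ennreal] show ?thesis .
  qed
  have PK: "P \<subseteq> pairs (k + r)" using P_le by blast
  have "(\<integral>z. ?G z \<partial>array (k + r)) = enn2real (\<integral>\<^sup>+z. ennreal (?G z) \<partial>array (k + r))"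
    by (intro integral_eq_nn_integral prod_deg_measurable AE_I2 prod_g01 nn)
  also have "(\<integral>\<^sup>+z. ennreal (?G z) \<partial>array (k + r)) = (\<integral>\<^sup>+z. 1 * (\<Prod>p\<in>P. ?h p (fst z) (snd z p)) \<partial>array (k + r))"
    using g01 nn by (intro nn_integral_cong) (simp add: prod_ennreal)
  also have "\<dots> = (\<integral>\<^sup>+x. 1 * ?v x \<partial>points (k + r))"
    using h_meas by (intro nn_integral_array_product PK) auto
  also have "\<dots> = (\<integral>\<^sup>+x. ?v (restrict x {1..k}) \<partial>points (k + r))"
  proof (intro nn_integral_cong)
    fix x :: "nat \<Rightarrow> 's"
    have "restrict x {1..k} (fst p) = x (fst p)" "restrict x {1..k} (snd p) = x (snd p)" if "p \<in> P" for p
      using P_le[OF that] by auto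
    then show "1 * ?v x = ?v (restrict x {1..k})" by (simp cong: prod.cong)
  qed
  also have "\<dots> = (\<integral>\<^sup>+x. ?v x \<partial>distr (points (k + r)) (points k) (\<lambda>x. restrict x {1..k}))"
  proof -
    have R: "(\<lambda>x. restrict x {1..k}) \<in> points (k + r) \<rightarrow>\<^sub>M points k"
      by (rule measurable_restrict_subset) auto
    have v: "?v \<in> borel_measurable (points k)"
      by (intro borel_measurable_prod_ennreal borel_measurable_suminf_order borel_measurable_times_ennreal h_meas order_refl
          measurable_compose[OF V_measurable_pair measurable_ennreal] subsetD[OF P])
    from nn_integral_distr[OF R, of ?v] v show ?thesis by (simp only: measurable_distr_eq1)
  qed
  also have "distr (points (k + r)) (points k) (\<lambda>x. restrict x {1..k}) = points k"
    by (rule points.distr_PiM_restrict_finite) auto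
  finally show ?thesis .
qed

end

end

text \<open>The probability of the entry pattern a. For a matrix it is the frequency of the pattern
  under random label maps, for a multigraphon it is \<open>t_eqW\<close>.\<close>

definition marginal :: "nat \<Rightarrow> (nat \<times> nat \<Rightarrow> nat) \<Rightarrow> real" where
  "marginal K a = enn2real (\<integral>\<^sup>+x. density_of K x a \<partial>points K)"

lemma V_le_1:
  assumes "x \<in> space S" "y \<in> space S"
  shows "V x y l \<le> 1"
proof -
  have "(\<Sum>i<Suc l. V x y i) \<le> 1"
    using V_sums[OF assms] V_nonneg[OF assms] sum_le_suminf[of "V x y" "{..<Suc l}"] by (simp add: sums_iff)
  moreover have "0 \<le> (\<Sum>i<l. V x y i)" using V_nonneg[OF assms] by (intro sum_nonneg)
  ultimately show ?thesis by simp
qed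

lemma marginal_ennreal: "(\<integral>\<^sup>+x. density_of K x a \<partial>points K) = ennreal (marginal K a)"
proof -
  have "(\<integral>\<^sup>+x. density_of K x a \<partial>points K) \<le> (\<integral>\<^sup>+x. 1 \<partial>points K)"
  proof (intro nn_integral_mono)
    fix x assume "x \<in> space (points K)"
    then have "x (fst p) \<in> space S" "x (snd p) \<in> space S" if "p \<in> pairs K" for p
      using pairs_le[OF that] by (auto simp: space_PiM PiE_iff)
    then show "density_of K x a \<le> 1"
      unfolding density_of_def using V_le_1 by (intro prod_le_1) auto
  qed
  also have "\<dots> < top" using prob_space.emeasure_space_1[OF prob_space_points[of K]] by simp
  finally show ?thesis by (simp add: marginal_def)
qed

lemma integral_array_marginal:
  assumes f: "\<And>a. 0 \<le> f a" "\<And>a. f a \<le> 1"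
  shows "has_bochner_integral (entries K) (\<lambda>a. f a * marginal K a) (\<integral>z. f (snd z) \<partial>array K)"
proof -
  interpret A: prob_space "array K" by (rule prob_space_array)
  have "integrable (array K) (\<lambda>z. f (snd z))"
    using f by (intro A.integrable_const_bound[of _ 1] snd_measurable AE_I2) auto
  then have "ennreal (\<integral>z. f (snd z) \<partial>array K) = (\<integral>\<^sup>+z. ennreal (f (snd z)) \<partial>array K)"
    using f by (intro nn_integral_eq_integral[symmetric] AE_I2)
  also have "\<dots> = (\<integral>\<^sup>+a. ennreal (marginal K a) * ennreal (f a) \<partial>entries K)"
    unfolding marginal_ennreal[symmetric] by (rule nn_integral_array_entries[OF entries_function_measurable])
  finally have "(\<integral>\<^sup>+a. ennreal (f a * marginal K a) \<partial>entries K) = ennreal (\<integral>z. f (snd z) \<partial>array K)"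
    using f by (simp add: ennreal_mult'' mult.commute marginal_def)
  then show ?thesis
    using f by (intro has_bochner_integral_nn_integral entries_function_measurable AE_I2) (auto simp: marginal_def)
qed

end

text \<open>Patterns form a discrete space, so pointwise convergence of marginals is convergence of
  densities; total variation convergence then allows any f with values in [0, 1], however many
  entries it involves.\<close>

lemma array_expectation_tendsto:
  fixes Sn :: "nat \<Rightarrow> 't measure" and S :: "'s measure" and f :: "(nat \<times> nat \<Rightarrow> nat) \<Rightarrow> real"
  assumes kn: "\<And>n. kernel (Sn n) (Vn n)" and k: "kernel S V"
    and conv: "\<And>a. a \<in> pairs K \<rightarrow>\<^sub>E UNIV \<Longrightarrow> (\<lambda>n. kernel.marginal (Sn n) (Vn n) K a) \<longlonglongrightarrow> kernel.marginal S V K a"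
    and f: "\<And>a. 0 \<le> f a" "\<And>a. f a \<le> 1"
  shows "(\<lambda>n. \<integral>z. f (snd z) \<partial>kernel.array (Sn n) (Vn n) K) \<longlonglongrightarrow> (\<integral>z. f (snd z) \<partial>kernel.array S V K)"
proof -
  let ?C = "Pi\<^sub>M (pairs K) (\<lambda>_. count_space UNIV) :: (nat \<times> nat \<Rightarrow> nat) measure"
  let ?F = "\<lambda>n. kernel.marginal (Sn n) (Vn n) K" and ?G = "kernel.marginal S V K"
  have one: "has_bochner_integral ?C (?F n) 1" for n
    using kernel.integral_array_marginal[OF kn, of "\<lambda>_. 1" K n] prob_space.prob_space[OF kernel.prob_space_array[OF kn]] by simp
  have one': "has_bochner_integral ?C ?G 1"
    using kernel.integral_array_marginal[OF k, of "\<lambda>_. 1" K] prob_space.prob_space[OF kernel.prob_space_array[OF k]] by simp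
  have nn: "0 \<le> ?F n a" "0 \<le> ?G a" for n a
    using kernel.marginal_def[OF kn] kernel.marginal_def[OF k] by simp_all
  have int1: "(\<integral>\<^sup>+a. ennreal (norm (?F n a)) \<partial>?C) = 1" for n
    using one[of n] nn by (simp add: has_bochner_integral_iff nn_integral_eq_integral)
  have int1': "(\<integral>\<^sup>+a. ennreal (norm (?G a)) \<partial>?C) = 1"
    using one' nn by (simp add: has_bochner_integral_iff nn_integral_eq_integral)
  have scheffe: "(\<lambda>n. \<integral>\<^sup>+a. norm (?F n a - ?G a) \<partial>?C) \<longlonglongrightarrow> 0"
  proof (rule Scheffe_lemma1)
    show "AE a in ?C. (\<lambda>n. ?F n a) \<longlonglongrightarrow> ?G a"
      using conv by (intro AE_I2) (auto simp: space_PiM)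
    \<comment> \<open>All marginals, including the limit, have total mass 1, so no mass escapes to
      infinity.\<close>
    show "limsup (\<lambda>n. \<integral>\<^sup>+a. norm (?F n a) \<partial>?C) \<le> (\<integral>\<^sup>+a. norm (?G a) \<partial>?C)"
      unfolding int1 int1' by (simp add: Limsup_const)
  qed (use one one' in \<open>auto simp: has_bochner_integral_iff\<close>)
  have le: "norm ((\<integral>z. f (snd z) \<partial>kernel.array (Sn n) (Vn n) K) - (\<integral>z. f (snd z) \<partial>kernel.array S V K)) \<le>
      enn2real (\<integral>\<^sup>+a. norm (?F n a - ?G a) \<partial>?C)" for n
  proof -
    note i1 = kernel.integral_array_marginal[OF kn, of f K n, OF f]
    note i2 = kernel.integral_array_marginal[OF k, of f K, OF f]
    have eq: "(\<integral>z. f (snd z) \<partial>kernel.array (Sn n) (Vn n) K) - (\<integral>z. f (snd z) \<partial>kernel.array S V K) =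
      (\<integral>a. f a * ?F n a - f a * ?G a \<partial>?C)"
      using i1 i2 by (simp add: has_bochner_integral_iff)
    have "norm ((\<integral>z. f (snd z) \<partial>kernel.array (Sn n) (Vn n) K) - (\<integral>z. f (snd z) \<partial>kernel.array S V K)) \<le>
      (\<integral>a. norm (f a * ?F n a - f a * ?G a) \<partial>?C)"
      unfolding eq by (rule integral_norm_bound)
    also have "\<dots> \<le> (\<integral>a. norm (?F n a - ?G a) \<partial>?C)"
    proof (rule integral_mono)
      fix a
      have "norm (f a * ?F n a - f a * ?G a) = f a * norm (?F n a - ?G a)"
        using f by (simp add: abs_mult flip: right_diff_distrib)
      also have "\<dots> \<le> norm (?F n a - ?G a)" using f by (intro mult_left_le_one_le) auto
      finally show "norm (f a * ?F n a - f a * ?G a) \<le> norm (?F n a - ?G a)" .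
    qed (use i1 i2 one[of n] one' in \<open>auto simp: has_bochner_integral_iff intro!: integrable_norm Bochner_Integration.integrable_diff\<close>)
    also have "\<dots> = enn2real (\<integral>\<^sup>+a. norm (?F n a - ?G a) \<partial>?C)"
      using one[of n] one' by (intro integral_eq_nn_integral) (auto simp: has_bochner_integral_iff)
    finally show ?thesis .
  qed
  have "(\<lambda>n. enn2real (\<integral>\<^sup>+a. norm (?F n a - ?G a) \<partial>?C)) \<longlonglongrightarrow> 0"
    by (rule tendsto_enn2real) (use scheffe in simp_all)
  then have "(\<lambda>n. (\<integral>z. f (snd z) \<partial>kernel.array (Sn n) (Vn n) K) - (\<integral>z. f (snd z) \<partial>kernel.array S V K)) \<longlonglongrightarrow> 0"
    by (rule Lim_null_comparison[OF always_eventually[OF allI[OF le]]])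
  then show ?thesis by (simp add: LIM_zero_iff)
qed


section \<open>Limits of moments and of degree-dependent expectations\<close>

lemma dist_less_three:
  fixes a b :: real
  assumes "\<bar>a - a'\<bar> < e / 3" "\<bar>b - b'\<bar> < e / 3" "dist a' b' < e / 3"
  shows "dist a b < e"
proof -
  have "dist a b \<le> \<bar>a - a'\<bar> + \<bar>b - b'\<bar> + dist a' b'" unfolding dist_real_def by linarith
  also have "\<dots> < e / 3 + e / 3 + e / 3" by (intro add_strict_mono assms)
  finally show ?thesis by simp
qed

text \<open>Fatou's lemma: truncated squares are bounded functions of one entry, so their
  expectations converge and inherit the bound, and the truncation level then tends to
  infinity.\<close>

lemma moment2_limit:
  fixes Sn :: "nat \<Rightarrow> 't measure" and S :: "'s measure"
  assumes kn: "\<And>n. kernel (Sn n) (Vn n)" and k: "kernel S V"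
    and conv: "\<And>K a. a \<in> pairs K \<rightarrow>\<^sub>E UNIV \<Longrightarrow> (\<lambda>n. kernel.marginal (Sn n) (Vn n) K a) \<longlonglongrightarrow> kernel.marginal S V K a"
    and mb: "0 \<le> mb" "\<forall>\<^sub>F n in sequentially. kernel.moment2 (Sn n) (Vn n) \<le> ennreal mb"
  shows "kernel.moment2 S V \<le> ennreal mb"
proof -
  interpret k: kernel S V by (rule k)
  interpret A: prob_space "k.array 2" by (rule k.prob_space_array)
  define c where "c a = real (a (1::nat, 2::nat)) ^ 2" for a :: "nat \<times> nat \<Rightarrow> nat"
  have bnd: "norm (min (c a) (real L)) \<le> real L" for a L by (simp add: c_def min_def)
  have trunc: "(\<integral>\<^sup>+z. ennreal (min (c (snd z)) (real L)) \<partial>k.array 2) \<le> ennreal mb" if L: "L \<ge> 1" for L :: nat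
  proof -
    \<comment> \<open>Division by the level brings the truncated square into [0, 1], the range
      required for convergence of expectations.\<close>
    define f where "f a = min (c a) (real L) / real L" for a
    have f: "0 \<le> f a" "f a \<le> 1" for a using L by (auto simp: f_def c_def)
    have "(\<lambda>n. real L * (\<integral>z. f (snd z) \<partial>kernel.array (Sn n) (Vn n) 2)) \<longlonglongrightarrow> real L * (\<integral>z. f (snd z) \<partial>k.array 2)"
      by (intro tendsto_mult tendsto_const array_expectation_tendsto[OF kn k conv f])
    moreover have "\<forall>\<^sub>F n in sequentially. real L * (\<integral>z. f (snd z) \<partial>kernel.array (Sn n) (Vn n) 2) \<le> mb"
      using mb(2)
    proof eventually_elim
      case (elim n)
      interpret kn: kernel "Sn n" "Vn n" by (rule kn)
      interpret An: prob_space "kn.array 2" by (rule kn.prob_space_array)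
      have h: "has_bochner_integral (kn.array 2) (\<lambda>z. c (snd z)) kn.m2"
        using kn.entry_sq_integral[OF mb(1) elim, of 1 2 2] by (simp add: c_def power2_eq_square)
      have "real L * (\<integral>z. f (snd z) \<partial>kn.array 2) = (\<integral>z. min (c (snd z)) (real L) \<partial>kn.array 2)"
        using L by (simp add: f_def)
      also have "\<dots> \<le> (\<integral>z. c (snd z) \<partial>kn.array 2)"
      proof (rule integral_mono)
        show "integrable (kn.array 2) (\<lambda>z. min (c (snd z)) (real L))"
          by (intro An.integrable_const_bound[of _ "real L"] AE_I2 bnd kn.snd_measurable[of "\<lambda>a. min (c a) (real L)"])
      qed (use h in \<open>auto simp: has_bochner_integral_iff\<close>)
      also have "\<dots> \<le> mb" using h kn.moment2_real(3)[OF mb(1) elim] by (simp add: has_bochner_integral_iff)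
      finally show ?case .
    qed
    ultimately have "real L * (\<integral>z. f (snd z) \<partial>k.array 2) \<le> mb" by (rule tendsto_upperbound) simp
    then have le: "(\<integral>z. min (c (snd z)) (real L) \<partial>k.array 2) \<le> mb" using L by (simp add: f_def)
    have "(\<integral>\<^sup>+z. ennreal (min (c (snd z)) (real L)) \<partial>k.array 2) = ennreal (\<integral>z. min (c (snd z)) (real L) \<partial>k.array 2)"
      by (intro nn_integral_eq_integral A.integrable_const_bound[of _ "real L"] AE_I2 bnd k.snd_measurable[of "\<lambda>a. min (c a) (real L)"])
        (simp add: c_def)
    with le show ?thesis by (simp add: ennreal_leI)
  qed
  have lim: "liminf (\<lambda>L. ennreal (min x (real L))) = ennreal x" if "0 \<le> x" for x
  proof -
    obtain N where N: "x \<le> real N" using real_arch_simple by blast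
    have "\<forall>\<^sub>F L in sequentially. ennreal (min x (real L)) = ennreal x"
      using N by (intro eventually_sequentiallyI[of N]) (simp add: min_def)
    then have "(\<lambda>L. ennreal (min x (real L))) \<longlonglongrightarrow> ennreal x" by (rule tendsto_eventually)
    then show ?thesis by (intro lim_imp_Liminf) auto
  qed
  have "k.moment2 = (\<integral>\<^sup>+z. of_nat (snd z (1, 2)) ^ 2 \<partial>k.array 2)"
    using k.nn_integral_entry_sq[of 1 2 2] by simp
  also have "\<dots> = (\<integral>\<^sup>+z. liminf (\<lambda>L. ennreal (min (c (snd z)) (real L))) \<partial>k.array 2)"
    by (intro nn_integral_cong) (simp add: lim c_def ennreal_of_nat_eq_real_of_nat ennreal_power)
  also have "\<dots> \<le> liminf (\<lambda>L. \<integral>\<^sup>+z. ennreal (min (c (snd z)) (real L)) \<partial>k.array 2)"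
    by (intro nn_integral_liminf measurable_compose[OF k.snd_measurable[of "\<lambda>a. min (c a) (real L)" for L] measurable_ennreal])
  also have "\<dots> \<le> limsup (\<lambda>L. \<integral>\<^sup>+z. ennreal (min (c (snd z)) (real L)) \<partial>k.array 2)"
    by (rule Liminf_le_Limsup) simp
  also have "\<dots> \<le> ennreal mb"
    by (rule Limsup_bounded) (use trunc in \<open>auto intro: eventually_sequentiallyI[of 1]\<close>)
  finally show ?thesis .
qed

text \<open>Bounded second moments make the entries uniformly integrable: truncating at L changes
  the mean by at most mb / L, for every kernel satisfying the bound and for the limit as
  well.\<close>

lemma mean_entry_tendsto:
  fixes Sn :: "nat \<Rightarrow> 't measure" and S :: "'s measure"
  assumes kn: "\<And>n. kernel (Sn n) (Vn n)" and k: "kernel S V"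
    and conv: "\<And>K a. a \<in> pairs K \<rightarrow>\<^sub>E UNIV \<Longrightarrow> (\<lambda>n. kernel.marginal (Sn n) (Vn n) K a) \<longlonglongrightarrow> kernel.marginal S V K a"
    and mb: "0 \<le> mb" "\<forall>\<^sub>F n in sequentially. kernel.moment2 (Sn n) (Vn n) \<le> ennreal mb"
  shows "(\<integral>\<^sup>+x. kernel.D S V x \<partial>S) < \<infinity>"
    and "(\<lambda>n. enn2real (\<integral>\<^sup>+x. kernel.D (Sn n) (Vn n) x \<partial>Sn n)) \<longlonglongrightarrow> enn2real (\<integral>\<^sup>+x. kernel.D S V x \<partial>S)"
proof -
  define c where "c a = real (a (1::nat, 2::nat))" for a :: "nat \<times> nat \<Rightarrow> nat"
  \<comment> \<open>Stated for an arbitrary space, since it is applied both to the approximating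
    kernels and to the limit kernel.\<close>
  have gen: "integrable (kernel.array T U 2) (\<lambda>z. c (snd z))"
    "(\<integral>\<^sup>+x. kernel.D T U x \<partial>T) = ennreal (\<integral>z. c (snd z) \<partial>kernel.array T U 2)"
    "(\<integral>z. c (snd z) \<partial>kernel.array T U 2) = enn2real (\<integral>\<^sup>+x. kernel.D T U x \<partial>T)"
    "L > 0 \<Longrightarrow> \<bar>enn2real (\<integral>\<^sup>+x. kernel.D T U x \<partial>T) - (\<integral>z. min (c (snd z)) L \<partial>kernel.array T U 2)\<bar> \<le> mb / L"
    if T: "kernel T U" "kernel.moment2 T U \<le> ennreal mb" for T :: "'u measure" and U L
  proof -
    interpret T: kernel T U by (rule T)
    interpret A: prob_space "T.array 2" by (rule T.prob_space_array)
    have h: "has_bochner_integral (T.array 2) (\<lambda>z. c (snd z) * c (snd z)) T.m2"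
      using T.entry_sq_integral[OF mb(1) T(2), of 1 2 2] by (simp add: c_def)
    show i: "integrable (T.array 2) (\<lambda>z. c (snd z))"
    proof (rule Bochner_Integration.integrable_bound)
      show "integrable (T.array 2) (\<lambda>z. c (snd z) * c (snd z))" using h by (simp add: has_bochner_integral_iff)
      have "real n \<le> real n * real n" for n by (cases n) auto
      then show "AE z in T.array 2. norm (c (snd z)) \<le> norm (c (snd z) * c (snd z))" by (simp add: c_def)
    qed (rule T.snd_measurable)
    have "(\<integral>\<^sup>+x. T.D x \<partial>T) = (\<integral>\<^sup>+z. of_nat (snd z (1, 2)) \<partial>T.array 2)"
      using T.nn_integral_entry[of 1 2 2] by simp
    also have "\<dots> = (\<integral>\<^sup>+z. ennreal (c (snd z)) \<partial>T.array 2)"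
      by (simp add: c_def ennreal_of_nat_eq_real_of_nat)
    also have "\<dots> = ennreal (\<integral>z. c (snd z) \<partial>T.array 2)"
      using i by (intro nn_integral_eq_integral) (auto simp: c_def)
    finally show e: "(\<integral>\<^sup>+x. T.D x \<partial>T) = ennreal (\<integral>z. c (snd z) \<partial>T.array 2)" .
    have nn: "0 \<le> (\<integral>z. c (snd z) \<partial>T.array 2)" by (intro integral_nonneg_AE) (simp add: c_def)
    show e': "(\<integral>z. c (snd z) \<partial>T.array 2) = enn2real (\<integral>\<^sup>+x. T.D x \<partial>T)"
      unfolding e using nn by simp
    assume L: "L > 0"
    have i': "integrable (T.array 2) (\<lambda>z. min (c (snd z)) L)"
      using L by (intro A.integrable_const_bound[of _ L] T.snd_measurable[of "\<lambda>a. min (c a) L"]) (auto simp: c_def)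
    have "\<bar>(\<integral>z. c (snd z) \<partial>T.array 2) - (\<integral>z. min (c (snd z)) L \<partial>T.array 2)\<bar> = \<bar>\<integral>z. c (snd z) - min (c (snd z)) L \<partial>T.array 2\<bar>"
      using i i' by simp
    also have "\<dots> \<le> (\<integral>z. \<bar>c (snd z) - min (c (snd z)) L\<bar> \<partial>T.array 2)" by (rule integral_abs_bound)
    also have "\<dots> \<le> (\<integral>z. c (snd z) * c (snd z) / L \<partial>T.array 2)"
    proof (rule integral_mono)
      fix z :: "(nat \<Rightarrow> 'u) \<times> (nat \<times> nat \<Rightarrow> nat)"
      have c0: "0 \<le> c (snd z)" by (simp add: c_def)
      show "\<bar>c (snd z) - min (c (snd z)) L\<bar> \<le> c (snd z) * c (snd z) / L"
      proof (cases "c (snd z) \<le> L")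
        case False
        then have "c (snd z) * L \<le> c (snd z) * c (snd z)" using c0 by (intro mult_left_mono) auto
        then have "c (snd z) \<le> c (snd z) * c (snd z) / L" using L by (simp add: field_simps)
        then show ?thesis using False L by simp
      qed (use L c0 in simp)
    qed (use i i' h in \<open>auto simp: has_bochner_integral_iff\<close>)
    also have "\<dots> = T.m2 / L" using h by (simp add: has_bochner_integral_iff)
    also have "\<dots> \<le> mb / L" using T.moment2_real(3)[OF mb(1) T(2)] L by (intro divide_right_mono) auto
    finally show "\<bar>enn2real (\<integral>\<^sup>+x. T.D x \<partial>T) - (\<integral>z. min (c (snd z)) L \<partial>T.array 2)\<bar> \<le> mb / L"
      unfolding e' .
  qed
  have mb': "kernel.moment2 S V \<le> ennreal mb" by (rule moment2_limit[OF kn k conv mb])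
  show "(\<integral>\<^sup>+x. kernel.D S V x \<partial>S) < \<infinity>" using gen(2)[OF k mb'] by simp
  let ?D = "\<lambda>n. enn2real (\<integral>\<^sup>+x. kernel.D (Sn n) (Vn n) x \<partial>Sn n)" and ?D' = "enn2real (\<integral>\<^sup>+x. kernel.D S V x \<partial>S)"
  show "?D \<longlonglongrightarrow> ?D'"
  proof (rule tendstoI)
    fix e :: real assume e: "e > 0"
    \<comment> \<open>Chosen so that mb / L < e / 3; adding 1 keeps L positive when mb = 0.\<close>
    define L where "L = 3 * (mb + 1) / e"
    have L: "L > 0" "mb / L < e / 3" using e mb(1) by (auto simp: L_def field_simps)
    let ?T = "\<lambda>n. \<integral>z. min (c (snd z)) L \<partial>kernel.array (Sn n) (Vn n) 2" and ?T' = "\<integral>z. min (c (snd z)) L \<partial>kernel.array S V 2"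
    have "(\<lambda>n. L * (\<integral>z. min (c (snd z)) L / L \<partial>kernel.array (Sn n) (Vn n) 2)) \<longlonglongrightarrow> L * (\<integral>z. min (c (snd z)) L / L \<partial>kernel.array S V 2)"
      using L by (intro tendsto_mult tendsto_const array_expectation_tendsto[OF kn k conv, of 2 "\<lambda>a. min (c a) L / L"]) (auto simp: c_def)
    then have "?T \<longlonglongrightarrow> ?T'" using L by simp
    then have "\<forall>\<^sub>F n in sequentially. dist (?T n) ?T' < e / 3" using e by (intro tendstoD) auto
    then show "\<forall>\<^sub>F n in sequentially. dist (?D n) ?D' < e"
      using mb(2)
    proof eventually_elim
      case (elim n)
      show ?case
        by (rule dist_less_three[OF _ _ elim(1)])
          (use gen(4)[OF kn elim(2) L(1)] gen(4)[OF k mb' L(1)] L(2) in linarith)+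
    qed
  qed
qed

text \<open>The expectation of the product of the g p over the random array when each rate is formed
  from true degrees, after the entries have been summed out.\<close>

definition (in kernel) deg_expectation ::
  "nat \<Rightarrow> (nat \<times> nat) set \<Rightarrow> (nat \<times> nat \<Rightarrow> nat \<Rightarrow> real \<Rightarrow> real) \<Rightarrow> real \<Rightarrow> real" where
  "deg_expectation k P g \<beta> = enn2real (\<integral>\<^sup>+x. (\<Prod>p\<in>P. \<Sum>l. ennreal (V (x (fst p)) (x (snd p)) l) *
     ennreal (g p l (\<beta> * deg (x (fst p)) * deg (x (snd p))))) \<partial>points k)"

text \<open>The sample size r is fixed first, making the sampling error small uniformly in n and for
  the limit. What remains is a function of an array of fixed size k + r.\<close>

lemma deg_expectation_tendsto:
  fixes Sn :: "nat \<Rightarrow> 't measure" and S :: "'s measure"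
  assumes kn: "\<And>n. kernel (Sn n) (Vn n)" and k: "kernel S V"
    and conv: "\<And>K a. a \<in> pairs K \<rightarrow>\<^sub>E UNIV \<Longrightarrow> (\<lambda>n. kernel.marginal (Sn n) (Vn n) K a) \<longlonglongrightarrow> kernel.marginal S V K a"
    and mb: "0 \<le> mb" "\<forall>\<^sub>F n in sequentially. kernel.moment2 (Sn n) (Vn n) \<le> ennreal mb"
    and P: "P \<subseteq> pairs k"
    and g01: "\<And>p h \<mu>. p \<in> P \<Longrightarrow> 0 \<le> \<mu> \<Longrightarrow> 0 \<le> g p h \<mu> \<and> g p h \<mu> \<le> 1"
    and g_lipschitz: "\<And>p h \<mu> \<nu>. p \<in> P \<Longrightarrow> 0 \<le> \<mu> \<Longrightarrow> 0 \<le> \<nu> \<Longrightarrow> \<bar>g p h \<mu> - g p h \<nu>\<bar> \<le> \<bar>\<mu> - \<nu>\<bar>"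
    and g_measurable: "\<And>p h. p \<in> P \<Longrightarrow> g p h \<in> borel_measurable borel"
    and \<beta>: "0 \<le> \<beta>"
  shows "(\<lambda>n. kernel.deg_expectation (Sn n) (Vn n) k P g \<beta>) \<longlonglongrightarrow> kernel.deg_expectation S V k P g \<beta>"
proof (rule tendstoI)
  fix e :: real assume e: "e > 0"
  have mb': "kernel.moment2 S V \<le> ennreal mb" by (rule moment2_limit[OF kn k conv mb])
  define A where "A = real (card P) * (4 * \<beta> * mb)"
  have A: "0 \<le> A" using \<beta> mb by (simp add: A_def)
  \<comment> \<open>Makes A / sqrt r < e / 3; adding 1 allows for A = 0.\<close>
  obtain r :: nat where r: "(3 * (A + 1) / e)\<^sup>2 < real r" using reals_Archimedean2 by blast
  have r1: "r \<ge> 1" using r zero_le_power2[of "3 * (A + 1) / e"] by (cases r) auto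
  have "3 * (A + 1) / e < sqrt (real r)" using r by (rule real_less_rsqrt)
  then have small: "A / sqrt (real r) < e / 3" using e A r1 by (simp add: field_simps)
  \<comment> \<open>Clipping to [0, 1] makes the required bounds immediate; by \<open>f_eq\<close>
    it changes nothing.\<close>
  define f where "f a = max 0 (min 1 (\<Prod>p\<in>P. g p (a p) (\<beta> * (1 / real r * (\<Sum>s\<in>{k+1..k+r}. real (a (fst p, s)))) *
    (1 / real r * (\<Sum>s\<in>{k+1..k+r}. real (a (snd p, s)))))))" for a :: "nat \<times> nat \<Rightarrow> nat"
  have f_eq: "f a = (\<Prod>p\<in>P. g p (a p) (\<beta> * (1 / real r * (\<Sum>s\<in>{k+1..k+r}. real (a (fst p, s)))) *
    (1 / real r * (\<Sum>s\<in>{k+1..k+r}. real (a (snd p, s))))))" for a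
  proof -
    have nn: "0 \<le> \<beta> * (1 / real r * (\<Sum>s\<in>{k+1..k+r}. real (a (i, s)))) * (1 / real r * (\<Sum>s\<in>{k+1..k+r}. real (a (j, s))))" for i j
      using \<beta> by (intro mult_nonneg_nonneg sum_nonneg) auto
    have "0 \<le> (\<Prod>p\<in>P. g p (a p) (\<beta> * (1 / real r * (\<Sum>s\<in>{k+1..k+r}. real (a (fst p, s)))) *
      (1 / real r * (\<Sum>s\<in>{k+1..k+r}. real (a (snd p, s))))))"
      using g01[OF _ nn] by (intro prod_nonneg) blast
    moreover have "(\<Prod>p\<in>P. g p (a p) (\<beta> * (1 / real r * (\<Sum>s\<in>{k+1..k+r}. real (a (fst p, s)))) *
      (1 / real r * (\<Sum>s\<in>{k+1..k+r}. real (a (snd p, s)))))) \<le> 1"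
      using g01[OF _ nn] by (intro prod_le_1) blast
    ultimately show ?thesis by (simp add: f_def)
  qed
  have close: "\<bar>(\<integral>z. f (snd z) \<partial>kernel.array T U (k + r)) - kernel.deg_expectation T U k P g \<beta>\<bar> < e / 3"
    if T: "kernel T U" "kernel.moment2 T U \<le> ennreal mb" for T :: "'u measure" and U
  proof -
    interpret T: kernel T U by (rule T)
    have "\<bar>(\<integral>z. f (snd z) \<partial>T.array (k + r)) - T.deg_expectation k P g \<beta>\<bar> \<le> real (card P) * (4 * \<beta> * mb / sqrt (real r))"
      using T.sample_comparison[OF mb(1) T(2) P g01 g_lipschitz g_measurable \<beta> r1]
        T.integral_prod_deg[OF mb(1) T(2) P g01 g_lipschitz g_measurable \<beta>, where r = r]
      unfolding f_eq T.deg_expectation_def T.sample_deg_def[OF mb(1) T(2)] by simp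
    also have "\<dots> = A / sqrt (real r)" by (simp add: A_def)
    finally show ?thesis using small by (rule order.strict_trans1)
  qed
  have "(\<lambda>n. \<integral>z. f (snd z) \<partial>kernel.array (Sn n) (Vn n) (k + r)) \<longlonglongrightarrow> (\<integral>z. f (snd z) \<partial>kernel.array S V (k + r))"
    by (rule array_expectation_tendsto[OF kn k conv]) (auto simp: f_def)
  then have "\<forall>\<^sub>F n in sequentially. dist (\<integral>z. f (snd z) \<partial>kernel.array (Sn n) (Vn n) (k + r)) (\<integral>z. f (snd z) \<partial>kernel.array S V (k + r)) < e / 3"
    using e by (intro tendstoD) auto
  then show "\<forall>\<^sub>F n in sequentially. dist (kernel.deg_expectation (Sn n) (Vn n) k P g \<beta>) (kernel.deg_expectation S V k P g \<beta>) < e"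
    using mb(2)
  proof eventually_elim
    case (elim n)
    show ?case
      by (rule dist_less_three[OF _ _ elim(1)])
        (use close[OF kn elim(2)] close[OF k mb'] in \<open>simp_all add: abs_minus_commute\<close>)
  qed
qed


text \<open>The product measure lives on maps into the whole type but is concentrated on the
  finitely many maps into A, each of equal mass; f needs no measurability because it is almost
  everywhere a finite sum of multiples of singleton indicators.\<close>

lemma nn_integral_PiM_uniform:
  fixes f :: "('i \<Rightarrow> 'b) \<Rightarrow> ennreal" and A :: "'b set"
  assumes I: "finite I" and A: "finite A" "A \<noteq> {}"
  shows "(\<integral>\<^sup>+x. f x \<partial>Pi\<^sub>M I (\<lambda>_. measure_pmf (pmf_of_set A))) = (\<Sum>\<phi>\<in>I \<rightarrow>\<^sub>E A. f \<phi> * ennreal (1 / real (card A) ^ card I))"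
proof -
  let ?M = "Pi\<^sub>M I (\<lambda>_. measure_pmf (pmf_of_set A))"
  interpret product_prob_space "\<lambda>_ :: 'i. measure_pmf (pmf_of_set A)" I
    by (intro product_prob_spaceI prob_space_measure_pmf)
  have fin: "finite (I \<rightarrow>\<^sub>E A)" using I A by (intro finite_PiE) auto
  have single: "{\<phi>} = (\<Pi>\<^sub>E i\<in>I. {\<phi> i})" if "\<phi> \<in> I \<rightarrow>\<^sub>E A" for \<phi> :: "'i \<Rightarrow> 'b"
    using PiE_singleton[of \<phi> I] that by (auto simp: PiE_iff)
  have sets: "{\<phi>} \<in> sets ?M" if "\<phi> \<in> I \<rightarrow>\<^sub>E A" for \<phi>
    unfolding single[OF that] using I by (intro sets_PiM_I_finite) auto
  have em: "emeasure ?M {\<phi>} = ennreal (1 / real (card A) ^ card I)" if \<phi>: "\<phi> \<in> I \<rightarrow>\<^sub>E A" for \<phi>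
  proof -
    have "emeasure ?M {\<phi>} = (\<Prod>i\<in>I. emeasure (measure_pmf (pmf_of_set A)) {\<phi> i})"
      unfolding single[OF \<phi>] using I by (intro emeasure_PiM) auto
    also have "\<dots> = (\<Prod>i\<in>I. ennreal (1 / real (card A)))"
      using \<phi> A by (intro prod.cong refl) (auto simp: emeasure_pmf_single pmf_of_set PiE_iff indicator_def)
    also have "\<dots> = ennreal (1 / real (card A) ^ card I)" by (simp add: ennreal_power power_one_over)
    finally show ?thesis .
  qed
  have "AE x in ?M. \<forall>i\<in>I. x i \<in> A"
    using A by (intro AE_finite_allI[OF I] AE_PiM_component prob_space_measure_pmf) (auto simp: AE_measure_pmf_iff)
  then have "AE x in ?M. f x = (\<Sum>\<phi>\<in>I \<rightarrow>\<^sub>E A. f \<phi> * indicator {\<phi>} x)"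
  proof (rule AE_mp, intro AE_I2 impI)
    fix x assume "x \<in> space ?M" "\<forall>i\<in>I. x i \<in> A"
    then have x: "x \<in> I \<rightarrow>\<^sub>E A" by (auto simp: space_PiM PiE_iff)
    have "(\<Sum>\<phi>\<in>I \<rightarrow>\<^sub>E A. f \<phi> * indicator {\<phi>} x) = (\<Sum>\<phi>\<in>I \<rightarrow>\<^sub>E A. if \<phi> = x then f \<phi> else 0)"
      by (intro sum.cong) (auto simp: indicator_def)
    then show "f x = (\<Sum>\<phi>\<in>I \<rightarrow>\<^sub>E A. f \<phi> * indicator {\<phi>} x)" using fin x by simp
  qed
  then have "(\<integral>\<^sup>+x. f x \<partial>?M) = (\<integral>\<^sup>+x. (\<Sum>\<phi>\<in>I \<rightarrow>\<^sub>E A. f \<phi> * indicator {\<phi>} x) \<partial>?M)"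
    by (rule nn_integral_cong_AE)
  also have "\<dots> = (\<Sum>\<phi>\<in>I \<rightarrow>\<^sub>E A. \<integral>\<^sup>+x. f \<phi> * indicator {\<phi>} x \<partial>?M)"
    using sets by (intro nn_integral_sum) auto
  also have "\<dots> = (\<Sum>\<phi>\<in>I \<rightarrow>\<^sub>E A. f \<phi> * ennreal (1 / real (card A) ^ card I))"
    using sets em by (intro sum.cong refl) (simp add: nn_integral_cmult_indicator)
  finally show ?thesis .
qed

section \<open>Finite matrices as kernels\<close>

abbreviation uniform :: "nat \<Rightarrow> nat measure" where
  "uniform n \<equiv> measure_pmf (pmf_of_set {1..n})"

text \<open>A degenerate kernel: given the two vertices, the entry law is the point mass at the
  matrix entry.\<close>

definition matrix_kernel :: "nmat \<Rightarrow> nat \<Rightarrow> nat \<Rightarrow> nat \<Rightarrow> real" where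
  "matrix_kernel B x y l = of_bool (B x y = l)"

text \<open>This includes n = 0, where \<open>pmf_of_set\<close> of the empty set is an unspecified
  but genuine probability, so that a whole sequence of kernels is available for the limit
  lemmas.\<close>

lemma kernel_matrix: "kernel (uniform n) (matrix_kernel B)"
proof (intro kernel.intro kernel_axioms.intro prob_space_measure_pmf)
  fix l
  have "(\<lambda>(x, y). matrix_kernel B x y l) \<in> borel_measurable (count_space UNIV \<Otimes>\<^sub>M count_space UNIV)"
    by (simp add: pair_measure_countable)
  then show "(\<lambda>(x, y). matrix_kernel B x y l) \<in> borel_measurable (uniform n \<Otimes>\<^sub>M uniform n)"
    by (subst measurable_cong_sets[OF sets_pair_measure_cong[OF sets_measure_pmf_count_space sets_measure_pmf_count_space] refl])
next
  fix x y
  have "(\<lambda>l. if l = B x y then 1 else 0 :: real) sums 1" by (rule sums_single)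
  moreover have "(\<lambda>l. if l = B x y then 1 else 0 :: real) = (\<lambda>l. matrix_kernel B x y l)"
    by (auto simp: matrix_kernel_def)
  ultimately show "(\<lambda>l. matrix_kernel B x y l) sums 1" by simp
qed (simp add: matrix_kernel_def)

lemma suminf_matrix_kernel: "(\<Sum>l. ennreal (matrix_kernel B x y l) * f l) = f (B x y)"
proof -
  have "(\<lambda>l. if l = B x y then f l else 0) sums f (B x y)" by (rule sums_single)
  moreover have "(\<lambda>l. if l = B x y then f l else 0) = (\<lambda>l. ennreal (matrix_kernel B x y l) * f l)"
    by (auto simp: matrix_kernel_def)
  ultimately show ?thesis by (simp add: sums_iff)
qed

lemma nn_integral_uniform:
  assumes "n \<ge> 1" and f: "\<And>x. 0 \<le> f x"
  shows "(\<integral>\<^sup>+x. ennreal (f x) \<partial>uniform n) = ennreal ((\<Sum>x\<in>{1..n}. f x) / real n)"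
proof -
  have "(\<integral>\<^sup>+x. ennreal (f x) \<partial>uniform n) = (\<Sum>x\<in>{1..n}. ennreal (f x)) / ennreal (real n)"
    using assms by (subst nn_integral_pmf_of_set) (auto simp: ennreal_of_nat_eq_real_of_nat)
  then show ?thesis using assms by (simp add: sum_ennreal divide_ennreal sum_nonneg)
qed

lemma matrix_D:
  assumes "n \<ge> 1"
  shows "kernel.D (uniform n) (matrix_kernel B) x = ennreal (real (Defs.deg n B x) / real n)"
proof -
  interpret kernel "uniform n" "matrix_kernel B" by (rule kernel_matrix)
  have "D x = (\<integral>\<^sup>+y. ennreal (real (B x y)) \<partial>uniform n)"
    unfolding D_def using suminf_matrix_kernel[of B x _ of_nat]
    by (simp add: mult.commute ennreal_of_nat_eq_real_of_nat)
  then show ?thesis using nn_integral_uniform[OF assms, of "\<lambda>y. real (B x y)"] by (simp add: Defs.deg_def)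
qed

lemma matrix_deg: "n \<ge> 1 \<Longrightarrow> kernel.deg (uniform n) (matrix_kernel B) x = real (Defs.deg n B x) / real n"
  using kernel.deg_def[OF kernel_matrix, of n B x] matrix_D[of n B x] by simp

text \<open>For a matrix with m edges this is 2 m / n^2, which links the edge density to
  \<open>rho\<close>.\<close>

lemma matrix_mean:
  assumes "n \<ge> 1"
  shows "enn2real (\<integral>\<^sup>+x. kernel.D (uniform n) (matrix_kernel B) x \<partial>uniform n) = (\<Sum>x\<in>{1..n}. real (Defs.deg n B x)) / (real n)\<^sup>2"
proof -
  have "(\<integral>\<^sup>+x. kernel.D (uniform n) (matrix_kernel B) x \<partial>uniform n) = ennreal ((\<Sum>x\<in>{1..n}. real (Defs.deg n B x) / real n) / real n)"
    unfolding matrix_D[OF assms] by (rule nn_integral_uniform[OF assms]) simp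
  then show ?thesis by (simp add: sum_nonneg power2_eq_square flip: sum_divide_distrib)
qed

lemma matrix_moment2:
  assumes "n \<ge> 1"
  shows "kernel.moment2 (uniform n) (matrix_kernel B) = ennreal ((\<Sum>x\<in>{1..n}. \<Sum>y\<in>{1..n}. (real (B x y))\<^sup>2) / (real n)\<^sup>2)"
proof -
  interpret kernel "uniform n" "matrix_kernel B" by (rule kernel_matrix)
  have "moment2 = (\<integral>\<^sup>+x. (\<integral>\<^sup>+y. ennreal ((real (B x y))\<^sup>2) \<partial>uniform n) \<partial>uniform n)"
    unfolding moment2_def using suminf_matrix_kernel[of B _ _ "\<lambda>l. of_nat l ^ 2"]
    by (simp add: mult.commute ennreal_of_nat_eq_real_of_nat ennreal_power)
  also have "\<dots> = (\<integral>\<^sup>+x. ennreal ((\<Sum>y\<in>{1..n}. (real (B x y))\<^sup>2) / real n) \<partial>uniform n)"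
    by (intro nn_integral_cong nn_integral_uniform[OF assms]) simp
  also have "\<dots> = ennreal ((\<Sum>x\<in>{1..n}. (\<Sum>y\<in>{1..n}. (real (B x y))\<^sup>2) / real n) / real n)"
    by (intro nn_integral_uniform[OF assms]) (auto intro!: divide_nonneg_nonneg sum_nonneg)
  finally show ?thesis by (simp add: power2_eq_square flip: sum_divide_distrib)
qed

lemma sum_ennreal_mult_const:
  assumes "\<And>i. 0 \<le> f i" "0 \<le> q"
  shows "(\<Sum>i\<in>A. ennreal (f i) * ennreal q) = ennreal (q * (\<Sum>i\<in>A. f i))"
proof -
  have "(\<Sum>i\<in>A. ennreal (f i) * ennreal q) = (\<Sum>i\<in>A. ennreal (q * f i))"
    using assms by (intro sum.cong refl) (simp add: ennreal_mult mult.commute)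
  also have "\<dots> = ennreal (\<Sum>i\<in>A. q * f i)" using assms by (intro sum_ennreal) simp
  finally show ?thesis by (simp only: sum_distrib_left)
qed

lemma matrix_marginal:
  assumes "n \<ge> 1"
  shows "kernel.marginal (uniform n) (matrix_kernel B) K a =
    1 / real n ^ K * (\<Sum>\<phi>\<in>{1..K} \<rightarrow>\<^sub>E {1..n}. of_bool (\<forall>p\<in>pairs K. B (\<phi> (fst p)) (\<phi> (snd p)) = a p))"
proof -
  interpret kernel "uniform n" "matrix_kernel B" by (rule kernel_matrix)
  have d: "density_of K \<phi> a = ennreal (of_bool (\<forall>p\<in>pairs K. B (\<phi> (fst p)) (\<phi> (snd p)) = a p))" for \<phi>
    unfolding density_of_def matrix_kernel_def by (auto intro!: prod.neutral prod_zero)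
  have "(\<integral>\<^sup>+x. density_of K x a \<partial>points K) =
    (\<Sum>\<phi>\<in>{1..K} \<rightarrow>\<^sub>E {1..n}. ennreal (of_bool (\<forall>p\<in>pairs K. B (\<phi> (fst p)) (\<phi> (snd p)) = a p)) * ennreal (1 / real n ^ K))"
    unfolding d using assms by (subst nn_integral_PiM_uniform) auto
  also have "\<dots> = ennreal (1 / real n ^ K * (\<Sum>\<phi>\<in>{1..K} \<rightarrow>\<^sub>E {1..n}. of_bool (\<forall>p\<in>pairs K. B (\<phi> (fst p)) (\<phi> (snd p)) = a p)))"
    by (rule sum_ennreal_mult_const) auto
  finally show ?thesis unfolding marginal_def by (simp add: sum_nonneg)
qed

lemma matrix_deg_expectation:
  assumes n: "n \<ge> 1" and g: "\<And>p h \<mu>. p \<in> P \<Longrightarrow> 0 \<le> \<mu> \<Longrightarrow> 0 \<le> g p h \<mu>" and \<beta>: "0 \<le> \<beta>"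
  shows "kernel.deg_expectation (uniform n) (matrix_kernel B) k P g \<beta> =
    1 / real n ^ k * (\<Sum>\<phi>\<in>{1..k} \<rightarrow>\<^sub>E {1..n}. \<Prod>p\<in>P. g p (B (\<phi> (fst p)) (\<phi> (snd p)))
      (\<beta> * (real (Defs.deg n B (\<phi> (fst p))) / real n) * (real (Defs.deg n B (\<phi> (snd p))) / real n)))"
proof -
  interpret kernel "uniform n" "matrix_kernel B" by (rule kernel_matrix)
  let ?G = "\<lambda>\<phi>. \<Prod>p\<in>P. g p (B (\<phi> (fst p)) (\<phi> (snd p)))
      (\<beta> * (real (Defs.deg n B (\<phi> (fst p))) / real n) * (real (Defs.deg n B (\<phi> (snd p))) / real n))"
  have nn: "0 \<le> g p (B (\<phi> (fst p)) (\<phi> (snd p)))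
      (\<beta> * (real (Defs.deg n B (\<phi> (fst p))) / real n) * (real (Defs.deg n B (\<phi> (snd p))) / real n))" if "p \<in> P" for p \<phi>
    using \<beta> by (intro g that) auto
  have d: "(\<Prod>p\<in>P. \<Sum>l. ennreal (matrix_kernel B (\<phi> (fst p)) (\<phi> (snd p)) l) *
     ennreal (g p l (\<beta> * deg (\<phi> (fst p)) * deg (\<phi> (snd p))))) = ennreal (?G \<phi>)" for \<phi>
    unfolding suminf_matrix_kernel[where f = "\<lambda>l. ennreal (h l)" for h] matrix_deg[OF n] using nn by (intro prod_ennreal)
  have Gnn: "0 \<le> ?G \<phi>" for \<phi> using nn by (intro prod_nonneg)
  have "(\<integral>\<^sup>+x. ennreal (?G x) \<partial>points k) = (\<Sum>\<phi>\<in>{1..k} \<rightarrow>\<^sub>E {1..n}. ennreal (?G \<phi>) * ennreal (1 / real n ^ k))"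
    using n by (subst nn_integral_PiM_uniform) auto
  also have "\<dots> = ennreal (1 / real n ^ k * (\<Sum>\<phi>\<in>{1..k} \<rightarrow>\<^sub>E {1..n}. ?G \<phi>))"
    by (rule sum_ennreal_mult_const) (use Gnn in auto)
  finally have e: "(\<integral>\<^sup>+x. ennreal (?G x) \<partial>points k) = ennreal (1 / real n ^ k * (\<Sum>\<phi>\<in>{1..k} \<rightarrow>\<^sub>E {1..n}. ?G \<phi>))" .
  have "0 \<le> 1 / real n ^ k * (\<Sum>\<phi>\<in>{1..k} \<rightarrow>\<^sub>E {1..n}. ?G \<phi>)"
    using Gnn by (intro mult_nonneg_nonneg sum_nonneg) auto
  then show ?thesis unfolding deg_expectation_def d e by (rule enn2real_ennreal)
qed


section \<open>The limit of the edge reconnecting chain\<close>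


lemma prob_space_lborel01: "prob_space lborel01"
  by (rule prob_spaceI) (simp add: space_restrict_space emeasure_restrict_space)

lemma space_lborel01: "space lborel01 = {0..1}"
  by (simp add: space_restrict_space)

lemma kernel_multigraphon:
  assumes W: "multigraphon W"
  shows "kernel lborel01 W"
proof (intro kernel.intro kernel_axioms.intro prob_space_lborel01)
  fix l :: nat
  have f: "(\<lambda>z. (fst z, snd z, l)) \<in> lborel01 \<Otimes>\<^sub>M lborel01 \<rightarrow>\<^sub>M lborel01 \<Otimes>\<^sub>M lborel01 \<Otimes>\<^sub>M count_space UNIV"
    by (intro measurable_Pair measurable_fst measurable_snd measurable_const) simp
  have g: "(\<lambda>(x, y, l). W x y l) \<in> borel_measurable (lborel01 \<Otimes>\<^sub>M lborel01 \<Otimes>\<^sub>M count_space UNIV)"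
    using W by (simp add: multigraphon_def)
  show "(\<lambda>(x, y). W x y l) \<in> borel_measurable (lborel01 \<Otimes>\<^sub>M lborel01)"
    using measurable_compose[OF f g] by (simp add: case_prod_beta)
qed (use W in \<open>auto simp: multigraphon_def space_lborel01\<close>)

lemma degW_eq: "multigraphon W \<Longrightarrow> kernel.D lborel01 W = degW W"
  using kernel.D_def[OF kernel_multigraphon] by (simp add: degW_def fun_eq_iff)

lemma prod_pairs:
  fixes f :: "nat \<Rightarrow> nat \<Rightarrow> 'b :: comm_monoid_mult"
  shows "(\<Prod>j\<in>{1..k}. \<Prod>i\<in>{1..j}. f i j) = (\<Prod>p\<in>pairs k. f (fst p) (snd p))"
proof -
  have "(\<Prod>j\<in>{1..k}. \<Prod>i\<in>{1..j}. f i j) = (\<Prod>(j, i)\<in>(SIGMA j:{1..k}. {1..j}). f i j)"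
    by (subst prod.Sigma) auto
  also have "\<dots> = (\<Prod>p\<in>pairs k. f (fst p) (snd p))"
    by (rule prod.reindex_bij_witness[of _ "\<lambda>(a, b). (b, a)" "\<lambda>(a, b). (b, a)"]) (auto simp: pairs_def)
  finally show ?thesis .
qed

lemma t_eqW_pairs:
  "t_eqW k A W = (\<integral>x. (\<Prod>p\<in>pairs k. W (x (fst p)) (x (snd p)) (A (fst p) (snd p))) \<partial>(Pi\<^sub>M {1..k} (\<lambda>_. lborel01)))"
  unfolding t_eqW_def prod_pairs ..

lemma marginal_multigraphon:
  assumes W: "multigraphon W"
  shows "kernel.marginal lborel01 W k a = t_eqW k (\<lambda>i j. a (i, j)) W"
proof -
  interpret kernel lborel01 W by (rule kernel_multigraphon[OF W])
  have pt: "x (fst p) \<in> space lborel01" "x (snd p) \<in> space lborel01" if "x \<in> space (points k)" "p \<in> pairs k" for x p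
    using that pairs_le[OF that(2)] unfolding space_PiM PiE_iff by blast+
  have "t_eqW k (\<lambda>i j. a (i, j)) W = enn2real (\<integral>\<^sup>+x. ennreal (\<Prod>p\<in>pairs k. W (x (fst p)) (x (snd p)) (a p)) \<partial>points k)"
    unfolding t_eqW_pairs prod.collapse
  proof (intro integral_eq_nn_integral borel_measurable_prod V_measurable_pair AE_I2 prod_nonneg)
    fix x p assume "x \<in> space (points k)" "p \<in> pairs k"
    then show "0 \<le> W (x (fst p)) (x (snd p)) (a p)" using pt V_nonneg by blast
  qed
  also have "(\<integral>\<^sup>+x. ennreal (\<Prod>p\<in>pairs k. W (x (fst p)) (x (snd p)) (a p)) \<partial>points k) = (\<integral>\<^sup>+x. density_of k x a \<partial>points k)"
    unfolding density_of_def using pt V_nonneg by (intro nn_integral_cong prod_ennreal[symmetric]) blast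
  finally show ?thesis by (simp add: marginal_def)
qed

lemma of_bool_ball: "finite P \<Longrightarrow> of_bool (\<forall>p\<in>P. R p) = (\<Prod>p\<in>P. of_bool (R p) :: real)"
  by (induction P rule: finite_induct) auto

text \<open>Both matrices are symmetric, so equality needs to be tested on the upper triangle only.
  This brings \<open>t_eq\<close> into the form of a marginal of a matrix kernel.\<close>

lemma t_eq_pairs:
  assumes A: "A \<in> adj k" and B: "B \<in> adj n"
  shows "t_eq k A n B = 1 / real n ^ k * (\<Sum>\<phi>\<in>{1..k} \<rightarrow>\<^sub>E {1..n}. \<Prod>p\<in>pairs k. of_bool (B (\<phi> (fst p)) (\<phi> (snd p)) = A (fst p) (snd p)))"
proof -
  have "of_bool (\<forall>i\<in>{1..k}. \<forall>j\<in>{1..k}. A i j = B (\<phi> i) (\<phi> j)) =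
    (\<Prod>p\<in>pairs k. of_bool (B (\<phi> (fst p)) (\<phi> (snd p)) = A (fst p) (snd p)) :: real)" for \<phi>
  proof -
    have "(\<forall>i\<in>{1..k}. \<forall>j\<in>{1..k}. A i j = B (\<phi> i) (\<phi> j)) \<longleftrightarrow> (\<forall>p\<in>pairs k. B (\<phi> (fst p)) (\<phi> (snd p)) = A (fst p) (snd p))"
    proof safe
      fix a b assume *: "\<forall>i\<in>{1..k}. \<forall>j\<in>{1..k}. A i j = B (\<phi> i) (\<phi> j)" "(a, b) \<in> pairs k"
      then have "a \<in> {1..k}" "b \<in> {1..k}" by (auto simp: pairs_def)
      then show "B (\<phi> (fst (a, b))) (\<phi> (snd (a, b))) = A (fst (a, b)) (snd (a, b))" using *(1) by simp
    next
      fix i j assume *: "\<forall>p\<in>pairs k. B (\<phi> (fst p)) (\<phi> (snd p)) = A (fst p) (snd p)" "i \<in> {1..k}" "j \<in> {1..k}"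
      show "A i j = B (\<phi> i) (\<phi> j)"
      proof (cases "i \<le> j")
        case True
        then have "(i, j) \<in> pairs k" using * by (auto simp: pairs_def)
        then show ?thesis using *(1) by force
      next
        case False
        then have "(j, i) \<in> pairs k" using * by (auto simp: pairs_def)
        then show ?thesis using *(1) adj_sym[OF A, of i j] adj_sym[OF B, of "\<phi> i" "\<phi> j"] by force
      qed
    qed
    then show ?thesis by (simp only: of_bool_ball[OF finite_pairs])
  qed
  note eq = this
  show ?thesis unfolding t_eq_def eq ..
qed

section \<open>Moment bounds from the exponential condition\<close>

lemma symmetric_sum:
  fixes f :: "nat \<Rightarrow> nat \<Rightarrow> real"
  assumes "\<And>i j. f i j = f j i"
  shows "(\<Sum>i\<in>{1..n}. \<Sum>j\<in>{1..n}. f i j) = 2 * (\<Sum>j\<in>{1..n}. \<Sum>i\<in>{1..<j}. f i j) + (\<Sum>i\<in>{1..n}. f i i)"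
proof (induction n)
  case (Suc n)
  have "(\<Sum>i\<in>{1..Suc n}. \<Sum>j\<in>{1..Suc n}. f i j) = (\<Sum>i\<in>{1..n}. \<Sum>j\<in>{1..n}. f i j) + 2 * (\<Sum>i\<in>{1..n}. f i (Suc n)) + f (Suc n) (Suc n)"
  proof -
    have "(\<Sum>j\<in>{1..n}. f (Suc n) j) = (\<Sum>j\<in>{1..n}. f j (Suc n))" by (intro sum.cong refl assms)
    then show ?thesis by (simp add: sum.distrib)
  qed
  moreover have "{1..<Suc n} = {1..n}" by auto
  ultimately show ?case using Suc by simp
qed simp

text \<open>The Poisson weight of 4 at mean l x is at most 1, and 24 is the factorial of 4.\<close>

lemma power4_le_exp:
  assumes "l > 0"
  shows "real x ^ 4 \<le> 24 / l ^ 4 * exp (l * real x)"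
proof -
  have "exp (- (l * real x)) * (l * real x) ^ 4 / fact 4 \<le> 1"
    using poisson_weight_le_1[of "l * real x" 4] assms by (simp add: poisson_weight_def)
  then have "(l * real x) ^ 4 \<le> 24 * exp (l * real x)"
    by (simp add: exp_minus fact_numeral field_simps)
  then show ?thesis using assms by (simp add: power_mult_distrib field_simps)
qed

lemma power_le_power4: "1 \<le> j \<Longrightarrow> j \<le> 4 \<Longrightarrow> real x ^ j \<le> real x ^ 4"
  by (cases x) (auto intro: power_increasing simp: power_0_left)

locale reconnecting_limit =
  fixes \<kappa> lam C :: real and m :: "nat \<Rightarrow> nat" and B :: "nat \<Rightarrow> nmat" and W :: "real \<Rightarrow> real \<Rightarrow> nat \<Rightarrow> real"
  assumes kappa: "\<kappa> > 0"
    and B: "\<And>n. n \<ge> 1 \<Longrightarrow> B n \<in> adj_edges n (m n)"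
    and W: "multigraphon W"
    and conv: "graph_converges B W"
    and rho_pos: "rho W > 0"
    and lam: "lam > 0"
    and exp_edges: "\<And>n. n \<ge> 2 \<Longrightarrow> 1 / real (n choose 2) * (\<Sum>j\<in>{1..n}. \<Sum>i\<in>{1..<j}. exp (lam * real (B n i j))) \<le> C"
    and exp_loops: "\<And>n. n \<ge> 1 \<Longrightarrow> 1 / real n * (\<Sum>i\<in>{1..n}. exp (lam * real (B n i i))) \<le> C"
begin

lemma B_adj: "n \<ge> 1 \<Longrightarrow> B n \<in> adj n"
  using B adj_edges_adj by blast

text \<open>The fourth-moment constant from \<open>power4_le_exp\<close>, raised to at least 1 so
  that lower-order terms can be absorbed.\<close>

definition Q :: real where "Q = max 1 (24 / lam ^ 4 * C)"

lemma loops_moment: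
  assumes n: "n \<ge> 1"
  shows "(\<Sum>i\<in>{1..n}. real (B n i i) ^ 4) \<le> Q * real n"
proof -
  have "(\<Sum>i\<in>{1..n}. real (B n i i) ^ 4) \<le> 24 / lam ^ 4 * (\<Sum>i\<in>{1..n}. exp (lam * real (B n i i)))"
    unfolding sum_distrib_left by (intro sum_mono power4_le_exp lam)
  also have "\<dots> \<le> 24 / lam ^ 4 * (C * real n)"
    using exp_loops[OF n] n lam by (intro mult_left_mono) (auto simp: field_simps)
  also have "\<dots> \<le> Q * real n" by (simp add: Q_def mult.assoc[symmetric] mult_right_mono del: times_divide_eq_left)
  finally show ?thesis .
qed

lemma entries_moment:
  assumes n: "n \<ge> 1"
  shows "(\<Sum>i\<in>{1..n}. \<Sum>j\<in>{1..n}. real (B n i j) ^ 4) \<le> Q * (real n)\<^sup>2"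
proof -
  define c where "c = 24 / lam ^ 4"
  have c: "0 \<le> c" using lam by (simp add: c_def)
  \<comment> \<open>For n = 1 both sides are 0, so the assumption on the binomial average is used
    from n = 2 only.\<close>
  have e1: "(\<Sum>j\<in>{1..n}. \<Sum>i\<in>{1..<j}. exp (lam * real (B n i j))) \<le> C * (real n * (real n - 1) / 2)"
  proof (cases "n = 1")
    case False
    then have "n \<ge> 2" using n by simp
    then have eq: "real (n choose 2) = real n * (real n - 1) / 2"
      by (simp add: choose_two real_of_nat_div of_nat_diff)
    have "real (n choose 2) > 0" using \<open>n \<ge> 2\<close> by (simp add: zero_less_binomial)
    then have "(\<Sum>j\<in>{1..n}. \<Sum>i\<in>{1..<j}. exp (lam * real (B n i j))) \<le> C * real (n choose 2)"
      using exp_edges[OF \<open>n \<ge> 2\<close>] by (simp add: field_simps)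
    then show ?thesis unfolding eq .
  qed simp
  have e2: "(\<Sum>i\<in>{1..n}. exp (lam * real (B n i i))) \<le> C * real n"
    using exp_loops[OF n] n by (simp add: field_simps)
  have "(\<Sum>i\<in>{1..n}. \<Sum>j\<in>{1..n}. real (B n i j) ^ 4) \<le> (\<Sum>i\<in>{1..n}. \<Sum>j\<in>{1..n}. c * exp (lam * real (B n i j)))"
    unfolding c_def by (intro sum_mono power4_le_exp lam)
  also have "\<dots> = c * (2 * (\<Sum>j\<in>{1..n}. \<Sum>i\<in>{1..<j}. exp (lam * real (B n i j))) + (\<Sum>i\<in>{1..n}. exp (lam * real (B n i i))))"
    using symmetric_sum[of "\<lambda>i j. exp (lam * real (B n i j))" n] adj_sym[OF B_adj[OF n]]
    by (simp add: sum_distrib_left[symmetric])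
  also have "\<dots> \<le> c * (2 * (C * (real n * (real n - 1) / 2)) + C * real n)"
    using e1 e2 c by (intro mult_left_mono add_mono) auto
  \<comment> \<open>Off-diagonal and diagonal contributions add up exactly: n (n - 1) + n =
    n^2.\<close>
  also have "\<dots> = c * C * (real n)\<^sup>2" by (simp add: field_simps power2_eq_square)
  also have "\<dots> \<le> Q * (real n)\<^sup>2" unfolding Q_def c_def by (intro mult_right_mono) auto
  finally show ?thesis .
qed

text \<open>Lower powers of a natural number are at most its fourth power, and Cauchy-Schwarz along
  rows passes from entries to degrees.\<close>

lemma moments:
  assumes n: "n \<ge> 1"
  shows "1 \<le> Q"
    "(\<Sum>i\<in>{1..n}. \<Sum>j\<in>{1..n}. (real (B n i j))\<^sup>2) \<le> Q * (real n)\<^sup>2"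
    "(\<Sum>v\<in>{1..n}. real (deg n (B n) v)) \<le> Q * (real n)^2"
    "(\<Sum>v\<in>{1..n}. (real (deg n (B n) v))^2) \<le> Q * (real n)^3"
    "(\<Sum>v\<in>{1..n}. (real (deg n (B n) v))^4) \<le> Q * (real n)^5"
    "(\<Sum>v\<in>{1..n}. (real (B n v v))\<^sup>2) \<le> Q * real n"
    "(\<Sum>v\<in>{1..n}. real (B n v v)) \<le> Q * real n"
proof -
  show "1 \<le> Q" by (simp add: Q_def)
  have le: "(\<Sum>i\<in>{1..n}. \<Sum>j\<in>{1..n}. real (B n i j) ^ l) \<le> Q * (real n)\<^sup>2" if "1 \<le> l" "l \<le> 4" for l
    by (rule order_trans[OF _ entries_moment[OF n]]) (intro sum_mono power_le_power4 that)
  show sq: "(\<Sum>i\<in>{1..n}. \<Sum>j\<in>{1..n}. (real (B n i j))\<^sup>2) \<le> Q * (real n)\<^sup>2" by (rule le) auto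
  show "(\<Sum>v\<in>{1..n}. real (deg n (B n) v)) \<le> Q * (real n)^2"
    using le[of 1] by (simp add: deg_def)
  have d2: "(real (deg n (B n) v))\<^sup>2 \<le> real n * (\<Sum>j\<in>{1..n}. (real (B n v j))\<^sup>2)" for v
    using sum_squared_le_sum_of_squares[of "\<lambda>j. real (B n v j)" "{1..n}"] by (simp add: deg_def mult.commute)
  have "(\<Sum>v\<in>{1..n}. (real (deg n (B n) v))^2) \<le> real n * (\<Sum>i\<in>{1..n}. \<Sum>j\<in>{1..n}. (real (B n i j))\<^sup>2)"
    by (subst sum_distrib_left) (intro sum_mono d2)
  also have "\<dots> \<le> real n * (Q * (real n)\<^sup>2)" using sq by (intro mult_left_mono) auto
  finally show "(\<Sum>v\<in>{1..n}. (real (deg n (B n) v))^2) \<le> Q * (real n)^3" by (simp add: eval_nat_numeral mult_ac)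
  \<comment> \<open>Cauchy-Schwarz twice: once for the row sum, once for its sum of squares.\<close>
  have d4: "(real (deg n (B n) v))^4 \<le> real n ^ 3 * (\<Sum>j\<in>{1..n}. real (B n v j) ^ 4)" for v
  proof -
    have "(real (deg n (B n) v))^4 = ((real (deg n (B n) v))\<^sup>2)\<^sup>2" by (simp flip: power_mult)
    also have "\<dots> \<le> (real n * (\<Sum>j\<in>{1..n}. (real (B n v j))\<^sup>2))\<^sup>2" by (intro power_mono d2) simp
    also have "\<dots> = (real n)\<^sup>2 * (\<Sum>j\<in>{1..n}. (real (B n v j))\<^sup>2)\<^sup>2" by (rule power_mult_distrib)
    also have "\<dots> \<le> (real n)\<^sup>2 * (real n * (\<Sum>j\<in>{1..n}. ((real (B n v j))\<^sup>2)\<^sup>2))"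
      using sum_squared_le_sum_of_squares[of "\<lambda>j. (real (B n v j))\<^sup>2" "{1..n}"]
      by (intro mult_left_mono) (auto simp: mult.commute)
    finally show ?thesis by (simp add: eval_nat_numeral mult_ac)
  qed
  have "(\<Sum>v\<in>{1..n}. (real (deg n (B n) v))^4) \<le> real n ^ 3 * (\<Sum>i\<in>{1..n}. \<Sum>j\<in>{1..n}. real (B n i j) ^ 4)"
    by (subst sum_distrib_left) (intro sum_mono d4)
  also have "\<dots> \<le> real n ^ 3 * (Q * (real n)\<^sup>2)" using entries_moment[OF n] by (intro mult_left_mono) auto
  finally show "(\<Sum>v\<in>{1..n}. (real (deg n (B n) v))^4) \<le> Q * (real n)^5" by (simp add: eval_nat_numeral mult_ac)
  have "(\<Sum>v\<in>{1..n}. real (B n v v) ^ l) \<le> Q * real n" if "1 \<le> l" "l \<le> 4" for l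
    by (rule order_trans[OF _ loops_moment[OF n]]) (intro sum_mono power_le_power4 that)
  from this[of 2] this[of 1] show "(\<Sum>v\<in>{1..n}. (real (B n v v))\<^sup>2) \<le> Q * real n" "(\<Sum>v\<in>{1..n}. real (B n v v)) \<le> Q * real n"
    by simp_all
qed

section \<open>Convergence of the marginals and of the edge density\<close>

abbreviation "Sn n \<equiv> uniform n"
abbreviation "Vn n \<equiv> matrix_kernel (B n)"

text \<open>The hypothesis speaks of nonempty symmetric patterns with even diagonal. The empty
  pattern has probability 1, and a pattern with an odd diagonal entry has probability 0 for the
  multigraphon and for every matrix with n \<ge> 1.\<close>

lemma marginal_tendsto:
  assumes a: "a \<in> pairs K \<rightarrow>\<^sub>E UNIV"
  shows "(\<lambda>n. kernel.marginal (Sn n) (Vn n) K a) \<longlonglongrightarrow> kernel.marginal lborel01 W K a"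
proof (cases "K = 0")
  case True
  have one: "kernel.marginal T U 0 a = 1" if k: "kernel T U" for T :: "'t measure" and U
  proof -
    interpret kernel T U by (rule k)
    have "pairs 0 = {}" by (auto simp: pairs_def)
    then show ?thesis
      using prob_space.emeasure_space_1[OF prob_space_points[of 0]] by (simp add: marginal_def density_of_def)
  qed
  show ?thesis unfolding True one[OF kernel_matrix] one[OF kernel_multigraphon[OF W]] by simp
next
  case False
  show ?thesis
  proof (cases "\<forall>i\<in>{1..K}. even (a (i, i))")
    case True
    \<comment> \<open>The symmetric extension of a pattern given on the upper triangle, with 0
      outside the index range as \<open>adj\<close> requires.\<close>
    define A where "A i j = (if i \<in> {1..K} \<and> j \<in> {1..K} then a (min i j, max i j) else 0)" for i j
    have A: "A \<in> adj K" using True by (auto simp: adj_def A_def min.commute max.commute)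
    have Aa: "A (fst p) (snd p) = a p" if "p \<in> pairs K" for p
      using that by (auto simp: A_def pairs_def min_def max_def)
    have "(\<lambda>n. t_eq K A n (B n)) \<longlonglongrightarrow> t_eqW K A W"
      using conv A False by (simp add: graph_converges_def)
    moreover have "\<forall>\<^sub>F n in sequentially. t_eq K A n (B n) = kernel.marginal (Sn n) (Vn n) K a"
    proof (rule eventually_sequentiallyI[of 1])
      fix n :: nat assume n: "1 \<le> n"
      have "(\<Prod>p\<in>pairs K. of_bool (B n (\<phi> (fst p)) (\<phi> (snd p)) = A (fst p) (snd p)) :: real) =
          of_bool (\<forall>p\<in>pairs K. B n (\<phi> (fst p)) (\<phi> (snd p)) = a p)" for \<phi>
        unfolding of_bool_ball[OF finite_pairs] using Aa by (intro prod.cong) auto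
      then show "t_eq K A n (B n) = kernel.marginal (Sn n) (Vn n) K a"
        unfolding matrix_marginal[OF n] t_eq_pairs[OF A B_adj[OF n]] by simp
    qed
    moreover have "t_eqW K A W = kernel.marginal lborel01 W K a"
      unfolding marginal_multigraphon[OF W] t_eqW_pairs using Aa by (simp cong: prod.cong)
    ultimately show ?thesis using Lim_transform_eventually by force
  next
    case False
    then obtain i where i: "i \<in> {1..K}" "odd (a (i, i))" by blast
    have p: "(i, i) \<in> pairs K" using i by (auto simp: pairs_def)
    have "\<forall>\<^sub>F n in sequentially. kernel.marginal (Sn n) (Vn n) K a = 0"
    proof (rule eventually_sequentiallyI[of 1])
      fix n :: nat assume n: "1 \<le> n"
      have "B n (\<phi> i) (\<phi> i) \<noteq> a (i, i)" for \<phi>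
        using adj_even[OF B_adj[OF n], of "\<phi> i"] i(2) by metis
      then have nz: "\<not> (\<forall>p\<in>pairs K. B n (\<phi> (fst p)) (\<phi> (snd p)) = a p)" for \<phi> using p by fastforce
      show "kernel.marginal (Sn n) (Vn n) K a = 0"
        unfolding matrix_marginal[OF n] by (simp only: nz of_bool_eq sum.neutral_const mult_zero_right)
    qed
    moreover have "kernel.marginal lborel01 W K a = 0"
    proof -
      interpret kernel lborel01 W by (rule kernel_multigraphon[OF W])
      obtain l where l: "a (i, i) = 2 * l + 1" using i(2) by (auto elim: oddE)
      have "(\<integral>\<^sup>+x. density_of K x a \<partial>points K) = (\<integral>\<^sup>+x. 0 \<partial>points K)"
      proof (intro nn_integral_cong)
        fix x assume "x \<in> space (points K)"
        then have "x i \<in> {0..1}" using i unfolding space_PiM PiE_iff space_lborel01 by blast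
        then have "W (x i) (x i) (a (i, i)) = 0" using W unfolding l multigraphon_def by blast
        then show "density_of K x a = 0" unfolding density_of_def using p by (intro prod_zero) (auto intro!: bexI[OF _ p])
      qed
      then show ?thesis by (simp add: marginal_def)
    qed
    ultimately show ?thesis by (simp add: tendsto_eventually)
  qed
qed

lemma moment2_bound: "0 \<le> Q" "\<forall>\<^sub>F n in sequentially. kernel.moment2 (Sn n) (Vn n) \<le> ennreal Q"
proof -
  show "0 \<le> Q" by (simp add: Q_def)
  show "\<forall>\<^sub>F n in sequentially. kernel.moment2 (Sn n) (Vn n) \<le> ennreal Q"
  proof (rule eventually_sequentiallyI[of 1])
    fix n :: nat assume n: "1 \<le> n"
    then show "kernel.moment2 (Sn n) (Vn n) \<le> ennreal Q"
      unfolding matrix_moment2[OF n] using moments(2)[OF n] by (intro ennreal_leI) (simp add: field_simps)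
  qed
qed

definition rho_W :: real where "rho_W = enn2real (rho W)"

text \<open>The mean entry of the n-th matrix is 2 m / n^2, so convergence of mean entries
  identifies the edge density. It also gives finiteness of \<open>rho W\<close>, which
  \<open>enn2real\<close> would otherwise turn into 0.\<close>

lemma edges_tendsto: "0 < rho_W" "(\<lambda>n. real (m n) / (real n)\<^sup>2) \<longlonglongrightarrow> rho_W / 2"
proof -
  have D: "(\<integral>\<^sup>+x. kernel.D lborel01 W x \<partial>lborel01) = rho W"
    unfolding degW_eq[OF W] rho_def ..
  note * = mean_entry_tendsto[OF kernel_matrix kernel_multigraphon[OF W] marginal_tendsto moment2_bound, unfolded D]
  show "0 < rho_W" using *(1) rho_pos by (simp add: rho_W_def enn2real_positive_iff less_top)
  have "\<forall>\<^sub>F n in sequentially. enn2real (\<integral>\<^sup>+x. kernel.D (Sn n) (Vn n) x \<partial>Sn n) = 2 * (real (m n) / (real n)\<^sup>2)"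
  proof (rule eventually_sequentiallyI[of 1])
    fix n :: nat assume n: "1 \<le> n"
    show "enn2real (\<integral>\<^sup>+x. kernel.D (Sn n) (Vn n) x \<partial>Sn n) = 2 * (real (m n) / (real n)\<^sup>2)"
      unfolding matrix_mean[OF n] adj_edges_sum(1)[OF B[OF n]] by simp
  qed
  from Lim_transform_eventually[OF *(2) this]
  have "(\<lambda>n. 2 * (real (m n) / (real n)\<^sup>2) / 2) \<longlonglongrightarrow> rho_W / 2"
    unfolding rho_W_def[symmetric] by (intro tendsto_divide tendsto_const) auto
  then show "(\<lambda>n. real (m n) / (real n)\<^sup>2) \<longlonglongrightarrow> rho_W / 2" by simp
qed

end


section \<open>From the chain to functionals of the initial matrix\<close>

lemma prod_of_bool_bounds: "0 \<le> (\<Prod>p\<in>P. of_bool (R p) :: real)" "(\<Prod>p\<in>P. of_bool (R p) :: real) \<le> 1"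
  by (auto intro!: prod_nonneg prod_le_1)

definition loop_div :: "nat \<times> nat \<Rightarrow> nat" where
  "loop_div p = (if fst p = snd p then 2 else 1)"

text \<open>The queue transition probability in terms of matrix entries instead of edge counts: on
  diagonal labels both entries and the rate are halved, and an odd target has probability 0.\<close>

definition transition :: "(nat \<times> nat \<Rightarrow> nat) \<Rightarrow> real \<Rightarrow> nat \<times> nat \<Rightarrow> nat \<Rightarrow> real \<Rightarrow> real" where
  "transition K t p h \<mu> = of_bool (fst p \<noteq> snd p \<or> even (K p)) * queue t (h div loop_div p) (K p div loop_div p) (\<mu> / real (loop_div p))"

lemma transition_bounds:
  assumes "0 \<le> t" "0 \<le> \<mu>"
  shows "0 \<le> transition K t p h \<mu> \<and> transition K t p h \<mu> \<le> 1"
  using queue_bounds[OF assms(1), of "\<mu> / real (loop_div p)" "h div loop_div p" "K p div loop_div p"] assms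
  by (simp add: transition_def)

lemma transition_lipschitz:
  assumes "0 \<le> t" "0 \<le> \<mu>" "0 \<le> \<nu>"
  shows "\<bar>transition K t p h \<mu> - transition K t p h \<nu>\<bar> \<le> \<bar>\<mu> - \<nu>\<bar>"
proof -
  let ?s = "real (loop_div p)"
  let ?q = "\<lambda>\<mu>. queue t (h div loop_div p) (K p div loop_div p) (\<mu> / ?s)"
  have s: "1 \<le> ?s" by (simp add: loop_div_def)
  have "\<bar>transition K t p h \<mu> - transition K t p h \<nu>\<bar> \<le> \<bar>?q \<mu> - ?q \<nu>\<bar>"
    by (simp add: transition_def)
  also have "\<dots> \<le> \<bar>\<mu> / ?s - \<nu> / ?s\<bar>" using assms s by (intro queue_lipschitz_rate) auto
  also have "\<dots> = \<bar>\<mu> - \<nu>\<bar> / ?s" using s by (simp add: abs_divide flip: diff_divide_distrib)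
  also have "\<dots> \<le> \<bar>\<mu> - \<nu>\<bar> / 1" using s by (intro divide_left_mono) auto
  finally show ?thesis by simp
qed

lemma transition_measurable: "transition K t p h \<in> borel_measurable borel"
  unfolding transition_def[abs_def] queue_def poisson_weight_def by measurable

context reconnecting_limit
begin

context
  fixes t :: real
  assumes t: "0 \<le> t"
begin

definition N :: "nat \<Rightarrow> nat" where "N n = nat \<lfloor>t * (rho_W * real n ^ 2 / 2)\<rfloor>"

lemma rho_W_pos: "0 < rho_W" by (rule edges_tendsto)

lemma N_bounds: "real (N n) \<le> t * (rho_W * real n ^ 2 / 2)" "t * (rho_W * real n ^ 2 / 2) - 1 \<le> real (N n)"
proof -
  have "0 \<le> t * (rho_W * real n ^ 2 / 2)" using t rho_W_pos by simp
  then show "real (N n) \<le> t * (rho_W * real n ^ 2 / 2)" "t * (rho_W * real n ^ 2 / 2) - 1 \<le> real (N n)"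
    unfolding N_def by linarith+
qed

text \<open>One step lasts queue time 1 / m, so the queues run for time N / m; rounding N down costs
  at most 1 / n^2 relative to the scale n^2.\<close>

lemma steps_tendsto: "(\<lambda>n. real (N n) / real (m n)) \<longlonglongrightarrow> t"
proof -
  have i: "(\<lambda>n. 1 / (real n)\<^sup>2) \<longlonglongrightarrow> 0" by real_asymp
  have "(\<lambda>n. real (N n) / (real n)\<^sup>2 - t * (rho_W / 2)) \<longlonglongrightarrow> 0"
  proof (rule Lim_null_comparison[OF _ i], rule eventually_sequentiallyI[of 1])
    fix n :: nat assume "1 \<le> n"
    then have n: "0 < (real n)\<^sup>2" by simp
    have "real (N n) / (real n)\<^sup>2 - t * (rho_W / 2) = (real (N n) - t * (rho_W * real n ^ 2 / 2)) / (real n)\<^sup>2"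
      using n by (simp add: field_simps)
    also have "norm \<dots> \<le> 1 / (real n)\<^sup>2"
      using N_bounds[of n] n by (simp add: abs_divide divide_le_cancel abs_le_iff)
    finally show "norm (real (N n) / (real n)\<^sup>2 - t * (rho_W / 2)) \<le> 1 / (real n)\<^sup>2" .
  qed
  then have "(\<lambda>n. real (N n) / (real n)\<^sup>2) \<longlonglongrightarrow> t * (rho_W / 2)" by (simp add: LIM_zero_iff)
  from tendsto_divide[OF this edges_tendsto(2)] rho_W_pos
  have "(\<lambda>n. (real (N n) / (real n)\<^sup>2) / (real (m n) / (real n)\<^sup>2)) \<longlonglongrightarrow> t" by simp
  moreover have "\<forall>\<^sub>F n in sequentially. (real (N n) / (real n)\<^sup>2) / (real (m n) / (real n)\<^sup>2) = real (N n) / real (m n)"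
    by (rule eventually_sequentiallyI[of 1]) simp
  ultimately show ?thesis by (rule Lim_transform_eventually)
qed

text \<open>The threshold rho / 4 is half the limiting edge density, hence eventually
  exceeded.\<close>

lemma eventually_dense: "\<forall>\<^sub>F n in sequentially. n \<ge> 1 \<and> m n > 0 \<and> rho_W / 4 * (real n)\<^sup>2 \<le> real (m n)"
proof -
  have "\<forall>\<^sub>F n in sequentially. rho_W / 4 < real (m n) / (real n)\<^sup>2"
    using edges_tendsto by (intro order_tendstoD) auto
  then show ?thesis using eventually_ge_at_top[of 1]
  proof eventually_elim
    case (elim n)
    then have "rho_W / 4 * (real n)\<^sup>2 < real (m n)" by (simp add: field_simps)
    moreover have "0 \<le> rho_W / 4 * (real n)\<^sup>2" using rho_W_pos by simp
    ultimately have "0 < real (m n)" by linarith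
    then show ?case using elim \<open>rho_W / 4 * (real n)\<^sup>2 < real (m n)\<close> by simp
  qed
qed

lemma eventually_scaled:
  "\<forall>\<^sub>F n in sequentially. scaled_reconnecting \<kappa> n (m n) (rho_W / 4) (2 * t) Q (root 4 (real n)) (N n) (B n)"
  using eventually_dense
proof eventually_elim
  case (elim n)
  then have n: "n \<ge> 1" by simp
  have "real (N n) \<le> t * (rho_W * real n ^ 2 / 2)" by (rule N_bounds)
  also have "\<dots> = 2 * t * (rho_W / 4 * (real n)\<^sup>2)" by simp
  \<comment> \<open>The horizon 2 t compensates for the density bound being only half the limit
    density.\<close>
  also have "\<dots> \<le> 2 * t * real (m n)" using elim t by (intro mult_left_mono) auto
  finally have N: "real (N n) \<le> 2 * t * real (m n)" .
  show ?case
  proof (unfold_locales)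
    show "1 \<le> root 4 (real n)" using n by (simp add: real_root_ge_1_iff)
    show "real n = root 4 (real n) ^ 4" by (simp add: real_root_pow_pos2)
  qed (use kappa elim B[OF n] rho_W_pos t N moments[OF n] in auto)
qed

lemma average_expect_queues_tendsto:
  assumes P: "P \<subseteq> pairs k"
  shows "(\<lambda>n. 1 / real n ^ k * (\<Sum>\<phi>\<in>{1..k} \<rightarrow>\<^sub>E {1..n}.
    \<bar>reconnecting.expect \<kappa> n (m n) (N n) (\<lambda>Y. queues P K (scaled_reconnecting.rate n (m n) (B n) \<phi>) 0 (\<lambda>p. edges Y (\<phi> (fst p)) (\<phi> (snd p)))) (B n) -
      queues P K (scaled_reconnecting.rate n (m n) (B n) \<phi>) (real (N n) / real (m n)) (\<lambda>p. edges (B n) (\<phi> (fst p)) (\<phi> (snd p)))\<bar>)) \<longlonglongrightarrow> 0"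
    (is "?L \<longlonglongrightarrow> 0")
proof -
  \<comment> \<open>This constant depends on \<kappa>, the density bound, the horizon, Q and the
    number of pairs, but not on n.\<close>
  let ?c = "scaled_reconnecting.average_const \<kappa> (rho_W / 4) (2 * t) Q (card P)"
  have "(\<lambda>n. 1 / root 4 (real n)) \<longlonglongrightarrow> 0" by real_asymp
  moreover have "(\<lambda>n. 1 / real n) \<longlonglongrightarrow> 0" by real_asymp
  ultimately have "(\<lambda>n. ?c * (1 / root 4 (real n)) + real (card (pairs k)) * (1 / real n)) \<longlonglongrightarrow> ?c * 0 + real (card (pairs k)) * 0"
    by (intro tendsto_add tendsto_mult tendsto_const)
  then have lim: "(\<lambda>n. ?c * (1 / root 4 (real n)) + real (card (pairs k)) * (1 / real n)) \<longlonglongrightarrow> 0" by simp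
  show ?thesis
  proof (rule Lim_null_comparison[OF _ lim])
    show "\<forall>\<^sub>F n in sequentially. norm (?L n) \<le> ?c * (1 / root 4 (real n)) + real (card (pairs k)) * (1 / real n)"
      using eventually_scaled
    proof eventually_elim
      case (elim n)
      have "0 \<le> ?L n" by (intro mult_nonneg_nonneg sum_nonneg) auto
      then show ?case using scaled_reconnecting.average_expect_queues[OF elim P, of K] by simp
    qed
  qed
qed

definition observable_mean :: "nat \<Rightarrow> nat \<Rightarrow> (nat \<times> nat) set \<Rightarrow> (nat \<times> nat \<Rightarrow> nat) \<Rightarrow> real" where
  "observable_mean n k P K = 1 / real n ^ k * (\<Sum>\<phi>\<in>{1..k} \<rightarrow>\<^sub>E {1..n}.
     reconnecting.expect \<kappa> n (m n) (N n) (\<lambda>Y. \<Prod>p\<in>P. of_bool (Y (\<phi> (fst p)) (\<phi> (snd p)) = K p)) (B n))"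

definition kernel_mean :: "nat \<Rightarrow> nat \<Rightarrow> (nat \<times> nat) set \<Rightarrow> (nat \<times> nat \<Rightarrow> nat) \<Rightarrow> real" where
  "kernel_mean n k P K = kernel.deg_expectation (Sn n) (Vn n) k P (transition K t) (1 / rho_W)"

text \<open>Bounds the change of one queue factor when the time N / m is replaced by t and the
  factor 1 / (2 m) in the rate by 1 / (rho n^2).\<close>

definition rate_error :: "nat \<Rightarrow> nat \<Rightarrow> nat \<Rightarrow> real" where
  "rate_error n v w = (real (deg n (B n) v) * real (deg n (B n) w) / (2 * real (m n)) + real (B n v w)) * \<bar>real (N n) / real (m n) - t\<bar>
     + real (deg n (B n) v) * real (deg n (B n) w) * \<bar>1 / (2 * real (m n)) - 1 / (rho_W * (real n)\<^sup>2)\<bar>"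

lemma rate_error_nonneg: "0 \<le> rate_error n v w"
  unfolding rate_error_def by (intro add_nonneg_nonneg mult_nonneg_nonneg divide_nonneg_nonneg) auto

text \<open>Products of degrees average to at most Q^2 n^2 and entries to at most Q, so after
  normalisation by n^2 both corrections carry a factor that tends to 0.\<close>

lemma average_rate_error_tendsto:
  assumes p: "p \<in> pairs k"
  shows "(\<lambda>n. 1 / real n ^ k * (\<Sum>\<phi>\<in>{1..k} \<rightarrow>\<^sub>E {1..n}. rate_error n (\<phi> (fst p)) (\<phi> (snd p)))) \<longlonglongrightarrow> 0"
    (is "?L \<longlonglongrightarrow> 0")
proof -
  let ?a = "\<lambda>n. \<bar>real (N n) / real (m n) - t\<bar>" and ?b = "\<lambda>n. \<bar>1 / (2 * (real (m n) / (real n)\<^sup>2)) - 1 / rho_W\<bar>"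
  let ?R = "\<lambda>n. (Q\<^sup>2 * (1 / (2 * (real (m n) / (real n)\<^sup>2))) + Q) * ?a n + Q\<^sup>2 * ?b n"
  have inv: "(\<lambda>n. 1 / (2 * (real (m n) / (real n)\<^sup>2))) \<longlonglongrightarrow> 1 / (2 * (rho_W / 2))"
    using rho_W_pos by (intro tendsto_intros edges_tendsto) auto
  have "?R \<longlonglongrightarrow> (Q\<^sup>2 * (1 / (2 * (rho_W / 2))) + Q) * \<bar>t - t\<bar> + Q\<^sup>2 * \<bar>1 / (2 * (rho_W / 2)) - 1 / rho_W\<bar>"
    by (intro tendsto_add tendsto_mult tendsto_const tendsto_rabs tendsto_diff inv steps_tendsto)
  then have lim: "?R \<longlonglongrightarrow> 0" using rho_W_pos by simp
  show ?thesis
  proof (rule Lim_null_comparison[OF _ lim])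
    show "\<forall>\<^sub>F n in sequentially. norm (?L n) \<le> ?R n"
      using eventually_dense
    proof eventually_elim
      case (elim n)
      then have n: "n \<ge> 1" and mn: "0 < real (m n)" by auto
      have n2: "0 < (real n)\<^sup>2" using n by simp
      note Q = moments[OF n]
      let ?c = "\<lambda>v. real (deg n (B n) v)"
      let ?A = "\<lambda>f :: nat \<Rightarrow> nat \<Rightarrow> real. 1 / real n ^ k * (\<Sum>\<phi>\<in>{1..k} \<rightarrow>\<^sub>E {1..n}. f (\<phi> (fst p)) (\<phi> (snd p)))"
      have A: "?A f = (if fst p = snd p then (\<Sum>v\<in>{1..n}. f v v) / real n else (\<Sum>v\<in>{1..n}. \<Sum>w\<in>{1..n}. f v w) / (real n)\<^sup>2)" for f
        using average_pair[OF n, of "fst p" "snd p" k f] p by simp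
      \<comment> \<open>Lets diagonal and off-diagonal pairs share the constant Q^2.\<close>
      have QQ: "Q \<le> Q\<^sup>2" using Q(1) by (simp add: power2_eq_square)
      have cc: "?A (\<lambda>v w. ?c v * ?c w) \<le> Q\<^sup>2 * (real n)\<^sup>2"
      proof (cases "fst p = snd p")
        case True
        have "(\<Sum>v\<in>{1..n}. ?c v * ?c v) / real n \<le> Q * (real n)^3 / real n"
          using Q(4) by (intro divide_right_mono) (auto simp: power2_eq_square)
        also have "\<dots> = Q * (real n)\<^sup>2" using n by (simp add: eval_nat_numeral)
        also have "\<dots> \<le> Q\<^sup>2 * (real n)\<^sup>2" using QQ by (intro mult_right_mono) auto
        finally show ?thesis unfolding A[of "\<lambda>v w. ?c v * ?c w"] using True by simp
      next
        case False
        have "(\<Sum>v\<in>{1..n}. \<Sum>w\<in>{1..n}. ?c v * ?c w) / (real n)\<^sup>2 = (\<Sum>v\<in>{1..n}. ?c v) * (\<Sum>v\<in>{1..n}. ?c v) / (real n)\<^sup>2"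
          by (simp only: sum_product)
        also have "\<dots> \<le> (Q * (real n)\<^sup>2) * (Q * (real n)\<^sup>2) / (real n)\<^sup>2"
          using Q(1,3) by (intro divide_right_mono mult_mono sum_nonneg) auto
        also have "\<dots> = Q\<^sup>2 * (real n)\<^sup>2" using n by (simp add: power2_eq_square)
        finally show ?thesis unfolding A[of "\<lambda>v w. ?c v * ?c w"] using False by simp
      qed
      have bb: "?A (\<lambda>v w. real (B n v w)) \<le> Q"
      proof (cases "fst p = snd p")
        case True
        have "(\<Sum>v\<in>{1..n}. real (B n v v)) / real n \<le> Q" using Q(7) n by (simp add: field_simps)
        then show ?thesis unfolding A[of "\<lambda>v w. real (B n v w)"] using True by simp
      next
        case False
        have "(\<Sum>v\<in>{1..n}. \<Sum>w\<in>{1..n}. real (B n v w)) / (real n)\<^sup>2 \<le> Q"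
          using Q(3) n2 by (simp add: deg_def divide_le_eq)
        then show ?thesis unfolding A[of "\<lambda>v w. real (B n v w)"] using False by simp
      qed
      have "?L n = (?A (\<lambda>v w. ?c v * ?c w) / (2 * real (m n)) + ?A (\<lambda>v w. real (B n v w))) * ?a n +
        ?A (\<lambda>v w. ?c v * ?c w) * \<bar>1 / (2 * real (m n)) - 1 / (rho_W * (real n)\<^sup>2)\<bar>"
        unfolding rate_error_def sum.distrib distrib_right sum_distrib_right[symmetric] sum_divide_distrib[symmetric] distrib_left
        by (simp add: mult.assoc)
      also have "\<dots> \<le> (Q\<^sup>2 * (real n)\<^sup>2 / (2 * real (m n)) + Q) * ?a n + Q\<^sup>2 * (real n)\<^sup>2 * \<bar>1 / (2 * real (m n)) - 1 / (rho_W * (real n)\<^sup>2)\<bar>"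
        using cc bb mn by (intro add_mono mult_right_mono divide_right_mono) auto
      also have "\<dots> = ?R n"
      proof -
        have "(real n)\<^sup>2 * \<bar>1 / (2 * real (m n)) - 1 / (rho_W * (real n)\<^sup>2)\<bar> = \<bar>(real n)\<^sup>2 * (1 / (2 * real (m n)) - 1 / (rho_W * (real n)\<^sup>2))\<bar>"
          by (simp add: abs_mult)
        also have "(real n)\<^sup>2 * (1 / (2 * real (m n)) - 1 / (rho_W * (real n)\<^sup>2)) = 1 / (2 * (real (m n) / (real n)\<^sup>2)) - 1 / rho_W"
          using n2 mn rho_W_pos by (simp add: right_diff_distrib)
        finally show ?thesis by (simp add: mult.assoc)
      qed
      finally have "?L n \<le> ?R n" .
      moreover have "0 \<le> ?L n" using rate_error_nonneg by (intro mult_nonneg_nonneg sum_nonneg) auto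
      ultimately show ?case by simp
    qed
  qed
qed

text \<open>The error has three sources: chain against queues, frozen time and rates against their
  limits, and collisions of labels. Each vanishes after averaging over the label maps.\<close>

lemma observable_minus_kernel_mean_tendsto:
  assumes P: "P \<subseteq> pairs k"
  shows "(\<lambda>n. observable_mean n k P K - kernel_mean n k P K) \<longlonglongrightarrow> 0"
proof -
  let ?K = "\<lambda>p. K p div loop_div p"
  let ?rate = "\<lambda>n. scaled_reconnecting.rate n (m n) (B n)"
  let ?e = "\<lambda>n \<phi>. \<bar>reconnecting.expect \<kappa> n (m n) (N n) (\<lambda>Y. queues P ?K (?rate n \<phi>) 0 (\<lambda>p. edges Y (\<phi> (fst p)) (\<phi> (snd p)))) (B n) -
      queues P ?K (?rate n \<phi>) (real (N n) / real (m n)) (\<lambda>p. edges (B n) (\<phi> (fst p)) (\<phi> (snd p)))\<bar>"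
  let ?E = "\<lambda>n. 1 / real n ^ k * (\<Sum>\<phi>\<in>{1..k} \<rightarrow>\<^sub>E {1..n}. ?e n \<phi>)"
  let ?R = "\<lambda>n. \<Sum>p\<in>P. 1 / real n ^ k * (\<Sum>\<phi>\<in>{1..k} \<rightarrow>\<^sub>E {1..n}. rate_error n (\<phi> (fst p)) (\<phi> (snd p)))"
  have i: "(\<lambda>n. real (card (pairs k)) / real n) \<longlonglongrightarrow> 0" by real_asymp
  have "?R \<longlonglongrightarrow> (\<Sum>p\<in>P. 0)"
    using P by (intro tendsto_sum average_rate_error_tendsto) auto
  from tendsto_add[OF tendsto_add[OF average_expect_queues_tendsto[OF P, of ?K] this] i]
  have lim: "(\<lambda>n. ?E n + ?R n + real (card (pairs k)) / real n) \<longlonglongrightarrow> 0" by simp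
  show ?thesis
  proof (rule Lim_null_comparison[OF _ lim])
    show "\<forall>\<^sub>F n in sequentially. norm (observable_mean n k P K - kernel_mean n k P K) \<le> ?E n + ?R n + real (card (pairs k)) / real n"
      using eventually_scaled
    proof eventually_elim
      case (elim n)
      interpret s: scaled_reconnecting \<kappa> n "m n" "rho_W / 4" "2 * t" Q "root 4 (real n)" "N n" "B n" by (rule elim)
      have n: "n \<ge> 1" and nr: "0 < real n" and mn: "0 < real (m n)" using s.n_pos s.m_pos by auto
      note Bn = s.B
      let ?F = "{1..k} \<rightarrow>\<^sub>E {1..n}"
      have finF: "finite ?F" by (intro finite_PiE) auto
      define obs where "obs \<phi> = s.expect (N n) (\<lambda>Y. \<Prod>p\<in>P. of_bool (Y (\<phi> (fst p)) (\<phi> (snd p)) = K p)) (B n)" for \<phi>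
      define ker where "ker \<phi> = (\<Prod>p\<in>P. transition K t p (B n (\<phi> (fst p)) (\<phi> (snd p)))
        (1 / rho_W * (s.c (\<phi> (fst p)) / real n) * (s.c (\<phi> (snd p)) / real n)))" for \<phi>
      have ker: "0 \<le> ker \<phi>" "ker \<phi> \<le> 1" for \<phi>
        unfolding ker_def using transition_bounds[OF t] rho_W_pos by (auto intro!: prod_nonneg prod_le_1)
      have obs: "0 \<le> obs \<phi>" "obs \<phi> \<le> 1" for \<phi>
      proof -
        show "0 \<le> obs \<phi>" unfolding obs_def by (intro s.expect_nonneg[OF Bn] prod_of_bool_bounds)
        have "obs \<phi> \<le> s.expect (N n) (\<lambda>_. 1) (B n)" unfolding obs_def by (intro s.expect_mono[OF Bn] prod_of_bool_bounds)
        then show "obs \<phi> \<le> 1" by (simp add: s.expect_const[OF Bn])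
      qed
      have e0: "0 \<le> ?e n \<phi>" for \<phi> by simp
      have r0: "0 \<le> (\<Sum>p\<in>P. rate_error n (\<phi> (fst p)) (\<phi> (snd p)))" for \<phi> by (intro sum_nonneg rate_error_nonneg)
      have inj: "\<bar>obs \<phi> - ker \<phi>\<bar> \<le> ?e n \<phi> + (\<Sum>p\<in>P. rate_error n (\<phi> (fst p)) (\<phi> (snd p)))"
        if \<phi>: "\<phi> \<in> ?F" "inj_on \<phi> {1..k}" for \<phi>
      proof -
        \<comment> \<open>Adjacency matrices never meet an odd diagonal target, but
          \<open>div 2\<close> would identify it with the even number below. The factor
          \<open>c0\<close> removes such targets from both sides before halving.\<close>
        define c0 where "c0 = (\<Prod>p\<in>P. of_bool (fst p \<noteq> snd p \<or> even (K p)) :: real)"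
        have c0: "0 \<le> c0" "c0 \<le> 1" unfolding c0_def by (rule prod_of_bool_bounds)+
        have eq: "\<phi> (fst p) = \<phi> (snd p) \<longleftrightarrow> fst p = snd p" if "p \<in> P" for p
        proof -
          have "fst p \<in> {1..k}" "snd p \<in> {1..k}" using P that by (auto simp: pairs_def)
          then show ?thesis using inj_on_eq_iff[OF \<phi>(2)] by blast
        qed
        have "(\<Prod>p\<in>P. of_bool (Y (\<phi> (fst p)) (\<phi> (snd p)) = K p)) =
          c0 * queues P ?K (s.rate \<phi>) 0 (\<lambda>p. edges Y (\<phi> (fst p)) (\<phi> (snd p)))" if Y: "Y \<in> adj_edges n (m n)" for Y
          unfolding c0_def queues_def prod.distrib[symmetric] queue_0
        proof (intro prod.cong refl)
          fix p assume p: "p \<in> P"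
          show "of_bool (Y (\<phi> (fst p)) (\<phi> (snd p)) = K p) =
            of_bool (fst p \<noteq> snd p \<or> even (K p)) * (of_bool (edges Y (\<phi> (fst p)) (\<phi> (snd p)) = K p div loop_div p) :: real)"
          proof (cases "fst p = snd p")
            case True
            have "even (Y (\<phi> (snd p)) (\<phi> (snd p)))" using adj_even[OF adj_edges_adj[OF Y]] .
            then have "Y (\<phi> (snd p)) (\<phi> (snd p)) = K p \<longleftrightarrow> even (K p) \<and> Y (\<phi> (snd p)) (\<phi> (snd p)) div 2 = K p div 2"
              by (metis dvd_div_eq_iff)
            then show ?thesis using True by (auto simp: edges_def loop_div_def)
          next
            case False
            then show ?thesis using eq[OF p] by (simp add: edges_def loop_div_def)
          qed
        qed
        then have "obs \<phi> = s.expect (N n) (\<lambda>Y. c0 * queues P ?K (s.rate \<phi>) 0 (\<lambda>p. edges Y (\<phi> (fst p)) (\<phi> (snd p)))) (B n)"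
          unfolding obs_def by (intro antisym s.expect_mono[OF Bn]) auto
        then have obs_eq: "obs \<phi> = c0 * s.expect (N n) (\<lambda>Y. queues P ?K (s.rate \<phi>) 0 (\<lambda>p. edges Y (\<phi> (fst p)) (\<phi> (snd p)))) (B n)"
          unfolding s.expect_cmult .
        let ?q = "\<lambda>p. queue t (B n (\<phi> (fst p)) (\<phi> (snd p)) div loop_div p) (?K p) (1 / rho_W * (s.c (\<phi> (fst p)) / real n) * (s.c (\<phi> (snd p)) / real n) / real (loop_div p))"
        let ?Q = "queues P ?K (s.rate \<phi>) (real (N n) / real (m n)) (\<lambda>p. edges (B n) (\<phi> (fst p)) (\<phi> (snd p)))"
        have ker_eq: "ker \<phi> = c0 * (\<Prod>p\<in>P. ?q p)"
          unfolding ker_def transition_def c0_def prod.distrib ..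
        have "\<bar>?Q - (\<Prod>p\<in>P. ?q p)\<bar> \<le> (\<Sum>p\<in>P. \<bar>queue (real (N n) / real (m n)) (edges (B n) (\<phi> (fst p)) (\<phi> (snd p))) (?K p) (s.rate \<phi> p) - ?q p\<bar>)"
          unfolding queues_def real_norm_def[symmetric]
        proof (intro norm_prod_diff)
          fix p assume "p \<in> P"
          show "norm (queue (real (N n) / real (m n)) (edges (B n) (\<phi> (fst p)) (\<phi> (snd p))) (?K p) (s.rate \<phi> p)) \<le> 1"
            using queue_bounds[of "real (N n) / real (m n)" "s.rate \<phi> p"] s.rate_nonneg by simp
          have "0 \<le> 1 / rho_W * (s.c (\<phi> (fst p)) / real n) * (s.c (\<phi> (snd p)) / real n) / real (loop_div p)"
            using rho_W_pos by simp
          then show "norm (?q p) \<le> 1" using queue_bounds[OF t] by simp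
        qed
        also have "\<dots> \<le> (\<Sum>p\<in>P. rate_error n (\<phi> (fst p)) (\<phi> (snd p)))"
        proof (intro sum_mono)
          fix p assume p: "p \<in> P"
          define d where "d = s.c (\<phi> (fst p)) * s.c (\<phi> (snd p))"
          have d: "0 \<le> d" by (simp add: d_def)
          have loop_div: "1 \<le> real (loop_div p)" by (simp add: loop_div_def)
          have rate: "s.rate \<phi> p = d / (2 * real (m n)) / real (loop_div p)"
            using eq[OF p] by (simp add: s.rate_def d_def loop_div_def)
          have h: "edges (B n) (\<phi> (fst p)) (\<phi> (snd p)) = B n (\<phi> (fst p)) (\<phi> (snd p)) div loop_div p"
            using eq[OF p] by (simp add: edges_def loop_div_def)
          let ?h = "B n (\<phi> (fst p)) (\<phi> (snd p)) div loop_div p"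
          have h_le: "real ?h \<le> real (B n (\<phi> (fst p)) (\<phi> (snd p)))" by simp
          have mu: "1 / rho_W * (s.c (\<phi> (fst p)) / real n) * (s.c (\<phi> (snd p)) / real n) / real (loop_div p) = d / (rho_W * (real n)\<^sup>2) / real (loop_div p)"
            by (simp add: d_def power2_eq_square)
          have "\<bar>queue (real (N n) / real (m n)) ?h (?K p) (s.rate \<phi> p) - queue t ?h (?K p) (s.rate \<phi> p)\<bar>
            \<le> (s.rate \<phi> p + real ?h) * \<bar>real (N n) / real (m n) - t\<bar>"
            using t s.rate_nonneg by (intro queue_lipschitz_time) auto
          also have "\<dots> \<le> (d / (2 * real (m n)) + real (B n (\<phi> (fst p)) (\<phi> (snd p)))) * \<bar>real (N n) / real (m n) - t\<bar>"
          proof (intro mult_right_mono add_mono h_le)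
            have "d / (2 * real (m n)) / real (loop_div p) \<le> d / (2 * real (m n)) / 1"
              using loop_div d by (intro divide_left_mono) auto
            then show "s.rate \<phi> p \<le> d / (2 * real (m n))" by (simp add: rate)
          qed simp
          finally have one: "\<bar>queue (real (N n) / real (m n)) ?h (?K p) (s.rate \<phi> p) - queue t ?h (?K p) (s.rate \<phi> p)\<bar> \<le>
            (d / (2 * real (m n)) + real (B n (\<phi> (fst p)) (\<phi> (snd p)))) * \<bar>real (N n) / real (m n) - t\<bar>" .
          have "\<bar>queue t ?h (?K p) (s.rate \<phi> p) - ?q p\<bar> \<le> \<bar>s.rate \<phi> p - d / (rho_W * (real n)\<^sup>2) / real (loop_div p)\<bar>"
            unfolding mu using t s.rate_nonneg d rho_W_pos by (intro queue_lipschitz_rate) auto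
          also have "\<dots> = d * \<bar>1 / (2 * real (m n)) - 1 / (rho_W * (real n)\<^sup>2)\<bar> / real (loop_div p)"
          proof -
            have "s.rate \<phi> p - d / (rho_W * (real n)\<^sup>2) / real (loop_div p) = d * (1 / (2 * real (m n)) - 1 / (rho_W * (real n)\<^sup>2)) / real (loop_div p)"
              unfolding rate by (simp add: right_diff_distrib diff_divide_distrib)
            then show ?thesis using d by (simp add: abs_mult)
          qed
          also have "\<dots> \<le> d * \<bar>1 / (2 * real (m n)) - 1 / (rho_W * (real n)\<^sup>2)\<bar> / 1"
            using loop_div d by (intro divide_left_mono) auto
          finally have two: "\<bar>queue t ?h (?K p) (s.rate \<phi> p) - ?q p\<bar> \<le> d * \<bar>1 / (2 * real (m n)) - 1 / (rho_W * (real n)\<^sup>2)\<bar>" by simp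
          show "\<bar>queue (real (N n) / real (m n)) (edges (B n) (\<phi> (fst p)) (\<phi> (snd p))) (?K p) (s.rate \<phi> p) - ?q p\<bar> \<le> rate_error n (\<phi> (fst p)) (\<phi> (snd p))"
            using one two unfolding h rate_error_def d_def by linarith
        qed
        finally have near: "\<bar>?Q - (\<Prod>p\<in>P. ?q p)\<bar> \<le> (\<Sum>p\<in>P. rate_error n (\<phi> (fst p)) (\<phi> (snd p)))" .
        have "\<bar>obs \<phi> - ker \<phi>\<bar> = c0 * \<bar>s.expect (N n) (\<lambda>Y. queues P ?K (s.rate \<phi>) 0 (\<lambda>p. edges Y (\<phi> (fst p)) (\<phi> (snd p)))) (B n) - (\<Prod>p\<in>P. ?q p)\<bar>"
          unfolding obs_eq ker_eq using c0 by (simp add: abs_mult flip: right_diff_distrib)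
        also have "\<dots> \<le> 1 * \<bar>s.expect (N n) (\<lambda>Y. queues P ?K (s.rate \<phi>) 0 (\<lambda>p. edges Y (\<phi> (fst p)) (\<phi> (snd p)))) (B n) - (\<Prod>p\<in>P. ?q p)\<bar>"
          using c0 by (intro mult_right_mono) auto
        also have "\<dots> \<le> ?e n \<phi> + (\<Sum>p\<in>P. rate_error n (\<phi> (fst p)) (\<phi> (snd p)))"
        proof -
          have "\<bar>y - z\<bar> \<le> R \<Longrightarrow> 1 * \<bar>x - z\<bar> \<le> \<bar>x - y\<bar> + R" for x y z R :: real
            using abs_triangle_ineq[of "x - y" "y - z"] by simp
          from this[OF near] show ?thesis .
        qed
        finally show ?thesis .
      qed
      have all: "\<bar>obs \<phi> - ker \<phi>\<bar> \<le> ?e n \<phi> + (\<Sum>p\<in>P. rate_error n (\<phi> (fst p)) (\<phi> (snd p))) + of_bool (\<not> inj_on \<phi> {1..k})"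
        if "\<phi> \<in> ?F" for \<phi>
      proof (cases "inj_on \<phi> {1..k}")
        case True
        then show ?thesis using inj[OF that True] by simp
      next
        case False
        have "\<bar>obs \<phi> - ker \<phi>\<bar> \<le> 1" using obs[of \<phi>] ker[of \<phi>] by (simp add: abs_le_iff)
        then show ?thesis using False e0[of \<phi>] r0[of \<phi>] by simp
      qed
      have ni: "(\<Sum>\<phi>\<in>?F. of_bool (\<not> inj_on \<phi> {1..k}) :: real) = real (card {\<phi> \<in> ?F. \<not> inj_on \<phi> {1..k}})"
        using finF by (simp add: of_bool_def sum.If_cases Int_def)
      have "kernel_mean n k P K = 1 / real n ^ k * (\<Sum>\<phi>\<in>?F. ker \<phi>)"
        unfolding kernel_mean_def ker_def using transition_bounds[OF t] rho_W_pos
        by (intro matrix_deg_expectation n) auto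
      then have "observable_mean n k P K - kernel_mean n k P K = 1 / real n ^ k * (\<Sum>\<phi>\<in>?F. obs \<phi> - ker \<phi>)"
        unfolding observable_mean_def obs_def[symmetric] by (simp only: sum_subtractf right_diff_distrib)
      also have "norm \<dots> \<le> 1 / real n ^ k * (\<Sum>\<phi>\<in>?F. \<bar>obs \<phi> - ker \<phi>\<bar>)"
        by (simp add: abs_mult divide_right_mono)
      also have "\<dots> \<le> 1 / real n ^ k * (\<Sum>\<phi>\<in>?F. ?e n \<phi> + (\<Sum>p\<in>P. rate_error n (\<phi> (fst p)) (\<phi> (snd p))) + of_bool (\<not> inj_on \<phi> {1..k}))"
        using all by (intro mult_left_mono sum_mono) auto
      also have "\<dots> = ?E n + 1 / real n ^ k * (\<Sum>\<phi>\<in>?F. \<Sum>p\<in>P. rate_error n (\<phi> (fst p)) (\<phi> (snd p)))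
          + 1 / real n ^ k * real (card {\<phi> \<in> ?F. \<not> inj_on \<phi> {1..k}})"
        unfolding sum.distrib distrib_left ni ..
      also have "1 / real n ^ k * (\<Sum>\<phi>\<in>?F. \<Sum>p\<in>P. rate_error n (\<phi> (fst p)) (\<phi> (snd p))) = ?R n"
        unfolding sum_distrib_left by (rule sum.swap)
      finally show ?case using sum_noninjective_le[OF n, of k] by linarith
    qed
  qed
qed

lemma kernel_mean_tendsto:
  assumes P: "P \<subseteq> pairs k"
  shows "(\<lambda>n. kernel_mean n k P K) \<longlonglongrightarrow> kernel.deg_expectation lborel01 W k P (transition K t) (1 / rho_W)"
  unfolding kernel_mean_def
  by (rule deg_expectation_tendsto[OF kernel_matrix kernel_multigraphon[OF W] marginal_tendsto moment2_bound P])
    (use rho_W_pos t transition_bounds transition_lipschitz transition_measurable in auto)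

end

end


section \<open>The limit in terms of the evolved multigraphon\<close>

lemma emeasure_lborel01_singleton: "emeasure lborel01 {x} = 0"
proof (cases "x \<in> {0..1}")
  case True
  then show ?thesis by (simp add: emeasure_restrict_space)
next
  case False
  then have "{x} \<notin> sets lborel01"
    using sets.sets_into_space[of "{x}" lborel01] by (auto simp: space_restrict_space)
  then show ?thesis by (rule emeasure_notin_sets)
qed

context reconnecting_limit
begin

context
  fixes t :: real
  assumes t: "0 \<le> t"
begin

text \<open>\<open>W_evol\<close> distinguishes cases by points and \<open>transition\<close> by
  labels. Points with distinct labels are almost surely distinct, and for equal labels the points
  coincide, so the two agree almost everywhere.\<close>

lemma deg_expectation_W_evol:
  "kernel.deg_expectation lborel01 W k (pairs k) (transition K t) (1 / rho_W) = t_eqW k (\<lambda>i j. K (i, j)) (W_evol W t)"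
proof -
  interpret kernel lborel01 W by (rule kernel_multigraphon[OF W])
  let ?d = "\<lambda>x. enn2real (degW W x)"
  have deg_eq: "deg x = ?d x" for x by (simp add: deg_def degW_eq[OF W])
  have sets_borel: "(\<lambda>x. x) \<in> lborel01 \<rightarrow>\<^sub>M (borel :: real measure)"
    by (intro measurable_restrict_space1) simp
  have comp: "(\<lambda>x. x i) \<in> points k \<rightarrow>\<^sub>M lborel01" if "i \<in> {1..k}" for i
    using that by (rule measurable_component_singleton)
  have comp': "(\<lambda>x. x i) \<in> borel_measurable (points k)" if "i \<in> {1..k}" for i
    by (rule measurable_compose[OF comp[OF that] sets_borel])
  have pt: "x (fst p) \<in> space lborel01" "x (snd p) \<in> space lborel01" if "x \<in> space (points k)" "p \<in> pairs k" for x p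
    using that pairs_le[OF that(2)] unfolding space_PiM PiE_iff by blast+
  \<comment> \<open>The point b is integrated out with a fixed; a single value has measure
    0.\<close>
  have distinct: "AE x in points k. x a \<noteq> x b" if ab: "a \<in> {1..k}" "b \<in> {1..k}" "a \<noteq> b" for a b
  proof -
    have m: "(\<lambda>(x, y). of_bool (x = y) :: ennreal) \<in> borel_measurable (lborel01 \<Otimes>\<^sub>M lborel01)"
    proof -
      have "{z \<in> space (lborel01 \<Otimes>\<^sub>M lborel01). fst z = snd z} \<in> sets (lborel01 \<Otimes>\<^sub>M lborel01)"
        by (intro borel_measurable_eq measurable_compose[OF measurable_fst sets_borel] measurable_compose[OF measurable_snd sets_borel])
      then have "(\<lambda>z. if fst z = snd z then 1 else 0 :: ennreal) \<in> borel_measurable (lborel01 \<Otimes>\<^sub>M lborel01)"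
        by (intro measurable_If) auto
      then show ?thesis by (simp add: case_prod_beta of_bool_def)
    qed
    have zero: "(\<integral>\<^sup>+y. of_bool (x = y) \<partial>lborel01) = 0" for x
    proof -
      have "(\<integral>\<^sup>+y. of_bool (x = y) \<partial>lborel01) = (\<integral>\<^sup>+y. indicator {x} y \<partial>lborel01)"
        by (intro nn_integral_cong) (auto simp: indicator_def)
      also have "\<dots> = 0"
      proof (cases "x \<in> {0..1}")
        case True
        then have "{x} \<in> sets lborel01" by (auto simp: sets_restrict_space intro!: image_eqI[of _ _ "{x}"])
        then show ?thesis by (simp add: emeasure_lborel01_singleton)
      next
        case False
        then have "(\<integral>\<^sup>+y. indicator {x} y \<partial>lborel01) = (\<integral>\<^sup>+y. 0 \<partial>lborel01)"
          by (intro nn_integral_cong) (auto simp: indicator_def space_restrict_space)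
        then show ?thesis by simp
      qed
      finally show ?thesis .
    qed
    have u: "(\<lambda>x. of_bool (x a = x b) :: ennreal) \<in> borel_measurable (points k)"
      using measurable_compose[OF measurable_Pair[OF comp[OF ab(1)] comp[OF ab(2)]] m] by simp
    have "(\<integral>\<^sup>+x. 1 * of_bool (x a = x b) \<partial>points k) = (\<integral>\<^sup>+x. 1 * (\<integral>\<^sup>+y. of_bool (x a = y) \<partial>lborel01) \<partial>points k)"
      using ab by (intro nn_integral_points_extract[OF _ _ _ _ _ m]) auto
    then have "(\<integral>\<^sup>+x. of_bool (x a = x b) \<partial>points k) = 0" unfolding zero by simp
    then have "AE x in points k. of_bool (x a = x b) = (0 :: ennreal)" by (simp only: nn_integral_0_iff_AE[OF u])
    then show ?thesis by (rule eventually_mono) auto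
  qed
  let ?F = "\<lambda>x. \<Prod>p\<in>pairs k. W_evol W t (x (fst p)) (x (snd p)) (K p)"
  have term_nonneg: "0 \<le> W x y l * queue t h k' \<mu>" if "x \<in> space lborel01" "y \<in> space lborel01" "0 \<le> \<mu>" for x y l h k' \<mu>
    using V_nonneg[OF that(1,2)] queue_bounds[OF t that(3)] by simp
  \<comment> \<open>The length is a function of the summation index, to cover both l and
    \<open>l div 2\<close>.\<close>
  have summ: "summable (\<lambda>l. W x y l * queue t (h l) k' \<mu>)" if xy: "x \<in> space lborel01" "y \<in> space lborel01" "0 \<le> \<mu>" for x y h k' \<mu>
  proof (rule summable_comparison_test)
    show "summable (W x y)" using V_sums[OF xy(1,2)] by (simp add: sums_iff)
    have "norm (W x y l * queue t (h l) k' \<mu>) \<le> W x y l" for l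
    proof -
      have "W x y l * queue t (h l) k' \<mu> \<le> W x y l * 1"
        using V_nonneg[OF xy(1,2)] queue_bounds[OF t xy(3)] by (intro mult_left_mono) auto
      then show ?thesis using term_nonneg[OF xy] by simp
    qed
    then show "\<exists>N. \<forall>l\<ge>N. norm (W x y l * queue t (h l) k' \<mu>) \<le> W x y l" by blast
  qed
  have W_evol_eq: "W_evol W t x y l =
    (if x \<noteq> y then \<Sum>h. W x y h * queue t h l (?d x * ?d y / rho_W)
     else of_bool (even l) * (\<Sum>h. W x y h * queue t (h div 2) (l div 2) (?d x * ?d y / (2 * rho_W))))" for x y l
    by (simp add: W_evol_def Let_def rho_W_def)
  have r0: "0 < rho_W" by (rule edges_tendsto)
  have nonneg: "0 \<le> W_evol W t x y l" if "x \<in> space lborel01" "y \<in> space lborel01" for x y l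
  proof -
    have nn: "0 \<le> (\<Sum>h. W x y h * queue t (f h) l' (?d x * ?d y / c))" if "0 < c" for f l' c
    proof -
      have mu: "0 \<le> ?d x * ?d y / c" using that by simp
      show ?thesis
        using \<open>x \<in> space lborel01\<close> \<open>y \<in> space lborel01\<close> by (intro suminf_nonneg summ term_nonneg mu)
    qed
    show ?thesis
      unfolding W_evol_eq using nn[of rho_W "\<lambda>h. h" l] nn[of "2 * rho_W" "\<lambda>h. h div 2" "l div 2"] r0 by auto
  qed
  have meas: "(\<lambda>x. W_evol W t (x (fst p)) (x (snd p)) (K p)) \<in> borel_measurable (points k)" if p: "p \<in> pairs k" for p
  proof -
    have ab: "fst p \<in> {1..k}" "snd p \<in> {1..k}" using pairs_le[OF p] by auto
    have d: "(\<lambda>x. ?d (x i)) \<in> borel_measurable (points k)" if "i \<in> {1..k}" for i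
      using deg_measurable_points[OF that] by (simp add: deg_eq)
    have q: "queue t h l \<in> borel_measurable borel" for h l
      unfolding queue_def[abs_def] poisson_weight_def by measurable
    have qd: "(\<lambda>x. queue t h l (?d (x (fst p)) * ?d (x (snd p)) / c)) \<in> borel_measurable (points k)" for h l c
      by (intro measurable_compose[OF _ q] borel_measurable_divide borel_measurable_times d ab borel_measurable_const)
    have eq: "{x \<in> space (points k). x (fst p) \<noteq> x (snd p)} \<in> sets (points k)"
      by (intro borel_measurable_neq comp' ab)
    show ?thesis
      unfolding W_evol_eq
      by (intro measurable_If borel_measurable_suminf borel_measurable_times V_measurable_pair p qd borel_measurable_const eq)
  qed
  have "t_eqW k (\<lambda>i j. K (i, j)) (W_evol W t) = enn2real (\<integral>\<^sup>+x. ennreal (?F x) \<partial>points k)"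
    unfolding t_eqW_pairs prod.collapse
    by (intro integral_eq_nn_integral borel_measurable_prod meas AE_I2 prod_nonneg nonneg pt)
  also have "(\<integral>\<^sup>+x. ennreal (?F x) \<partial>points k) = (\<integral>\<^sup>+x. (\<Prod>p\<in>pairs k. \<Sum>l. ennreal (W (x (fst p)) (x (snd p)) l) *
     ennreal (transition K t p l (1 / rho_W * deg (x (fst p)) * deg (x (snd p))))) \<partial>points k)"
  proof (rule nn_integral_cong_AE)
    have "AE x in points k. \<forall>p\<in>{p \<in> pairs k. fst p \<noteq> snd p}. x (fst p) \<noteq> x (snd p)"
    proof (rule AE_finite_allI)
      show "finite {p \<in> pairs k. fst p \<noteq> snd p}" by (rule finite_subset[OF _ finite_pairs[of k]]) auto
      fix p assume p: "p \<in> {p \<in> pairs k. fst p \<noteq> snd p}"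
      then show "AE x in points k. x (fst p) \<noteq> x (snd p)" using pairs_le[of p k] by (intro distinct) auto
    qed
    then show "AE x in points k. ennreal (?F x) = (\<Prod>p\<in>pairs k. \<Sum>l. ennreal (W (x (fst p)) (x (snd p)) l) *
     ennreal (transition K t p l (1 / rho_W * deg (x (fst p)) * deg (x (snd p)))))"
    proof (rule AE_mp, intro AE_I2 impI)
      fix x assume x: "x \<in> space (points k)" and d: "\<forall>p\<in>{p \<in> pairs k. fst p \<noteq> snd p}. x (fst p) \<noteq> x (snd p)"
      have "ennreal (?F x) = (\<Prod>p\<in>pairs k. ennreal (W_evol W t (x (fst p)) (x (snd p)) (K p)))"
        by (intro prod_ennreal[symmetric] nonneg pt x)
      also have "\<dots> = (\<Prod>p\<in>pairs k. \<Sum>l. ennreal (W (x (fst p)) (x (snd p)) l) *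
         ennreal (transition K t p l (1 / rho_W * deg (x (fst p)) * deg (x (snd p)))))"
      proof (intro prod.cong refl)
        fix p assume p: "p \<in> pairs k"
        let ?x = "x (fst p)" and ?y = "x (snd p)"
        let ?mu = "?d ?x * ?d ?y / rho_W / real (loop_div p)"
        have sp: "?x \<in> space lborel01" "?y \<in> space lborel01" using pt[OF x p] by auto
        have mu: "0 \<le> ?mu" using r0 by simp
        have "W_evol W t ?x ?y (K p) = of_bool (fst p \<noteq> snd p \<or> even (K p)) * (\<Sum>l. W ?x ?y l * queue t (l div loop_div p) (K p div loop_div p) ?mu)"
        proof (cases "fst p = snd p")
          case True
          then show ?thesis unfolding W_evol_eq by (simp add: loop_div_def mult.commute)
        next
          case False
          then have "?x \<noteq> ?y" using d p by blast
          then show ?thesis using False unfolding W_evol_eq by (simp add: loop_div_def)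
        qed
        also have "\<dots> = (\<Sum>l. of_bool (fst p \<noteq> snd p \<or> even (K p)) * (W ?x ?y l * queue t (l div loop_div p) (K p div loop_div p) ?mu))"
          by (intro suminf_mult[symmetric] summ sp mu)
        finally have "ennreal (W_evol W t ?x ?y (K p)) = ennreal (\<Sum>l. of_bool (fst p \<noteq> snd p \<or> even (K p)) * (W ?x ?y l * queue t (l div loop_div p) (K p div loop_div p) ?mu))"
          by (rule arg_cong)
        also have "\<dots> = (\<Sum>l. ennreal (of_bool (fst p \<noteq> snd p \<or> even (K p)) * (W ?x ?y l * queue t (l div loop_div p) (K p div loop_div p) ?mu)))"
          by (intro suminf_ennreal2[symmetric] summable_mult summ sp mu mult_nonneg_nonneg[OF _ term_nonneg[OF sp mu]]) simp
        also have "\<dots> = (\<Sum>l. ennreal (W ?x ?y l) * ennreal (transition K t p l (1 / rho_W * deg ?x * deg ?y)))"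
        proof (intro suminf_cong)
          fix l
          have e: "of_bool (fst p \<noteq> snd p \<or> even (K p)) * (W ?x ?y l * queue t (l div loop_div p) (K p div loop_div p) ?mu) =
            W ?x ?y l * transition K t p l (1 / rho_W * deg ?x * deg ?y)"
            by (simp add: transition_def deg_eq mult_ac)
          have "0 \<le> 1 / rho_W * deg ?x * deg ?y" using r0 deg_nonneg by simp
          then have "0 \<le> transition K t p l (1 / rho_W * deg ?x * deg ?y)" using transition_bounds[OF t] by blast
          then show "ennreal (of_bool (fst p \<noteq> snd p \<or> even (K p)) * (W ?x ?y l * queue t (l div loop_div p) (K p div loop_div p) ?mu)) =
            ennreal (W ?x ?y l) * ennreal (transition K t p l (1 / rho_W * deg ?x * deg ?y))"
            unfolding e by (intro ennreal_mult V_nonneg[OF sp])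
        qed
        finally show "ennreal (W_evol W t ?x ?y (K p)) = (\<Sum>l. ennreal (W ?x ?y l) * ennreal (transition K t p l (1 / rho_W * deg ?x * deg ?y)))" .
      qed
      finally show "ennreal (?F x) = (\<Prod>p\<in>pairs k. \<Sum>l. ennreal (W (x (fst p)) (x (snd p)) l) *
         ennreal (transition K t p l (1 / rho_W * deg (x (fst p)) * deg (x (snd p)))))" .
    qed
  qed
  finally show ?thesis unfolding deg_expectation_def by simp
qed

end

end

text \<open>Two disjoint copies of the labels \<open>1, \<dots>, k\<close> inside \<open>1, \<dots>, 2 k\<close>, for second moments.\<close>

definition shift :: "nat \<Rightarrow> nat \<times> nat \<Rightarrow> nat \<times> nat" where
  "shift k p = (fst p + k, snd p + k)"

definition two_copies :: "nat \<Rightarrow> (nat \<times> nat) set" where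
  "two_copies k = pairs k \<union> shift k ` pairs k"

lemma two_copies_subset: "two_copies k \<subseteq> pairs (k + k)"
  by (auto simp: two_copies_def pairs_def shift_def)

text \<open>The two blocks of labels are mapped independently and no factor couples them, so the sum
  over joint maps is the square of the single sum.\<close>

lemma sum_PiE_two_copies:
  fixes F :: "nat \<times> nat \<Rightarrow> nat \<Rightarrow> nat \<Rightarrow> real"
  assumes shift: "\<And>p. p \<in> pairs k \<Longrightarrow> F (shift k p) = F p"
  shows "(\<Sum>\<theta>\<in>{1..k + k} \<rightarrow>\<^sub>E V. \<Prod>p\<in>two_copies k. F p (\<theta> (fst p)) (\<theta> (snd p))) =
    (\<Sum>\<phi>\<in>{1..k} \<rightarrow>\<^sub>E V. \<Prod>p\<in>pairs k. F p (\<phi> (fst p)) (\<phi> (snd p)))\<^sup>2"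
proof -
  let ?G = "\<lambda>\<phi> :: nat \<Rightarrow> nat. \<Prod>p\<in>pairs k. F p (\<phi> (fst p)) (\<phi> (snd p))"
  have prod: "(\<Prod>p\<in>two_copies k. F p (\<theta> (fst p)) (\<theta> (snd p))) = ?G \<theta> * ?G (\<lambda>i. \<theta> (i + k))" for \<theta>
  proof -
    have inj: "inj_on (shift k) (pairs k)" by (auto simp: inj_on_def shift_def prod_eq_iff)
    have disj: "pairs k \<inter> shift k ` pairs k = {}" by (auto simp: pairs_def shift_def)
    have "(\<Prod>p\<in>shift k ` pairs k. F p (\<theta> (fst p)) (\<theta> (snd p))) = (\<Prod>p\<in>pairs k. F (shift k p) (\<theta> (fst (shift k p))) (\<theta> (snd (shift k p))))"
      by (simp add: prod.reindex[OF inj])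
    also have "\<dots> = ?G (\<lambda>i. \<theta> (i + k))"
    proof (intro prod.cong refl)
      fix p assume p: "p \<in> pairs k"
      show "F (shift k p) (\<theta> (fst (shift k p))) (\<theta> (snd (shift k p))) = F p (\<theta> (fst p + k)) (\<theta> (snd p + k))"
        unfolding shift[OF p] by (simp add: shift_def)
    qed
    finally show ?thesis
      unfolding two_copies_def using disj by (subst prod.union_disjoint) auto
  qed
  have cong: "?G \<phi> = ?G \<psi>" if "\<And>i. i \<in> {1..k} \<Longrightarrow> \<phi> i = \<psi> i" for \<phi> \<psi>
  proof (intro prod.cong refl)
    fix p assume "p \<in> pairs k"
    then have "fst p \<in> {1..k}" "snd p \<in> {1..k}" by (auto simp: pairs_def)
    then show "F p (\<phi> (fst p)) (\<phi> (snd p)) = F p (\<psi> (fst p)) (\<psi> (snd p))" using that by simp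
  qed
  have "(\<Sum>\<phi>\<in>{1..k} \<rightarrow>\<^sub>E V. ?G \<phi>)\<^sup>2 = (\<Sum>(\<phi>, \<psi>)\<in>({1..k} \<rightarrow>\<^sub>E V) \<times> ({1..k} \<rightarrow>\<^sub>E V). ?G \<phi> * ?G \<psi>)"
    by (simp add: power2_eq_square sum_product sum.cartesian_product)
  also have "\<dots> = (\<Sum>\<theta>\<in>{1..k + k} \<rightarrow>\<^sub>E V. ?G \<theta> * ?G (\<lambda>i. \<theta> (i + k)))"
  \<comment> \<open>Joint maps correspond to pairs of maps, the second read with indices lowered by
    k; \<open>undefined\<close> elsewhere keeps the joint map extensional.\<close>
  proof (rule sum.reindex_bij_witness[of _ "\<lambda>\<theta>. (restrict \<theta> {1..k}, restrict (\<lambda>i. \<theta> (i + k)) {1..k})"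
      "\<lambda>(\<phi>, \<psi>) i. if i \<in> {1..k} then \<phi> i else if i \<in> {k + 1..k + k} then \<psi> (i - k) else undefined"], goal_cases)
    case (1 z)
    then show ?case by (auto simp: PiE_iff extensional_def fun_eq_iff)
  next
    case (2 z)
    then obtain \<phi> \<psi> where z: "z = (\<phi>, \<psi>)" "\<phi> \<in> {1..k} \<rightarrow>\<^sub>E V" "\<psi> \<in> {1..k} \<rightarrow>\<^sub>E V" by auto
    have "(if i \<in> {1..k} then \<phi> i else if i \<in> {k + 1..k + k} then \<psi> (i - k) else undefined) \<in> V"
      if i: "i \<in> {1..k + k}" for i
    proof (cases "i \<in> {1..k}")
      case True
      then show ?thesis using z(2) by auto
    next
      case False
      then have "i - k \<in> {1..k}" "i \<in> {k + 1..k + k}" using i by auto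
      then show ?thesis using False z(3) by auto
    qed
    moreover have "(if i \<in> {1..k} then \<phi> i else if i \<in> {k + 1..k + k} then \<psi> (i - k) else undefined) = undefined"
      if "i \<notin> {1..k + k}" for i
      using that by auto
    ultimately show ?case unfolding z(1) prod.case by (rule PiE_I)
  next
    case (3 \<theta>)
    then show ?case by (auto simp: PiE_iff extensional_def fun_eq_iff)
  next
    case (4 \<theta>)
    then show ?case by (auto simp: PiE_iff)
  next
    case (5 z)
    obtain \<phi> \<psi> where z: "z = (\<phi>, \<psi>)" by (cases z)
    let ?\<theta> = "\<lambda>i. if i \<in> {1..k} then \<phi> i else if i \<in> {k + 1..k + k} then \<psi> (i - k) else undefined"
    have "?G ?\<theta> = ?G \<phi>" by (rule cong) simp
    moreover have "?G (\<lambda>i. ?\<theta> (i + k)) = ?G \<psi>" by (rule cong) auto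
    ultimately show ?case unfolding z by simp
  qed
  finally show ?thesis unfolding prod ..
qed

theorem theorem1:
  fixes \<kappa> lam C :: real
    and m :: "nat \<Rightarrow> nat"
    and B :: "nat \<Rightarrow> nmat"
    and M :: "nat \<Rightarrow> 'a measure"
    and X :: "nat \<Rightarrow> nat \<Rightarrow> 'a \<Rightarrow> nmat"
    and W :: "real \<Rightarrow> real \<Rightarrow> nat \<Rightarrow> real"
  assumes "\<kappa> > 0"
    and "\<And>n. n \<ge> 1 \<Longrightarrow> B n \<in> adj_edges n (m n)"
    and "\<And>n. n \<ge> 1 \<Longrightarrow> edge_reconnecting_model \<kappa> n (m n) (B n) (M n) (X n)"
    and "multigraphon W"
    and "graph_converges B W"
    and "rho W > 0"
    and "lam > 0"
    and "\<And>n. n \<ge> 2 \<Longrightarrow>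
           1 / real (n choose 2) * (\<Sum>j\<in>{1..n}. \<Sum>i\<in>{1..<j}. exp (lam * real (B n i j))) \<le> C"
    and "\<And>n. n \<ge> 1 \<Longrightarrow> 1 / real n * (\<Sum>i\<in>{1..n}. exp (lam * real (B n i i))) \<le> C"
  shows "\<forall>t\<ge>0. graph_converges_in_probability M
           (\<lambda>n. X n (nat \<lfloor>t * (enn2real (rho W) * real n ^ 2 / 2)\<rfloor>)) (W_evol W t)"
proof (intro allI impI)
  fix t :: real assume t: "t \<ge> 0"
  interpret reconnecting_limit \<kappa> lam C m B W
    using assms by unfold_locales auto
  have N: "nat \<lfloor>t * (enn2real (rho W) * real n ^ 2 / 2)\<rfloor> = N t n" for n
    by (simp add: N_def[OF t] rho_W_def)
  show "graph_converges_in_probability M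
           (\<lambda>n. X n (nat \<lfloor>t * (enn2real (rho W) * real n ^ 2 / 2)\<rfloor>)) (W_evol W t)"
    unfolding graph_converges_in_probability_def converges_in_probability_def N
  proof (intro allI impI ballI)
    fix k :: nat and A and \<epsilon> :: real
    assume A: "A \<in> adj k" and \<epsilon>: "0 < \<epsilon>"
    \<comment> \<open>The pattern A repeated on the second block of labels. Pairs in
      \<open>two_copies\<close> stay inside one block, so testing the first label is enough.\<close>
    define K where "K p = (if fst p \<le> k then A (fst p) (snd p) else A (fst p - k) (snd p - k))" for p
    define c where "c = t_eqW k A (W_evol W t)"
    have K: "K p = A (fst p) (snd p)" "K (shift k p) = K p" if "p \<in> pairs k" for p
      using that by (auto simp: K_def pairs_def shift_def)
    have c: "c = kernel.deg_expectation lborel01 W k (pairs k) (transition K t) (1 / rho_W)"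
      unfolding c_def deg_expectation_W_evol[OF t] t_eqW_pairs using K(1) by (simp cong: prod.cong)
    define z where "z n Y = 1 / real n ^ k * (\<Sum>\<phi>\<in>{1..k} \<rightarrow>\<^sub>E {1..n}. \<Prod>p\<in>pairs k. of_bool (Y (\<phi> (fst p)) (\<phi> (snd p)) = K p))"
      for n and Y :: nmat
    let ?P = "two_copies k"
    have km: "(\<lambda>n. kernel_mean t n k (pairs k) K) \<longlonglongrightarrow> c"
      unfolding c by (rule kernel_mean_tendsto[OF t order_refl])
    have first: "(\<lambda>n. observable_mean t n k (pairs k) K) \<longlonglongrightarrow> c"
      using tendsto_add[OF observable_minus_kernel_mean_tendsto[OF t order_refl, where k = k and K = K] km] by simp
    have "\<forall>\<^sub>F n in sequentially. (kernel_mean t n k (pairs k) K)\<^sup>2 = kernel_mean t n (k + k) ?P K"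
    proof (rule eventually_sequentiallyI[of 1])
      fix n :: nat assume n: "1 \<le> n"
      have nn: "0 \<le> transition K t p h \<mu>" if "0 \<le> \<mu>" for p h \<mu> using transition_bounds[OF t that] by blast
      have r0: "0 \<le> 1 / rho_W" using rho_W_pos[OF t] by simp
      let ?F = "\<lambda>p v w. transition K t p (B n v w) (1 / rho_W * (real (deg n (B n) v) / real n) * (real (deg n (B n) w) / real n))"
      have km_eq: "kernel_mean t n j P' K = 1 / real n ^ j * (\<Sum>\<phi>\<in>{1..j} \<rightarrow>\<^sub>E {1..n}. \<Prod>p\<in>P'. ?F p (\<phi> (fst p)) (\<phi> (snd p)))" for j P'
        unfolding kernel_mean_def[OF t] by (rule matrix_deg_expectation[OF n _ r0]) (rule nn)
      have "?F (shift k p) = ?F p" if "p \<in> pairs k" for p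
        using K(2)[OF that] by (simp add: transition_def loop_div_def shift_def)
      \<comment> \<open>The kernel mean averages over all label maps, collisions included, so the
        square is an identity for every n \<ge> 1 and not merely a limit.\<close>
      from sum_PiE_two_copies[of k ?F "{1..n}", OF this]
      show "(kernel_mean t n k (pairs k) K)\<^sup>2 = kernel_mean t n (k + k) ?P K"
        unfolding km_eq
        by (simp add: power_mult_distrib power_add power2_eq_square)
    qed
    from Lim_transform_eventually[OF tendsto_power[OF km] this]
    have "(\<lambda>n. kernel_mean t n (k + k) ?P K) \<longlonglongrightarrow> c\<^sup>2" .
    from tendsto_add[OF observable_minus_kernel_mean_tendsto[OF t two_copies_subset[of k], where K = K] this]
    have second: "(\<lambda>n. observable_mean t n (k + k) ?P K) \<longlonglongrightarrow> c\<^sup>2" by simp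
    \<comment> \<open>The right-hand side of Chebyshev's inequality around the constant c, expanded
      so that only the first two moments of the density occur.\<close>
    have "(\<lambda>n. (observable_mean t n (k + k) ?P K - 2 * c * observable_mean t n k (pairs k) K + c\<^sup>2) / \<epsilon>\<^sup>2) \<longlonglongrightarrow> (c\<^sup>2 - 2 * c * c + c\<^sup>2) / \<epsilon>\<^sup>2"
      using \<epsilon> by (intro tendsto_divide tendsto_add tendsto_diff tendsto_mult tendsto_const first second) auto
    then have lim: "(\<lambda>n. (observable_mean t n (k + k) ?P K - 2 * c * observable_mean t n k (pairs k) K + c\<^sup>2) / \<epsilon>\<^sup>2) \<longlonglongrightarrow> 0"
      by (simp add: power2_eq_square)
    have "\<forall>\<^sub>F n in sequentially. norm (measure (M n) {\<omega> \<in> space (M n). \<epsilon> < \<bar>t_eq k A n (X n (N t n) \<omega>) - c\<bar>}) \<le>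
      (observable_mean t n (k + k) ?P K - 2 * c * observable_mean t n k (pairs k) K + c\<^sup>2) / \<epsilon>\<^sup>2"
      using eventually_dense[OF t]
    proof eventually_elim
      case (elim n)
      then have n: "n \<ge> 1" by simp
      interpret s: reconnecting \<kappa> n "m n" using elim assms(1) by unfold_locales auto
      note Bn = assms(2)[OF n] and model = assms(3)[OF n]
      have X_in: "X n (N t n) \<omega> \<in> adj_edges n (m n)" if "\<omega> \<in> space (M n)" for \<omega>
        using model measurable_space[of "X n (N t n)" "M n" "count_space (adj_edges n (m n))"] that
        by (simp add: edge_reconnecting_model_def)
      have z_eq: "t_eq k A n Y = z n Y" if "Y \<in> adj_edges n (m n)" for Y
        unfolding t_eq_pairs[OF A adj_edges_adj[OF that]] z_def using K(1) by (simp cong: prod.cong)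
      have m1: "s.expect (N t n) (z n) (B n) = observable_mean t n k (pairs k) K"
        unfolding z_def[abs_def] observable_mean_def[OF t] s.expect_cmult s.expect_sum[OF Bn] ..
      have sq: "(z n Y)\<^sup>2 = 1 / real n ^ (k + k) * (\<Sum>\<theta>\<in>{1..k + k} \<rightarrow>\<^sub>E {1..n}. \<Prod>p\<in>?P. of_bool (Y (\<theta> (fst p)) (\<theta> (snd p)) = K p))" for Y
        using sum_PiE_two_copies[of k "\<lambda>p v w. of_bool (Y v w = K p)" "{1..n}"] K(2)
        by (simp add: z_def power_mult_distrib power_add power2_eq_square)
      have m2: "s.expect (N t n) (\<lambda>Y. (z n Y)\<^sup>2) (B n) = observable_mean t n (k + k) ?P K"
        unfolding sq observable_mean_def[OF t] s.expect_cmult s.expect_sum[OF Bn] ..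
      have "measure (M n) {\<omega> \<in> space (M n). \<epsilon> < \<bar>t_eq k A n (X n (N t n) \<omega>) - c\<bar>} =
        measure (M n) ({\<omega> \<in> space (M n). \<epsilon> < \<bar>t_eq k A n (X n (N t n) \<omega>) - c\<bar>} \<inter> space (M n))"
        by (rule arg_cong[where f = "measure (M n)"]) auto
      also have "\<dots> = (\<integral>\<omega>. indicator {\<omega> \<in> space (M n). \<epsilon> < \<bar>t_eq k A n (X n (N t n) \<omega>) - c\<bar>} \<omega> \<partial>M n)"
        by (rule Bochner_Integration.integral_indicator[symmetric])
      also have "\<dots> = (\<integral>\<omega>. of_bool (\<epsilon> < \<bar>z n (X n (N t n) \<omega>) - c\<bar>) \<partial>M n)"
        using z_eq X_in by (intro Bochner_Integration.integral_cong) (auto simp: indicator_def)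
      also have "\<dots> = s.expect (N t n) (\<lambda>Y. of_bool (\<epsilon> < \<bar>z n Y - c\<bar>)) (B n)"
        by (rule s.expectation_edge_reconnecting_model(2)[OF model Bn])
      \<comment> \<open>Chebyshev's inequality, applied pointwise to the indicator and then averaged
        by the transition operator.\<close>
      also have "\<dots> \<le> s.expect (N t n) (\<lambda>Y. 1 / \<epsilon>\<^sup>2 * (((z n Y)\<^sup>2 - 2 * c * z n Y) + c\<^sup>2)) (B n)"
      proof (rule s.expect_mono[OF Bn])
        fix Y
        have "((z n Y)\<^sup>2 - 2 * c * z n Y) + c\<^sup>2 = (z n Y - c)\<^sup>2" by (simp add: power2_diff)
        moreover have "of_bool (\<epsilon> < \<bar>z n Y - c\<bar>) \<le> 1 / \<epsilon>\<^sup>2 * (z n Y - c)\<^sup>2"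
        proof (cases "\<epsilon> < \<bar>z n Y - c\<bar>")
          case True
          then have "\<epsilon>\<^sup>2 \<le> \<bar>z n Y - c\<bar>\<^sup>2" using \<epsilon> by (intro power_mono) auto
          then show ?thesis using True \<epsilon> by simp
        qed simp
        ultimately show "of_bool (\<epsilon> < \<bar>z n Y - c\<bar>) \<le> 1 / \<epsilon>\<^sup>2 * (((z n Y)\<^sup>2 - 2 * c * z n Y) + c\<^sup>2)" by simp
      qed
      also have "\<dots> = 1 / \<epsilon>\<^sup>2 * ((observable_mean t n (k + k) ?P K - 2 * c * observable_mean t n k (pairs k) K) + c\<^sup>2)"
        by (simp only: s.expect_cmult s.expect_add s.expect_diff s.expect_const[OF Bn] m1 m2)
      finally show ?case by simp
    qed
    from Lim_null_comparison[OF this lim]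
    show "(\<lambda>n. measure (M n) {\<omega> \<in> space (M n). \<epsilon> < \<bar>t_eq k A n (X n (N t n) \<omega>) - t_eqW k A (W_evol W t)\<bar>}) \<longlonglongrightarrow> 0"
      unfolding c_def .
  qed
qed

end
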